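(* Let $(X,d,\mu)$ be a complete non-compact metric-measure space with $\mu$ doubling, admitting a Poincaré inequality $(P_q)$ for some $1<q<\infty$, and let $q_0=\inf\{q\in(1,\infty):(P_q)\text{ holds}\}$. Then for $q_0<p_1<p<p_2\le\infty$, $H^1_p=(H^1_{p_1},H^1_{p_2})_{\theta,p}$ with equivalent norms, where $\frac1p=\frac{1-\theta}{p_1}+\frac\theta{p_2}$; in particular $H^1_p$ is an interpolation space between $H^1_{p_1}$ and $H^1_{p_2}$.
   Context: Doubling: $\mu(B(x,2r))\le C\mu(B(x,r))$ for all $x\in X$, $r>0$. A Borel $g:X\to[0,\infty]$ is an upper gradient of a Borel $u$ if $|u(\gamma(b))-u(\gamma(a))|\le\int_a^bg(\gamma(t))\,dt$ for every 1-Lipschitz curve $\gamma:[a,b]\to X$. $(P_q)$: there exist $C>0$, $\lambda\ge1$ such that for every continuous $u$, every upper gradient $g$ of $u$ and every ball $B$ of radius $r>0$, $\big(\frac1{\mu(B)}\int_B|u-u_B|^q\,d\mu\big)^{1/q}\le Cr\big(\frac1{\mu(\lambda B)}\int_{\lambda B}g^q\,d\mu\big)^{1/q}$. For locally Lipschitz $u$, $\operatorname{Lip}u(x)=\limsup_{y\to x,y\ne x}|u(y)-u(x)|/d(y,x)$. Under these hypotheses (Cheeger) there is a linear operator $D$ assigning to each locally Lipschitz $u$ a measurable $Du:X\to\mathbb R^N$ with $\operatorname{Lip}u\le|Du|\le C\operatorname{Lip}u$ (and the usual Leibniz/locality properties). For $1\le p<\infty$, $H^1_p$ is the closure of the locally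 Lipschitz functions for the norm $\|u\|_p+\|\,|Du|\,\|_p$; $H^1_\infty$ is the space of bounded Lipschitz functions. $(A_0,A_1)_{\theta,s}$ is the real interpolation space via the $K$-functional $K(a,t)=\inf_{a=a_0+a_1}(\|a_0\|_{A_0}+t\|a_1\|_{A_1})$, norm $(\int_0^\infty(t^{-\theta}K(a,t))^s\,dt/t)^{1/s}$. *)

theory Defs
  imports "HOL-Analysis.Analysis" "HOL-Probability.Essential_Supremum"
begin

definition epow :: "ennreal \<Rightarrow> real \<Rightarrow> ennreal" where
  "epow x r = (if x = \<infinity> then \<infinity> else ennreal (enn2real x powr r))"

definition mm_space :: "'a::metric_space measure \<Rightarrow> bool" where
  "mm_space M \<longleftrightarrow> sets M = sets borel"

definition doubling :: "'a::metric_space measure \<Rightarrow> bool" where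
  "doubling M \<longleftrightarrow>
     (\<forall>x r. r > 0 \<longrightarrow> 0 < emeasure M (ball x r) \<and> emeasure M (ball x r) < \<infinity>) \<and>
     (\<exists>C. \<forall>x r. r > 0 \<longrightarrow> emeasure M (ball x (2*r)) \<le> ennreal C * emeasure M (ball x r))"

definition upper_gradient ::
  "'a::metric_space measure \<Rightarrow> ('a \<Rightarrow> real) \<Rightarrow> ('a \<Rightarrow> ennreal) \<Rightarrow> bool" where
  "upper_gradient M u g \<longleftrightarrow> u \<in> borel_measurable M \<and> g \<in> borel_measurable M \<and>
     (\<forall>(\<gamma>::real \<Rightarrow> 'a) a b. a \<le> b \<longrightarrow> 1-lipschitz_on {a..b} \<gamma> \<longrightarrow>
        ennreal \<bar>u (\<gamma> b) - u (\<gamma> a)\<bar> \<le> (\<integral>\<^sup>+ t\<in>{a..b}. g (\<gamma> t) \<partial>lborel))"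

definition avg :: "'a measure \<Rightarrow> 'a set \<Rightarrow> ('a \<Rightarrow> real) \<Rightarrow> real" where
  "avg M B u = (\<integral>x\<in>B. u x \<partial>M) / measure M B"

definition poincare :: "'a::metric_space measure \<Rightarrow> real \<Rightarrow> bool" where
  "poincare M q \<longleftrightarrow> (\<exists>C lam. C > 0 \<and> lam \<ge> 1 \<and>
     (\<forall>u g x r. continuous_on UNIV u \<longrightarrow> upper_gradient M u g \<longrightarrow> r > 0 \<longrightarrow>
        epow ((\<integral>\<^sup>+ y\<in>ball x r. ennreal (\<bar>u y - avg M (ball x r) u\<bar> powr q) \<partial>M)
               / emeasure M (ball x r)) (1/q)
        \<le> ennreal (C * r) *
          epow ((\<integral>\<^sup>+ y\<in>ball x (lam*r). epow (g y) q \<partial>M) / emeasure M (ball x (lam*r))) (1/q)))"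

definition loc_lipschitz :: "('a::metric_space \<Rightarrow> real) \<Rightarrow> bool" where
  "loc_lipschitz u \<longleftrightarrow> (\<forall>x. \<exists>U L. open U \<and> x \<in> U \<and> L-lipschitz_on U u)"

definition Lip :: "('a::metric_space \<Rightarrow> real) \<Rightarrow> 'a \<Rightarrow> ereal" where
  "Lip u x = Limsup (at x) (\<lambda>y. ereal (\<bar>u y - u x\<bar> / dist y x))"

definition cheeger_diff ::
  "'a::metric_space measure \<Rightarrow> (('a \<Rightarrow> real) \<Rightarrow> 'a \<Rightarrow> real^'n) \<Rightarrow> bool" where
  "cheeger_diff M D \<longleftrightarrow>
     (\<forall>u v a b. loc_lipschitz u \<longrightarrow> loc_lipschitz v \<longrightarrow>
        D (\<lambda>x. a * u x + b * v x) = (\<lambda>x. a *\<^sub>R D u x + b *\<^sub>R D v x)) \<and>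
     (\<exists>C. \<forall>u. loc_lipschitz u \<longrightarrow> D u \<in> borel_measurable M \<and>
        (AE x in M. Lip u x \<le> ereal (norm (D u x)) \<and> ereal (norm (D u x)) \<le> ereal C * Lip u x))"

definition Lp_norm :: "'a measure \<Rightarrow> real \<Rightarrow> ('a \<Rightarrow> real) \<Rightarrow> ennreal" where
  "Lp_norm M p f = epow (\<integral>\<^sup>+ x. ennreal (\<bar>f x\<bar> powr p) \<partial>M) (1/p)"

definition Linf_norm :: "'a measure \<Rightarrow> ('a \<Rightarrow> real) \<Rightarrow> ennreal" where
  "Linf_norm M f = esssup M (\<lambda>x. ennreal \<bar>f x\<bar>)"

definition H1_lipnorm :: "'a measure \<Rightarrow> (('a \<Rightarrow> real) \<Rightarrow> 'a \<Rightarrow> real^'n) \<Rightarrow> real \<Rightarrow> ('a \<Rightarrow> real) \<Rightarrow> ennreal" where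
  "H1_lipnorm M D p u = Lp_norm M p u + Lp_norm M p (\<lambda>x. norm (D u x))"

text \<open>Approximating sequence: locally Lipschitz u_n with finite H^1_p norm, Cauchy for this
  norm, converging to f in L^p.  This describes the closure (completion) of the locally
  Lipschitz functions in the norm ||u||_p + || |Du| ||_p, realised inside L^p.\<close>
definition H1_approx :: "'a::metric_space measure \<Rightarrow> (('a \<Rightarrow> real) \<Rightarrow> 'a \<Rightarrow> real^'n) \<Rightarrow> real
    \<Rightarrow> (nat \<Rightarrow> 'a \<Rightarrow> real) \<Rightarrow> ('a \<Rightarrow> real) \<Rightarrow> bool" where
  "H1_approx M D p u f \<longleftrightarrow> f \<in> borel_measurable M \<and>
     (\<forall>n. loc_lipschitz (u n) \<and> H1_lipnorm M D p (u n) < \<infinity>) \<and>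
     (\<forall>e>0. \<exists>N. \<forall>m\<ge>N. \<forall>n\<ge>N. H1_lipnorm M D p (\<lambda>x. u m x - u n x) < ennreal e) \<and>
     ((\<lambda>n. Lp_norm M p (\<lambda>x. u n x - f x)) \<longlonglongrightarrow> 0)"

definition H1 :: "'a::metric_space measure \<Rightarrow> (('a \<Rightarrow> real) \<Rightarrow> 'a \<Rightarrow> real^'n) \<Rightarrow> ereal
    \<Rightarrow> ('a \<Rightarrow> real) \<Rightarrow> bool" where
  "H1 M D p f = (if p = \<infinity>
     then f \<in> borel_measurable M \<and>
          (\<exists>u L B. L-lipschitz_on UNIV u \<and> (\<forall>x. \<bar>u x\<bar> \<le> B) \<and> (AE x in M. f x = u x))
     else (\<exists>u. H1_approx M D (real_of_ereal p) u f))"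

definition H1_norm :: "'a::metric_space measure \<Rightarrow> (('a \<Rightarrow> real) \<Rightarrow> 'a \<Rightarrow> real^'n) \<Rightarrow> ereal
    \<Rightarrow> ('a \<Rightarrow> real) \<Rightarrow> ennreal" where
  "H1_norm M D p f = (if p = \<infinity>
     then Inf {Linf_norm M u + Linf_norm M (\<lambda>x. norm (D u x)) | u.
                 (\<exists>L B. L-lipschitz_on UNIV u \<and> (\<forall>x. \<bar>u x\<bar> \<le> B)) \<and> (AE x in M. f x = u x)}
     else Inf {c. \<exists>u. H1_approx M D (real_of_ereal p) u f \<and>
                 (\<lambda>n. H1_lipnorm M D (real_of_ereal p) (u n)) \<longlonglongrightarrow> c})"

text \<open>A normed function space is given by a membership predicate and a norm.
  K(f,t) = inf over f = f0 + f1 (a.e.) with f0 in A0, f1 in A1.\<close>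
definition Kfun :: "'a measure \<Rightarrow> (('a \<Rightarrow> real) \<Rightarrow> bool) \<Rightarrow> (('a \<Rightarrow> real) \<Rightarrow> ennreal)
    \<Rightarrow> (('a \<Rightarrow> real) \<Rightarrow> bool) \<Rightarrow> (('a \<Rightarrow> real) \<Rightarrow> ennreal) \<Rightarrow> ('a \<Rightarrow> real) \<Rightarrow> real \<Rightarrow> ennreal" where
  "Kfun M A0 N0 A1 N1 f t = Inf {N0 f0 + ennreal t * N1 f1 | f0 f1.
      A0 f0 \<and> A1 f1 \<and> (AE x in M. f x = f0 x + f1 x)}"

definition in_sum_space :: "'a measure \<Rightarrow> (('a \<Rightarrow> real) \<Rightarrow> bool) \<Rightarrow> (('a \<Rightarrow> real) \<Rightarrow> bool)
    \<Rightarrow> ('a \<Rightarrow> real) \<Rightarrow> bool" where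
  "in_sum_space M A0 A1 f \<longleftrightarrow> (\<exists>f0 f1. A0 f0 \<and> A1 f1 \<and> (AE x in M. f x = f0 x + f1 x))"

definition interp_norm :: "'a measure \<Rightarrow> (('a \<Rightarrow> real) \<Rightarrow> bool) \<Rightarrow> (('a \<Rightarrow> real) \<Rightarrow> ennreal)
    \<Rightarrow> (('a \<Rightarrow> real) \<Rightarrow> bool) \<Rightarrow> (('a \<Rightarrow> real) \<Rightarrow> ennreal) \<Rightarrow> real \<Rightarrow> real
    \<Rightarrow> ('a \<Rightarrow> real) \<Rightarrow> ennreal" where
  "interp_norm M A0 N0 A1 N1 \<theta> s f =
     epow (\<integral>\<^sup>+ t\<in>{0<..}. epow (ennreal (t powr (-\<theta>)) * Kfun M A0 N0 A1 N1 f t) s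
                          * ennreal (1/t) \<partial>lborel) (1/s)"

definition in_interp :: "'a measure \<Rightarrow> (('a \<Rightarrow> real) \<Rightarrow> bool) \<Rightarrow> (('a \<Rightarrow> real) \<Rightarrow> ennreal)
    \<Rightarrow> (('a \<Rightarrow> real) \<Rightarrow> bool) \<Rightarrow> (('a \<Rightarrow> real) \<Rightarrow> ennreal) \<Rightarrow> real \<Rightarrow> real
    \<Rightarrow> ('a \<Rightarrow> real) \<Rightarrow> bool" where
  "in_interp M A0 N0 A1 N1 \<theta> s f \<longleftrightarrow> f \<in> borel_measurable M \<and> in_sum_space M A0 A1 f \<and>
     interp_norm M A0 N0 A1 N1 \<theta> s f < \<infinity>"

definition einv :: "ereal \<Rightarrow> real" where
  "einv p = (if p = \<infinity> then 0 else 1 / real_of_ereal p)"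

end

theory Submission
  imports Defs
begin

text \<open>
  Above the Poincare exponent \<open>q\<close>, the space \<open>H^1_p\<close> consists of the \<open>f \<in> L^p\<close> that admit a Hajlasz
  gradient \<open>h \<in> L^p\<close>, i.e. \<open>\<bar>f x - f y\<bar> \<le> dist x y * (h x + h y)\<close> off a null set, with equivalent
  norms; for \<open>p = \<infinity>\<close> this is the description of bounded Lipschitz functions. One inclusion is
  the chaining argument with the Poincare inequality and the maximal theorem in \<open>L^(p/q)\<close>.
  For the other one, put \<open>F = \<bar>f\<bar> + h\<close>: on \<open>{F \<le> l}\<close> the function \<open>f\<close> is \<open>2l\<close>-Lipschitz and extends
  to a bounded Lipschitz function \<open>g\<close>. The functions \<open>g\<close> and \<open>f - g\<close> have the Hajlasz gradients
  \<open>2 min F l\<close> and \<open>4 F 1_{F > l}\<close>, and almost everywhere \<open>Lip g \<le> 2 h'\<close> for each Hajlasz gradient \<open>h'\<close>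
  of \<open>g\<close>, since almost no point of a set is a porosity point of it.

  The same truncations split \<open>f\<close> for the \<open>K\<close>-functional, exactly as the truncations of \<open>F\<close> do for
  the couple \<open>(L^p1, L^p2)\<close>, which gives \<open>H^1_p \<subseteq> (H^1_p1, H^1_p2)\<close>. For the converse, the sharp
  maximal function is controlled by the maximal function of any Hajlasz gradient, and a multiple of
  it is a Hajlasz gradient itself; the splittings of \<open>f\<close> therefore give tail bounds for
  \<open>\<bar>f\<bar> + sharp f\<close>, which sum up to an \<open>L^p\<close> bound.
\<close>

section \<open>Powers in the extended nonnegative reals and dyadic sums\<close>

text \<open>The operator \<open>D\<close> is constrained only on locally Lipschitz functions, and a
  member of \<open>H1\<close> is a limit of such functions, so it carries no gradient of its own
  that could be truncated. A Hajlasz gradient is attached to the limit itself and is stable under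
  sums, a.e. limits and changes on null sets. The Poincare exponent \<open>q\<close> is taken
  strictly below \<open>p1\<close>, which leaves room for the maximal theorem with exponent
  \<open>p1 / q > 1\<close>. In the lower bound every \<open>t\<close> comes with its own splitting
  of \<open>f\<close>, and the gradients of the two pieces change with \<open>t\<close>. The sharp
  function depends on \<open>f\<close> alone, so the estimates for all \<open>t\<close> concern one
  and the same function. With \<open>t = dyad k\<close> they say that
  \<open>\<bar>f\<bar> + Csharp * sharp f\<close> exceeds a multiple of
  \<open>t powr -\<sigma> * K(f,t)\<close> on a set of measure at most
  \<open>2 * t powr (\<sigma> * p1)\<close>, where \<open>\<sigma> = p2 / (p2 - p1)\<close>, or
  \<open>1\<close> if \<open>p2 = \<infinity>\<close>. This is the classical comparison of the
  decreasing rearrangement with the K-functional of the couple (L^p1, L^p2), read at dyadic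
  points.\<close>

lemma epow_ennreal: "0 \<le> x \<Longrightarrow> epow (ennreal x) r = ennreal (x powr r)"
  by (simp add: epow_def)

lemma epow_top [simp]: "epow \<infinity> r = \<infinity>" "epow top r = top"
  by (simp_all add: epow_def infinity_ennreal_def)

lemma epow_0 [simp]: "epow 0 r = 0"
  by (simp add: epow_def)

lemma epow_1 [simp]: "epow x 1 = x"
  by (cases x) (auto simp: epow_def infinity_ennreal_def)

lemma epow_mono: "x \<le> y \<Longrightarrow> 0 \<le> r \<Longrightarrow> epow x r \<le> epow y r"
  by (cases x; cases y)
    (auto simp: epow_ennreal top_unique intro!: ennreal_leI powr_mono2)

lemma epow_less_top_iff [simp]: "epow x r < top \<longleftrightarrow> x < top"
  by (cases x) (auto simp: epow_ennreal)

lemma epow_eq_top_iff [simp]: "epow x r = top \<longleftrightarrow> x = top"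
  by (cases x) (auto simp: epow_ennreal)

lemma epow_mult: "0 < r \<Longrightarrow> epow (x * y) r = epow x r * epow y r"
proof -
  assume r: "0 < r"
  have top: "epow (top * y) r = epow top r * epow y r" for y
  proof (cases "y = 0")
    case False
    then have "epow y r \<noteq> 0"
      by (cases y) (auto simp: epow_ennreal)
    with False show ?thesis by (simp add: ennreal_top_mult)
  qed simp
  show ?thesis
  proof (cases "x = top \<or> y = top")
    case True
    then show ?thesis using top[of x] top[of y] by (auto simp: mult.commute)
  next
    case False
    then show ?thesis
      by (cases x; cases y)
         (auto simp: epow_ennreal ennreal_mult[symmetric] powr_mult)
  qed
qed

lemma epow_epow: "epow (epow x r) s = epow x (r * s)"
  by (cases x) (auto simp: epow_ennreal powr_powr)

lemma epow_add_exp: "epow x (r + s) = epow x r * epow x s"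
  by (cases x) (auto simp: epow_ennreal powr_add ennreal_mult[symmetric])

lemma epow_le_iff:
  assumes "0 < r"
  shows "epow x r \<le> y \<longleftrightarrow> x \<le> epow y (1 / r)"
proof
  assume "epow x r \<le> y"
  from epow_mono[OF this, of "1/r"] assms show "x \<le> epow y (1 / r)" by (simp add: epow_epow)
next
  assume "x \<le> epow y (1 / r)"
  from epow_mono[OF this, of r] assms show "epow x r \<le> y" by (simp add: epow_epow)
qed



lemma epow_eq_0_iff [simp]: "epow x r = 0 \<longleftrightarrow> x = 0"
  by (cases x) (auto simp: epow_ennreal)

lemma epow_measurable [measurable]:
  assumes [measurable]: "f \<in> borel_measurable M"
  shows "(\<lambda>x. epow (f x) r) \<in> borel_measurable M"
proof -
  have "{x \<in> space M. f x = \<infinity>} = f -` {\<infinity>} \<inter> space M" by auto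
  then have [measurable]: "{x \<in> space M. f x = \<infinity>} \<in> sets M"
    by (simp add: measurable_sets[OF assms])
  show ?thesis unfolding epow_def by simp
qed

text \<open>Comparison with twice the maximum replaces convexity, so every exponent
  \<open>r > 0\<close> is covered.\<close>

lemma epow_add_le:
  assumes "0 < r"
  shows "epow (x + y) r \<le> ennreal (2 powr r) * (epow x r + epow y r)"
proof -
  have "x + y \<le> 2 * max x y"
    by (metis add_mono max.cobounded1 max.cobounded2 mult_2)
  then have "epow (x + y) r \<le> epow (2 * max x y) r" using assms by (intro epow_mono) auto
  also have "\<dots> = ennreal (2 powr r) * epow (max x y) r"
    using assms epow_ennreal[of 2 r] by (simp only: epow_mult) simp
  also have "epow (max x y) r \<le> epow x r + epow y r"
    by (cases "x \<le> y") (simp_all add: max_def)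
  finally show ?thesis by (meson mult_left_mono order_trans zero_le)
qed

lemma epow_cmult: "0 < r \<Longrightarrow> 0 \<le> c \<Longrightarrow> epow (ennreal c * x) r = ennreal (c powr r) * epow x r"
  by (simp add: epow_mult epow_ennreal)

lemma epow_enn_cmult_inv:
  "0 < r \<Longrightarrow> 0 \<le> c \<Longrightarrow> epow (ennreal (c powr r) * x) (1 / r) = ennreal c * epow x (1 / r)"
  by (simp add: epow_mult epow_ennreal powr_powr)

text \<open>Two-sided series over dyadic scales are written as \<open>nn_integral\<close> over
  \<open>count_space UNIV\<close>: a shift of the index is then a bijection, and exchanging a series
  with an integral or another series is Tonelli's theorem.\<close>

abbreviation dyad :: "int \<Rightarrow> real" where "dyad j \<equiv> 2 powr real_of_int j"

lemma int_sum_shift: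
  fixes f :: "int \<Rightarrow> ennreal"
  shows "(\<integral>\<^sup>+j. f (j + k) \<partial>count_space UNIV) = (\<integral>\<^sup>+j. f j \<partial>count_space UNIV)"
proof (rule nn_integral_bij_count_space)
  show "bij (\<lambda>j::int. j + k)"
    by (rule bij_betw_byWitness[where f' = "\<lambda>j. j - k"]) auto
qed

lemma int_sum_ge:
  fixes f :: "int \<Rightarrow> ennreal"
  shows "f j \<le> (\<integral>\<^sup>+j. f j \<partial>count_space UNIV)"
proof -
  have "f j = (\<integral>\<^sup>+i. f i * indicator {j} i \<partial>count_space UNIV)"
    by (subst nn_integral_count_space'[where A="{j}"]) (auto simp: indicator_def)
  also have "\<dots> \<le> (\<integral>\<^sup>+j. f j \<partial>count_space UNIV)"
    by (intro nn_integral_mono) (auto simp: indicator_def)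
  finally show ?thesis .
qed

text \<open>The substitution \<open>j = k - n\<close> turns the half-infinite sum into a geometric
  series of ratio \<open>2 powr -a\<close>, which converges because \<open>a > 0\<close>.\<close>

lemma dyadic_sum_atMost:
  assumes "0 < a"
  shows "(\<integral>\<^sup>+j. ennreal (dyad j powr a) * of_bool (j \<le> k) \<partial>count_space UNIV)
    = ennreal (dyad k powr a / (1 - 2 powr -a))"
proof -
  have bij: "bij_betw (\<lambda>n::nat. k - int n) UNIV {..k}"
    by (rule bij_betw_byWitness[where f' = "\<lambda>j. nat (k - j)"]) auto
  have "(\<integral>\<^sup>+j. ennreal (dyad j powr a) * of_bool (j \<le> k) \<partial>count_space UNIV)
    = (\<integral>\<^sup>+j. ennreal (dyad j powr a) \<partial>count_space {..k})"
    by (subst nn_integral_count_space_indicator) (auto intro!: nn_integral_cong simp: indicator_def)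
  also have "\<dots> = (\<integral>\<^sup>+n. ennreal (dyad (k - int n) powr a) \<partial>count_space UNIV)"
    by (rule nn_integral_bij_count_space[OF bij, symmetric])
  also have "\<dots> = (\<Sum>n. ennreal (dyad (k - int n) powr a))"
    by (rule nn_integral_count_space_nat)
  also have "\<dots> = ennreal (dyad k powr a / (1 - 2 powr -a))"
  proof (rule suminf_ennreal_eq)
    have r: "norm (2 powr -a :: real) < 1" using assms by (simp add: powr_less_one)
    have "(\<lambda>n. dyad k powr a * (2 powr -a) ^ n) sums (dyad k powr a * (1 / (1 - 2 powr -a)))"
      by (intro sums_mult geometric_sums r)
    moreover have "dyad (k - int n) powr a = dyad k powr a * (2 powr -a) ^ n" for n
      by (simp add: powr_powr powr_realpow[symmetric] powr_add[symmetric] algebra_simps)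
    ultimately show "(\<lambda>n. dyad (k - int n) powr a) sums (dyad k powr a / (1 - 2 powr -a))"
      by simp
  qed simp
  finally show ?thesis .
qed

lemma dyadic_sum_atLeast:
  assumes "0 < a"
  shows "(\<integral>\<^sup>+j. ennreal (dyad j powr -a) * of_bool (k \<le> j) \<partial>count_space UNIV)
    = ennreal (dyad k powr -a / (1 - 2 powr -a))"
proof -
  have bij: "bij (uminus :: int \<Rightarrow> int)" by (rule bij_uminus)
  have "(\<integral>\<^sup>+j. ennreal (dyad j powr -a) * of_bool (k \<le> j) \<partial>count_space UNIV)
    = (\<integral>\<^sup>+j. ennreal (dyad (-j) powr -a) * of_bool (k \<le> -j) \<partial>count_space UNIV)"
    by (rule nn_integral_bij_count_space[OF bij, symmetric])
  also have "\<dots> = (\<integral>\<^sup>+j. ennreal (dyad j powr a) * of_bool (j \<le> -k) \<partial>count_space UNIV)"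
    by (intro nn_integral_cong) (auto simp: powr_powr)
  also have "\<dots> = ennreal (dyad k powr -a / (1 - 2 powr -a))"
    by (subst dyadic_sum_atMost[OF assms]) (simp add: powr_powr)
  finally show ?thesis .
qed

text \<open>The bracket is open below and closed above, to match the strict condition
  \<open>dyad j < x\<close> in the sums that follow.\<close>

lemma dyadic_exists:
  fixes x :: ennreal
  assumes "0 < x" "x < top"
  shows "\<exists>j. ennreal (dyad j) < x \<and> x \<le> ennreal (dyad (j + 1))"
proof -
  obtain y where y: "x = ennreal y" "0 < y" using assms by (cases x) auto
  define j where "j = \<lceil>log 2 y\<rceil> - 1"
  have "real_of_int j < log 2 y" "log 2 y \<le> real_of_int (j + 1)"
    unfolding j_def by linarith+
  then have "dyad j < y" "y \<le> dyad (j + 1)"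
    using y by (simp_all add: less_log_iff log_le_iff)
  then show ?thesis using y by (auto intro!: exI[of _ j] ennreal_lessI ennreal_leI)
qed

text \<open>A geometric sum is dominated by its largest term, here the last dyadic number below
  \<open>x\<close>. This is the discrete form of integrating \<open>s powr (a - 1)\<close> from
  \<open>0\<close> to \<open>x\<close>.\<close>

lemma dyadic_sum_below:
  assumes "0 < a"
  shows "(\<integral>\<^sup>+j. ennreal (dyad j powr a) * of_bool (ennreal (dyad j) < x) \<partial>count_space UNIV)
    \<le> ennreal (1 / (1 - 2 powr -a)) * epow x a"
proof (cases "x = 0 \<or> x = top")
  case True
  have "1 - 2 powr -a > (0::real)" using assms by (simp add: powr_less_one)
  then show ?thesis using True by (auto simp: ennreal_mult_top)
next
  case False
  then obtain k where k: "ennreal (dyad k) < x" "x \<le> ennreal (dyad (k + 1))"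
    using dyadic_exists[of x] by (auto simp: top.not_eq_extremum zero_less_iff_neq_zero)
  have pos: "1 - 2 powr -a > (0::real)" using assms by (simp add: powr_less_one)
  have "(\<integral>\<^sup>+j. ennreal (dyad j powr a) * of_bool (ennreal (dyad j) < x) \<partial>count_space UNIV)
    \<le> (\<integral>\<^sup>+j. ennreal (dyad j powr a) * of_bool (j \<le> k) \<partial>count_space UNIV)"
  proof (intro nn_integral_mono mult_left_mono)
    fix j :: int
    have "j \<le> k" if "ennreal (dyad j) < x"
    proof -
      have "ennreal (dyad j) < ennreal (dyad (k + 1))" using that k by simp
      then show ?thesis by (simp add: ennreal_less_iff)
    qed
    then show "of_bool (ennreal (dyad j) < x) \<le> (of_bool (j \<le> k) :: ennreal)" by simp
  qed simp
  also have "\<dots> = ennreal (dyad k powr a / (1 - 2 powr -a))"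
    by (rule dyadic_sum_atMost[OF assms])
  also have "\<dots> = ennreal (1 / (1 - 2 powr -a)) * epow (ennreal (dyad k)) a"
    using pos by (simp add: epow_ennreal ennreal_mult[symmetric])
  also have "\<dots> \<le> ennreal (1 / (1 - 2 powr -a)) * epow x a"
    using k assms by (intro mult_left_mono epow_mono) auto
  finally show ?thesis .
qed

text \<open>Splitting the sum where \<open>dyad j\<close> passes \<open>x\<close> leaves a geometric series on either side.\<close>
lemma dyadic_sum_min:
  assumes "0 < P" "P < Q"
  shows "(\<integral>\<^sup>+j. ennreal (dyad j powr (P - Q)) * epow (min x (ennreal (dyad j))) Q \<partial>count_space UNIV)
    \<le> ennreal (1 / (1 - 2 powr -P) + 1 / (1 - 2 powr (P - Q))) * epow x P"
    (is "?L \<le> _")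
proof (cases "x = 0 \<or> x = top")
  case True
  have "1 - 2 powr -P > (0::real)" "1 - 2 powr (P - Q) > (0::real)"
    using assms by (simp_all add: powr_less_one)
  then have "1 / (1 - 2 powr -P) + 1 / (1 - 2 powr (P - Q)) > (0::real)"
    by (intro add_pos_pos) auto
  then show ?thesis using True by (auto simp: ennreal_mult_top)
next
  case False
  then obtain y where y: "x = ennreal y" "0 < y" by (cases x) auto
  have pos: "1 - 2 powr -P > (0::real)" "1 - 2 powr (P - Q) > (0::real)"
    using assms by (simp_all add: powr_less_one)
  define k where "k = \<lceil>log 2 y\<rceil>"
  have "log 2 y \<le> real_of_int k" by (simp add: k_def)
  then have yk: "y \<le> dyad k" using y by (simp add: log_le_iff)
  have "?L \<le> (\<integral>\<^sup>+j. ennreal (dyad j powr P) * of_bool (ennreal (dyad j) < x)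
        + ennreal (y powr Q) * (ennreal (dyad j powr -(Q - P)) * of_bool (k \<le> j)) \<partial>count_space UNIV)"
  proof (intro nn_integral_mono)
    fix j :: int
    show "ennreal (dyad j powr (P - Q)) * epow (min x (ennreal (dyad j))) Q
      \<le> ennreal (dyad j powr P) * of_bool (ennreal (dyad j) < x)
        + ennreal (y powr Q) * (ennreal (dyad j powr -(Q - P)) * of_bool (k \<le> j))"
    proof (cases "dyad j < y")
      case True
      then have "ennreal (dyad j) < x" using y by (auto intro: ennreal_lessI)
      moreover have "dyad j powr (P - Q) * dyad j powr Q = dyad j powr P"
        by (simp add: powr_add[symmetric] powr_powr algebra_simps)
      ultimately show ?thesis
        by (simp add: min.absorb2 less_imp_le epow_ennreal ennreal_mult[symmetric])
    next
      case False
      then have "log 2 y \<le> real_of_int j" using y by (simp add: log_le_iff)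
      then have "k \<le> j" by (simp add: k_def ceiling_le_iff)
      moreover have "min x (ennreal (dyad j)) = ennreal y"
        using False y by (auto simp: min_def)
      moreover have "\<not> ennreal (dyad j) < x" using False y by (simp add: ennreal_less_iff)
      ultimately show ?thesis using y
        by (simp add: epow_ennreal mult.commute)
    qed
  qed
  also have "\<dots> = (\<integral>\<^sup>+j. ennreal (dyad j powr P) * of_bool (ennreal (dyad j) < x) \<partial>count_space UNIV)
        + ennreal (y powr Q) * ennreal (dyad k powr -(Q - P) / (1 - 2 powr -(Q - P)))"
    using assms dyadic_sum_atLeast[of "Q - P" k]
    by (simp only: nn_integral_add nn_integral_cmult borel_measurable_count_space)
  also have "\<dots> \<le> ennreal (1 / (1 - 2 powr -P)) * epow x P
        + ennreal (1 / (1 - 2 powr (P - Q))) * epow x P"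
  proof (rule add_mono)
    have "dyad k powr -(Q - P) \<le> y powr -(Q - P)"
      using yk y assms by (intro powr_mono2') auto
    then have "y powr Q * dyad k powr -(Q - P) \<le> y powr Q * y powr -(Q - P)"
      by (intro mult_left_mono) auto
    also have "\<dots> = y powr P" using y by (simp add: powr_add[symmetric])
    finally have "y powr Q * (dyad k powr -(Q - P) / (1 - 2 powr -(Q - P)))
      \<le> 1 / (1 - 2 powr (P - Q)) * y powr P"
      using pos by (simp add: divide_simps)
    then show "ennreal (y powr Q) * ennreal (dyad k powr -(Q - P) / (1 - 2 powr -(Q - P)))
      \<le> ennreal (1 / (1 - 2 powr (P - Q))) * epow x P"
      using pos y by (simp add: epow_ennreal ennreal_mult[symmetric] ennreal_leI)
  qed (rule dyadic_sum_below[OF assms(1)])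
  also have "\<dots> = ennreal (1 / (1 - 2 powr -P) + 1 / (1 - 2 powr (P - Q))) * epow x P"
    using pos by (subst ennreal_plus) (auto simp: distrib_right)
  finally show ?thesis .
qed

section \<open>The maximal function of a doubling measure\<close>

lemma of_bool_borel_measurable [measurable]:
  "Measurable.pred M P \<Longrightarrow> (\<lambda>x. of_bool (P x) :: ennreal) \<in> borel_measurable M"
  by (rule measurable_compose[of P M "count_space UNIV" of_bool borel]) auto

lemma nn_integral_of_bool:
  "Measurable.pred M P \<Longrightarrow> (\<integral>\<^sup>+x. of_bool (P x) \<partial>M) = emeasure M {x \<in> space M. P x}"
proof -
  assume [measurable]: "Measurable.pred M P"
  have "(\<integral>\<^sup>+x. of_bool (P x) \<partial>M) = (\<integral>\<^sup>+x. indicator {x \<in> space M. P x} x \<partial>M)"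
    by (intro nn_integral_cong) (auto simp: indicator_def)
  also have "\<dots> = emeasure M {x \<in> space M. P x}" by (rule nn_integral_indicator) measurable
  finally show ?thesis .
qed

text \<open>Countable subadditivity over an arbitrary countable index set: the indicator of the
  union is at most the sum of the indicators, and Tonelli finishes. The index set will be a family
  of balls without a natural enumeration.\<close>

lemma emeasure_UN_le_count_space:
  assumes [measurable]: "\<And>i. i \<in> I \<Longrightarrow> X i \<in> sets M" and I: "countable I"
  shows "emeasure M (\<Union>i\<in>I. X i) \<le> (\<integral>\<^sup>+i. emeasure M (X i) \<partial>count_space I)"
proof -
  have UN: "(\<Union>i\<in>I. X i) \<in> sets M" using I by (intro sets.countable_UN') auto
  have "emeasure M (\<Union>i\<in>I. X i) = (\<integral>\<^sup>+x. indicator (\<Union>i\<in>I. X i) x \<partial>M)"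
    using UN by simp
  also have "\<dots> \<le> (\<integral>\<^sup>+x. \<integral>\<^sup>+i. indicator (X i) x \<partial>count_space I \<partial>M)"
  proof (intro nn_integral_mono)
    fix x
    show "indicator (\<Union>i\<in>I. X i) x \<le> (\<integral>\<^sup>+i. indicator (X i) x \<partial>count_space I :: ennreal)"
    proof (cases "\<exists>i\<in>I. x \<in> X i")
      case True
      then obtain i where i: "i \<in> I" "x \<in> X i" by auto
      have "(1::ennreal) = (\<integral>\<^sup>+j. indicator {i} j \<partial>count_space I)"
        using i by (subst nn_integral_count_space'[where A="{i}"]) (auto simp: indicator_def)
      also have "\<dots> \<le> (\<integral>\<^sup>+j. indicator (X j) x \<partial>count_space I)"
        using i by (intro nn_integral_mono) (auto simp: indicator_def)
      finally show ?thesis using True by (simp add: indicator_def)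
    qed (auto simp: indicator_def)
  qed
  also have "\<dots> = (\<integral>\<^sup>+i. \<integral>\<^sup>+x. indicator (X i) x \<partial>M \<partial>count_space I)"
    using I by (intro nn_integral_count_space_nn_integral) auto
  also have "\<dots> = (\<integral>\<^sup>+i. emeasure M (X i) \<partial>count_space I)"
    by (intro nn_integral_cong) auto
  finally show ?thesis .
qed

text \<open>Zorn's lemma is applied to the disjoint subfamilies in which every ball of the family that
  meets a chosen ball also meets a chosen ball of at least half its radius.\<close>
lemma vitali_covering_balls:
  fixes F :: "('a::metric_space \<times> real) set"
  assumes F: "\<And>b. b \<in> F \<Longrightarrow> 0 < snd b \<and> snd b \<le> R"
  obtains I where "I \<subseteq> F" "disjoint_family_on (\<lambda>b. ball (fst b) (snd b)) I"
    "\<And>b. b \<in> F \<Longrightarrow> \<exists>c\<in>I. ball (fst b) (snd b) \<subseteq> ball (fst c) (5 * snd c)"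
proof -
  define B where "B = (\<lambda>b::'a \<times> real. ball (fst b) (snd b))"
  define \<A> where "\<A> = {I. I \<subseteq> F \<and> (\<forall>b\<in>I. \<forall>c\<in>I. b \<noteq> c \<longrightarrow> B b \<inter> B c = {}) \<and>
    (\<forall>b\<in>F. (\<exists>c\<in>I. B b \<inter> B c \<noteq> {}) \<longrightarrow> (\<exists>c\<in>I. B b \<inter> B c \<noteq> {} \<and> snd b \<le> 2 * snd c))}"
  have "\<exists>I\<in>\<A>. \<forall>J\<in>\<A>. I \<subseteq> J \<longrightarrow> J = I"
  proof (rule subset_Zorn_nonempty)
    show "\<A> \<noteq> {}" by (auto simp: \<A>_def intro!: exI[of _ "{}"])
  next
    fix \<C> assume ne: "\<C> \<noteq> {}" and ch: "subset.chain \<A> \<C>"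
    then have sub: "\<C> \<subseteq> \<A>" and tot: "\<And>I J. I \<in> \<C> \<Longrightarrow> J \<in> \<C> \<Longrightarrow> I \<subseteq> J \<or> J \<subseteq> I"
      by (auto simp: subset.chain_def)
    have "B b \<inter> B c = {}" if "b \<in> \<Union>\<C>" "c \<in> \<Union>\<C>" "b \<noteq> c" for b c
    proof -
      from that obtain I J where "I \<in> \<C>" "J \<in> \<C>" "b \<in> I" "c \<in> J" by auto
      then obtain K where "K \<in> \<C>" "b \<in> K" "c \<in> K" using tot by blast
      then show ?thesis using sub that by (auto simp: \<A>_def)
    qed
    moreover have "\<exists>c\<in>\<Union>\<C>. B b \<inter> B c \<noteq> {} \<and> snd b \<le> 2 * snd c"
      if "b \<in> F" "\<exists>c\<in>\<Union>\<C>. B b \<inter> B c \<noteq> {}" for b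
    proof -
      from that obtain I where I: "I \<in> \<C>" "\<exists>c\<in>I. B b \<inter> B c \<noteq> {}" by blast
      then have "I \<in> \<A>" using sub by blast
      then have "\<exists>c\<in>I. B b \<inter> B c \<noteq> {} \<and> snd b \<le> 2 * snd c"
        using I that(1) unfolding \<A>_def by blast
      then show ?thesis using I by blast
    qed
    moreover have "\<Union>\<C> \<subseteq> F" using sub by (auto simp: \<A>_def)
    ultimately show "\<Union>\<C> \<in> \<A>" unfolding \<A>_def by blast
  qed
  then obtain I where I: "I \<in> \<A>" and max: "\<And>J. J \<in> \<A> \<Longrightarrow> I \<subseteq> J \<Longrightarrow> J = I" by blast
  have IF: "I \<subseteq> F" and disj: "\<And>b c. b \<in> I \<Longrightarrow> c \<in> I \<Longrightarrow> b \<noteq> c \<Longrightarrow> B b \<inter> B c = {}"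
    and half: "\<And>b. b \<in> F \<Longrightarrow> \<exists>c\<in>I. B b \<inter> B c \<noteq> {} \<Longrightarrow> \<exists>c\<in>I. B b \<inter> B c \<noteq> {} \<and> snd b \<le> 2 * snd c"
    using I unfolding \<A>_def by blast+
  define N where "N = {b\<in>F. \<forall>c\<in>I. B b \<inter> B c = {}}"
  have "N = {}"
  proof (rule ccontr)
    assume N: "N \<noteq> {}"
    \<comment> \<open>Balls in \<open>N\<close> meet no chosen ball. One of them with radius above
      half the supremum of the radii in \<open>N\<close> can be added without destroying the
      half-radius property, which contradicts maximality.\<close>
    define s where "s = Sup (snd ` N)"
    have bdd: "bdd_above (snd ` N)" using F by (auto simp: N_def intro!: bdd_aboveI[of _ R])
    have le_s: "snd b \<le> s" if "b \<in> N" for b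
      unfolding s_def using that bdd by (intro cSup_upper) auto
    have "0 < s" using N le_s F unfolding N_def by force
    then have "s / 2 < s" by simp
    then obtain b0 where b0: "b0 \<in> N" "s / 2 < snd b0"
      using less_cSup_iff[OF _ bdd, of "s/2"] N unfolding s_def[symmetric] by auto
    have "insert b0 I \<in> \<A>"
    proof -
      have "insert b0 I \<subseteq> F" using IF b0 by (auto simp: N_def)
      moreover have "\<forall>b\<in>insert b0 I. \<forall>c\<in>insert b0 I. b \<noteq> c \<longrightarrow> B b \<inter> B c = {}"
        using disj b0 unfolding N_def by blast
      moreover have "\<exists>c\<in>insert b0 I. B b \<inter> B c \<noteq> {} \<and> snd b \<le> 2 * snd c"
        if b: "b \<in> F" "\<exists>c\<in>insert b0 I. B b \<inter> B c \<noteq> {}" for b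
      proof (cases "\<exists>c\<in>I. B b \<inter> B c \<noteq> {}")
        case True
        then show ?thesis using half[OF b(1)] by blast
      next
        case False
        then have "b \<in> N" "B b \<inter> B b0 \<noteq> {}" using b by (auto simp: N_def)
        moreover have "snd b \<le> 2 * snd b0" using le_s[OF \<open>b \<in> N\<close>] b0 by simp
        ultimately show ?thesis by blast
      qed
      ultimately show ?thesis unfolding \<A>_def by blast
    qed
    then have "b0 \<in> I" using max[of "insert b0 I"] by blast
    then have "B b0 = {}" using b0 by (auto simp: N_def)
    then show False using b0 F[of b0] by (auto simp: N_def B_def)
  qed
  show thesis
  proof
    show "I \<subseteq> F" by fact
    show "disjoint_family_on (\<lambda>b. ball (fst b) (snd b)) I"
      using disj by (auto simp: disjoint_family_on_def B_def)
    fix b assume b: "b \<in> F"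
    then have "\<exists>c\<in>I. B b \<inter> B c \<noteq> {}" using \<open>N = {}\<close> unfolding N_def by blast
    from half[OF b this] obtain c y where c: "c \<in> I" "y \<in> B b" "y \<in> B c" "snd b \<le> 2 * snd c" by auto
    have "ball (fst b) (snd b) \<subseteq> ball (fst c) (5 * snd c)"
    proof
      fix x assume "x \<in> ball (fst b) (snd b)"
      \<comment> \<open>The factor 5: a common point \<open>y\<close> joins the balls and
        \<open>snd b \<le> 2 * snd c\<close>, so the distance stays below
        \<open>snd c + 2 * snd b \<le> 5 * snd c\<close>.\<close>
      then have "dist (fst c) x < snd c + snd b + snd b"
        using c dist_triangle[of "fst c" x y] dist_triangle[of y x "fst b"]
        by (simp add: B_def dist_commute)
      then show "x \<in> ball (fst c) (5 * snd c)" using c by simp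
    qed
    then show "\<exists>c\<in>I. ball (fst b) (snd b) \<subseteq> ball (fst c) (5 * snd c)" using c by blast
  qed
qed

definition mavg :: "'a::metric_space measure \<Rightarrow> ('a \<Rightarrow> ennreal) \<Rightarrow> 'a \<Rightarrow> real \<Rightarrow> ennreal" where
  "mavg M g x r = (\<integral>\<^sup>+y\<in>ball x r. g y \<partial>M) / emeasure M (ball x r)"

text \<open>The uncentred maximal function. Balls are passed as pairs of centre and radius, since in
  a metric space the set alone need not determine them. Admitting every ball that contains
  \<open>x\<close> makes the superlevel sets unions of open balls.\<close>

definition maxf :: "'a::metric_space measure \<Rightarrow> ('a \<Rightarrow> ennreal) \<Rightarrow> 'a \<Rightarrow> ennreal" where
  "maxf M g x = (SUP b\<in>{b. 0 < snd b \<and> x \<in> ball (fst b) (snd b)}. mavg M g (fst b) (snd b))"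

lemma mavg_le_maxf: "0 < r \<Longrightarrow> x \<in> ball z r \<Longrightarrow> mavg M g z r \<le> maxf M g x"
  unfolding maxf_def by (rule SUP_upper2[of "(z, r)"]) auto

lemma superlevel_maxf:
  "{x. a < maxf M g x} =
    (\<Union>b\<in>{b. 0 < snd b \<and> a < mavg M g (fst b) (snd b)}. ball (fst b) (snd b))"
  unfolding maxf_def less_SUP_iff by blast

lemma open_superlevel_maxf: "open {x. a < maxf M g x}"
  unfolding superlevel_maxf by auto

lemma open_superlevel_borel_measurable:
  fixes f :: "'a::topological_space \<Rightarrow> ennreal"
  assumes "\<And>a. open {x. a < f x}" "sets M = sets borel"
  shows "f \<in> borel_measurable M"
proof (rule borel_measurableI_greater)
  fix a
  have "space M = UNIV" using sets_eq_imp_space_eq[OF assms(2)] by simp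
  then show "{x \<in> space M. a < f x} \<in> sets M" using assms by (simp add: borel_open)
qed

text \<open>The normalisation \<open>1 \<le> Cd\<close> costs nothing and keeps the powers of
  \<open>Cd\<close> increasing and all derived constants positive.\<close>

locale doubling_space =
  fixes M :: "'a::metric_space measure" and Cd :: real
  assumes sets_M [measurable_cong, simp]: "sets M = sets borel"
    and ball_pos: "0 < r \<Longrightarrow> 0 < emeasure M (ball x r)"
    and ball_fin': "0 < r \<Longrightarrow> emeasure M (ball x r) < top"
    and Cd1: "1 \<le> Cd"
    and dbl: "0 < r \<Longrightarrow> emeasure M (ball x (2 * r)) \<le> ennreal Cd * emeasure M (ball x r)"
begin

lemma space_M [simp]: "space M = UNIV"
  using sets_eq_imp_space_eq[OF sets_M] by simp

lemma ball_fin [simp]: "emeasure M (ball x r) < top"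
  using ball_fin'[of r x] by (cases "0 < r") (auto simp: ball_empty)

lemma ball_not_top [simp]: "emeasure M (ball x r) \<noteq> top"
  using ball_fin[of x r] by (simp only: less_top)

lemma ball_not_0: "0 < r \<Longrightarrow> emeasure M (ball x r) \<noteq> 0"
  using ball_pos[of r x] by simp

lemma ball_sets [measurable, simp]: "ball x r \<in> sets M"
  by simp

lemma dbl_pow: "0 < r \<Longrightarrow> emeasure M (ball x (2 ^ n * r)) \<le> ennreal (Cd ^ n) * emeasure M (ball x r)"
proof (induction n)
  case (Suc n)
  have "emeasure M (ball x (2 ^ Suc n * r)) \<le> ennreal Cd * emeasure M (ball x (2 ^ n * r))"
    using dbl[of "2 ^ n * r" x] Suc.prems by (simp add: mult.assoc)
  also have "\<dots> \<le> ennreal Cd * (ennreal (Cd ^ n) * emeasure M (ball x r))"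
    using Suc by (intro mult_left_mono) auto
  also have "\<dots> = ennreal (Cd ^ Suc n) * emeasure M (ball x r)"
    using Cd1 by (simp add: ennreal_mult mult.assoc)
  finally show ?case .
qed simp

lemma ball_subset_dbl:
  assumes "0 < r" "ball y s \<subseteq> ball x (2 ^ n * r)"
  shows "emeasure M (ball y s) \<le> ennreal (Cd ^ n) * emeasure M (ball x r)"
  using emeasure_mono[OF assms(2)] dbl_pow[OF assms(1), of x n] by (meson ball_sets order_trans)

lemma mavg_times: "0 < r \<Longrightarrow> mavg M g x r * emeasure M (ball x r) = (\<integral>\<^sup>+y\<in>ball x r. g y \<partial>M)"
  unfolding mavg_def using ball_not_0[of r x] ball_fin[of x r]
  by (simp add: ennreal_divide_times ennreal_divide_self)

lemma mavg_leI:
  assumes "0 < r" "(\<integral>\<^sup>+y\<in>ball x r. g y \<partial>M) \<le> c * emeasure M (ball x r)"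
  shows "mavg M g x r \<le> c"
proof -
  have "mavg M g x r \<le> c * emeasure M (ball x r) / emeasure M (ball x r)"
    unfolding mavg_def by (intro divide_right_mono_ennreal assms)
  also have "\<dots> = c" using ball_not_0[OF assms(1)] by (simp add: ennreal_mult_divide_eq)
  finally show ?thesis .
qed



lemma mavg_mono_AE: "AE y in M. g y \<le> h y \<Longrightarrow> mavg M g x r \<le> mavg M h x r"
  unfolding mavg_def
  by (intro divide_right_mono_ennreal nn_integral_mono_AE) (auto simp: mult_right_mono)

lemma mavg_add:
  assumes [measurable]: "g \<in> borel_measurable M" "h \<in> borel_measurable M"
  shows "mavg M (\<lambda>y. g y + h y) x r = mavg M g x r + mavg M h x r"
  unfolding mavg_def by (simp add: distrib_right nn_integral_add add_divide_distrib_ennreal)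

lemma mavg_const: "0 < r \<Longrightarrow> mavg M (\<lambda>y. c) x r = c"
  unfolding mavg_def using ball_not_0[of r x]
  by (simp add: nn_integral_cmult_indicator ennreal_mult_divide_eq)

lemma mavg_cmult:
  assumes [measurable]: "g \<in> borel_measurable M"
  shows "mavg M (\<lambda>y. c * g y) x r = c * mavg M g x r"
  unfolding mavg_def by (simp add: mult.assoc nn_integral_cmult ennreal_times_divide)

lemma maxf_measurable [measurable]: "maxf M g \<in> borel_measurable M"
  by (rule open_superlevel_borel_measurable) (auto simp: open_superlevel_maxf)



text \<open>Meant for \<open>h\<close> equal to the part of \<open>g\<close> above the level
  \<open>c\<close>: the remaining part is at most \<open>c\<close> and adds at most \<open>c\<close>
  to every average.\<close>

lemma maxf_le_add_const:
  assumes [measurable]: "h \<in> borel_measurable M" and "\<And>y. g y \<le> h y + c"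
  shows "maxf M g x \<le> maxf M h x + c"
  unfolding maxf_def[of M g]
proof (rule SUP_least)
  fix b assume b: "b \<in> {b. 0 < snd b \<and> x \<in> ball (fst b) (snd b)}"
  have "mavg M g (fst b) (snd b) \<le> mavg M (\<lambda>y. h y + c) (fst b) (snd b)"
    using assms by (intro mavg_mono_AE) auto
  also have "\<dots> = mavg M h (fst b) (snd b) + c"
    using b by (simp add: mavg_add mavg_const)
  also have "\<dots> \<le> maxf M h x + c"
    using b by (intro add_mono mavg_le_maxf) auto
  finally show "mavg M g (fst b) (snd b) \<le> maxf M h x + c" .
qed

lemma maxf_le_const_AE: "AE y in M. g y \<le> c \<Longrightarrow> maxf M g x \<le> c"
  unfolding maxf_def
  by (rule SUP_least) (use mavg_mono_AE[of g "\<lambda>_. c"] mavg_const[where c=c] in \<open>metis mem_Collect_eq\<close>)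

text \<open>The finite measure \<open>density M g\<close> gives finitely many disjoint balls a total
  mass of at most the integral of \<open>g\<close>. The masses are therefore summable, and a
  summable family has only countably many nonzero members.\<close>

lemma countable_disjoint_balls:
  assumes [measurable]: "g \<in> borel_measurable M" and fin: "(\<integral>\<^sup>+x. g x \<partial>M) < top"
    and disj: "disjoint_family_on (\<lambda>b. ball (fst b) (snd b)) I"
    and pos: "\<And>b. b \<in> I \<Longrightarrow> (\<integral>\<^sup>+y\<in>ball (fst b) (snd b). g y \<partial>M) > 0"
  shows "countable I"
proof -
  define \<nu> where "\<nu> = density M g"
  define v where "v b = enn2real (emeasure \<nu> (ball (fst b) (snd b)))" for b :: "'a \<times> real"
  have \<nu>: "emeasure \<nu> A = (\<integral>\<^sup>+y\<in>A. g y \<partial>M)" if "A \<in> sets M" for A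
    unfolding \<nu>_def using that by (simp add: emeasure_density)
  have \<nu>_le: "emeasure \<nu> A \<le> (\<integral>\<^sup>+x. g x \<partial>M)" if "A \<in> sets M" for A
    unfolding \<nu>[OF that] by (intro nn_integral_mono) (auto simp: indicator_def)
  have \<nu>_fin: "emeasure \<nu> A < top" if "A \<in> sets M" for A
    using \<nu>_le[OF that] fin by simp
  have sets\<nu>: "sets \<nu> = sets M" by (simp add: \<nu>_def)
  have "v summable_on I"
  proof (rule nonneg_bdd_above_summable_on)
    show "bdd_above (sum v ` {F. F \<subseteq> I \<and> finite F})"
    proof (intro bdd_aboveI2[where M = "enn2real (\<integral>\<^sup>+x. g x \<partial>M)"])
      fix F assume "F \<in> {F. F \<subseteq> I \<and> finite F}"
      then have F: "F \<subseteq> I" "finite F" by auto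
      have "ennreal (sum v F) = (\<Sum>b\<in>F. emeasure \<nu> (ball (fst b) (snd b)))"
        unfolding v_def using \<nu>_fin[OF ball_sets]
        by (subst sum_ennreal[symmetric]) auto
      also have "\<dots> = emeasure \<nu> (\<Union>b\<in>F. ball (fst b) (snd b))"
        using F disjoint_family_on_mono[OF F(1) disj]
        by (intro sum_emeasure) (auto simp: sets\<nu>)
      also have "\<dots> \<le> (\<integral>\<^sup>+x. g x \<partial>M)"
        by (intro \<nu>_le) (auto intro!: borel_open)
      finally have "enn2real (ennreal (sum v F)) \<le> enn2real (\<integral>\<^sup>+x. g x \<partial>M)"
        using fin by (intro enn2real_mono) auto
      then show "sum v F \<le> enn2real (\<integral>\<^sup>+x. g x \<partial>M)"
        by (simp add: v_def sum_nonneg)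
    qed
  qed (simp add: v_def)
  then have "countable {b\<in>I. v b \<noteq> 0}" by (rule summable_countable_real)
  moreover have "{b\<in>I. v b \<noteq> 0} = I"
  proof -
    have "v b \<noteq> 0" if "b \<in> I" for b
      using pos[OF that] \<nu>_fin[OF ball_sets, of "fst b" "snd b"] \<nu>[OF ball_sets, of "fst b" "snd b"]
      by (auto simp: v_def enn2real_eq_0_iff)
    then show ?thesis by auto
  qed
  ultimately show ?thesis by simp
qed

text \<open>Vitali selects disjoint balls on which the average of \<open>g\<close> exceeds
  \<open>l\<close>, so \<open>l\<close> times their total measure is at most the integral of
  \<open>g\<close>. The fivefold balls cover the superlevel set and cost \<open>Cd ^ 3\<close>,
  because \<open>5 \<le> 2 ^ 3\<close>. Vitali needs bounded radii; the bound \<open>n\<close> is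
  removed by continuity from below.\<close>

lemma maxf_weak_type:
  assumes [measurable]: "g \<in> borel_measurable M" and l: "0 < l"
  shows "ennreal l * emeasure M {x. ennreal l < maxf M g x} \<le> ennreal (Cd ^ 3) * (\<integral>\<^sup>+x. g x \<partial>M)"
proof (cases "(\<integral>\<^sup>+x. g x \<partial>M) = top")
  case True
  then show ?thesis using Cd1 by (auto simp: ennreal_mult_top)
next
  case False
  then have fin: "(\<integral>\<^sup>+x. g x \<partial>M) < top" by (simp add: top.not_eq_extremum)
  define F where "F n = {b. 0 < snd b \<and> snd b \<le> real n \<and> ennreal l < mavg M g (fst b) (snd b)}"
    for n :: nat
  define S where "S n = (\<Union>b\<in>F n. ball (fst b) (snd b))" for n
  have S_open: "open (S n)" for n by (auto simp: S_def)
  have bound: "ennreal l * emeasure M (S n) \<le> ennreal (Cd ^ 3) * (\<integral>\<^sup>+x. g x \<partial>M)" for n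
  proof -
    obtain I where I: "I \<subseteq> F n" "disjoint_family_on (\<lambda>b. ball (fst b) (snd b)) I"
      and cov: "\<And>b. b \<in> F n \<Longrightarrow> \<exists>c\<in>I. ball (fst b) (snd b) \<subseteq> ball (fst c) (5 * snd c)"
      by (rule vitali_covering_balls[of "F n" "real n"]) (auto simp: F_def)
    have le: "ennreal l * emeasure M (ball (fst b) (snd b)) \<le> (\<integral>\<^sup>+y\<in>ball (fst b) (snd b). g y \<partial>M)"
      and r: "0 < snd b" if "b \<in> I" for b
    proof -
      from that I have b: "0 < snd b" "ennreal l < mavg M g (fst b) (snd b)" by (auto simp: F_def)
      then show "0 < snd b" by simp
      show "ennreal l * emeasure M (ball (fst b) (snd b)) \<le> (\<integral>\<^sup>+y\<in>ball (fst b) (snd b). g y \<partial>M)"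
        unfolding mavg_times[OF b(1), symmetric] using b by (intro mult_right_mono) auto
    qed
    have cI: "countable I"
    proof (rule countable_disjoint_balls[OF _ fin I(2)])
      fix b assume "b \<in> I"
      then have "0 < ennreal l * emeasure M (ball (fst b) (snd b))"
        using l ball_pos[OF r] by (simp add: ennreal_zero_less_mult_iff)
      also note le[OF \<open>b \<in> I\<close>]
      finally show "0 < (\<integral>\<^sup>+y\<in>ball (fst b) (snd b). g y \<partial>M)" .
    qed simp
    have "emeasure M (S n) \<le> emeasure M (\<Union>b\<in>I. ball (fst b) (5 * snd b))"
    proof (rule emeasure_mono)
      show "S n \<subseteq> (\<Union>b\<in>I. ball (fst b) (5 * snd b))" unfolding S_def using cov by blast
    qed (auto intro!: borel_open)
    also have "\<dots> \<le> (\<integral>\<^sup>+b. emeasure M (ball (fst b) (5 * snd b)) \<partial>count_space I)"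
      by (intro emeasure_UN_le_count_space cI) simp
    also have "\<dots> \<le> (\<integral>\<^sup>+b. ennreal (Cd ^ 3) * emeasure M (ball (fst b) (snd b)) \<partial>count_space I)"
      using r by (intro nn_integral_mono ball_subset_dbl) (auto intro!: subset_ball)
    finally have "ennreal l * emeasure M (S n)
      \<le> ennreal l * (\<integral>\<^sup>+b. ennreal (Cd ^ 3) * emeasure M (ball (fst b) (snd b)) \<partial>count_space I)"
      by (intro mult_left_mono) auto
    also have "\<dots> = (\<integral>\<^sup>+b. ennreal (Cd ^ 3) * (ennreal l * emeasure M (ball (fst b) (snd b))) \<partial>count_space I)"
      by (subst nn_integral_cmult[symmetric]) (auto simp: mult_ac)
    also have "\<dots> \<le> (\<integral>\<^sup>+b. ennreal (Cd ^ 3) * (\<integral>\<^sup>+y\<in>ball (fst b) (snd b). g y \<partial>M) \<partial>count_space I)"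
      using le by (intro nn_integral_mono mult_left_mono) auto
    also have "\<dots> = ennreal (Cd ^ 3) * (\<integral>\<^sup>+b. emeasure (density M g) (ball (fst b) (snd b)) \<partial>count_space I)"
      by (subst nn_integral_cmult) (auto simp: emeasure_density)
    also have "(\<integral>\<^sup>+b. emeasure (density M g) (ball (fst b) (snd b)) \<partial>count_space I)
      = emeasure (density M g) (\<Union>b\<in>I. ball (fst b) (snd b))"
      by (subst emeasure_UN_countable) (auto simp: cI I)
    also have "\<dots> \<le> (\<integral>\<^sup>+x. g x \<partial>M)"
      by (subst emeasure_density) (auto intro!: borel_open nn_integral_mono simp: indicator_def)
    finally show ?thesis by (simp add: mult_left_mono)
  qed
  have UN: "{x. ennreal l < maxf M g x} = (\<Union>n. S n)"
    unfolding superlevel_maxf S_def F_def using real_arch_simple by fastforce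
  have "incseq S" unfolding S_def F_def incseq_def by fastforce
  then have "emeasure M (\<Union>n. S n) = (SUP n. emeasure M (S n))"
    using S_open by (intro SUP_emeasure_incseq[symmetric]) (auto intro!: borel_open)
  then have "ennreal l * emeasure M {x. ennreal l < maxf M g x} = (SUP n. ennreal l * emeasure M (S n))"
    by (simp add: UN SUP_mult_left_ennreal)
  also have "\<dots> \<le> ennreal (Cd ^ 3) * (\<integral>\<^sup>+x. g x \<partial>M)"
    by (intro SUP_least bound)
  finally show ?thesis .
qed

text \<open>The indices are shifted by one so that the level \<open>dyad (j + 1)\<close> can later
  be split into two halves \<open>dyad j\<close>.\<close>

lemma epow_le_dyadic_sum:
  assumes "0 < s"
  shows "epow m s \<le> (\<integral>\<^sup>+j. ennreal (dyad (j + 2) powr s) * of_bool (ennreal (dyad (j + 1)) < m)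
    \<partial>count_space UNIV)"
proof -
  have "epow m s \<le> (\<integral>\<^sup>+j. ennreal (dyad (j + 1) powr s) * of_bool (ennreal (dyad j) < m)
    \<partial>count_space UNIV)" (is "_ \<le> ?S")
  proof -
    consider "m = 0" | "m = top" | "0 < m" "m < top"
      by (metis top.not_eq_extremum zero_less_iff_neq_zero)
    then show ?thesis
    proof cases
      case 2
      \<comment> \<open>For \<open>m = top\<close> no term is switched off, and a single term with a
        large index already exceeds \<open>n\<close>.\<close>
      have "of_nat n \<le> ?S" for n
      proof -
        have "of_nat n \<le> ennreal (dyad (\<lceil>(real n) / s\<rceil> + 1) powr s)"
        proof -
          have "real n \<le> 2 powr (real n)" by (simp add: powr_realpow less_exp less_imp_le)
          also have "\<dots> \<le> 2 powr (real_of_int (\<lceil>(real n) / s\<rceil> + 1) * s)"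
          proof (intro powr_mono)
            have "real n / s \<le> real_of_int (\<lceil>(real n) / s\<rceil> + 1)" by linarith
            then show "real n \<le> real_of_int (\<lceil>(real n) / s\<rceil> + 1) * s"
              using assms by (simp add: divide_le_eq)
          qed simp
          finally show ?thesis
            by (subst ennreal_of_nat_eq_real_of_nat) (auto intro!: ennreal_leI simp: powr_powr)
        qed
        also have "\<dots> \<le> ?S"
          using int_sum_ge[of "\<lambda>j. ennreal (dyad (j + 1) powr s) * of_bool (ennreal (dyad j) < m)" "\<lceil>(real n) / s\<rceil>"] 2
          by simp
        finally show ?thesis .
      qed
      note S_ge = this
      have "?S = top"
      proof (rule ccontr)
        assume "?S \<noteq> top"
        then have "?S < top" by (simp only: less_top)
        then obtain n where "?S < of_nat n" by (meson ennreal_Ex_less_of_nat)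
        then show False using S_ge[of n] by (simp add: leD)
      qed
      then show ?thesis by simp
    next
      case 3
      then obtain j where j: "ennreal (dyad j) < m" "m \<le> ennreal (dyad (j + 1))"
        using dyadic_exists by blast
      then have "epow m s \<le> ennreal (dyad (j + 1) powr s) * of_bool (ennreal (dyad j) < m)"
        using epow_mono[OF j(2), of s] assms by (simp add: epow_ennreal)
      also have "\<dots> \<le> ?S" by (rule int_sum_ge)
      finally show ?thesis .
    qed simp
  qed
  also have "?S = (\<integral>\<^sup>+j. ennreal (dyad (j + 2) powr s) * of_bool (ennreal (dyad (j + 1)) < m)
    \<partial>count_space UNIV)"
    by (subst int_sum_shift[of _ 1, symmetric]) (simp add: add.assoc)
  finally show ?thesis .
qed

text \<open>Marcinkiewicz interpolation by hand. Where \<open>maxf M g\<close> exceeds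
  \<open>2 * dyad j\<close>, the maximal function of the part of \<open>g\<close> above
  \<open>dyad j\<close> exceeds \<open>dyad j\<close>, and the weak type bound applies to that part.
  Summation over \<open>j\<close> leaves \<open>g\<close> times the sum of
  \<open>dyad j powr (s - 1)\<close> over \<open>dyad j < g\<close>, which is of order
  \<open>g powr s\<close> exactly because \<open>s > 1\<close>.\<close>

lemma maxf_strong_type:
  assumes s: "1 < s"
  shows "\<exists>C>0. \<forall>g::'a \<Rightarrow> ennreal. g \<in> borel_measurable M \<longrightarrow>
    (\<integral>\<^sup>+x. epow (maxf M g x) s \<partial>M) \<le> ennreal C * (\<integral>\<^sup>+x. epow (g x) s \<partial>M)"
proof (intro exI conjI allI impI)
  define A where "A = 1 / (1 - 2 powr -(s - 1) :: real)"
  define C where "C = 4 powr s * Cd ^ 3"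
  have "A > 0" using s by (simp add: A_def powr_less_one)
  have "C > 0" using Cd1 by (simp add: C_def)
  show "C * A > 0" using \<open>A > 0\<close> \<open>C > 0\<close> by simp
  fix g :: "'a \<Rightarrow> ennreal" assume [measurable]: "g \<in> borel_measurable M"
  define gj where "gj j x = g x * of_bool (ennreal (dyad j) < g x)" for j x
  have [measurable]: "gj j \<in> borel_measurable M" for j unfolding gj_def by measurable
  have level: "emeasure M {x. ennreal (dyad (j + 1)) < maxf M g x}
    \<le> ennreal (dyad (-j) * Cd ^ 3) * (\<integral>\<^sup>+x. gj j x \<partial>M)" for j
  proof -
    have "maxf M g x \<le> maxf M (gj j) x + ennreal (dyad j)" for x
      by (rule maxf_le_add_const) (auto simp: gj_def)
    moreover have "ennreal (dyad (j + 1)) = ennreal (dyad j) + ennreal (dyad j)"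
      by (simp add: powr_add ennreal_plus[symmetric] del: ennreal_plus)
    ultimately have "{x. ennreal (dyad (j + 1)) < maxf M g x} \<subseteq> {x. ennreal (dyad j) < maxf M (gj j) x}"
      by (smt (verit) Collect_mono add_right_mono leD leI order_trans)
    then have "emeasure M {x. ennreal (dyad (j + 1)) < maxf M g x}
      \<le> emeasure M {x. ennreal (dyad j) < maxf M (gj j) x}"
      by (intro emeasure_mono) (auto intro!: borel_open open_superlevel_maxf)
    also have "\<dots> = ennreal (dyad (-j)) * (ennreal (dyad j) * emeasure M {x. ennreal (dyad j) < maxf M (gj j) x})"
      by (simp add: mult.assoc[symmetric] ennreal_mult[symmetric] powr_add[symmetric])
    also have "\<dots> \<le> ennreal (dyad (-j)) * (ennreal (Cd ^ 3) * (\<integral>\<^sup>+x. gj j x \<partial>M))"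
      by (intro mult_left_mono maxf_weak_type) auto
    finally show ?thesis using Cd1 by (simp add: ennreal_mult mult.assoc)
  qed
  have "(\<integral>\<^sup>+x. epow (maxf M g x) s \<partial>M)
    \<le> (\<integral>\<^sup>+x. \<integral>\<^sup>+j. ennreal (dyad (j + 2) powr s) * of_bool (ennreal (dyad (j + 1)) < maxf M g x)
        \<partial>count_space UNIV \<partial>M)"
    using s by (intro nn_integral_mono epow_le_dyadic_sum) auto
  also have "\<dots> = (\<integral>\<^sup>+j. ennreal (dyad (j + 2) powr s) * emeasure M {x. ennreal (dyad (j + 1)) < maxf M g x}
        \<partial>count_space UNIV)"
    by (subst nn_integral_count_space_nn_integral)
       (auto intro!: nn_integral_cong simp: nn_integral_cmult nn_integral_of_bool)
  also have "\<dots> \<le> (\<integral>\<^sup>+j. ennreal (dyad (j + 2) powr s) * (ennreal (dyad (-j) * Cd ^ 3) * (\<integral>\<^sup>+x. gj j x \<partial>M))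
        \<partial>count_space UNIV)"
    by (intro nn_integral_mono mult_left_mono level) auto
  also have "\<dots> = (\<integral>\<^sup>+j. \<integral>\<^sup>+x. ennreal C * (ennreal (dyad j powr (s - 1)) * gj j x) \<partial>M \<partial>count_space UNIV)"
  proof (intro nn_integral_cong)
    fix j :: int
    \<comment> \<open>The factor \<open>4 powr s\<close> in \<open>C\<close> comes from the two
      index shifts, and \<open>Cd ^ 3\<close> from the weak type bound.\<close>
    have "dyad (j + 2) powr s * (dyad (-j) * Cd ^ 3) = C * dyad j powr (s - 1)"
    proof -
      have "dyad (j + 2) powr s = 4 powr s * dyad j powr s"
        by (simp add: powr_add powr_mult)
      moreover have "dyad j powr s * dyad (-j) = dyad j powr (s - 1)"
        by (simp add: powr_powr powr_add[symmetric] algebra_simps)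
      ultimately show ?thesis by (simp add: C_def)
    qed
    then have "ennreal (dyad (j + 2) powr s) * ennreal (dyad (-j) * Cd ^ 3) = ennreal C * ennreal (dyad j powr (s - 1))"
      using Cd1 \<open>C > 0\<close> by (subst (1 2) ennreal_mult[symmetric]) auto
    then show "ennreal (dyad (j + 2) powr s) * (ennreal (dyad (-j) * Cd ^ 3) * (\<integral>\<^sup>+x. gj j x \<partial>M))
      = (\<integral>\<^sup>+x. ennreal C * (ennreal (dyad j powr (s - 1)) * gj j x) \<partial>M)"
      by (simp add: nn_integral_cmult mult.assoc[symmetric])
  qed
  also have "\<dots> = (\<integral>\<^sup>+x. \<integral>\<^sup>+j. ennreal C * (ennreal (dyad j powr (s - 1)) * gj j x) \<partial>count_space UNIV \<partial>M)"
    by (subst nn_integral_count_space_nn_integral) auto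
  also have "\<dots> \<le> (\<integral>\<^sup>+x. ennreal (C * A) * epow (g x) s \<partial>M)"
  proof (intro nn_integral_mono)
    fix x
    have "(\<integral>\<^sup>+j. ennreal C * (ennreal (dyad j powr (s - 1)) * gj j x) \<partial>count_space UNIV)
      = (\<integral>\<^sup>+j. (ennreal C * g x) * (ennreal (dyad j powr (s - 1)) * of_bool (ennreal (dyad j) < g x)) \<partial>count_space UNIV)"
      by (intro nn_integral_cong) (simp add: gj_def mult_ac)
    also have "\<dots> = ennreal C * g x * (\<integral>\<^sup>+j. ennreal (dyad j powr (s - 1)) * of_bool (ennreal (dyad j) < g x) \<partial>count_space UNIV)"
      by (subst nn_integral_cmult) auto
    also have "\<dots> \<le> ennreal C * g x * (ennreal A * epow (g x) (s - 1))"
      unfolding A_def using s by (intro mult_left_mono dyadic_sum_below) auto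
    also have "\<dots> = ennreal (C * A) * epow (g x) (1 + (s - 1))"
      unfolding epow_add_exp using \<open>A > 0\<close> \<open>C > 0\<close> by (simp add: ennreal_mult mult_ac)
    finally show "(\<integral>\<^sup>+j. ennreal C * (ennreal (dyad j powr (s - 1)) * gj j x) \<partial>count_space UNIV)
      \<le> ennreal (C * A) * epow (g x) s" by simp
  qed
  also have "\<dots> = ennreal (C * A) * (\<integral>\<^sup>+x. epow (g x) s \<partial>M)"
    by (intro nn_integral_cmult) auto
  finally show "(\<integral>\<^sup>+x. epow (maxf M g x) s \<partial>M) \<le> ennreal (C * A) * (\<integral>\<^sup>+x. epow (g x) s \<partial>M)" .
qed

end

section \<open>The sharp maximal function and Hajlasz gradients\<close>

lemma ennreal_tendsto_0I:
  fixes X :: "'b \<Rightarrow> ennreal"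
  assumes "\<And>e::real. 0 < e \<Longrightarrow> eventually (\<lambda>n. X n \<le> ennreal e) F"
  shows "(X \<longlongrightarrow> 0) F"
proof (rule order_tendstoI)
  fix a :: ennreal assume "0 < a"
  then obtain e where e: "0 < e" "ennreal e < a"
  proof (cases a)
    case (real r)
    then show ?thesis using \<open>0 < a\<close> by (intro that[of "r/2"]) (auto intro!: ennreal_lessI)
  next
    case top
    then show ?thesis by (intro that[of 1]) auto
  qed
  show "eventually (\<lambda>n. X n < a) F"
    using assms[OF e(1)] by eventually_elim (use e in simp)
qed simp

definition osc :: "'a::metric_space measure \<Rightarrow> ('a \<Rightarrow> real) \<Rightarrow> 'a \<Rightarrow> real \<Rightarrow> ennreal" where
  "osc M f z r = (INF c. mavg M (\<lambda>y. ennreal \<bar>f y - c\<bar>) z r)"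

text \<open>Taking the infimum over constants, rather than the average, avoids integrability assumptions,
  and using all balls that contain \<open>x\<close> makes the superlevel sets open, hence Borel.\<close>
definition sharp :: "'a::metric_space measure \<Rightarrow> ('a \<Rightarrow> real) \<Rightarrow> 'a \<Rightarrow> ennreal" where
  "sharp M f x = (SUP b\<in>{b. 0 < snd b \<and> x \<in> ball (fst b) (snd b)}.
     ennreal (1 / snd b) * osc M f (fst b) (snd b))"

definition hajlasz :: "'a::metric_space measure \<Rightarrow> ('a \<Rightarrow> real) \<Rightarrow> ('a \<Rightarrow> ennreal) \<Rightarrow> bool" where
  "hajlasz M f h \<longleftrightarrow> (\<exists>N\<in>null_sets M. \<forall>x y. x \<notin> N \<longrightarrow> y \<notin> N \<longrightarrow>
     ennreal \<bar>f x - f y\<bar> \<le> ennreal (dist x y) * (h x + h y))"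

text \<open>Averages are tested only along radii \<open>r / 2 ^ n\<close>; these are the balls that
  occur in the telescoping argument.\<close>

definition leb_pt :: "'a::metric_space measure \<Rightarrow> ('a \<Rightarrow> real) \<Rightarrow> 'a \<Rightarrow> bool" where
  "leb_pt M f x \<longleftrightarrow>
     (\<forall>r>0. (\<lambda>n. mavg M (\<lambda>y. ennreal \<bar>f y - f x\<bar>) x (r / 2 ^ n)) \<longlonglongrightarrow> 0)"

text \<open>At an isolated point \<open>Lip u x\<close> is \<open>-\<infinity>\<close>, which becomes \<open>0\<close> here.\<close>
definition lipn :: "('a::metric_space \<Rightarrow> real) \<Rightarrow> 'a \<Rightarrow> ennreal" where
  "lipn u x = e2ennreal (Lip u x)"

lemma osc_le: "osc M f z r \<le> mavg M (\<lambda>y. ennreal \<bar>f y - c\<bar>) z r"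
  unfolding osc_def by (rule INF_lower) simp

lemma open_superlevel_sharp: "open {x. a < sharp M f x}"
proof -
  have "{x. a < sharp M f x} = (\<Union>b\<in>{b. 0 < snd b \<and> a < ennreal (1 / snd b) * osc M f (fst b) (snd b)}.
    ball (fst b) (snd b))"
    unfolding sharp_def less_SUP_iff by blast
  then show ?thesis by auto
qed

lemma osc_le_sharp:
  assumes "0 < r" "x \<in> ball z r"
  shows "osc M f z r \<le> ennreal r * sharp M f x"
proof -
  have "ennreal (1 / r) * osc M f z r \<le> sharp M f x"
    unfolding sharp_def by (rule SUP_upper2[of "(z, r)"]) (use assms in auto)
  then have "ennreal r * (ennreal (1 / r) * osc M f z r) \<le> ennreal r * sharp M f x"
    by (intro mult_left_mono) auto
  then show ?thesis using assms by (simp add: mult.assoc[symmetric] ennreal_mult[symmetric])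
qed

lemma sharp_leI:
  assumes "\<And>z r. 0 < r \<Longrightarrow> x \<in> ball z r \<Longrightarrow> osc M f z r \<le> ennreal r * c"
  shows "sharp M f x \<le> c"
  unfolding sharp_def
proof (rule SUP_least)
  fix b assume "b \<in> {b. 0 < snd b \<and> x \<in> ball (fst b) (snd b)}"
  then have b: "0 < snd b" "x \<in> ball (fst b) (snd b)" by auto
  have "ennreal (1 / snd b) * osc M f (fst b) (snd b) \<le> ennreal (1 / snd b) * (ennreal (snd b) * c)"
    using b by (intro mult_left_mono assms) auto
  also have "\<dots> = c" using b by (simp add: mult.assoc[symmetric] ennreal_mult[symmetric])
  finally show "ennreal (1 / snd b) * osc M f (fst b) (snd b) \<le> c" .
qed

context doubling_space
begin

lemma sharp_measurable [measurable]: "sharp M f \<in> borel_measurable M"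
  by (rule open_superlevel_borel_measurable) (auto simp: open_superlevel_sharp)

lemma mavg_mono_on:
  "AE y in M. y \<in> ball x r \<longrightarrow> g y \<le> h y \<Longrightarrow> mavg M g x r \<le> mavg M h x r"
  unfolding mavg_def
  by (intro divide_right_mono_ennreal nn_integral_mono_AE) (auto simp: indicator_def)

lemma mavg_sub:
  assumes "0 < s" "ball y s \<subseteq> ball x r" "emeasure M (ball x r) \<le> ennreal K * emeasure M (ball y s)"
  shows "mavg M g y s \<le> ennreal K * mavg M g x r"
proof (rule mavg_leI[OF assms(1)])
  have r: "0 < r"
  proof (rule ccontr)
    assume "\<not> 0 < r"
    then have "ball x r = {}" by (simp add: ball_empty)
    with assms show False by auto
  qed
  have "(\<integral>\<^sup>+w\<in>ball y s. g w \<partial>M) \<le> (\<integral>\<^sup>+w\<in>ball x r. g w \<partial>M)"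
    using assms(2) by (intro nn_integral_mono) (auto simp: indicator_def)
  also have "\<dots> = mavg M g x r * emeasure M (ball x r)" using r by (simp add: mavg_times)
  also have "\<dots> \<le> mavg M g x r * (ennreal K * emeasure M (ball y s))"
    by (intro mult_left_mono assms) simp
  finally show "(\<integral>\<^sup>+w\<in>ball y s. g w \<partial>M) \<le> ennreal K * mavg M g x r * emeasure M (ball y s)"
    by (simp add: mult_ac)
qed

lemma AE_null_set:
  assumes "AE x in M. P x"
  obtains N where "N \<in> null_sets M" "\<And>x. x \<notin> N \<Longrightarrow> P x"
proof -
  from AE_E[OF assms] obtain N where "{x \<in> space M. \<not> P x} \<subseteq> N" "emeasure M N = 0" "N \<in> sets M" .
  then show thesis by (intro that[of N]) auto
qed

lemma hajlasz_mono_AE: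
  assumes "hajlasz M f h" "AE x in M. h x \<le> h' x" "AE x in M. f x = f' x"
  shows "hajlasz M f' h'"
proof -
  from assms(1) obtain N where N: "N \<in> null_sets M"
    "\<And>x y. x \<notin> N \<Longrightarrow> y \<notin> N \<Longrightarrow> ennreal \<bar>f x - f y\<bar> \<le> ennreal (dist x y) * (h x + h y)"
    unfolding hajlasz_def by blast
  obtain N' where N': "N' \<in> null_sets M" "\<And>x. x \<notin> N' \<Longrightarrow> h x \<le> h' x"
    using AE_null_set[OF assms(2)] by blast
  obtain N'' where N'': "N'' \<in> null_sets M" "\<And>x. x \<notin> N'' \<Longrightarrow> f x = f' x"
    using AE_null_set[OF assms(3)] by blast
  have "ennreal \<bar>f' x - f' y\<bar> \<le> ennreal (dist x y) * (h' x + h' y)"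
    if "x \<notin> N \<union> N' \<union> N''" "y \<notin> N \<union> N' \<union> N''" for x y
  proof -
    have "ennreal \<bar>f' x - f' y\<bar> \<le> ennreal (dist x y) * (h x + h y)"
      using N(2)[of x y] N''(2)[of x] N''(2)[of y] that by simp
    also have "\<dots> \<le> ennreal (dist x y) * (h' x + h' y)"
      using that by (intro mult_left_mono add_mono N') auto
    finally show ?thesis .
  qed
  moreover have "N \<union> N' \<union> N'' \<in> null_sets M" using N N' N'' by auto
  ultimately show ?thesis unfolding hajlasz_def by blast
qed

text \<open>The hypothesis on increments covers sums and differences of \<open>f\<close> and
  \<open>g\<close> at once.\<close>

lemma hajlasz_lincomb:
  assumes "hajlasz M f h" "hajlasz M g k" "\<And>x y. \<bar>w x - w y\<bar> \<le> \<bar>f x - f y\<bar> + \<bar>g x - g y\<bar>"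
  shows "hajlasz M w (\<lambda>x. h x + k x)"
proof -
  from assms(1) obtain N where N: "N \<in> null_sets M"
    "\<And>x y. x \<notin> N \<Longrightarrow> y \<notin> N \<Longrightarrow> ennreal \<bar>f x - f y\<bar> \<le> ennreal (dist x y) * (h x + h y)"
    unfolding hajlasz_def by blast
  from assms(2) obtain N' where N': "N' \<in> null_sets M"
    "\<And>x y. x \<notin> N' \<Longrightarrow> y \<notin> N' \<Longrightarrow> ennreal \<bar>g x - g y\<bar> \<le> ennreal (dist x y) * (k x + k y)"
    unfolding hajlasz_def by blast
  have "ennreal \<bar>w x - w y\<bar> \<le> ennreal (dist x y) * ((h x + k x) + (h y + k y))"
    if "x \<notin> N \<union> N'" "y \<notin> N \<union> N'" for x y
  proof -
    have "ennreal \<bar>w x - w y\<bar> \<le> ennreal (\<bar>f x - f y\<bar> + \<bar>g x - g y\<bar>)"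
      by (intro ennreal_leI assms(3))
    also have "\<dots> = ennreal \<bar>f x - f y\<bar> + ennreal \<bar>g x - g y\<bar>" by simp
    also have "\<dots> \<le> ennreal (dist x y) * (h x + h y) + ennreal (dist x y) * (k x + k y)"
      using that by (intro add_mono N N') auto
    finally show ?thesis by (simp add: distrib_left add_ac)
  qed
  moreover have "N \<union> N' \<in> null_sets M" using N N' by auto
  ultimately show ?thesis unfolding hajlasz_def by blast
qed

text \<open>Otherwise \<open>h\<close> would exceed its own average by \<open>e\<close> almost
  everywhere on the ball. The point found here serves as a base point whose value replaces the mean
  of \<open>f\<close>.\<close>

lemma exists_le_mavg:
  assumes N: "N \<in> null_sets M" and r: "0 < r" and a: "mavg M h z r < top" and e: "0 < e"
  shows "\<exists>y. y \<in> ball z r \<and> y \<notin> N \<and> h y \<le> mavg M h z r + ennreal e"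
proof (rule ccontr)
  assume *: "\<not> ?thesis"
  have "mavg M h z r + ennreal e = mavg M (\<lambda>_. mavg M h z r + ennreal e) z r"
    using r by (simp add: mavg_const)
  also have "\<dots> \<le> mavg M h z r"
  proof (rule mavg_mono_on)
    show "AE y in M. y \<in> ball z r \<longrightarrow> mavg M h z r + ennreal e \<le> h y"
      using AE_not_in[OF N] by eventually_elim (use * in force)
  qed
  finally show False using a e by (cases "mavg M h z r") (auto simp: ennreal_plus[symmetric] simp del: ennreal_plus)
qed

text \<open>The oscillation is tested with the constant \<open>f y0\<close>, where
  \<open>h y0\<close> is at most the average \<open>a\<close> of \<open>h\<close> up to an error.
  Two points of the ball are at distance at most \<open>2 * r\<close>, so the mean of
  \<open>\<bar>f y - f y0\<bar>\<close> is at most \<open>2 * r * (a + a)\<close>, whence the factor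
  4.\<close>

lemma sharp_le_maxf:
  assumes haj: "hajlasz M f h" and [measurable]: "h \<in> borel_measurable M"
  shows "sharp M f x \<le> 4 * maxf M h x"
proof (rule sharp_leI)
  fix z r assume r: "0 < r" and x: "x \<in> ball z r"
  from haj obtain N where N: "N \<in> null_sets M"
    "\<And>x y. x \<notin> N \<Longrightarrow> y \<notin> N \<Longrightarrow> ennreal \<bar>f x - f y\<bar> \<le> ennreal (dist x y) * (h x + h y)"
    unfolding hajlasz_def by blast
  define a where "a = mavg M h z r"
  have "osc M f z r \<le> ennreal r * (4 * a)"
  proof (rule ennreal_le_epsilon)
    fix e :: real assume fin: "ennreal r * (4 * a) < top" and e: "0 < e"
    have "a < top"
    proof (rule ccontr)
      assume "\<not> a < top"
      then have "a = top" using less_top by blast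
      then show False using fin r by (simp add: ennreal_mult_top ennreal_top_mult)
    qed
    define e' where "e' = e / (2 * r)"
    have "0 < e'" using e r by (simp add: e'_def)
    then obtain y0 where y0: "y0 \<in> ball z r" "y0 \<notin> N" "h y0 \<le> a + ennreal e'"
      using exists_le_mavg[OF N(1) r, where h=h and e=e' and z=z] \<open>a < top\<close> unfolding a_def by blast
    have "osc M f z r \<le> mavg M (\<lambda>y. ennreal \<bar>f y - f y0\<bar>) z r" by (rule osc_le)
    also have "\<dots> \<le> mavg M (\<lambda>y. ennreal (2 * r) * (h y + (a + ennreal e'))) z r"
    proof (rule mavg_mono_on)
      show "AE y in M. y \<in> ball z r \<longrightarrow> ennreal \<bar>f y - f y0\<bar> \<le> ennreal (2 * r) * (h y + (a + ennreal e'))"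
        using AE_not_in[OF N(1)]
      proof eventually_elim
        case (elim y)
        show ?case
        proof
          assume y: "y \<in> ball z r"
          have "ennreal \<bar>f y - f y0\<bar> \<le> ennreal (dist y y0) * (h y + h y0)"
            using N(2) elim y0 by blast
          also have "\<dots> \<le> ennreal (2 * r) * (h y + (a + ennreal e'))"
          proof (intro mult_mono add_mono ennreal_leI)
            show "dist y y0 \<le> 2 * r"
              using y y0 dist_triangle[of y y0 z] by (simp add: dist_commute)
          qed (use y0 in auto)
          finally show "ennreal \<bar>f y - f y0\<bar> \<le> ennreal (2 * r) * (h y + (a + ennreal e'))" .
        qed
      qed
    qed
    also have "\<dots> = ennreal (2 * r) * (a + (a + ennreal e'))"
      using r by (simp add: mavg_cmult mavg_add mavg_const a_def)
    also have "\<dots> = ennreal r * (4 * a) + ennreal e"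
    proof -
      have "ennreal (2 * r) = ennreal r * 2" using r by (simp add: ennreal_mult mult.commute)
      moreover have "ennreal (2 * r) * ennreal e' = ennreal e"
        using r e by (subst ennreal_mult[symmetric]) (auto simp: e'_def)
      moreover have "a + (a + ennreal e') = 2 * a + ennreal e'"
        by (simp only: mult_2 add.assoc)
      moreover have "(4::ennreal) = 2 * 2" by simp
      ultimately show ?thesis by (metis distrib_left mult.assoc)
    qed
    finally show "osc M f z r \<le> ennreal r * (4 * a) + ennreal e" .
  qed
  also have "\<dots> \<le> ennreal r * (4 * maxf M h x)"
    unfolding a_def using r x by (intro mult_left_mono mavg_le_maxf) auto
  finally show "osc M f z r \<le> ennreal r * (4 * maxf M h x)" .
qed

section \<open>Lebesgue points and pointwise bounds by the sharp maximal function\<close>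

lemma leb_pt_continuous:
  assumes "isCont f x"
  shows "leb_pt M f x"
  unfolding leb_pt_def
proof (intro allI impI ennreal_tendsto_0I)
  fix r e :: real assume r: "0 < r" and e: "0 < e"
  obtain d where d: "0 < d" "\<And>y. dist y x < d \<Longrightarrow> dist (f y) (f x) < e"
    using assms e unfolding continuous_at_eps_delta by blast
  have "(\<lambda>n. r / 2 ^ n) \<longlonglongrightarrow> 0" by (rule LIMSEQ_divide_realpow_zero) simp
  then have "eventually (\<lambda>n. r / 2 ^ n < d) sequentially"
    using d(1) by (rule order_tendstoD)
  then show "\<forall>\<^sub>F n in sequentially. mavg M (\<lambda>y. ennreal \<bar>f y - f x\<bar>) x (r / 2 ^ n) \<le> ennreal e"
  proof eventually_elim
    case (elim n)
    have "mavg M (\<lambda>y. ennreal \<bar>f y - f x\<bar>) x (r / 2 ^ n) \<le> mavg M (\<lambda>y. ennreal e) x (r / 2 ^ n)"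
    proof (rule mavg_mono_on, rule AE_I2, rule impI)
      fix y assume "y \<in> ball x (r / 2 ^ n)"
      then have "dist y x < d" using elim by (simp add: dist_commute)
      then show "ennreal \<bar>f y - f x\<bar> \<le> ennreal e"
        using d(2)[of y] by (intro ennreal_leI) (simp add: dist_real_def)
    qed
    then show ?case using r by (simp add: mavg_const)
  qed
qed

text \<open>This takes the place of the Lebesgue differentiation theorem: the mean of
  \<open>\<bar>f y - f x\<bar>\<close> over \<open>ball x r\<close> is at most \<open>r\<close>
  times \<open>h x + maxf M h x\<close>, hence tends to 0 linearly in \<open>r\<close> wherever this
  sum is finite.\<close>

lemma leb_pt_hajlasz:
  assumes haj: "hajlasz M f h" and [measurable]: "h \<in> borel_measurable M"
    and fin: "AE x in M. h x < top" "AE x in M. maxf M h x < top"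
  shows "AE x in M. leb_pt M f x"
proof -
  from haj obtain N where N: "N \<in> null_sets M"
    "\<And>x y. x \<notin> N \<Longrightarrow> y \<notin> N \<Longrightarrow> ennreal \<bar>f x - f y\<bar> \<le> ennreal (dist x y) * (h x + h y)"
    unfolding hajlasz_def by blast
  from AE_not_in[OF N(1)] fin show ?thesis
  proof eventually_elim
    case (elim x)
    then obtain A where A: "h x + maxf M h x = ennreal A" "0 \<le> A"
      by (cases "h x"; cases "maxf M h x") (auto simp: ennreal_plus[symmetric] simp del: ennreal_plus)
    have le: "mavg M (\<lambda>y. ennreal \<bar>f y - f x\<bar>) x r \<le> ennreal (r * A)" if r: "0 < r" for r
    proof -
      have "mavg M (\<lambda>y. ennreal \<bar>f y - f x\<bar>) x r \<le> mavg M (\<lambda>y. ennreal r * (h y + h x)) x r"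
      proof (rule mavg_mono_on)
        show "AE y in M. y \<in> ball x r \<longrightarrow> ennreal \<bar>f y - f x\<bar> \<le> ennreal r * (h y + h x)"
          using AE_not_in[OF N(1)]
        proof eventually_elim
          case (elim y)
          show ?case
          proof
            assume y: "y \<in> ball x r"
            have "ennreal \<bar>f y - f x\<bar> \<le> ennreal (dist y x) * (h y + h x)"
              using N(2) elim \<open>x \<notin> N\<close> by blast
            also have "\<dots> \<le> ennreal r * (h y + h x)"
              using y by (intro mult_right_mono ennreal_leI) (auto simp: dist_commute)
            finally show "ennreal \<bar>f y - f x\<bar> \<le> ennreal r * (h y + h x)" .
          qed
        qed
      qed
      also have "\<dots> = ennreal r * (mavg M h x r + h x)"
        using r by (simp add: mavg_cmult mavg_add mavg_const)
      also have "\<dots> \<le> ennreal r * (maxf M h x + h x)"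
        using r by (intro mult_left_mono add_mono mavg_le_maxf) auto
      also have "\<dots> = ennreal (r * A)" using r A by (simp add: add.commute ennreal_mult)
      finally show ?thesis .
    qed
    show ?case unfolding leb_pt_def
    proof (intro allI impI)
      fix r :: real assume r: "0 < r"
      have "(\<lambda>n. r / 2 ^ n * A) \<longlonglongrightarrow> 0"
        by (intro tendsto_mult_left_zero LIMSEQ_divide_realpow_zero) simp
      then have lim: "(\<lambda>n. ennreal (r / 2 ^ n * A)) \<longlonglongrightarrow> 0" using tendsto_ennrealI by fastforce
      show "(\<lambda>n. mavg M (\<lambda>y. ennreal \<bar>f y - f x\<bar>) x (r / 2 ^ n)) \<longlonglongrightarrow> 0"
        by (rule tendsto_sandwich[OF _ _ tendsto_const lim]) (use le[of "r / 2 ^ n" for n] r in \<open>simp_all del: times_divide_eq_left\<close>)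
    qed
  qed
qed

text \<open>The infimum in \<open>osc\<close> need not be attained; the strict bound on
  \<open>sharp\<close> leaves the room to pick a constant.\<close>

lemma osc_choose:
  assumes "sharp M f x < ennreal A" "0 < r" "x \<in> ball z r"
  shows "\<exists>c. mavg M (\<lambda>y. ennreal \<bar>f y - c\<bar>) z r \<le> ennreal (r * A)"
proof -
  have "osc M f z r \<le> ennreal r * sharp M f x" by (rule osc_le_sharp[OF assms(2,3)])
  also have "\<dots> < ennreal r * ennreal A"
    using assms by (intro ennreal_mult_strict_left_mono) auto
  also have "\<dots> = ennreal (r * A)" using assms by (simp add: ennreal_mult')
  finally show ?thesis unfolding osc_def INF_less_iff using less_imp_le by blast
qed

lemma const_compare:
  assumes [measurable]: "f \<in> borel_measurable M" and "0 < s" "0 \<le> a" "0 \<le> b"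
    and "mavg M (\<lambda>y. ennreal \<bar>f y - c\<bar>) x s \<le> ennreal a"
    and "mavg M (\<lambda>y. ennreal \<bar>f y - c'\<bar>) x s \<le> ennreal b"
  shows "\<bar>c - c'\<bar> \<le> a + b"
proof -
  have "ennreal \<bar>c - c'\<bar> = mavg M (\<lambda>y. ennreal \<bar>c - c'\<bar>) x s" using assms by (simp add: mavg_const)
  also have "\<dots> \<le> mavg M (\<lambda>y. ennreal \<bar>f y - c\<bar> + ennreal \<bar>f y - c'\<bar>) x s"
    by (intro mavg_mono_AE AE_I2) (auto simp: ennreal_plus[symmetric] simp del: ennreal_plus intro!: ennreal_leI)
  also have "\<dots> \<le> ennreal (a + b)" using assms by (simp add: mavg_add add_mono)
  finally show ?thesis using assms by (subst (asm) ennreal_le_iff) auto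
qed

text \<open>Near-optimal constants on consecutive balls \<open>ball x (r / 2 ^ n)\<close> differ by
  at most \<open>(Cd + 1) * B * r / 2 ^ n\<close>, since halving the radius costs a factor
  \<open>Cd\<close> in the average. The series sums to the claimed bound, and the constants tend to
  \<open>f x\<close> at a Lebesgue point. The bound \<open>B\<close> may exceed \<open>A\<close>
  because the prescribed first constant \<open>c\<close> can be worse than what \<open>sharp\<close>
  allows.\<close>

lemma leb_pt_telescope:
  assumes [measurable]: "f \<in> borel_measurable M" and leb: "leb_pt M f x"
    and A: "sharp M f x < ennreal A" "0 < A" "A \<le> B" and r: "0 < r"
    and c: "mavg M (\<lambda>y. ennreal \<bar>f y - c\<bar>) x r \<le> ennreal (r * B)"
  shows "\<bar>f x - c\<bar> \<le> 2 * (Cd + 1) * r * B"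
proof -
  define m where "m n t = mavg M (\<lambda>y. ennreal \<bar>f y - t\<bar>) x (r / 2 ^ n)" for n t
  have B: "0 < B" using A by simp
  have "\<exists>t. m n t \<le> ennreal (r / 2 ^ n * B)" for n
  proof -
    obtain t where "m n t \<le> ennreal (r / 2 ^ n * A)"
      using osc_choose[OF A(1), of "r / 2 ^ n" x] r by (auto simp: m_def)
    also have "\<dots> \<le> ennreal (r / 2 ^ n * B)" using A r by (intro ennreal_leI mult_left_mono) auto
    finally show ?thesis by blast
  qed
  then obtain t where t: "\<And>n. m n (t n) \<le> ennreal (r / 2 ^ n * B)" by metis
  \<comment> \<open>The chain starts at the given constant; all later ones come from the sharp
    function.\<close>
  define k where "k n = (if n = 0 then c else t n)" for n
  have k: "m n (k n) \<le> ennreal (r / 2 ^ n * B)" for n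
    using t[of n] c by (auto simp: k_def m_def)
  have step: "\<bar>k n - k (Suc n)\<bar> \<le> (Cd + 1) * B * r / 2 ^ n" for n
  proof -
    have "m (Suc n) (k n) \<le> ennreal Cd * m n (k n)"
      unfolding m_def
    proof (rule mavg_sub)
      have eq: "r / 2 ^ n = 2 * (r / 2 ^ Suc n)" by simp
      show "emeasure M (ball x (r / 2 ^ n)) \<le> ennreal Cd * emeasure M (ball x (r / 2 ^ Suc n))"
        unfolding eq using r by (intro dbl) simp
      show "ball x (r / 2 ^ Suc n) \<subseteq> ball x (r / 2 ^ n)"
        using r by (intro subset_ball) (simp add: field_simps)
    qed (use r in simp)
    also have "\<dots> \<le> ennreal Cd * ennreal (r / 2 ^ n * B)" by (intro mult_left_mono k) simp
    also have "\<dots> = ennreal (Cd * (r / 2 ^ n * B))" using Cd1 r B by (intro ennreal_mult[symmetric]) auto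
    finally have 1: "m (Suc n) (k n) \<le> ennreal (Cd * (r / 2 ^ n * B))" .
    have "\<bar>k n - k (Suc n)\<bar> \<le> Cd * (r / 2 ^ n * B) + r / 2 ^ Suc n * B"
      by (rule const_compare[OF _ _ _ _ 1[unfolded m_def] k[of "Suc n", unfolded m_def]])
         (use r B Cd1 in auto)
    also have "r / 2 ^ Suc n * B \<le> r / 2 ^ n * B"
      using r B by (intro mult_right_mono) (auto simp: field_simps)
    finally show ?thesis by (simp add: field_simps)
  qed
  have tel: "\<bar>c - k n\<bar> \<le> 2 * (Cd + 1) * B * r * (1 - 1 / 2 ^ n)" for n
  proof (induction n)
    case (Suc n)
    have "\<bar>c - k (Suc n)\<bar> \<le> \<bar>c - k n\<bar> + \<bar>k n - k (Suc n)\<bar>" by simp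
    also have "\<dots> \<le> 2 * (Cd + 1) * B * r * (1 - 1 / 2 ^ n) + (Cd + 1) * B * r / 2 ^ n"
      using Suc step[of n] by linarith
    also have "\<dots> = 2 * (Cd + 1) * B * r * (1 - 1 / 2 ^ Suc n)" by (simp add: field_simps)
    finally show ?case .
  qed (simp add: k_def)
  have "ennreal \<bar>f x - c\<bar> \<le> ennreal (2 * (Cd + 1) * r * B) + (ennreal (r / 2 ^ n * B) + m n (f x))" for n
  proof -
    have "ennreal \<bar>f x - k n\<bar> = mavg M (\<lambda>y. ennreal \<bar>f x - k n\<bar>) x (r / 2 ^ n)"
      using r by (simp add: mavg_const)
    also have "\<dots> \<le> mavg M (\<lambda>y. ennreal \<bar>f y - k n\<bar> + ennreal \<bar>f y - f x\<bar>) x (r / 2 ^ n)"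
      by (intro mavg_mono_AE AE_I2) (auto simp: ennreal_plus[symmetric] simp del: ennreal_plus intro!: ennreal_leI)
    also have "\<dots> = m n (k n) + m n (f x)" by (simp add: mavg_add m_def)
    also have "\<dots> \<le> ennreal (r / 2 ^ n * B) + m n (f x)" by (intro add_mono k) simp
    finally have 1: "ennreal \<bar>f x - k n\<bar> \<le> ennreal (r / 2 ^ n * B) + m n (f x)" .
    have "2 * (Cd + 1) * B * r * (1 - 1 / 2 ^ n) \<le> 2 * (Cd + 1) * B * r * 1"
      using r B Cd1 by (intro mult_left_mono) auto
    then have "\<bar>f x - c\<bar> \<le> 2 * (Cd + 1) * r * B + \<bar>f x - k n\<bar>"
      using tel[of n] by (simp add: mult_ac)
    then have "ennreal \<bar>f x - c\<bar> \<le> ennreal (2 * (Cd + 1) * r * B + \<bar>f x - k n\<bar>)"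
      by (rule ennreal_leI)
    also have "\<dots> = ennreal (2 * (Cd + 1) * r * B) + ennreal \<bar>f x - k n\<bar>"
      using r B Cd1 by (intro ennreal_plus) auto
    also have "\<dots> \<le> ennreal (2 * (Cd + 1) * r * B) + (ennreal (r / 2 ^ n * B) + m n (f x))"
      by (intro add_mono 1) simp
    finally show ?thesis .
  qed
  moreover have "(\<lambda>n. ennreal (2 * (Cd + 1) * r * B) + (ennreal (r / 2 ^ n * B) + m n (f x)))
    \<longlonglongrightarrow> ennreal (2 * (Cd + 1) * r * B) + (ennreal 0 + 0)"
  proof (intro tendsto_add tendsto_const tendsto_ennrealI)
    show "(\<lambda>n. r / 2 ^ n * B) \<longlonglongrightarrow> 0"
        by (intro tendsto_mult_left_zero LIMSEQ_divide_realpow_zero) simp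
    show "(\<lambda>n. m n (f x)) \<longlonglongrightarrow> 0" using leb r unfolding leb_pt_def m_def by blast
  qed
  ultimately have "ennreal \<bar>f x - c\<bar> \<le> ennreal (2 * (Cd + 1) * r * B) + (ennreal 0 + 0)"
    by (intro LIMSEQ_le_const) auto
  then show ?thesis using r B Cd1 by (simp add: ennreal_le_iff)
qed

text \<open>The sum of two telescoping bounds at distance \<open>d\<close>:
  \<open>2 * (Cd + 1) * (2 * d)\<close> at \<open>x\<close>, and \<open>2 * (Cd + 1) * d\<close>
  times the loss \<open>2 * Cd\<^sup>2\<close> at \<open>y\<close>.\<close>

definition "Csharp = 4 * (Cd + 1) * (1 + Cd\<^sup>2)"

lemma Csharp_pos: "0 < Csharp"
  unfolding Csharp_def using Cd1 by (intro mult_pos_pos add_pos_nonneg) auto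

text \<open>One constant \<open>c\<close> on \<open>ball x (2 * d)\<close> with
  \<open>d = dist x y\<close> is shared by both points. It is also a fair constant on
  \<open>ball y d\<close>, with loss \<open>Cd\<^sup>2\<close> because \<open>ball x (2 * d)\<close>
  lies in \<open>ball y (4 * d)\<close>. Telescoping from \<open>c\<close> reaches
  \<open>f x\<close> and \<open>f y\<close>.\<close>

lemma sharp_pointwise:
  assumes [measurable]: "f \<in> borel_measurable M" and leb: "leb_pt M f x" "leb_pt M f y"
  shows "ennreal \<bar>f x - f y\<bar> \<le> ennreal (dist x y) * (ennreal Csharp * sharp M f x + ennreal Csharp * sharp M f y)"
proof (cases "x = y \<or> sharp M f x = top \<or> sharp M f y = top")
  case True
  then show ?thesis using Csharp_pos by (auto simp: ennreal_mult_top)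
next
  case False
  then obtain a b where ab: "sharp M f x = ennreal a" "0 \<le> a" "sharp M f y = ennreal b" "0 \<le> b"
    by (cases "sharp M f x"; cases "sharp M f y") auto
  define d where "d = dist x y"
  have d: "0 < d" using False by (simp add: d_def)
  \<comment> \<open>The slack \<open>e\<close> makes both sharp values strictly smaller than
    \<open>a + b + e\<close>, as the choice of constants requires; it is removed at the end.\<close>
  have main: "\<bar>f x - f y\<bar> \<le> Csharp * d * (a + b + e)" if e: "0 < e" for e
  proof -
    define A where "A = a + b + e"
    have A: "0 < A" "sharp M f x < ennreal A" "sharp M f y < ennreal A"
      unfolding ab by (rule_tac [2-] ennreal_lessI) (use ab e in \<open>simp_all add: A_def\<close>)
    obtain c where c: "mavg M (\<lambda>z. ennreal \<bar>f z - c\<bar>) x (2 * d) \<le> ennreal (2 * d * A)"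
      using osc_choose[OF A(2), of "2 * d" x] d by auto
    have 1: "\<bar>f x - c\<bar> \<le> 2 * (Cd + 1) * (2 * d) * A"
      by (rule leb_pt_telescope[OF _ leb(1) A(2) _ _ _ c]) (use d A in auto)
    have "mavg M (\<lambda>z. ennreal \<bar>f z - c\<bar>) y d \<le> ennreal (Cd ^ 2) * mavg M (\<lambda>z. ennreal \<bar>f z - c\<bar>) x (2 * d)"
    proof (rule mavg_sub)
      show "ball y d \<subseteq> ball x (2 * d)"
      proof
        fix z assume "z \<in> ball y d"
        then show "z \<in> ball x (2 * d)"
          using dist_triangle[of x z y] by (simp add: d_def)
      qed
      show "emeasure M (ball x (2 * d)) \<le> ennreal (Cd ^ 2) * emeasure M (ball y d)"
      proof (rule ball_subset_dbl[OF d], rule subsetI)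
        fix z assume "z \<in> ball x (2 * d)"
        moreover have "dist y x = d" by (simp add: d_def dist_commute)
        ultimately show "z \<in> ball y (2 ^ 2 * d)"
          using dist_triangle[of y z x] d by simp
      qed
    qed (rule d)
    also have "\<dots> \<le> ennreal (Cd ^ 2) * ennreal (2 * d * A)" by (intro mult_left_mono c) simp
    also have "\<dots> = ennreal (d * (2 * Cd ^ 2 * A))" using d A by (simp add: ennreal_mult[symmetric] mult_ac)
    finally have c': "mavg M (\<lambda>z. ennreal \<bar>f z - c\<bar>) y d \<le> ennreal (d * (2 * Cd ^ 2 * A))" .
    have "1 \<le> Cd ^ 2" using Cd1 by simp
    then have "1 * A \<le> 2 * Cd ^ 2 * A" using A by (intro mult_right_mono) auto
    then have 2: "\<bar>f y - c\<bar> \<le> 2 * (Cd + 1) * d * (2 * Cd ^ 2 * A)"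
      by (intro leb_pt_telescope[OF _ leb(2) A(3) _ _ d c']) (use A in auto)
    have "\<bar>f x - f y\<bar> \<le> \<bar>f x - c\<bar> + \<bar>f y - c\<bar>" by simp
    also have "\<dots> \<le> 2 * (Cd + 1) * (2 * d) * A + 2 * (Cd + 1) * d * (2 * Cd ^ 2 * A)" using 1 2 by linarith
    also have "\<dots> = Csharp * d * (a + b + e)" by (simp add: Csharp_def A_def algebra_simps)
    finally show ?thesis .
  qed
  have "\<bar>f x - f y\<bar> \<le> Csharp * d * (a + b)"
  proof (rule field_le_epsilon)
    fix e :: real assume "0 < e"
    then have "0 < e / (Csharp * d)" using Csharp_pos d by simp
    from main[OF this] show "\<bar>f x - f y\<bar> \<le> Csharp * d * (a + b) + e"
      using Csharp_pos d by (simp add: distrib_left)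
  qed
  also have "\<dots> = d * (Csharp * a + Csharp * b)" by (simp add: algebra_simps)
  finally have "ennreal \<bar>f x - f y\<bar> \<le> ennreal (d * (Csharp * a + Csharp * b))" by (rule ennreal_leI)
  also have "\<dots> = ennreal d * (ennreal Csharp * ennreal a + ennreal Csharp * ennreal b)"
    using ab Csharp_pos d by (simp add: ennreal_mult ennreal_plus)
  finally show ?thesis by (simp add: ab d_def)
qed

text \<open>At a porosity point \<open>x\<close> of \<open>E\<close> there are, arbitrarily close to
  \<open>x\<close>, balls of relative size \<open>1 / (k + 1)\<close> that miss the closure of
  \<open>E\<close>. They lie in thin layers \<open>V R n\<close> of points at small positive
  distance from \<open>E\<close>, so the maximal function of the indicator of each layer is bounded
  below at \<open>x\<close>. The layers decrease to the empty set inside a bounded ball, and the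
  weak type bound makes the set of such \<open>x\<close> null. The set \<open>E\<close> enters only
  through \<open>infdist\<close>, which depends only on its closure and is continuous.\<close>

lemma AE_nonporous:
  fixes E :: "'a set"
  shows "AE x in M. x \<in> E \<longrightarrow>
    (\<forall>e>0. \<exists>\<delta>>0. \<forall>y. 0 < dist x y \<and> dist x y < \<delta> \<longrightarrow> (\<exists>z\<in>E. dist z y < e * dist x y))"
proof (cases "E = {}")
  case False
  fix x0 :: 'a
  \<comment> \<open>The margin 2 accommodates the holes: they are found within distance 2 of a point
    of \<open>ball x0 R\<close>.\<close>
  define V where "V R n = ball x0 (real R + 2) \<inter> {x. 0 < infdist x E \<and> infdist x E < 1 / (real n + 1)}"
    for R n :: nat
  have "\<exists>m::nat. 2 * (real k + 1) \<le> 2 ^ m" for k :: nat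
    using real_arch_pow[of 2 "2 * (real k + 1)"] less_imp_le by (metis one_less_numeral_iff semiring_norm(76))
  then obtain mk :: "nat \<Rightarrow> nat" where mk: "\<And>k. 2 * (real k + 1) \<le> 2 ^ mk k" by metis
  \<comment> \<open>A hole of radius \<open>s\<close> fills at least the fraction
    \<open>1 / Cd ^ mk k\<close> of the ball of radius \<open>2 * d = 2 * (real k + 1) * s\<close>
    around its centre; half of this makes the lower bound strict.\<close>
  define l where "l k = 1 / (2 * Cd ^ mk k)" for k
  define N where "N k R = (\<Inter>n. {x. ennreal (l k) < maxf M (indicator (V R n)) x})" for k R
  have l: "0 < l k" for k using Cd1 by (simp add: l_def)
  have V_sets [measurable]: "V R n \<in> sets M" for R n
  proof -
    have "open {x. 0 < infdist x E \<and> infdist x E < 1 / (real n + 1)}"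
      by (intro open_Collect_conj open_Collect_less continuous_intros)
    then show ?thesis unfolding V_def by (auto intro!: borel_open)
  qed
  have N_null: "N k R \<in> null_sets M" for k R
  proof -
    have N_sets: "N k R \<in> sets M"
      unfolding N_def by (rule sets.countable_INT) (auto intro!: borel_open open_superlevel_maxf)
    have le: "emeasure M (N k R) \<le> ennreal (Cd ^ 3 / l k) * emeasure M (V R n)" for n
    proof -
      have "emeasure M (N k R) \<le> emeasure M {x. ennreal (l k) < maxf M (indicator (V R n)) x}"
        by (intro emeasure_mono) (auto simp: N_def intro!: borel_open open_superlevel_maxf)
      also have "\<dots> = ennreal (1 / l k) * (ennreal (l k) * emeasure M {x. ennreal (l k) < maxf M (indicator (V R n)) x})"
        using l[of k] by (simp add: mult.assoc[symmetric] ennreal_mult[symmetric])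
      also have "\<dots> \<le> ennreal (1 / l k) * (ennreal (Cd ^ 3) * (\<integral>\<^sup>+x. indicator (V R n) x \<partial>M))"
        by (intro mult_left_mono maxf_weak_type l) auto
      also have "\<dots> = ennreal (Cd ^ 3 / l k) * emeasure M (V R n)"
        using l[of k] Cd1
        by (simp add: mult.assoc[symmetric] ennreal_mult[symmetric] nn_integral_indicator[OF V_sets])
      finally show ?thesis .
    qed
    have "(\<lambda>n. emeasure M (V R n)) \<longlonglongrightarrow> emeasure M (\<Inter>n. V R n)"
    proof (rule Lim_emeasure_decseq)
      show "range (V R) \<subseteq> sets M" using V_sets by auto
      show "decseq (V R)"
      proof (rule decseq_SucI)
        fix n
        have "1 / (real (Suc n) + 1) \<le> 1 / (real n + 1)" by (simp add: field_simps)
        then show "V R (Suc n) \<subseteq> V R n" unfolding V_def by fastforce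
      qed
      fix n
      have "emeasure M (V R n) \<le> emeasure M (ball x0 (real R + 2))"
        by (intro emeasure_mono) (auto simp: V_def)
      also have "\<dots> < top" by (rule ball_fin)
      finally show "emeasure M (V R n) \<noteq> \<infinity>" by (simp add: less_top)
    qed
    moreover have "(\<Inter>n. V R n) = {}"
    proof (rule ccontr)
      assume "(\<Inter>n. V R n) \<noteq> {}"
      then obtain x where x: "0 < infdist x E" "\<And>n. infdist x E < 1 / (real n + 1)"
        unfolding V_def by blast
      obtain n where "inverse (real (Suc n)) < infdist x E" using reals_Archimedean[OF x(1)] by auto
      then show False using x(2)[of n] by (simp add: inverse_eq_divide add.commute)
    qed
    ultimately have "(\<lambda>n. emeasure M (V R n)) \<longlonglongrightarrow> 0" by simp
    then have "(\<lambda>n. ennreal (Cd ^ 3 / l k) * emeasure M (V R n)) \<longlonglongrightarrow> ennreal (Cd ^ 3 / l k) * 0"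
      by (intro ennreal_tendsto_cmult) auto
    then have "emeasure M (N k R) \<le> ennreal (Cd ^ 3 / l k) * 0"
      using le by (intro LIMSEQ_le_const) auto
    then show ?thesis using N_sets by auto
  qed
  have in_N: "x \<in> N k R"
    if xE: "x \<in> E" and xR: "dist x0 x < real R"
      and por: "\<And>\<delta>. 0 < \<delta> \<Longrightarrow> \<exists>y. 0 < dist x y \<and> dist x y < \<delta> \<and> (\<forall>z\<in>E. 1 / (real k + 1) * dist x y \<le> dist z y)"
    for x k R
    unfolding N_def
  proof (intro INT_I CollectI)
    fix n :: nat
    \<comment> \<open>Points of the hole are within \<open>2 * dist x y\<close> of \<open>x\<close>.
      The two bounds keep them inside the enlarged ball and at distance below
      \<open>1 / (real n + 1)\<close> from \<open>E\<close>.\<close>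
    have "0 < min 1 (1 / (2 * (real n + 1)))" by simp
    from por[OF this] obtain y where y: "0 < dist x y" "dist x y < 1" "dist x y < 1 / (2 * (real n + 1))"
      "\<And>z. z \<in> E \<Longrightarrow> 1 / (real k + 1) * dist x y \<le> dist z y"
      unfolding min_less_iff_conj by blast
    define d where "d = dist x y"
    define s where "s = 1 / (real k + 1) * d"
    have s: "0 < s" "s \<le> d" using y by (auto simp: s_def d_def field_simps)
    have "ball y s \<subseteq> V R n"
    proof
      fix w assume w: "w \<in> ball y s"
      have "w \<notin> closure E"
      proof
        assume "w \<in> closure E"
        then have "ball y s \<inter> E \<noteq> {}"
          using w by (metis open_Int_closure_eq_empty open_ball disjoint_iff)
        then obtain z where "z \<in> E" "dist y z < s" by auto
        with y(4)[of z] show False by (simp add: s_def d_def dist_commute)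
      qed
      then have "infdist w E \<noteq> 0" using in_closure_iff_infdist_zero[OF False] by simp
      then have 1: "0 < infdist w E" using infdist_nonneg[of w E] by linarith
      have wx: "dist w x < 2 * d"
        using w s dist_triangle[of w x y] by (simp add: d_def dist_commute)
      have "infdist w E \<le> dist w x" by (rule infdist_le[OF xE])
      also have "\<dots> < 2 * d" by (rule wx)
      also have "\<dots> < 1 / (real n + 1)" using y(3) by (simp add: d_def field_simps)
      finally have 2: "infdist w E < 1 / (real n + 1)" .
      have "dist x0 w < real R + 2"
        using wx xR y(2) dist_triangle[of x0 w x] by (simp add: d_def dist_commute)
      then show "w \<in> V R n" using 1 2 by (simp add: V_def)
    qed
    have x2: "x \<in> ball y (2 * d)" "0 < 2 * d" using y by (auto simp: d_def dist_commute)
    have "2 * d = 2 * (real k + 1) * s" by (simp add: s_def field_simps)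
    also have "\<dots> \<le> 2 ^ mk k * s" using s mk[of k] by (intro mult_right_mono) auto
    finally have dk: "2 * d \<le> 2 ^ mk k * s" .
    have "1 = mavg M (indicator (V R n)) y s"
    proof -
      have "mavg M (indicator (V R n)) y s = mavg M (\<lambda>_. 1) y s"
        using \<open>ball y s \<subseteq> V R n\<close>
        by (intro antisym mavg_mono_on AE_I2) (auto simp: indicator_def subset_iff)
      then show ?thesis using s by (simp add: mavg_const)
    qed
    also have "\<dots> \<le> ennreal (Cd ^ mk k) * mavg M (indicator (V R n)) y (2 * d)"
    proof (rule mavg_sub[OF s(1)])
      show "ball y s \<subseteq> ball y (2 * d)" using s by (intro subset_ball) auto
      show "emeasure M (ball y (2 * d)) \<le> ennreal (Cd ^ mk k) * emeasure M (ball y s)"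
        using dk by (intro ball_subset_dbl[OF s(1)] subset_ball)
    qed
    also have "\<dots> \<le> ennreal (Cd ^ mk k) * maxf M (indicator (V R n)) x"
      by (intro mult_left_mono mavg_le_maxf x2) simp
    finally have ge: "1 \<le> ennreal (Cd ^ mk k) * maxf M (indicator (V R n)) x" .
    show "ennreal (l k) < maxf M (indicator (V R n)) x"
    proof (rule ccontr)
      assume "\<not> ?thesis"
      then have "ennreal (Cd ^ mk k) * maxf M (indicator (V R n)) x \<le> ennreal (Cd ^ mk k) * ennreal (l k)"
        by (intro mult_left_mono) auto
      also have "\<dots> = ennreal (1 / 2)"
        using Cd1 l[of k] by (subst ennreal_mult[symmetric]) (auto simp: l_def)
      finally have "ennreal 1 \<le> ennreal (1 / 2)" unfolding ennreal_1 using ge by order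
      then have "(1::real) \<le> 1 / 2" by (subst (asm) ennreal_le_iff) simp_all
      then show False by simp
    qed
  qed
  have "AE x in M. \<forall>k R. x \<notin> N k R"
    unfolding AE_all_countable using N_null AE_not_in by blast
  then show ?thesis
  proof eventually_elim
    case (elim x)
    show ?case
    proof (intro impI allI)
      fix e :: real assume xE: "x \<in> E" and e: "0 < e"
      obtain R where R: "dist x0 x < real R" using reals_Archimedean2 by blast
      obtain k where k: "inverse (real (Suc k)) < e" using reals_Archimedean[OF e] by blast
      then have k': "1 / (real k + 1) < e" by (simp add: inverse_eq_divide add.commute)
      show "\<exists>\<delta>>0. \<forall>y. 0 < dist x y \<and> dist x y < \<delta> \<longrightarrow> (\<exists>z\<in>E. dist z y < e * dist x y)"
      proof (rule ccontr)
        assume *: "\<not> ?thesis"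
        have "x \<in> N k R"
        proof (rule in_N[OF xE R])
          fix \<delta> :: real assume "0 < \<delta>"
          with * obtain y where y: "0 < dist x y" "dist x y < \<delta>" "\<And>z. z \<in> E \<Longrightarrow> \<not> dist z y < e * dist x y"
            by blast
          have "1 / (real k + 1) * dist x y \<le> dist z y" if "z \<in> E" for z
          proof -
            have "1 / (real k + 1) * dist x y \<le> e * dist x y" using k' by (intro mult_right_mono) auto
            then show ?thesis using y(3)[OF that] by linarith
          qed
          then show "\<exists>y. 0 < dist x y \<and> dist x y < \<delta> \<and> (\<forall>z\<in>E. 1 / (real k + 1) * dist x y \<le> dist z y)"
            using y by blast
        qed
        then show False using elim by blast
      qed
    qed
  qed
qed simp

end

section \<open>Pointwise Lipschitz constants and the Poincare inequality\<close>

lemma abs_diff_le_lipschitz: "L-lipschitz_on U u \<Longrightarrow> x \<in> U \<Longrightarrow> y \<in> U \<Longrightarrow> \<bar>u y - u x\<bar> \<le> L * dist y x"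
  for u :: "'a::metric_space \<Rightarrow> real"
  using lipschitz_onD[of L U u y x] by (simp add: dist_real_def)

lemma loc_lipschitz_continuous:
  assumes "loc_lipschitz u" shows "isCont u x"
proof -
  from assms obtain U L where "open U" "x \<in> U" "L-lipschitz_on U u"
    unfolding loc_lipschitz_def by blast
  then show ?thesis
    using lipschitz_on_continuous_on continuous_on_eq_continuous_at by blast
qed

lemma loc_lipschitz_continuous_on: "loc_lipschitz u \<Longrightarrow> continuous_on UNIV u"
  by (simp add: continuous_on_eq_continuous_at loc_lipschitz_continuous)

lemma loc_lipschitz_diff:
  assumes "loc_lipschitz u" "loc_lipschitz v"
  shows "loc_lipschitz (\<lambda>x. u x - v x)"
  unfolding loc_lipschitz_def
proof
  fix x
  from assms obtain U L V K where *: "open U" "x \<in> U" "L-lipschitz_on U u" "open V" "x \<in> V" "K-lipschitz_on V v"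
    unfolding loc_lipschitz_def by meson
  then have "(L + K)-lipschitz_on (U \<inter> V) (\<lambda>x. u x - v x)"
    by (intro lipschitz_on_diff) (auto intro: lipschitz_on_subset)
  then show "\<exists>U L. open U \<and> x \<in> U \<and> L-lipschitz_on U (\<lambda>x. u x - v x)"
    using * by (intro exI[of _ "U \<inter> V"] exI[of _ "L + K"]) auto
qed

lemma lipschitz_loc_lipschitz: "L-lipschitz_on UNIV u \<Longrightarrow> loc_lipschitz u"
  unfolding loc_lipschitz_def by (intro allI exI[of _ UNIV] exI[of _ L]) auto

lemma Lip_leI:
  assumes "0 < d" "\<And>y. 0 < dist y x \<Longrightarrow> dist y x < d \<Longrightarrow> \<bar>u y - u x\<bar> \<le> B * dist y x"
  shows "Lip u x \<le> ereal B"
  unfolding Lip_def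
proof (rule Limsup_bounded)
  show "eventually (\<lambda>y. ereal (\<bar>u y - u x\<bar> / dist y x) \<le> ereal B) (at x)"
    unfolding eventually_at
    by (intro exI[of _ d] conjI ballI impI) (use assms in \<open>auto simp: divide_le_eq\<close>)
qed

lemma Lip_lessD:
  assumes "Lip u x < ereal B"
  shows "\<exists>d>0. \<forall>y. dist y x < d \<longrightarrow> \<bar>u y - u x\<bar> \<le> B * dist y x"
proof -
  have "eventually (\<lambda>y. ereal (\<bar>u y - u x\<bar> / dist y x) < ereal B) (at x)"
    using Limsup_lessD assms unfolding Lip_def by blast
  then obtain d where d: "0 < d" "\<And>y. y \<noteq> x \<Longrightarrow> dist y x < d \<Longrightarrow> \<bar>u y - u x\<bar> / dist y x < B"
    unfolding eventually_at by auto
  have "\<bar>u y - u x\<bar> \<le> B * dist y x" if "dist y x < d" for y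
    using d(2)[of y] that by (cases "y = x") (auto simp: divide_less_eq)
  then show ?thesis using d(1) by blast
qed

lemma Lip_le_lipschitz:
  assumes "open U" "x \<in> U" "L-lipschitz_on U u"
  shows "Lip u x \<le> ereal L"
proof -
  obtain d where d: "0 < d" "ball x d \<subseteq> U" using assms openE by blast
  show ?thesis
  proof (rule Lip_leI[OF d(1)])
    fix y assume "dist y x < d"
    then have "y \<in> U" using d(2) by (auto simp: dist_commute)
    then show "\<bar>u y - u x\<bar> \<le> L * dist y x" using abs_diff_le_lipschitz assms by blast
  qed
qed

lemma lipn_le_lipschitz: "L-lipschitz_on UNIV u \<Longrightarrow> lipn u x \<le> ennreal L"
  using Lip_le_lipschitz[of UNIV x L u] e2ennreal_mono[of "Lip u x" "ereal L"]
  by (simp add: lipn_def)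

lemma Lip_less_lipn:
  assumes "loc_lipschitz u" "0 < e"
  shows "lipn u x < top" "Lip u x < ereal (enn2real (lipn u x) + e)"
proof -
  from assms(1) obtain U L where *: "open U" "x \<in> U" "L-lipschitz_on U u"
    unfolding loc_lipschitz_def by blast
  from Lip_le_lipschitz[OF *] have "Lip u x \<noteq> \<infinity>" by auto
  then have "lipn u x < top \<and> Lip u x < ereal (enn2real (lipn u x) + e)"
  proof (cases "Lip u x")
    case (real r)
    have "r \<le> enn2real (ennreal r)" by (cases "0 \<le> r") (auto simp: ennreal_neg)
    then have "r < enn2real (ennreal r) + e" using assms(2) by linarith
    then show ?thesis by (simp add: lipn_def real)
  next
    case MInf
    then have "lipn u x = 0" unfolding lipn_def by (intro e2ennreal_neg) simp
    then show ?thesis using MInf assms(2) by simp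
  qed simp
  then show "lipn u x < top" "Lip u x < ereal (enn2real (lipn u x) + e)" by auto
qed

lemma lipn_local:
  assumes "loc_lipschitz u" "0 < e"
  shows "\<exists>d>0. \<forall>y. dist y x < d \<longrightarrow> \<bar>u y - u x\<bar> \<le> (enn2real (lipn u x) + e) * dist y x"
  by (rule Lip_lessD[OF Lip_less_lipn(2)[OF assms]])

text \<open>\<open>Lip u x < a\<close> means that a difference bound with some rational slope
  \<open>b < a\<close> holds on a punctured ball of radius \<open>1 / (real n + 1)\<close>. For
  fixed \<open>b\<close> and \<open>n\<close> the complement of this condition is a union over
  \<open>y\<close> of open sets, so the condition is closed in \<open>x\<close>.\<close>

lemma Lip_borel_measurable:
  fixes u :: "'a::metric_space \<Rightarrow> real"
  assumes "continuous_on UNIV u"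
  shows "Lip u \<in> borel_measurable borel"
proof (rule borel_measurableI_less)
  fix a :: ereal
  define S where "S b n = {x. \<forall>y. 0 < dist y x \<and> dist y x < 1 / (real n + 1) \<longrightarrow> \<bar>u y - u x\<bar> \<le> real_of_rat b * dist y x}"
    for b :: rat and n :: nat
  have closed: "closed (S b n)" for b n
  proof -
    have "- S b n = (\<Union>y. {x. 0 < dist y x \<and> dist y x < 1 / (real n + 1) \<and> real_of_rat b * dist y x < \<bar>u y - u x\<bar>})"
      by (auto simp: S_def not_le)
    also have "open \<dots>"
      by (intro open_UN ballI open_Collect_conj open_Collect_less continuous_intros assms)
    finally show ?thesis by (simp add: closed_def)
  qed
  have "{x. Lip u x < a} = (\<Union>b\<in>{b. ereal (real_of_rat b) < a}. \<Union>n. S b n)"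
  proof (intro equalityI subsetI)
    fix x assume "x \<in> {x. Lip u x < a}"
    then obtain b where b: "Lip u x < ereal (real_of_rat b)" "ereal (real_of_rat b) < a"
      using ereal_dense3[of "Lip u x" a] by auto
    obtain d where d: "0 < d" "\<And>y. dist y x < d \<Longrightarrow> \<bar>u y - u x\<bar> \<le> real_of_rat b * dist y x"
      using Lip_lessD[OF b(1)] by blast
    obtain n where "inverse (real (Suc n)) < d" using reals_Archimedean[OF d(1)] by blast
    then have "1 / (real n + 1) < d" by (simp add: inverse_eq_divide add.commute)
    then have "x \<in> S b n" using d(2) by (auto simp: S_def)
    then show "x \<in> (\<Union>b\<in>{b. ereal (real_of_rat b) < a}. \<Union>n. S b n)" using b by blast
  next
    fix x assume "x \<in> (\<Union>b\<in>{b. ereal (real_of_rat b) < a}. \<Union>n. S b n)"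
    then obtain b n where b: "ereal (real_of_rat b) < a" "x \<in> S b n" by blast
    have "Lip u x \<le> ereal (real_of_rat b)"
      using b(2) by (intro Lip_leI[of "1 / (real n + 1)"]) (auto simp: S_def)
    then show "x \<in> {x. Lip u x < a}" using b(1) by auto
  qed
  also have "\<dots> \<in> sets borel"
    by (intro sets.countable_UN' sets.countable_UN) (auto intro: borel_closed closed)
  finally show "{x \<in> space borel. Lip u x < a} \<in> sets borel" by simp
qed

lemma lipn_borel_measurable: "loc_lipschitz u \<Longrightarrow> lipn u \<in> borel_measurable borel"
  unfolding lipn_def using Lip_borel_measurable[OF loc_lipschitz_continuous_on, of u] by measurable

text \<open>The pointwise bound on the difference quotients is a gauge; on a tagged division
  finer than it the increment of \<open>\<phi>\<close> is bounded by the Riemann sum of \<open>h\<close>.\<close>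
lemma increment_le_integral:
  fixes \<phi> h :: "real \<Rightarrow> real"
  assumes ab: "a \<le> b" and int: "(h has_integral I) {a..b}"
    and loc: "\<And>t e. t \<in> {a..b} \<Longrightarrow> 0 < e \<Longrightarrow>
      \<exists>d>0. \<forall>s\<in>{a..b}. \<bar>s - t\<bar> < d \<longrightarrow> \<bar>\<phi> s - \<phi> t\<bar> \<le> (h t + e) * \<bar>s - t\<bar>"
  shows "\<bar>\<phi> b - \<phi> a\<bar> \<le> I"
proof (rule field_le_epsilon)
  fix e0 :: real assume e0: "0 < e0"
  \<comment> \<open>One \<open>e\<close> pays for the error of the Riemann sum, and
    \<open>e * (b - a)\<close> for the excess slope on the division.\<close>
  define e where "e = e0 / (1 + (b - a))"
  have e: "0 < e" using e0 ab by (simp add: e_def)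
  have "e * (1 + (b - a)) = e0" using ab by (simp add: e_def)
  then have ee: "e + e * (b - a) = e0" by (simp add: algebra_simps)
  have "\<forall>t. \<exists>d>0. t \<in> {a..b} \<longrightarrow> (\<forall>s\<in>{a..b}. \<bar>s - t\<bar> < d \<longrightarrow> \<bar>\<phi> s - \<phi> t\<bar> \<le> (h t + e) * \<bar>s - t\<bar>)"
    using loc[OF _ e] zero_less_one by meson
  then obtain d where d: "\<And>t. 0 < d t"
    "\<And>t s. t \<in> {a..b} \<Longrightarrow> s \<in> {a..b} \<Longrightarrow> \<bar>s - t\<bar> < d t \<Longrightarrow> \<bar>\<phi> s - \<phi> t\<bar> \<le> (h t + e) * \<bar>s - t\<bar>"
    by metis
  from int e obtain \<gamma> where \<gamma>: "gauge \<gamma>"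
    "\<And>\<D>. \<D> tagged_division_of {a..b} \<Longrightarrow> \<gamma> fine \<D> \<Longrightarrow>
       norm ((\<Sum>(x, k)\<in>\<D>. measure lborel k *\<^sub>R h x) - I) < e"
    unfolding box_real(2)[symmetric] has_integral by meson
  have "gauge (\<lambda>t. \<gamma> t \<inter> ball t (d t))"
    by (intro gauge_Int \<gamma>) (auto simp: gauge_def d)
  then obtain \<D> where \<D>: "\<D> tagged_division_of {a..b}" "(\<lambda>t. \<gamma> t \<inter> ball t (d t)) fine \<D>"
    by (rule fine_division_exists_real)
  then have fine: "\<gamma> fine \<D>" "(\<lambda>t. ball t (d t)) fine \<D>" by (auto simp: fine_Int)
  have "\<bar>\<phi> b - \<phi> a\<bar> = \<bar>\<Sum>(x,K)\<in>\<D>. \<phi> (Sup K) - \<phi> (Inf K)\<bar>"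
    using additive_tagged_division_1[OF ab \<D>(1), of \<phi>] by simp
  also have "\<dots> \<le> (\<Sum>xK\<in>\<D>. \<bar>case xK of (x,K) \<Rightarrow> \<phi> (Sup K) - \<phi> (Inf K)\<bar>)" by (rule sum_abs)
  also have "\<dots> \<le> (\<Sum>(x,K)\<in>\<D>. measure lborel K *\<^sub>R h x + e * measure lborel K)"
  proof (rule sum_mono, clarify)
    fix x K assume xK: "(x, K) \<in> \<D>"
    obtain l r where K: "K = {l..r}" "x \<in> {l..r}" "{l..r} \<subseteq> {a..b}"
      using tagged_division_ofD(2-4)[OF \<D>(1) xK] by (metis box_real(2))
    have sub: "{l..r} \<subseteq> ball x (d x)" using fine(2) xK K unfolding fine_def by blast
    have lr: "l \<le> x" "x \<le> r" using K by auto
    have mem: "l \<in> {l..r}" "r \<in> {l..r}" using lr by auto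
    then have "l \<in> ball x (d x)" "r \<in> ball x (d x)" using sub by blast+
    then have "\<bar>l - x\<bar> < d x" "\<bar>r - x\<bar> < d x"
      by (auto simp: dist_real_def abs_minus_commute)
    moreover have "l \<in> {a..b}" "r \<in> {a..b}" "x \<in> {a..b}" using mem K by blast+
    ultimately
    have "\<bar>\<phi> l - \<phi> x\<bar> \<le> (h x + e) * \<bar>l - x\<bar>" "\<bar>\<phi> r - \<phi> x\<bar> \<le> (h x + e) * \<bar>r - x\<bar>"
      using d(2) by blast+
    then have "\<bar>\<phi> r - \<phi> l\<bar> \<le> (h x + e) * (x - l) + (h x + e) * (r - x)"
      using lr by (simp add: abs_if split: if_splits)
    also have "\<dots> = (r - l) * h x + e * (r - l)" by (simp add: algebra_simps)
    finally show "\<bar>\<phi> (Sup K) - \<phi> (Inf K)\<bar> \<le> measure lborel K *\<^sub>R h x + e * measure lborel K"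
      using lr K by simp
  qed
  also have "\<dots> = (\<Sum>(x,K)\<in>\<D>. measure lborel K *\<^sub>R h x) + e * (\<Sum>(x,K)\<in>\<D>. measure lborel K)"
    by (simp add: case_prod_unfold sum.distrib sum_distrib_left)
  also have "(\<Sum>(x,K)\<in>\<D>. measure lborel K) = b - a"
    using additive_content_tagged_division[of \<D> a b] \<D>(1) ab by simp
  finally have "\<bar>\<phi> b - \<phi> a\<bar> \<le> I + (e + e * (b - a))"
    using \<gamma>(2)[OF \<D>(1) fine(1)] by (simp add: real_norm_def abs_if split: if_splits)
  then show "\<bar>\<phi> b - \<phi> a\<bar> \<le> I + e0" by (simp add: ee)
qed

text \<open>Along a 1-Lipschitz curve the composition \<open>u (\<gamma> t)\<close> has local slope
  at most \<open>lipn u (\<gamma> t)\<close>, up to any positive excess;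
  \<open>increment_le_integral\<close> integrates this pointwise bound.\<close>

lemma lipn_upper_gradient:
  assumes u: "loc_lipschitz u" and M: "sets M = sets borel"
  shows "upper_gradient M u (lipn u)"
  unfolding upper_gradient_def
proof (intro conjI allI impI)
  note cong = measurable_cong_sets[OF M refl]
  show "u \<in> borel_measurable M"
    unfolding cong by (intro borel_measurable_continuous_onI loc_lipschitz_continuous_on u)
  show "lipn u \<in> borel_measurable M" unfolding cong by (rule lipn_borel_measurable[OF u])
  fix \<gamma> :: "real \<Rightarrow> 'a" and a b :: real
  assume ab: "a \<le> b" and \<gamma>: "1-lipschitz_on {a..b} \<gamma>"
  \<comment> \<open>The curve is controlled only on \<open>{a..b}\<close>. Clamping the parameter
    extends it continuously to the whole line, which yields Borel measurability of the
    integrand.\<close>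
  define c where "c t = max a (min b t)" for t
  define h where "h t = enn2real (lipn u (\<gamma> (c t))) * indicator {a..b} t" for t
  have c: "c t \<in> {a..b}" for t using ab by (auto simp: c_def)
  have c_id: "c t = t" if "t \<in> {a..b}" for t using that by (auto simp: c_def)
  have "continuous_on UNIV (\<gamma> \<circ> c)"
  proof (rule continuous_on_compose)
    show "continuous_on UNIV c" unfolding c_def by (intro continuous_intros)
    show "continuous_on (range c) \<gamma>"
      using lipschitz_on_continuous_on[OF \<gamma>] by (rule continuous_on_subset) (use c in auto)
  qed
  then have [measurable]: "(\<lambda>t. \<gamma> (c t)) \<in> borel_measurable borel"
    by (intro borel_measurable_continuous_onI) (simp add: o_def)
  have [measurable]: "(\<lambda>t. lipn u (\<gamma> (c t))) \<in> borel_measurable borel"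
    by (rule measurable_compose[OF _ lipn_borel_measurable[OF u]]) measurable
  have h_meas: "h \<in> borel_measurable borel" unfolding h_def by measurable
  define J where "J = (\<integral>\<^sup>+t\<in>{a..b}. lipn u (\<gamma> t) \<partial>lborel)"
  have J: "(\<integral>\<^sup>+t. ennreal (h t) \<partial>lborel) = J"
    unfolding J_def
  proof (intro nn_integral_cong)
    fix t
    show "ennreal (h t) = lipn u (\<gamma> t) * indicator {a..b} t"
      using Lip_less_lipn(1)[OF u zero_less_one, of "\<gamma> t"] c_id[of t]
      by (auto simp: h_def indicator_def)
  qed
  show "ennreal \<bar>u (\<gamma> b) - u (\<gamma> a)\<bar> \<le> (\<integral>\<^sup>+t\<in>{a..b}. lipn u (\<gamma> t) \<partial>lborel)"
  proof (cases "J = top")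
    case True
    then show ?thesis by (simp add: J_def)
  next
    case False
    then obtain I where I: "J = ennreal I" "0 \<le> I" by (cases J) auto
    have "(h has_integral I) UNIV"
      by (rule nn_integral_has_integral[OF h_meas _ _ I(2)]) (auto simp: h_def J[unfolded h_def] I)
    then have "((\<lambda>t. if t \<in> {a..b} then enn2real (lipn u (\<gamma> t)) else 0) has_integral I) UNIV"
      by (rule has_integral_eq[rotated]) (auto simp: h_def c_id)
    then have int: "((\<lambda>t. enn2real (lipn u (\<gamma> t))) has_integral I) {a..b}"
      by (subst (asm) has_integral_restrict_UNIV)
    have "\<bar>u (\<gamma> b) - u (\<gamma> a)\<bar> \<le> I"
    proof (rule increment_le_integral[where \<phi> = "\<lambda>t. u (\<gamma> t)", OF ab int])
      fix t e :: real assume t: "t \<in> {a..b}" and e: "0 < e"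
      obtain d where d: "0 < d" "\<And>y. dist y (\<gamma> t) < d \<Longrightarrow>
          \<bar>u y - u (\<gamma> t)\<bar> \<le> (enn2real (lipn u (\<gamma> t)) + e) * dist y (\<gamma> t)"
        using lipn_local[OF u e] by blast
      have "\<bar>u (\<gamma> s) - u (\<gamma> t)\<bar> \<le> (enn2real (lipn u (\<gamma> t)) + e) * \<bar>s - t\<bar>"
        if s: "s \<in> {a..b}" "\<bar>s - t\<bar> < d" for s
      proof -
        have l: "dist (\<gamma> s) (\<gamma> t) \<le> \<bar>s - t\<bar>"
          using lipschitz_onD[OF \<gamma> s(1) t] by (simp add: dist_real_def)
        then have "\<bar>u (\<gamma> s) - u (\<gamma> t)\<bar> \<le> (enn2real (lipn u (\<gamma> t)) + e) * dist (\<gamma> s) (\<gamma> t)"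
          using s by (intro d(2)) simp
        also have "\<dots> \<le> (enn2real (lipn u (\<gamma> t)) + e) * \<bar>s - t\<bar>"
          using l e by (intro mult_left_mono) auto
        finally show ?thesis .
      qed
      then show "\<exists>d>0. \<forall>s\<in>{a..b}. \<bar>s - t\<bar> < d \<longrightarrow>
        \<bar>u (\<gamma> s) - u (\<gamma> t)\<bar> \<le> (enn2real (lipn u (\<gamma> t)) + e) * \<bar>s - t\<bar>"
        using d(1) by blast
    qed
    then show ?thesis using I by (simp add: J_def[symmetric] ennreal_leI)
  qed
qed

context doubling_space
begin

text \<open>Jensen's inequality up to the factor 2. The pointwise bound
  \<open>v \<le> S + S powr (1 - q) * v powr q\<close> is averaged, and for \<open>S powr q\<close>
  at least the mean of \<open>v powr q\<close> both summands contribute at most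
  \<open>S\<close>.\<close>

lemma mavg_le_power:
  assumes [measurable]: "v \<in> borel_measurable M" and q: "1 < q" and r: "0 < r"
  shows "mavg M v z r \<le> 2 * epow (mavg M (\<lambda>y. epow (v y) q) z r) (1 / q)"
proof (cases "mavg M (\<lambda>y. epow (v y) q) z r")
  case top
  then show ?thesis by (simp add: ennreal_mult_top)
next
  case (real m)
  have le: "mavg M v z r \<le> ennreal (2 * S)" if S: "0 < S" "m \<le> S powr q" for S
  proof -
    have "v y \<le> ennreal S + ennreal (S powr (1 - q)) * epow (v y) q" for y
    proof (cases "v y")
      case (real t)
      show ?thesis
      proof (cases "t \<le> S")
        case True
        then have "v y \<le> ennreal S" using real by (simp add: ennreal_leI)
        then show ?thesis by (simp add: add_increasing2)
      next
        case False
        then have "t = t powr (1 - q) * t powr q" using S by (simp add: powr_add[symmetric])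
        also have "\<dots> \<le> S powr (1 - q) * t powr q"
          using False S q by (intro mult_right_mono powr_mono2') auto
        finally have "v y \<le> ennreal (S powr (1 - q)) * epow (v y) q"
          using real by (simp add: epow_ennreal ennreal_mult[symmetric] ennreal_leI)
        then show ?thesis by (simp add: add_increasing)
      qed
    qed (use S in \<open>simp add: ennreal_mult_top\<close>)
    then have "mavg M v z r \<le> mavg M (\<lambda>y. ennreal S + ennreal (S powr (1 - q)) * epow (v y) q) z r"
      by (intro mavg_mono_AE AE_I2)
    also have "\<dots> = ennreal S + ennreal (S powr (1 - q)) * ennreal m"
      using r real by (simp add: mavg_add mavg_cmult mavg_const)
    also have "\<dots> = ennreal (S + S powr (1 - q) * m)" using S real by (simp add: ennreal_mult ennreal_plus)
    also have "\<dots> \<le> ennreal (2 * S)"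
    proof (rule ennreal_leI)
      have "S powr (1 - q) * m \<le> S powr (1 - q) * S powr q" using S by (intro mult_left_mono) auto
      also have "\<dots> = S" using S by (simp add: powr_add[symmetric])
      finally show "S + S powr (1 - q) * m \<le> 2 * S" by simp
    qed
    finally show ?thesis .
  qed
  have eq: "2 * epow (mavg M (\<lambda>y. epow (v y) q) z r) (1 / q) = ennreal (2 * m powr (1 / q))"
    using real by (simp add: epow_ennreal ennreal_mult)
  show ?thesis unfolding eq
  \<comment> \<open>The level \<open>S\<close> must be positive while \<open>m\<close> may vanish,
    hence \<open>S = m powr (1 / q) + e / 2\<close>.\<close>
  proof (rule ennreal_le_epsilon)
    fix e :: real assume e: "0 < e"
    have "m = (m powr (1 / q)) powr q" using real q by (simp add: powr_powr)
    also have "\<dots> \<le> (m powr (1 / q) + e / 2) powr q" using e q by (intro powr_mono2) auto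
    finally have "mavg M v z r \<le> ennreal (2 * (m powr (1 / q) + e / 2))"
      using e by (intro le) (auto intro: add_nonneg_pos)
    also have "\<dots> = ennreal (2 * m powr (1 / q)) + ennreal e"
      using e by (subst ennreal_plus[symmetric]) auto
    finally show "mavg M v z r \<le> ennreal (2 * m powr (1 / q)) + ennreal e" .
  qed
qed

text \<open>On \<open>E s\<close>, where \<open>h\<close> is at most \<open>s\<close>, the function
  \<open>u\<close> is \<open>2 * s\<close>-Lipschitz. If \<open>x\<close> is not a porosity point of
  \<open>E s\<close>, every nearby \<open>y\<close> has a neighbour \<open>z\<close> in
  \<open>E s\<close> at distance \<open>e * dist x y\<close>, and the local Lipschitz constant
  \<open>L\<close> makes the passage from \<open>z\<close> to \<open>y\<close> negligible. Letting
  the rational \<open>s\<close> decrease to \<open>h x\<close> gives the bound.\<close>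

lemma lipn_le_hajlasz:
  assumes u: "loc_lipschitz u" and haj: "hajlasz M u h"
  shows "AE x in M. lipn u x \<le> 2 * h x"
proof -
  from haj obtain N where N: "N \<in> null_sets M"
    "\<And>x y. x \<notin> N \<Longrightarrow> y \<notin> N \<Longrightarrow> ennreal \<bar>u x - u y\<bar> \<le> ennreal (dist x y) * (h x + h y)"
    unfolding hajlasz_def by blast
  define E where "E s = {x. x \<notin> N \<and> h x \<le> ennreal (real_of_rat s)}" for s
  have "AE x in M. \<forall>s. x \<in> E s \<longrightarrow>
    (\<forall>e>0. \<exists>\<delta>>0. \<forall>y. 0 < dist x y \<and> dist x y < \<delta> \<longrightarrow> (\<exists>z\<in>E s. dist z y < e * dist x y))"
    unfolding AE_all_countable using AE_nonporous by blast
  with AE_not_in[OF N(1)] show ?thesis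
  proof eventually_elim
    case (elim x)
    have Lip_le: "Lip u x \<le> ereal (2 * s')" if s: "0 < s" "h x \<le> ennreal s'" "s' = real_of_rat s" for s s'
    proof (rule ereal_le_epsilon2)
      fix e0 :: real assume e0: "0 < e0"
      have s': "0 < s'" using s by simp
      from u obtain U L where U: "open U" "x \<in> U" "L-lipschitz_on U u"
        unfolding loc_lipschitz_def by blast
      have L: "0 \<le> L" using lipschitz_on_nonneg[OF U(3)] .
      obtain \<rho> where \<rho>: "0 < \<rho>" "ball x \<rho> \<subseteq> U" using U openE by blast
      \<comment> \<open>The excess slope produced by replacing \<open>y\<close> by \<open>z\<close>
        is \<open>e * (2 * s' + L)\<close>, to be at most \<open>e0\<close>;
        \<open>e \<le> 1\<close> keeps \<open>z\<close> inside the neighbourhood where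
        \<open>L\<close> is valid.\<close>
      define e where "e = min 1 (e0 / (2 * s' + L))"
      have e: "0 < e" "e \<le> 1" using e0 s' L by (auto simp: e_def)
      have "e * (2 * s' + L) \<le> e0 / (2 * s' + L) * (2 * s' + L)"
        using s' L by (intro mult_right_mono) (auto simp: e_def)
      then have ee: "e * (2 * s' + L) \<le> e0" using s' L by simp
      have "x \<in> E s" using elim(1) s by (simp add: E_def)
      then obtain \<delta> where \<delta>: "0 < \<delta>" "\<And>y. 0 < dist x y \<Longrightarrow> dist x y < \<delta> \<Longrightarrow> \<exists>z\<in>E s. dist z y < e * dist x y"
        using elim(2) e(1) by meson
      have "Lip u x \<le> ereal (2 * s' + e0)"
      proof (rule Lip_leI[of "min \<delta> (\<rho> / 2)"])
        show "0 < min \<delta> (\<rho> / 2)" using \<delta> \<rho> by simp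
        fix y assume y: "0 < dist y x" "dist y x < min \<delta> (\<rho> / 2)"
        define d where "d = dist y x"
        have dxy: "dist x y = d" by (simp add: d_def dist_commute)
        have d: "0 < d" "d < \<delta>" "d < \<rho> / 2" using y by (auto simp: d_def)
        obtain z where z: "z \<in> E s" "dist z y < e * d" using \<delta>(2)[of y] d dxy by auto
        have ed: "e * d \<le> d" using e d by simp
        have xz: "dist x z \<le> d + e * d"
          using dist_triangle[of x z y] z dxy by (simp add: dist_commute)
        have "dist x z < \<rho>" "dist x y < \<rho>" using xz ed d dxy by linarith+
        then have "z \<in> U" "y \<in> U" using \<rho>(2) by auto
        then have 1: "\<bar>u z - u y\<bar> \<le> L * (e * d)"
          using abs_diff_le_lipschitz[OF U(3), of y z] z L
          by (smt (verit) mult_left_mono)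
        have "ennreal \<bar>u x - u z\<bar> \<le> ennreal (dist x z) * (h x + h z)"
          using N(2) elim(1) z(1) by (auto simp: E_def)
        also have "\<dots> \<le> ennreal (dist x z) * (ennreal s' + ennreal s')"
          using s z(1) by (intro mult_left_mono add_mono) (auto simp: E_def)
        also have "\<dots> = ennreal (dist x z * (2 * s'))"
          using s' by (simp add: ennreal_mult ennreal_plus[symmetric] del: ennreal_plus)
        finally have "\<bar>u x - u z\<bar> \<le> dist x z * (2 * s')" using s' by (subst (asm) ennreal_le_iff) auto
        also have "\<dots> \<le> (d + e * d) * (2 * s')" using xz s' by (intro mult_right_mono) auto
        finally have "\<bar>u y - u x\<bar> \<le> (d + e * d) * (2 * s') + L * (e * d)" using 1 by linarith
        also have "\<dots> = (2 * s' + e * (2 * s' + L)) * d" by (simp add: algebra_simps)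
        also have "\<dots> \<le> (2 * s' + e0) * d" using ee d by (intro mult_right_mono) auto
        finally show "\<bar>u y - u x\<bar> \<le> (2 * s' + e0) * dist y x" by (simp add: d_def)
      qed
      then show "Lip u x \<le> ereal (2 * s') + ereal e0" by simp
    qed
    show ?case
    proof (cases "h x")
      case top
      then show ?thesis by (simp add: ennreal_mult_top)
    next
      case (real t)
      have "lipn u x \<le> ennreal (2 * t)"
      proof (rule ennreal_le_epsilon)
        fix e :: real assume e: "0 < e"
        obtain s where s: "t < real_of_rat s" "real_of_rat s < t + e / 2"
          using of_rat_dense[of t "t + e / 2"] e by auto
        then have "0 < real_of_rat s" using real by linarith
        then have "0 < s" by simp
        then have "Lip u x \<le> ereal (2 * real_of_rat s)"
          using s real by (intro Lip_le) (auto intro!: ennreal_leI)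
        then have "lipn u x \<le> ennreal (2 * real_of_rat s)"
          unfolding lipn_def e2ennreal_ereal[symmetric] by (rule e2ennreal_mono)
        also have "\<dots> \<le> ennreal (2 * t + e)" using s by (intro ennreal_leI) simp
        also have "\<dots> = ennreal (2 * t) + ennreal e" using real e by (intro ennreal_plus) auto
        finally show "lipn u x \<le> ennreal (2 * t) + ennreal e" .
      qed
      then show ?thesis using real by (simp add: ennreal_mult)
    qed
  qed
qed

end

section \<open>Consequences of the Poincare inequality\<close>

locale poincare_space = doubling_space M Cd
  for M :: "'a::metric_space measure" and Cd +
  fixes q Cp lam :: real
  assumes q1: "1 < q" and Cp_pos: "0 < Cp" and lam1: "1 \<le> lam"
    and PI: "continuous_on UNIV u \<Longrightarrow> upper_gradient M u g \<Longrightarrow> 0 < r \<Longrightarrow>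
        epow ((\<integral>\<^sup>+ y\<in>ball x r. ennreal (\<bar>u y - avg M (ball x r) u\<bar> powr q) \<partial>M)
               / emeasure M (ball x r)) (1/q)
        \<le> ennreal (Cp * r) *
          epow ((\<integral>\<^sup>+ y\<in>ball x (lam*r). epow (g y) q \<partial>M) / emeasure M (ball x (lam*r))) (1/q)"
begin

text \<open>The average of \<open>u\<close> is admissible in \<open>osc\<close>. The Poincare
  inequality is applied to the upper gradient \<open>lipn u\<close>, and the enlarged ball still
  contains \<open>x\<close>, so its average is dominated by the uncentred maximal function at
  \<open>x\<close>. The factor 2 comes from \<open>mavg_le_power\<close>.\<close>

lemma sharp_le_poincare:
  assumes u: "loc_lipschitz u" and g: "AE x in M. lipn u x \<le> g x"
  shows "sharp M u x \<le> ennreal (2 * Cp) * epow (maxf M (\<lambda>y. epow (g y) q) x) (1 / q)"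
proof (rule sharp_leI)
  fix z r assume r: "0 < r" and x: "x \<in> ball z r"
  define c where "c = avg M (ball z r) u"
  have [measurable]: "u \<in> borel_measurable M"
    using lipn_upper_gradient[OF u sets_M] by (simp add: upper_gradient_def)
  have lam: "0 < lam * r" "r \<le> lam * r" using r lam1 by auto
  have eq: "epow (ennreal \<bar>u y - c\<bar>) q = ennreal (\<bar>u y - c\<bar> powr q)" for y by (simp add: epow_ennreal)
  have "osc M u z r \<le> mavg M (\<lambda>y. ennreal \<bar>u y - c\<bar>) z r" by (rule osc_le)
  also have "\<dots> \<le> 2 * epow (mavg M (\<lambda>y. ennreal (\<bar>u y - c\<bar> powr q)) z r) (1 / q)"
    using mavg_le_power[OF _ q1 r, of "\<lambda>y. ennreal \<bar>u y - c\<bar>" z] by (simp add: eq)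
  also have "epow (mavg M (\<lambda>y. ennreal (\<bar>u y - c\<bar> powr q)) z r) (1 / q)
    \<le> ennreal (Cp * r) * epow (mavg M (\<lambda>y. epow (lipn u y) q) z (lam * r)) (1 / q)"
    unfolding mavg_def c_def
    by (rule PI[OF loc_lipschitz_continuous_on[OF u] lipn_upper_gradient[OF u sets_M] r])
  also have "mavg M (\<lambda>y. epow (lipn u y) q) z (lam * r) \<le> mavg M (\<lambda>y. epow (g y) q) z (lam * r)"
    using g q1 by (intro mavg_mono_AE) (auto elim!: eventually_mono intro!: epow_mono)
  also have "\<dots> \<le> maxf M (\<lambda>y. epow (g y) q) x"
    using lam x by (intro mavg_le_maxf) auto
  finally have "osc M u z r \<le> 2 * (ennreal (Cp * r) * epow (maxf M (\<lambda>y. epow (g y) q) x) (1 / q))"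
    using q1 by (simp add: epow_mono mult_left_mono)
  also have "2 * (ennreal (Cp * r) * epow (maxf M (\<lambda>y. epow (g y) q) x) (1 / q))
    = ennreal r * (ennreal (2 * Cp) * epow (maxf M (\<lambda>y. epow (g y) q) x) (1 / q))"
    using r Cp_pos by (simp add: ennreal_mult mult_ac)
  finally show "osc M u z r \<le> ennreal r * (ennreal (2 * Cp) * epow (maxf M (\<lambda>y. epow (g y) q) x) (1 / q))" .
qed

definition "Chaj = Csharp * (2 * Cp)"

lemma Chaj_pos: "0 < Chaj"
  unfolding Chaj_def using Csharp_pos Cp_pos by simp

text \<open>By continuity all points are Lebesgue points, so the bound holds for every pair and not
  only off a null set.\<close>

lemma loc_lipschitz_pointwise:
  assumes u: "loc_lipschitz u" and g: "AE x in M. lipn u x \<le> g x"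
  defines "h \<equiv> \<lambda>x. ennreal Chaj * epow (maxf M (\<lambda>y. epow (g y) q) x) (1 / q)"
  shows "ennreal \<bar>u x - u y\<bar> \<le> ennreal (dist x y) * (h x + h y)"
proof -
  have [measurable]: "u \<in> borel_measurable M"
    using lipn_upper_gradient[OF u sets_M] by (simp add: upper_gradient_def)
  have "ennreal \<bar>u x - u y\<bar> \<le> ennreal (dist x y) * (ennreal Csharp * sharp M u x + ennreal Csharp * sharp M u y)"
    by (intro sharp_pointwise leb_pt_continuous loc_lipschitz_continuous u) measurable
  also have "\<dots> \<le> ennreal (dist x y) * (h x + h y)"
  proof -
    have "ennreal Csharp * sharp M u x \<le> h x" for x
    proof -
      have "ennreal Csharp * sharp M u x \<le>
        ennreal Csharp * (ennreal (2 * Cp) * epow (maxf M (\<lambda>y. epow (g y) q) x) (1 / q))"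
        by (intro mult_left_mono sharp_le_poincare u g) simp
      then show ?thesis using Csharp_pos Cp_pos by (simp add: h_def Chaj_def ennreal_mult mult.assoc)
    qed
    then show ?thesis by (intro mult_left_mono add_mono) auto
  qed
  finally show ?thesis .
qed

text \<open>At an isolated point the indicator of \<open>{x}\<close> is continuous and constant
  along curves, so 0 is an upper gradient. The Poincare inequality then makes it almost everywhere
  constant on a ball that contains a second point, although both values 0 and 1 occur on sets of
  positive measure. This keeps the limit superior in \<open>Lip\<close> from being taken over a
  trivial filter.\<close>

lemma no_isolated_points:
  fixes x y :: 'a
  assumes "x \<noteq> y"
  shows "at x \<noteq> bot"
proof
  assume "at x = bot"
  then have op: "open {x}" by (simp add: at_eq_bot_iff)
  define u where "u z = (if z = x then 1 else 0 :: real)" for z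
  have cont: "continuous_on UNIV u"
  proof -
    have "continuous_on (- {x}) u" by (rule continuous_on_eq[of _ "\<lambda>_. 0"]) (auto simp: u_def)
    then have "continuous_on ({x} \<union> - {x}) u" by (intro continuous_on_open_Un) (auto simp: op open_Compl)
    then show ?thesis by simp
  qed
  have ug: "upper_gradient M u (\<lambda>_. 0)"
    unfolding upper_gradient_def
  proof (intro conjI allI impI)
    show "u \<in> borel_measurable M"
      unfolding measurable_cong_sets[OF sets_M refl] by (rule borel_measurable_continuous_onI[OF cont])
    fix \<gamma> :: "real \<Rightarrow> 'a" and a b :: real
    assume ab: "a \<le> b" and \<gamma>: "1-lipschitz_on {a..b} \<gamma>"
    have "continuous_on {a..b} (\<lambda>t. u (\<gamma> t))"
      using continuous_on_compose2[OF cont lipschitz_on_continuous_on[OF \<gamma>]] by simp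
    moreover have "finite ((\<lambda>t. u (\<gamma> t)) ` {a..b})"
      by (rule finite_subset[of _ "{0, 1}"]) (auto simp: u_def)
    ultimately have "(\<lambda>t. u (\<gamma> t)) constant_on {a..b}"
      by (intro continuous_finite_range_constant connected_Icc)
    then have "u (\<gamma> b) = u (\<gamma> a)" using ab by (auto simp: constant_on_def)
    then show "ennreal \<bar>u (\<gamma> b) - u (\<gamma> a)\<bar> \<le> (\<integral>\<^sup>+t\<in>{a..b}. 0 \<partial>lborel)" by simp
  qed simp
  define R where "R = dist x y + 1"
  have R: "0 < R" by (simp add: R_def add_nonneg_pos)
  define c where "c = avg M (ball x R) u"
  have [measurable]: "u \<in> borel_measurable M" using ug by (simp add: upper_gradient_def)
  have "epow ((\<integral>\<^sup>+ w\<in>ball x R. ennreal (\<bar>u w - c\<bar> powr q) \<partial>M) / emeasure M (ball x R)) (1/q) \<le> 0"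
    using PI[OF cont ug R, of x] by (simp add: c_def)
  then have "(\<integral>\<^sup>+ w\<in>ball x R. ennreal (\<bar>u w - c\<bar> powr q) \<partial>M) = 0"
    using mavg_times[OF R, of "\<lambda>w. ennreal (\<bar>u w - c\<bar> powr q)" x] by (simp add: mavg_def)
  then have "AE w in M. ennreal (\<bar>u w - c\<bar> powr q) * indicator (ball x R) w = 0"
    by (subst (asm) nn_integral_0_iff_AE) auto
  then obtain N where N: "N \<in> null_sets M"
    "\<And>w. w \<notin> N \<Longrightarrow> ennreal (\<bar>u w - c\<bar> powr q) * indicator (ball x R) w = 0"
    using AE_null_set by blast
  \<comment> \<open>Every ball has positive measure and therefore is not swallowed by the null set
    on which \<open>u\<close> differs from \<open>c\<close>.\<close>
  have hit: "\<exists>w\<in>ball z s. u w = c" if zs: "0 < s" "ball z s \<subseteq> ball x R" for z s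
  proof -
    have "\<not> ball z s \<subseteq> N"
    proof
      assume "ball z s \<subseteq> N"
      then have "emeasure M (ball z s) \<le> emeasure M N" using N by (intro emeasure_mono) auto
      then show False using ball_pos[OF zs(1), of z] N by auto
    qed
    then obtain w where "w \<in> ball z s" "w \<notin> N" by blast
    then show ?thesis using N(2)[of w] zs by (intro bexI[of _ w]) (auto simp: indicator_def split: if_splits)
  qed
  obtain s where s: "0 < s" "ball x s \<subseteq> {x}" using op openE[of "{x}" x] by auto
  have "\<exists>w\<in>ball x (min s R). u w = c" using s R by (intro hit subset_ball) auto
  then have "c = 1" using s by (auto simp: u_def)
  have "\<exists>w\<in>ball y (min 1 (dist x y)). u w = c"
  proof (rule hit)
    show "0 < min 1 (dist x y)" using assms by simp
    show "ball y (min 1 (dist x y)) \<subseteq> ball x R"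
    proof
      fix w assume "w \<in> ball y (min 1 (dist x y))"
      then show "w \<in> ball x R" using dist_triangle[of x w y] by (simp add: R_def)
    qed
  qed
  then have "c = 0" by (auto simp: u_def dist_commute)
  with \<open>c = 1\<close> show False by simp
qed

end

section \<open>Lipschitz truncation\<close>

lemma Lp_norm_epow: "Lp_norm M p f = epow (\<integral>\<^sup>+x. epow (ennreal \<bar>f x\<bar>) p \<partial>M) (1 / p)"
  unfolding Lp_norm_def by (simp add: epow_ennreal)

lemma epow_Lp_norm: "0 < p \<Longrightarrow> epow (Lp_norm M p f) p = (\<integral>\<^sup>+x. epow (ennreal \<bar>f x\<bar>) p \<partial>M)"
  by (simp add: Lp_norm_epow epow_epow)

lemma nn_integral_epow_le:
  assumes "AE x in M. g x \<le> ennreal c * G x" "0 \<le> c" "0 < p" "G \<in> borel_measurable M"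
  shows "(\<integral>\<^sup>+x. epow (g x) p \<partial>M) \<le> ennreal (c powr p) * (\<integral>\<^sup>+x. epow (G x) p \<partial>M)"
proof -
  have "(\<integral>\<^sup>+x. epow (g x) p \<partial>M) \<le> (\<integral>\<^sup>+x. ennreal (c powr p) * epow (G x) p \<partial>M)"
  proof (rule nn_integral_mono_AE)
    show "AE x in M. epow (g x) p \<le> ennreal (c powr p) * epow (G x) p"
      using assms(1) by eventually_elim (use epow_mono assms(2,3) in \<open>fastforce simp: epow_cmult[symmetric]\<close>)
  qed
  also have "\<dots> = ennreal (c powr p) * (\<integral>\<^sup>+x. epow (G x) p \<partial>M)"
    using assms by (intro nn_integral_cmult) auto
  finally show ?thesis .
qed

lemma Lp_norm_le:
  assumes "AE x in M. ennreal \<bar>w x\<bar> \<le> ennreal c * G x" "0 \<le> c" "0 < p" "G \<in> borel_measurable M"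
  shows "Lp_norm M p w \<le> ennreal c * epow (\<integral>\<^sup>+x. epow (G x) p \<partial>M) (1 / p)"
proof -
  have "Lp_norm M p w \<le> epow (ennreal (c powr p) * (\<integral>\<^sup>+x. epow (G x) p \<partial>M)) (1 / p)"
    unfolding Lp_norm_epow using assms by (intro epow_mono nn_integral_epow_le) auto
  then show ?thesis using assms by (simp add: epow_enn_cmult_inv)
qed

text \<open>A substitute for Minkowski's inequality: if \<open>S\<close> is the weighted series on
  the right, each \<open>a k\<close> is at most \<open>(1 / 2) ^ k * S powr (1 / p)\<close>, and
  these bounds sum to twice the root of \<open>S\<close>. The weights \<open>(2 ^ k) powr p\<close>
  are later absorbed by terms of size \<open>4 ^ -k\<close>.\<close>

lemma epow_suminf_le:
  assumes p: "0 < p"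
  shows "epow (\<Sum>k. a k) p \<le> ennreal (2 powr p) * (\<Sum>k. ennreal ((2 ^ k) powr p) * epow (a k) p)"
proof -
  define S where "S = (\<Sum>k. ennreal ((2 ^ k) powr p) * epow (a k) p)"
  have a: "a k \<le> ennreal ((1 / 2) ^ k) * epow S (1 / p)" for k
  proof -
    have "(\<Sum>i\<in>{k}. ennreal ((2 ^ i) powr p) * epow (a i) p) \<le> S"
      unfolding S_def by (rule sum_le_suminf) auto
    then have "epow (ennreal (2 ^ k) * a k) p \<le> S" using p by (simp add: epow_cmult)
    then have "ennreal (2 ^ k) * a k \<le> epow S (1 / p)" using p by (simp add: epow_le_iff)
    then have "ennreal ((1 / 2) ^ k) * (ennreal (2 ^ k) * a k) \<le> ennreal ((1 / 2) ^ k) * epow S (1 / p)"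
      by (intro mult_left_mono) auto
    moreover have "ennreal ((1 / 2) ^ k) * ennreal (2 ^ k) = 1"
      by (simp add: ennreal_mult[symmetric] power_mult_distrib[symmetric] del: ennreal_power)
    ultimately show ?thesis by (simp only: mult.assoc[symmetric] mult_1_left)
  qed
  have "(\<Sum>k. a k) \<le> (\<Sum>k. ennreal ((1 / 2) ^ k) * epow S (1 / p))"
    by (intro suminf_le a) auto
  also have "\<dots> = (\<Sum>k. ennreal ((1 / 2) ^ k)) * epow S (1 / p)" by simp
  also have "(\<Sum>k. ennreal ((1 / 2) ^ k)) = ennreal 2"
    by (rule suminf_ennreal_eq) (use geometric_sums[of "1/2::real"] in auto)
  finally have "epow (\<Sum>k. a k) p \<le> epow (ennreal 2 * epow S (1 / p)) p" using p by (intro epow_mono) auto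
  also have "\<dots> = ennreal (2 powr p) * S" using p by (subst epow_cmult) (auto simp: epow_epow)
  finally show ?thesis by (simp add: S_def)
qed

text \<open>The infimal convolution \<open>g0\<close> is the largest \<open>K\<close>-Lipschitz
  extension of \<open>f\<close>; clamping it to \<open>[-l, l]\<close> preserves the Lipschitz
  constant and leaves the values on \<open>S\<close> unchanged.\<close>

lemma mcshane_extension:
  fixes f :: "'a::metric_space \<Rightarrow> real"
  assumes lip: "\<And>x y. x \<in> S \<Longrightarrow> y \<in> S \<Longrightarrow> \<bar>f x - f y\<bar> \<le> K * dist x y"
    and bd: "\<And>x. x \<in> S \<Longrightarrow> \<bar>f x\<bar> \<le> l" and K: "0 \<le> K" and l: "0 \<le> l"
  shows "\<exists>g. K-lipschitz_on UNIV g \<and> (\<forall>x. \<bar>g x\<bar> \<le> l) \<and> (\<forall>x\<in>S. g x = f x)"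
proof (cases "S = {}")
  case True
  then show ?thesis using K l by (intro exI[of _ "\<lambda>_. 0"]) (auto intro!: lipschitz_onI)
next
  case False
  define g0 where "g0 x = (INF z\<in>S. f z + K * dist x z)" for x
  define g where "g x = max (-l) (min l (g0 x))" for x
  have bdd: "bdd_below ((\<lambda>z. f z + K * dist x z) ` S)" for x
  proof (rule bdd_belowI2)
    fix z assume "z \<in> S"
    then have "-l \<le> f z" using bd[of z] by auto
    then show "-l \<le> f z + K * dist x z" using K by (simp add: add_increasing2)
  qed
  have g0_le: "g0 x \<le> f z + K * dist x z" if "z \<in> S" for x z
    unfolding g0_def by (rule cINF_lower[OF bdd that])
  have g0_lip: "g0 x \<le> g0 y + K * dist x y" for x y
  proof -
    have "g0 x - K * dist x y \<le> g0 y"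
      unfolding g0_def[of y]
    proof (rule cINF_greatest[OF False])
      fix z assume "z \<in> S"
      have "K * dist x z \<le> K * (dist x y + dist y z)" using K by (intro mult_left_mono dist_triangle)
      then show "g0 x - K * dist x y \<le> f z + K * dist y z"
        using g0_le[OF \<open>z \<in> S\<close>, of x] by (simp add: distrib_left)
    qed
    then show ?thesis by simp
  qed
  have g0_eq: "g0 x = f x" if "x \<in> S" for x
  proof (rule antisym)
    show "g0 x \<le> f x" using g0_le[OF that, of x] by simp
    show "f x \<le> g0 x" unfolding g0_def
    proof (rule cINF_greatest[OF False])
      fix z assume "z \<in> S"
      then show "f x \<le> f z + K * dist x z" using lip[OF that, of z] by linarith
    qed
  qed
  have "\<bar>g x - g y\<bar> \<le> K * dist x y" for x y
    using g0_lip[of x y] g0_lip[of y x] K unfolding g_def by (auto simp: dist_commute max_def min_def)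
  then have "K-lipschitz_on UNIV g" using K by (intro lipschitz_onI) (auto simp: dist_real_def)
  moreover have "\<bar>g x\<bar> \<le> l" for x using l by (auto simp: g_def)
  moreover have "g x = f x" if "x \<in> S" for x
    using g0_eq[OF that] bd[OF that] by (auto simp: g_def)
  ultimately show ?thesis by blast
qed

context doubling_space
begin

lemma continuous_measurable_M: "continuous_on UNIV u \<Longrightarrow> u \<in> borel_measurable M" for u :: "'a \<Rightarrow> real"
  unfolding measurable_cong_sets[OF sets_M refl] by (rule borel_measurable_continuous_onI)

lemma loc_lipschitz_measurable: "loc_lipschitz u \<Longrightarrow> u \<in> borel_measurable M"
  by (intro continuous_measurable_M loc_lipschitz_continuous_on)


text \<open>The set \<open>S\<close> where \<open>F \<le> l\<close> carries \<open>f\<close>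
  unchanged, so \<open>f - g\<close> has no increment between two of its points. For any other pair
  the increment is at most the distance times \<open>h x + h y + 2 * l\<close>; a point of
  \<open>S\<close> contributes at most \<open>l\<close>, so a point outside must absorb
  \<open>h + 3 * l\<close>, which is at most \<open>4 * F\<close> there. For \<open>g\<close> itself
  a pair inside \<open>S\<close> is handled by \<open>h\<close>, and any other pair by the Lipschitz
  constant \<open>2 * l\<close>.\<close>

lemma lipschitz_truncation:
  assumes haj: "hajlasz M f h" and l: "0 < l"
  defines "F \<equiv> \<lambda>x. ennreal \<bar>f x\<bar> + h x"
  obtains g where "(2 * l)-lipschitz_on UNIV g" "\<And>x. \<bar>g x\<bar> \<le> l"
    "AE x in M. ennreal \<bar>f x - g x\<bar> \<le> 2 * (F x * of_bool (ennreal l < F x))"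
    "AE x in M. ennreal \<bar>g x\<bar> \<le> min (F x) (ennreal l)"
    "hajlasz M (\<lambda>x. f x - g x) (\<lambda>x. 4 * (F x * of_bool (ennreal l < F x)))"
    "hajlasz M g (\<lambda>x. 2 * min (F x) (ennreal l))"
proof -
  from haj obtain N where N: "N \<in> null_sets M"
    "\<And>x y. x \<notin> N \<Longrightarrow> y \<notin> N \<Longrightarrow> ennreal \<bar>f x - f y\<bar> \<le> ennreal (dist x y) * (h x + h y)"
    unfolding hajlasz_def by blast
  define S where "S = {x. x \<notin> N \<and> F x \<le> ennreal l}"
  have S_bd: "\<bar>f x\<bar> \<le> l" "h x \<le> ennreal l" if "x \<in> S" for x
  proof -
    have F: "F x \<le> ennreal l" using that by (simp add: S_def)
    have "ennreal \<bar>f x\<bar> \<le> F x" "h x \<le> F x" by (simp_all add: F_def)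
    then have "ennreal \<bar>f x\<bar> \<le> ennreal l" "h x \<le> ennreal l" using F by order+
    then show "\<bar>f x\<bar> \<le> l" "h x \<le> ennreal l" using l by auto
  qed
  have S_lip: "\<bar>f x - f y\<bar> \<le> 2 * l * dist x y" if "x \<in> S" "y \<in> S" for x y
  proof -
    have "ennreal \<bar>f x - f y\<bar> \<le> ennreal (dist x y) * (h x + h y)" using N(2) that by (auto simp: S_def)
    also have "\<dots> \<le> ennreal (dist x y) * (ennreal l + ennreal l)"
      using S_bd that by (intro mult_left_mono add_mono) auto
    also have "\<dots> = ennreal (2 * l * dist x y)"
      using l by (simp add: ennreal_plus[symmetric] ennreal_mult[symmetric] mult_ac del: ennreal_plus)
    finally show ?thesis using l by (subst (asm) ennreal_le_iff) auto
  qed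
  obtain g where g: "(2 * l)-lipschitz_on UNIV g" "\<And>x. \<bar>g x\<bar> \<le> l" "\<And>x. x \<in> S \<Longrightarrow> g x = f x"
    using mcshane_extension[of S f "2 * l" l] S_lip S_bd l by auto
  have bad: "ennreal l < F x" if "x \<notin> N" "x \<notin> S" for x using that by (auto simp: S_def)
  have good: "\<not> ennreal l < F x" if "x \<in> S" for x using that by (auto simp: S_def)
  have fF: "ennreal \<bar>f x\<bar> \<le> F x" and hF: "h x \<le> F x" for x by (simp_all add: F_def)
  have gl: "ennreal \<bar>g x\<bar> \<le> ennreal l" for x using g(2) by (rule ennreal_leI)
  have glip: "ennreal \<bar>g x - g y\<bar> \<le> ennreal (dist x y) * (2 * ennreal l)" for x y
  proof -
    have "\<bar>g x - g y\<bar> \<le> 2 * l * dist x y" using abs_diff_le_lipschitz[OF g(1), of y x] by simp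
    then have "ennreal \<bar>g x - g y\<bar> \<le> ennreal (2 * l * dist x y)" by (rule ennreal_leI)
    also have "\<dots> = ennreal (dist x y) * (2 * ennreal l)" using l by (simp add: ennreal_mult mult_ac)
    finally show ?thesis .
  qed
  show thesis
  proof (rule that[OF g(1,2)])
    show "AE x in M. ennreal \<bar>f x - g x\<bar> \<le> 2 * (F x * of_bool (ennreal l < F x))"
      using AE_not_in[OF N(1)]
    proof eventually_elim
      case (elim x)
      show ?case
      proof (cases "x \<in> S")
        case False
        have "ennreal \<bar>f x - g x\<bar> \<le> ennreal (\<bar>f x\<bar> + \<bar>g x\<bar>)" by (intro ennreal_leI) simp
        also have "\<dots> = ennreal \<bar>f x\<bar> + ennreal \<bar>g x\<bar>" by simp
        also have "\<dots> \<le> F x + F x" using fF[of x] gl[of x] bad[OF elim False] by (intro add_mono) auto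
        finally show ?thesis using bad[OF elim False] by (simp add: mult_2)
      qed (simp add: g)
    qed
    show "AE x in M. ennreal \<bar>g x\<bar> \<le> min (F x) (ennreal l)"
      using AE_not_in[OF N(1)]
    proof eventually_elim
      case (elim x)
      show ?case
      proof (cases "x \<in> S")
        case True
        then show ?thesis using g(3)[OF True] fF[of x] gl[of x] by simp
      next
        case False
        then show ?thesis using bad[OF elim False] gl[of x] by simp
      qed
    qed
    show "hajlasz M (\<lambda>x. f x - g x) (\<lambda>x. 4 * (F x * of_bool (ennreal l < F x)))"
      unfolding hajlasz_def
    proof (intro bexI[OF _ N(1)] allI impI)
      fix x y assume xy: "x \<notin> N" "y \<notin> N"
      define k where "k x = 4 * (F x * of_bool (ennreal l < F x))" for x
      have main: "ennreal \<bar>(f x - g x) - (f y - g y)\<bar> \<le> ennreal (dist x y) * (h x + h y + 2 * ennreal l)"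
      proof -
        have "ennreal \<bar>(f x - g x) - (f y - g y)\<bar> \<le> ennreal (\<bar>f x - f y\<bar> + \<bar>g x - g y\<bar>)"
          by (intro ennreal_leI) simp
        also have "\<dots> = ennreal \<bar>f x - f y\<bar> + ennreal \<bar>g x - g y\<bar>" by simp
        also have "\<dots> \<le> ennreal (dist x y) * (h x + h y) + ennreal (dist x y) * (2 * ennreal l)"
          by (intro add_mono N(2) xy glip)
        finally show ?thesis by (simp add: distrib_left)
      qed
      have kbad: "h x + 3 * ennreal l \<le> k x" if "x \<notin> N" "x \<notin> S" for x
      proof -
        have "h x + 3 * ennreal l \<le> F x + 3 * F x"
          using hF[of x] bad[OF that] by (intro add_mono mult_left_mono) auto
        also have "\<dots> = (1 + 3) * F x" by (subst distrib_right) simp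
        also have "\<dots> = k x" using bad[OF that] by (simp add: k_def)
        finally show ?thesis .
      qed
      have "ennreal \<bar>(f x - g x) - (f y - g y)\<bar> \<le> ennreal (dist x y) * (k x + k y)"
      proof (cases "x \<in> S \<and> y \<in> S")
        case True
        then show ?thesis by (simp add: g)
      next
        case False
        have "h x + h y + 2 * ennreal l \<le> k x + k y"
        proof -
          consider "x \<in> S" "y \<notin> S" | "x \<notin> S" "y \<in> S" | "x \<notin> S" "y \<notin> S" using False by blast
          then show ?thesis
          proof cases
            case 1
            have "h x + h y + 2 * ennreal l \<le> ennreal l + h y + 2 * ennreal l"
              using S_bd[OF 1(1)] by (intro add_mono) auto
            also have "\<dots> = h y + (1 + 2) * ennreal l" by (subst distrib_right) (simp add: add_ac)
            also have "\<dots> \<le> k x + k y" using kbad[OF xy(2) 1(2)] by (simp add: add_increasing)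
            finally show ?thesis .
          next
            case 2
            have "h x + h y + 2 * ennreal l \<le> h x + ennreal l + 2 * ennreal l"
              using S_bd[OF 2(2)] by (intro add_mono) auto
            also have "\<dots> = h x + (1 + 2) * ennreal l" by (subst distrib_right) (simp add: add_ac)
            also have "\<dots> \<le> k x + k y" using kbad[OF xy(1) 2(1)] by (simp add: add_increasing2)
            finally show ?thesis .
          next
            case 3
            have "h x + h y + 2 * ennreal l = (h x + ennreal l) + (h y + ennreal l)"
              by (simp add: mult_2 add_ac)
            also have "\<dots> \<le> (h x + 3 * ennreal l) + (h y + 3 * ennreal l)"
              using mult_right_mono[of 1 3 "ennreal l"] by (intro add_mono) auto
            also have "\<dots> \<le> k x + k y" by (intro add_mono kbad xy 3)
            finally show ?thesis .
          qed
        qed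
        then show ?thesis using main by (meson mult_left_mono order_trans zero_le)
      qed
      then show "ennreal \<bar>(f x - g x) - (f y - g y)\<bar> \<le> ennreal (dist x y) *
        (4 * (F x * of_bool (ennreal l < F x)) + 4 * (F y * of_bool (ennreal l < F y)))"
        by (simp add: k_def)
    qed
    show "hajlasz M g (\<lambda>x. 2 * min (F x) (ennreal l))"
      unfolding hajlasz_def
    proof (intro bexI[OF _ N(1)] allI impI)
      fix x y assume xy: "x \<notin> N" "y \<notin> N"
      show "ennreal \<bar>g x - g y\<bar> \<le> ennreal (dist x y) * (2 * min (F x) (ennreal l) + 2 * min (F y) (ennreal l))"
      proof (cases "x \<in> S \<and> y \<in> S")
        case True
        have *: "h z \<le> 2 * min (F z) (ennreal l)" if "z \<in> S" for z
        proof -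
          have "h z \<le> min (F z) (ennreal l)" using hF[of z] S_bd[OF that] by simp
          also have "\<dots> \<le> 2 * min (F z) (ennreal l)" using mult_right_mono[of 1 2 "min (F z) (ennreal l)"] by simp
          finally show ?thesis .
        qed
        have "ennreal \<bar>g x - g y\<bar> \<le> ennreal (dist x y) * (h x + h y)"
          using N(2)[OF xy] True g(3) by simp
        also have "\<dots> \<le> ennreal (dist x y) * (2 * min (F x) (ennreal l) + 2 * min (F y) (ennreal l))"
          using True by (intro mult_left_mono add_mono *) auto
        finally show ?thesis .
      next
        case False
        then have "2 * ennreal l \<le> 2 * min (F x) (ennreal l) + 2 * min (F y) (ennreal l)"
          using bad xy by (auto simp: min.absorb2 less_imp_le add_increasing add_increasing2)
        then show ?thesis using glip[of x y] by (meson mult_left_mono order_trans zero_le)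
      qed
    qed
  qed
qed

end

section \<open>From Hajlasz gradients to Sobolev functions\<close>

locale cheeger_space = poincare_space M Cd q Cp lam
  for M :: "'a::metric_space measure" and Cd q Cp lam +
  fixes D :: "('a \<Rightarrow> real) \<Rightarrow> 'a \<Rightarrow> real^'n" and CD :: real
  assumes CD_nonneg: "0 \<le> CD"
    and D_measurable: "loc_lipschitz u \<Longrightarrow> D u \<in> borel_measurable M"
    and D_lower: "loc_lipschitz u \<Longrightarrow> AE x in M. lipn u x \<le> ennreal (norm (D u x))"
    and D_upper: "loc_lipschitz u \<Longrightarrow> AE x in M. ennreal (norm (D u x)) \<le> ennreal CD * lipn u x"
begin

lemma D_le_hajlasz:
  assumes "loc_lipschitz u" "hajlasz M u h"
  shows "AE x in M. ennreal (norm (D u x)) \<le> ennreal (2 * CD) * h x"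
  using D_upper[OF assms(1)] lipn_le_hajlasz[OF assms]
proof eventually_elim
  case (elim x)
  note elim(1)
  also have "ennreal CD * lipn u x \<le> ennreal CD * (2 * h x)" using elim(2) by (intro mult_left_mono) auto
  also have "\<dots> = ennreal (2 * CD) * h x" using CD_nonneg by (simp add: ennreal_mult mult_ac)
  finally show ?case .
qed

lemma H1_lipnorm_le:
  assumes "loc_lipschitz w" "AE x in M. ennreal \<bar>w x\<bar> \<le> ennreal c * G x" "hajlasz M w (\<lambda>x. ennreal c * G x)"
    "0 \<le> c" "0 < p" "G \<in> borel_measurable M"
  shows "H1_lipnorm M D p w \<le> ennreal (c * (1 + 2 * CD)) * epow (\<integral>\<^sup>+x. epow (G x) p \<partial>M) (1 / p)"
proof -
  have "AE x in M. ennreal \<bar>norm (D w x)\<bar> \<le> ennreal (2 * CD * c) * G x"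
    using D_le_hajlasz[OF assms(1,3)] CD_nonneg assms(4) by (simp add: ennreal_mult mult.assoc)
  then have "Lp_norm M p (\<lambda>x. norm (D w x)) \<le> ennreal (2 * CD * c) * epow (\<integral>\<^sup>+x. epow (G x) p \<partial>M) (1 / p)"
    using CD_nonneg assms by (intro Lp_norm_le) auto
  then have "H1_lipnorm M D p w \<le> ennreal c * epow (\<integral>\<^sup>+x. epow (G x) p \<partial>M) (1 / p)
    + ennreal (2 * CD * c) * epow (\<integral>\<^sup>+x. epow (G x) p \<partial>M) (1 / p)"
    unfolding H1_lipnorm_def using Lp_norm_le[OF assms(2,4,5,6)] by (intro add_mono)
  also have "\<dots> = (ennreal c + ennreal (2 * CD * c)) * epow (\<integral>\<^sup>+x. epow (G x) p \<partial>M) (1 / p)"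
    by (simp add: distrib_right)
  also have "ennreal c + ennreal (2 * CD * c) = ennreal (c * (1 + 2 * CD))"
    using CD_nonneg assms(4) by (subst ennreal_plus[symmetric]) (auto simp: algebra_simps)
  finally show ?thesis .
qed

lemma H1_approx_subseq:
  assumes "H1_approx M D p u f" "strict_mono \<sigma>"
  shows "H1_approx M D p (\<lambda>n. u (\<sigma> n)) f"
  unfolding H1_approx_def
proof (intro conjI allI impI)
  fix e :: real assume "0 < e"
  then obtain N where "\<forall>m\<ge>N. \<forall>n\<ge>N. H1_lipnorm M D p (\<lambda>x. u m x - u n x) < ennreal e"
    using assms(1) unfolding H1_approx_def by blast
  then show "\<exists>N. \<forall>m\<ge>N. \<forall>n\<ge>N. H1_lipnorm M D p (\<lambda>x. u (\<sigma> m) x - u (\<sigma> n) x) < ennreal e"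
    using seq_suble[OF assms(2)] order_trans by blast
next
  show "(\<lambda>n. Lp_norm M p (\<lambda>x. u (\<sigma> n) x - f x)) \<longlonglongrightarrow> 0"
    using LIMSEQ_subseq_LIMSEQ[OF _ assms(2), of "\<lambda>n. Lp_norm M p (\<lambda>x. u n x - f x)"] assms(1)
    unfolding H1_approx_def by (auto simp: o_def)
qed (use assms in \<open>auto simp: H1_approx_def\<close>)

text \<open>The approximants are the Lipschitz truncations at the levels \<open>2 ^ n\<close>. Both
  \<open>f - g n\<close> and its Hajlasz gradient are bounded by multiples of \<open>B n\<close>,
  the part of \<open>F\<close> above \<open>2 ^ n\<close>, whose L^p norm \<open>t n\<close> tends
  to 0 by dominated convergence. Since \<open>D\<close> is dominated by Hajlasz gradients, this
  controls the full Sobolev norms of the differences.\<close>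

lemma hajlasz_imp_H1:
  assumes [measurable]: "f \<in> borel_measurable M" "h \<in> borel_measurable M"
    and haj: "hajlasz M f h" and p: "0 < p"
    and fin: "(\<integral>\<^sup>+x. epow (ennreal \<bar>f x\<bar> + h x) p \<partial>M) < top"
  shows "H1 M D (ereal p) f" (is ?H)
    and "H1_norm M D (ereal p) f
      \<le> ennreal (2 * (1 + 2 * CD)) * epow (\<integral>\<^sup>+x. epow (ennreal \<bar>f x\<bar> + h x) p \<partial>M) (1 / p)" (is ?N)
proof -
  define F where "F x = ennreal \<bar>f x\<bar> + h x" for x
  have [measurable]: "F \<in> borel_measurable M" unfolding F_def by measurable
  define I where "I = epow (\<integral>\<^sup>+x. epow (F x) p \<partial>M) (1 / p)"
  define K where "K = 2 * (1 + 2 * CD)"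
  have K: "0 < K" using CD_nonneg by (simp add: K_def)
  define B where "B n x = F x * of_bool (ennreal (2 ^ n) < F x)" for n :: nat and x
  have [measurable]: "B n \<in> borel_measurable M" for n unfolding B_def by measurable
  define t where "t n = epow (\<integral>\<^sup>+x. epow (B n x) p \<partial>M) (1 / p)" for n
  define P where "P n g \<longleftrightarrow> (2 * 2 ^ n)-lipschitz_on UNIV g \<and>
    (AE x in M. ennreal \<bar>f x - g x\<bar> \<le> 2 * B n x) \<and>
    (AE x in M. ennreal \<bar>g x\<bar> \<le> F x) \<and>
    hajlasz M (\<lambda>x. f x - g x) (\<lambda>x. 4 * B n x) \<and> hajlasz M g (\<lambda>x. 2 * F x)" for n g
  have "\<exists>g. P n g" for n
  proof -
    have pos: "(0::real) < 2 ^ n" by simp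
    obtain g where g: "(2 * 2 ^ n)-lipschitz_on UNIV g"
      "AE x in M. ennreal \<bar>f x - g x\<bar> \<le> 2 * (F x * of_bool (ennreal (2 ^ n) < F x))"
      "AE x in M. ennreal \<bar>g x\<bar> \<le> min (F x) (ennreal (2 ^ n))"
      "hajlasz M (\<lambda>x. f x - g x) (\<lambda>x. 4 * (F x * of_bool (ennreal (2 ^ n) < F x)))"
      "hajlasz M g (\<lambda>x. 2 * min (F x) (ennreal (2 ^ n)))"
      unfolding F_def using lipschitz_truncation[OF haj pos] by blast
    have "hajlasz M g (\<lambda>x. 2 * F x)"
      by (rule hajlasz_mono_AE[OF g(5)]) (auto intro!: mult_left_mono)
    moreover have "AE x in M. ennreal \<bar>g x\<bar> \<le> F x"
      using g(3) by eventually_elim simp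
    ultimately show ?thesis using g unfolding P_def B_def by blast
  qed
  then obtain g where "\<And>n. P n (g n)" by metis
  then have g_lip: "\<And>n. (2 * 2 ^ n)-lipschitz_on UNIV (g n)"
    and fg: "\<And>n. AE x in M. ennreal \<bar>f x - g n x\<bar> \<le> 2 * B n x"
    and gF: "\<And>n. AE x in M. ennreal \<bar>g n x\<bar> \<le> F x"
    and haj_fg: "\<And>n. hajlasz M (\<lambda>x. f x - g n x) (\<lambda>x. 4 * B n x)"
    and haj_g: "\<And>n. hajlasz M (g n) (\<lambda>x. 2 * F x)" unfolding P_def by blast+
  have g_loc: "loc_lipschitz (g n)" for n by (rule lipschitz_loc_lipschitz[OF g_lip])
  have I_fin: "I < top" using fin by (simp add: I_def F_def)
  have lipnorm_g: "H1_lipnorm M D p (g n) \<le> ennreal K * I" for n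
  proof -
    have "AE x in M. ennreal \<bar>g n x\<bar> \<le> ennreal 2 * F x"
      using gF[of n]
    proof eventually_elim
      case (elim x)
      also have "F x \<le> 2 * F x" using mult_right_mono[of 1 2 "F x"] by simp
      finally show ?case by simp
    qed
    then show ?thesis unfolding K_def I_def
      using haj_g[of n] p by (intro H1_lipnorm_le g_loc) auto
  qed
  have diff_le: "H1_lipnorm M D p (\<lambda>x. g m x - g n x) \<le> ennreal (8 * (1 + 2 * CD)) * t k"
    if "k \<le> m" "k \<le> n" for k m n
    unfolding t_def
  proof (rule H1_lipnorm_le)
    have B_mono: "B m x \<le> B k x" if "k \<le> m" for m x
    proof -
      have "ennreal (2 ^ k) \<le> ennreal (2 ^ m)" using that by (intro ennreal_leI power_increasing) auto
      then have "ennreal (2 ^ k) < F x" if "ennreal (2 ^ m) < F x" using that by order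
      then show ?thesis unfolding B_def by (intro mult_left_mono) auto
    qed
    have B4: "4 * B m x + 4 * B n x \<le> ennreal 8 * B k x" for x
    proof -
      have "4 * B m x + 4 * B n x \<le> 4 * B k x + 4 * B k x"
        using that by (intro add_mono mult_left_mono B_mono) auto
      also have "\<dots> = (4 + 4) * B k x" by (simp only: distrib_right)
      finally show ?thesis by simp
    qed
    show "AE x in M. ennreal \<bar>g m x - g n x\<bar> \<le> ennreal 8 * B k x"
      using fg[of m] fg[of n]
    proof eventually_elim
      case (elim x)
      have "ennreal \<bar>g m x - g n x\<bar> \<le> ennreal (\<bar>f x - g m x\<bar> + \<bar>f x - g n x\<bar>)" by (intro ennreal_leI) simp
      also have "\<dots> = ennreal \<bar>f x - g m x\<bar> + ennreal \<bar>f x - g n x\<bar>" by simp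
      also have "\<dots> \<le> 2 * B m x + 2 * B n x" by (intro add_mono elim)
      also have "\<dots> \<le> 4 * B m x + 4 * B n x" by (intro add_mono mult_right_mono) auto
      also note B4[of x]
      finally show ?case .
    qed
    have "hajlasz M (\<lambda>x. g m x - g n x) (\<lambda>x. 4 * B m x + 4 * B n x)"
      by (rule hajlasz_lincomb[OF haj_fg haj_fg]) simp
    then show "hajlasz M (\<lambda>x. g m x - g n x) (\<lambda>x. ennreal 8 * B k x)"
      by (rule hajlasz_mono_AE) (use B4 in auto)
  qed (use p in \<open>auto intro!: loc_lipschitz_diff g_loc\<close>)
  have t0: "t \<longlonglongrightarrow> 0"
  proof -
    have "(\<lambda>n. \<integral>\<^sup>+x. epow (B n x) p \<partial>M) \<longlonglongrightarrow> (\<integral>\<^sup>+x. 0 \<partial>M)"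
    proof (rule nn_integral_dominated_convergence[where w = "\<lambda>x. epow (F x) p"])
      show "AE x in M. epow (B n x) p \<le> epow (F x) p" for n
        using p by (intro AE_I2 epow_mono) (auto simp: B_def)
      have "AE x in M. epow (F x) p \<noteq> \<infinity>"
        using fin by (intro nn_integral_PInf_AE) (auto simp: F_def less_top)
      then show "AE x in M. (\<lambda>n. epow (B n x) p) \<longlonglongrightarrow> 0"
      proof eventually_elim
        case (elim x)
        then have "F x < top" by (simp add: less_top)
        then obtain r where r: "F x = ennreal r" "0 \<le> r" by (cases "F x") auto
        obtain n where n: "r < 2 ^ n" using real_arch_pow[of 2 r] by auto
        have "epow (B m x) p = 0" if "n \<le> m" for m
        proof -
          have "(2::real) ^ n \<le> 2 ^ m" by (intro power_increasing that) simp
          with n have "r < 2 ^ m" by linarith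
          then have "\<not> ennreal (2 ^ m) < F x" using r ennreal_leI[of r "2^m"] by (simp add: not_less)
          then show ?thesis by (simp add: B_def)
        qed
        then show ?case by (intro tendsto_eventually eventually_sequentiallyI)
      qed
    qed (use fin in \<open>auto simp: F_def less_top\<close>)
    then have lim: "(\<lambda>n. \<integral>\<^sup>+x. epow (B n x) p \<partial>M) \<longlonglongrightarrow> 0" by simp
    show ?thesis
    proof (rule ennreal_tendsto_0I)
      fix e :: real assume e: "0 < e"
      have "0 < ennreal (e powr p)" using e by simp
      from order_tendstoD(2)[OF lim this]
      show "\<forall>\<^sub>F n in sequentially. t n \<le> ennreal e"
      proof eventually_elim
        case (elim n)
        then have "t n \<le> epow (ennreal (e powr p)) (1 / p)"
          unfolding t_def using p by (intro epow_mono) auto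
        then show ?case using e p by (simp add: epow_ennreal powr_powr)
      qed
    qed
  qed
  have approx: "H1_approx M D p g f"
    unfolding H1_approx_def
  proof (intro conjI allI impI)
    show "H1_lipnorm M D p (g n) < \<infinity>" for n
      using lipnorm_g[of n] I_fin by (auto simp: ennreal_mult_less_top intro: le_less_trans)
    fix e :: real assume e: "0 < e"
    have "(\<lambda>n. ennreal (8 * (1 + 2 * CD)) * t n) \<longlonglongrightarrow> ennreal (8 * (1 + 2 * CD)) * 0"
      by (intro ennreal_tendsto_cmult t0) auto
    then have "\<forall>\<^sub>F n in sequentially. ennreal (8 * (1 + 2 * CD)) * t n < ennreal e"
      using e by (intro order_tendstoD(2)) auto
    then obtain N where "ennreal (8 * (1 + 2 * CD)) * t N < ennreal e"
      by (meson eventually_sequentially order_refl)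
    then show "\<exists>N. \<forall>m\<ge>N. \<forall>n\<ge>N. H1_lipnorm M D p (\<lambda>x. g m x - g n x) < ennreal e"
      using diff_le le_less_trans by blast
  next
    have le: "Lp_norm M p (\<lambda>x. g n x - f x) \<le> ennreal 2 * t n" for n
      unfolding t_def using fg[of n] p by (intro Lp_norm_le) (auto simp: abs_minus_commute)
    have "(\<lambda>n. ennreal 2 * t n) \<longlonglongrightarrow> ennreal 2 * 0" by (intro ennreal_tendsto_cmult t0) auto
    then have lim: "(\<lambda>n. ennreal 2 * t n) \<longlonglongrightarrow> 0" by simp
    show "(\<lambda>n. Lp_norm M p (\<lambda>x. g n x - f x)) \<longlonglongrightarrow> 0"
      by (rule tendsto_sandwich[OF _ _ tendsto_const lim]) (use le in auto)
  qed (use g_loc in auto)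
  then show ?H unfolding H1_def by auto
  \<comment> \<open>\<open>H1_norm\<close> admits only sequences whose norms converge. A monotone
    subsequence of norms has a limit in the extended reals, and it inherits the uniform
    bound.\<close>
  obtain \<sigma> where \<sigma>: "strict_mono \<sigma>" "monoseq (\<lambda>n. H1_lipnorm M D p (g (\<sigma> n)))"
    using seq_monosub[of "\<lambda>n. H1_lipnorm M D p (g n)"] by blast
  obtain c where c: "(\<lambda>n. H1_lipnorm M D p (g (\<sigma> n))) \<longlonglongrightarrow> c"
    using \<sigma>(2) LIMSEQ_SUP LIMSEQ_INF unfolding monoseq_iff by blast
  have "H1_norm M D (ereal p) f \<le> c"
    unfolding H1_norm_def using H1_approx_subseq[OF approx \<sigma>(1)] c by (auto intro!: Inf_lower)
  also have "c \<le> ennreal K * I"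
    using c lipnorm_g by (intro LIMSEQ_le_const2) auto
  finally show ?N by (simp add: K_def I_def F_def)
qed

lemma lipschitz_imp_H1_infinity:
  assumes [measurable]: "f \<in> borel_measurable M" and lip: "L-lipschitz_on UNIV f" and bd: "\<And>x. \<bar>f x\<bar> \<le> B"
  shows "H1 M D \<infinity> f" "H1_norm M D \<infinity> f \<le> ennreal (B + CD * L)"
proof -
  have f: "loc_lipschitz f" by (rule lipschitz_loc_lipschitz[OF lip])
  have [measurable]: "D f \<in> borel_measurable M" by (rule D_measurable[OF f])
  have L: "0 \<le> L" using lipschitz_on_nonneg[OF lip] .
  have B: "0 \<le> B" using bd[of undefined] abs_ge_zero order_trans by blast
  show "H1 M D \<infinity> f" unfolding H1_def using lip bd by auto
  have "Linf_norm M f \<le> ennreal B"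
    unfolding Linf_norm_def by (intro esssup_I) (auto intro!: ennreal_leI bd)
  moreover have "Linf_norm M (\<lambda>x. norm (D f x)) \<le> ennreal (CD * L)"
    unfolding Linf_norm_def
  proof (intro esssup_I)
    show "AE x in M. ennreal \<bar>norm (D f x)\<bar> \<le> ennreal (CD * L)"
      using D_upper[OF f]
    proof eventually_elim
      case (elim x)
      also have "ennreal CD * lipn f x \<le> ennreal CD * ennreal L"
        by (intro mult_left_mono lipn_le_lipschitz lip) simp
      finally show ?case using CD_nonneg L by (simp add: ennreal_mult)
    qed
  qed measurable
  ultimately have "Linf_norm M f + Linf_norm M (\<lambda>x. norm (D f x)) \<le> ennreal (B + CD * L)"
    using B CD_nonneg L by (simp add: add_mono)
  then show "H1_norm M D \<infinity> f \<le> ennreal (B + CD * L)"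
    unfolding H1_norm_def using lip bd by (auto intro!: Inf_lower2)
qed

end

section \<open>Hajlasz gradients of Sobolev functions\<close>

context cheeger_space
begin

text \<open>Built from \<open>D w\<close> instead of \<open>lipn w\<close>, so that its L^p norm is
  controlled by \<open>H1_lipnorm\<close> directly.\<close>

definition haj_grad :: "('a \<Rightarrow> real) \<Rightarrow> 'a \<Rightarrow> ennreal" where
  "haj_grad w x = ennreal Chaj * epow (maxf M (\<lambda>y. epow (ennreal (norm (D w y))) q) x) (1 / q)"

lemma haj_grad_measurable [measurable]: "haj_grad w \<in> borel_measurable M"
  unfolding haj_grad_def by measurable

lemma haj_grad_pointwise:
  assumes "loc_lipschitz w"
  shows "ennreal \<bar>w x - w y\<bar> \<le> ennreal (dist x y) * (haj_grad w x + haj_grad w y)"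
  unfolding haj_grad_def by (rule loc_lipschitz_pointwise[OF assms D_lower[OF assms]])

text \<open>The maximal theorem is used with exponent \<open>p / q\<close> for the function
  \<open>norm (D w)\<close> to the power \<open>q\<close>; this is where \<open>q < p\<close> must
  be strict.\<close>

lemma haj_grad_norm:
  assumes p: "q < p"
  shows "\<exists>C>0. \<forall>w. loc_lipschitz w \<longrightarrow>
    (\<integral>\<^sup>+x. epow (ennreal \<bar>w x\<bar> + haj_grad w x) p \<partial>M) \<le> ennreal C * epow (H1_lipnorm M D p w) p"
proof -
  have p0: "0 < p" "1 < p / q" using p q1 by auto
  obtain Cs where Cs: "0 < Cs" "\<And>g::'a \<Rightarrow> ennreal. g \<in> borel_measurable M \<Longrightarrow>
    (\<integral>\<^sup>+x. epow (maxf M g x) (p / q) \<partial>M) \<le> ennreal Cs * (\<integral>\<^sup>+x. epow (g x) (p / q) \<partial>M)"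
    using maxf_strong_type[OF p0(2)] by blast
  define C1 where "C1 = Chaj powr p * Cs"
  have C1: "0 \<le> C1" using Cs by (simp add: C1_def)
  have "(\<integral>\<^sup>+x. epow (ennreal \<bar>w x\<bar> + haj_grad w x) p \<partial>M)
    \<le> ennreal (2 powr p * (1 + C1)) * epow (H1_lipnorm M D p w) p" if w: "loc_lipschitz w" for w
  proof -
    have [measurable]: "w \<in> borel_measurable M" "D w \<in> borel_measurable M"
      using loc_lipschitz_measurable[OF w] D_measurable[OF w] by auto
    define N where "N = epow (H1_lipnorm M D p w) p"
    have 1: "(\<integral>\<^sup>+x. epow (ennreal \<bar>w x\<bar>) p \<partial>M) \<le> N"
      unfolding epow_Lp_norm[OF p0(1), symmetric] N_def H1_lipnorm_def using p0 by (intro epow_mono) auto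
    have "(\<integral>\<^sup>+x. epow (haj_grad w x) p \<partial>M)
      = (\<integral>\<^sup>+x. ennreal (Chaj powr p) * epow (maxf M (\<lambda>y. epow (ennreal (norm (D w y))) q) x) (p / q) \<partial>M)"
      unfolding haj_grad_def using p0 Chaj_pos by (simp add: epow_cmult epow_epow)
    also have "\<dots> = ennreal (Chaj powr p) * (\<integral>\<^sup>+x. epow (maxf M (\<lambda>y. epow (ennreal (norm (D w y))) q) x) (p / q) \<partial>M)"
      by (intro nn_integral_cmult) measurable
    also have "\<dots> \<le> ennreal (Chaj powr p) * (ennreal Cs * (\<integral>\<^sup>+x. epow (epow (ennreal (norm (D w x))) q) (p / q) \<partial>M))"
      by (intro mult_left_mono Cs(2)) auto
    also have "\<dots> = ennreal C1 * (\<integral>\<^sup>+x. epow (ennreal \<bar>norm (D w x)\<bar>) p \<partial>M)"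
      using q1 Cs(1) by (simp add: epow_epow C1_def ennreal_mult mult.assoc)
    also have "\<dots> \<le> ennreal C1 * N"
      unfolding epow_Lp_norm[OF p0(1)] N_def H1_lipnorm_def
    proof (intro mult_left_mono)
      have "epow (Lp_norm M p (\<lambda>x. norm (D w x))) p
        \<le> epow (Lp_norm M p w + Lp_norm M p (\<lambda>x. norm (D w x))) p" using p0 by (intro epow_mono) auto
      then show "(\<integral>\<^sup>+x. epow (ennreal \<bar>norm (D w x)\<bar>) p \<partial>M)
        \<le> epow (Lp_norm M p w + Lp_norm M p (\<lambda>x. norm (D w x))) p" by (simp add: epow_Lp_norm[OF p0(1)])
    qed simp
    finally have 2: "(\<integral>\<^sup>+x. epow (haj_grad w x) p \<partial>M) \<le> ennreal C1 * N" .
    have "(\<integral>\<^sup>+x. epow (ennreal \<bar>w x\<bar> + haj_grad w x) p \<partial>M)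
      \<le> (\<integral>\<^sup>+x. ennreal (2 powr p) * (epow (ennreal \<bar>w x\<bar>) p + epow (haj_grad w x) p) \<partial>M)"
      using p0 by (intro nn_integral_mono epow_add_le)
    also have "\<dots> = ennreal (2 powr p) * ((\<integral>\<^sup>+x. epow (ennreal \<bar>w x\<bar>) p \<partial>M) + (\<integral>\<^sup>+x. epow (haj_grad w x) p \<partial>M))"
      by (subst nn_integral_cmult, measurable, subst nn_integral_add, measurable)
    also have "\<dots> \<le> ennreal (2 powr p) * (N + ennreal C1 * N)" by (intro mult_left_mono add_mono 1 2) auto
    also have "\<dots> = ennreal (2 powr p * (1 + C1)) * N"
      using C1 by (simp add: ennreal_mult ennreal_plus distrib_right mult.assoc)
    finally show ?thesis by (simp add: N_def)
  qed
  moreover have "0 < 2 powr p * (1 + C1)" using C1 by (intro mult_pos_pos) auto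
  ultimately show ?thesis by blast
qed

text \<open>Hajlasz gradients of an approximating sequence need not converge, so a gradient of the
  limit is assembled as a sum: along a fast subsequence the limit is the telescoping series of the
  differences \<open>w k\<close>, and \<open>h\<close> is the sum of the gradients of the
  \<open>w k\<close>. The bound \<open>N\<close> and the start \<open>n0\<close> are left free:
  \<open>N\<close> will be close to the norm of \<open>f\<close>, or just some finite
  number.\<close>

lemma H1_approx_imp_hajlasz:
  assumes p: "q < p"
  shows "\<exists>C>0. \<forall>u f N n0. H1_approx M D p u f \<longrightarrow> 0 < N \<longrightarrow> H1_lipnorm M D p (u n0) \<le> ennreal N \<longrightarrow>
    (\<forall>m\<ge>n0. \<forall>n\<ge>n0. H1_lipnorm M D p (\<lambda>x. u m x - u n x) \<le> ennreal N) \<longrightarrow>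
    (\<exists>h\<in>borel_measurable M. hajlasz M f h \<and>
      (\<integral>\<^sup>+x. epow (ennreal \<bar>f x\<bar> + h x) p \<partial>M) \<le> ennreal (C * N powr p))"
proof -
  have p1: "1 < p" using p q1 by simp
  then have p0: "0 < p" by simp
  obtain C1 where C1: "0 < C1" "\<And>w. loc_lipschitz w \<Longrightarrow>
    (\<integral>\<^sup>+x. epow (ennreal \<bar>w x\<bar> + haj_grad w x) p \<partial>M) \<le> ennreal C1 * epow (H1_lipnorm M D p w) p"
    using haj_grad_norm[OF p] by blast
  define C where "C = 2 powr p * (C1 * 4 powr p * 2)"
  have "\<exists>h\<in>borel_measurable M. hajlasz M f h \<and>
      (\<integral>\<^sup>+x. epow (ennreal \<bar>f x\<bar> + h x) p \<partial>M) \<le> ennreal (C * N powr p)"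
    if approx: "H1_approx M D p u f" and N: "0 < N" and n0: "H1_lipnorm M D p (u n0) \<le> ennreal N"
      and cau0: "\<forall>m\<ge>n0. \<forall>n\<ge>n0. H1_lipnorm M D p (\<lambda>x. u m x - u n x) \<le> ennreal N" for u f N n0
  proof -
    have [measurable]: "f \<in> borel_measurable M" and u_loc: "\<And>n. loc_lipschitz (u n)"
      and cau: "\<And>e. 0 < e \<Longrightarrow> \<exists>N. \<forall>m\<ge>N. \<forall>n\<ge>N. H1_lipnorm M D p (\<lambda>x. u m x - u n x) < ennreal e"
      and lim: "(\<lambda>n. Lp_norm M p (\<lambda>x. u n x - f x)) \<longlonglongrightarrow> 0"
      using approx unfolding H1_approx_def by auto
    have [measurable]: "u n \<in> borel_measurable M" for n by (rule loc_lipschitz_measurable[OF u_loc])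
    \<comment> \<open>The first half makes the differences small in the Sobolev norm; the second
      makes the distances to \<open>f\<close> summable, which yields convergence almost
      everywhere.\<close>
    define P where "P k B \<longleftrightarrow>
      (\<forall>m\<ge>B. \<forall>n\<ge>B. H1_lipnorm M D p (\<lambda>x. u m x - u n x) \<le> ennreal (N / 4 ^ k)) \<and>
      (\<forall>n\<ge>B. (\<integral>\<^sup>+x. epow (ennreal \<bar>u n x - f x\<bar>) p \<partial>M) \<le> ennreal ((1 / 2) ^ k))" for k B :: nat
    have "\<exists>B. P k B" for k
    proof -
      have "0 < N / 4 ^ k" using N by simp
      from cau[OF this] obtain B1 where B1: "\<forall>m\<ge>B1. \<forall>n\<ge>B1. H1_lipnorm M D p (\<lambda>x. u m x - u n x) < ennreal (N / 4 ^ k)"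
        by blast
      have "0 < epow (ennreal ((1 / 2) ^ k)) (1 / p)" by (subst epow_ennreal) auto
      from order_tendstoD(2)[OF lim this] obtain B2
        where B2: "\<And>n. n \<ge> B2 \<Longrightarrow> Lp_norm M p (\<lambda>x. u n x - f x) < epow (ennreal ((1 / 2) ^ k)) (1 / p)"
        unfolding eventually_sequentially by blast
      have "(\<integral>\<^sup>+x. epow (ennreal \<bar>u n x - f x\<bar>) p \<partial>M) \<le> ennreal ((1 / 2) ^ k)" if "n \<ge> B2" for n
        using B2[OF that] unfolding epow_Lp_norm[OF p0, symmetric] epow_le_iff[OF p0] by simp
      then have "P k (max B1 B2)" using B1 unfolding P_def by (auto simp: less_imp_le)
      then show ?thesis by blast
    qed
    then obtain B where "\<And>k. P k (B k)" by metis
    then have B: "\<And>k m n. m \<ge> B k \<Longrightarrow> n \<ge> B k \<Longrightarrow> H1_lipnorm M D p (\<lambda>x. u m x - u n x) \<le> ennreal (N / 4 ^ k)"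
      "\<And>k n. n \<ge> B k \<Longrightarrow> (\<integral>\<^sup>+x. epow (ennreal \<bar>u n x - f x\<bar>) p \<partial>M) \<le> ennreal ((1 / 2) ^ k)"
      unfolding P_def by blast+
    \<comment> \<open>The first index is \<open>n0\<close>, so that \<open>w 0\<close> has norm at
      most \<open>N\<close>. From \<open>k = 1\<close> on the index exceeds all thresholds
      \<open>B i\<close> with \<open>i \<le> k\<close>.\<close>
    define idx where "idx k = (if k = 0 then n0 else n0 + (\<Sum>i\<le>k. B i))" for k :: nat
    have idx_n0: "n0 \<le> idx k" for k by (simp add: idx_def)
    have B_idx: "B k \<le> idx m" if "k \<le> m" "0 < m" for k m
    proof -
      have "B k \<le> (\<Sum>i\<le>m. B i)" using that by (intro member_le_sum) auto
      then show ?thesis using that by (simp add: idx_def)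
    qed
    define v where "v k = u (idx k)" for k
    define w where "w k = (if k = 0 then v 0 else (\<lambda>x. v k x - v (k - 1) x))" for k
    have v_sum: "v k x = (\<Sum>i\<le>k. w i x)" for k x by (induction k) (auto simp: w_def)
    have w_loc: "loc_lipschitz (w k)" for k
      using u_loc by (auto simp: w_def v_def intro!: loc_lipschitz_diff)
    have [measurable]: "w k \<in> borel_measurable M" "v k \<in> borel_measurable M" for k
      using loc_lipschitz_measurable[OF w_loc] loc_lipschitz_measurable[OF u_loc] by (auto simp: v_def)
    \<comment> \<open>The factor 4 is the index shift: the difference with number
      \<open>Suc j\<close> is controlled at stage \<open>j\<close>, where stage 0 uses
      \<open>cau0\<close>.\<close>
    have w_norm: "H1_lipnorm M D p (w k) \<le> ennreal (4 * N / 4 ^ k)" for k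
    proof (cases k)
      case 0
      have "H1_lipnorm M D p (w 0) \<le> ennreal N" using n0 by (simp add: w_def v_def idx_def)
      also have "\<dots> \<le> ennreal (4 * N / 4 ^ 0)" using N by (intro ennreal_leI) simp
      finally show ?thesis using 0 by simp
    next
      case (Suc j)
      have "H1_lipnorm M D p (\<lambda>x. u (idx (Suc j)) x - u (idx j) x) \<le> ennreal (N / 4 ^ j)"
      proof (cases "j = 0")
        case True
        then show ?thesis using cau0 idx_n0 by simp
      next
        case False
        then show ?thesis by (intro B(1) B_idx) auto
      qed
      then show ?thesis by (simp add: w_def v_def Suc)
    qed
    define h where "h x = (\<Sum>k. haj_grad (w k) x)" for x
    have [measurable]: "h \<in> borel_measurable M" unfolding h_def by measurable
    \<comment> \<open>The term with index 0 is left out because \<open>u n0\<close> need not be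
      close to \<open>f\<close>.\<close>
    have "AE x in M. (\<Sum>k. epow (ennreal \<bar>v (Suc k) x - f x\<bar>) p) \<noteq> \<infinity>"
    proof (rule nn_integral_PInf_AE)
      have "(\<integral>\<^sup>+x. (\<Sum>k. epow (ennreal \<bar>v (Suc k) x - f x\<bar>) p) \<partial>M)
        = (\<Sum>k. \<integral>\<^sup>+x. epow (ennreal \<bar>v (Suc k) x - f x\<bar>) p \<partial>M)"
        by (intro nn_integral_suminf) measurable
      also have "\<dots> \<le> (\<Sum>k. ennreal ((1 / 2) ^ Suc k))"
        unfolding v_def by (intro suminf_le B(2) B_idx) auto
      also have "\<dots> = ennreal 1"
        by (rule suminf_ennreal_eq) (use power_half_series in auto)
      also have "\<dots> < \<infinity>" by simp
      finally show "(\<integral>\<^sup>+x. (\<Sum>k. epow (ennreal \<bar>v (Suc k) x - f x\<bar>) p) \<partial>M) \<noteq> \<infinity>" by simp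
    qed measurable
    then have conv: "AE x in M. (\<lambda>k. v k x) \<longlonglongrightarrow> f x"
    proof eventually_elim
      case (elim x)
      then have "summable (\<lambda>k. \<bar>v (Suc k) x - f x\<bar> powr p)"
        by (intro summable_suminf_not_top) (auto simp: epow_ennreal)
      then have X: "(\<lambda>k. \<bar>v (Suc k) x - f x\<bar> powr p) \<longlonglongrightarrow> 0" by (rule summable_LIMSEQ_zero)
      have "(\<lambda>k. v (Suc k) x) \<longlonglongrightarrow> f x"
      proof (rule LIMSEQ_I)
        fix e :: real assume e: "0 < e"
        then have "0 < e powr p" by simp
        from order_tendstoD(2)[OF X this] obtain k0
          where k0: "\<And>k. k \<ge> k0 \<Longrightarrow> \<bar>v (Suc k) x - f x\<bar> powr p < e powr p"
          unfolding eventually_sequentially by blast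
        have "\<bar>v (Suc k) x - f x\<bar> < e" if "k \<ge> k0" for k
          using k0[OF that] powr_mono2[of p e "\<bar>v (Suc k) x - f x\<bar>"] e p0 by linarith
        then show "\<exists>k0. \<forall>k\<ge>k0. norm (v (Suc k) x - f x) < e" by auto
      qed
      then show ?case by (rule LIMSEQ_imp_Suc)
    qed
    have partial_le: "(\<Sum>i\<le>k. a i) \<le> (\<Sum>i. a i)" for a :: "nat \<Rightarrow> ennreal" and k
      by (rule sum_le_suminf) auto
    have haj: "hajlasz M f h"
    proof -
      obtain Z where Z: "Z \<in> null_sets M" "\<And>x. x \<notin> Z \<Longrightarrow> (\<lambda>k. v k x) \<longlonglongrightarrow> f x"
        using AE_null_set[OF conv] by blast
      have "ennreal \<bar>f x - f y\<bar> \<le> ennreal (dist x y) * (h x + h y)" if "x \<notin> Z" "y \<notin> Z" for x y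
      proof (rule LIMSEQ_le_const2)
        show "(\<lambda>k. ennreal \<bar>v k x - v k y\<bar>) \<longlonglongrightarrow> ennreal \<bar>f x - f y\<bar>"
          by (intro tendsto_ennrealI tendsto_rabs tendsto_diff Z that)
        have "ennreal \<bar>v k x - v k y\<bar> \<le> ennreal (dist x y) * (h x + h y)" for k
        proof -
          have "\<bar>v k x - v k y\<bar> = \<bar>\<Sum>i\<le>k. w i x - w i y\<bar>" by (simp add: v_sum sum_subtractf)
          also have "\<dots> \<le> (\<Sum>i\<le>k. \<bar>w i x - w i y\<bar>)" by (rule sum_abs)
          finally have "ennreal \<bar>v k x - v k y\<bar> \<le> ennreal (\<Sum>i\<le>k. \<bar>w i x - w i y\<bar>)" by (rule ennreal_leI)
          also have "\<dots> = (\<Sum>i\<le>k. ennreal \<bar>w i x - w i y\<bar>)" by (rule sum_ennreal[symmetric]) auto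
          also have "\<dots> \<le> (\<Sum>i\<le>k. ennreal (dist x y) * (haj_grad (w i) x + haj_grad (w i) y))"
            by (intro sum_mono haj_grad_pointwise w_loc)
          also have "\<dots> = ennreal (dist x y) * ((\<Sum>i\<le>k. haj_grad (w i) x) + (\<Sum>i\<le>k. haj_grad (w i) y))"
            by (simp add: sum_distrib_left[symmetric] sum.distrib)
          also have "\<dots> \<le> ennreal (dist x y) * (h x + h y)"
            unfolding h_def by (intro mult_left_mono add_mono partial_le) auto
          finally show ?thesis .
        qed
        then show "\<exists>n. \<forall>k\<ge>n. ennreal \<bar>v k x - v k y\<bar> \<le> ennreal (dist x y) * (h x + h y)" by blast
      qed
      then show ?thesis unfolding hajlasz_def using Z(1) by blast
    qed
    have f_le: "AE x in M. ennreal \<bar>f x\<bar> \<le> (\<Sum>i. ennreal \<bar>w i x\<bar>)"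
      using conv
    proof eventually_elim
      case (elim x)
      show ?case
      proof (rule LIMSEQ_le_const2)
        show "(\<lambda>k. ennreal \<bar>v k x\<bar>) \<longlonglongrightarrow> ennreal \<bar>f x\<bar>" by (intro tendsto_ennrealI tendsto_rabs elim)
        have "ennreal \<bar>v k x\<bar> \<le> (\<Sum>i. ennreal \<bar>w i x\<bar>)" for k
        proof -
          have "ennreal \<bar>v k x\<bar> \<le> ennreal (\<Sum>i\<le>k. \<bar>w i x\<bar>)"
            unfolding v_sum by (intro ennreal_leI sum_abs)
          also have "\<dots> = (\<Sum>i\<le>k. ennreal \<bar>w i x\<bar>)" by (rule sum_ennreal[symmetric]) auto
          also have "\<dots> \<le> (\<Sum>i. ennreal \<bar>w i x\<bar>)" by (rule partial_le)
          finally show ?thesis .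
        qed
        then show "\<exists>n. \<forall>k\<ge>n. ennreal \<bar>v k x\<bar> \<le> (\<Sum>i. ennreal \<bar>w i x\<bar>)" by blast
      qed
    qed
    define F where "F k x = ennreal \<bar>w k x\<bar> + haj_grad (w k) x" for k x
    have [measurable]: "F k \<in> borel_measurable M" for k unfolding F_def by measurable
    have "(\<integral>\<^sup>+x. epow (ennreal \<bar>f x\<bar> + h x) p \<partial>M) \<le> (\<integral>\<^sup>+x. epow (\<Sum>k. F k x) p \<partial>M)"
    proof (rule nn_integral_mono_AE)
      show "AE x in M. epow (ennreal \<bar>f x\<bar> + h x) p \<le> epow (\<Sum>k. F k x) p"
        using f_le
      proof eventually_elim
        case (elim x)
        have "ennreal \<bar>f x\<bar> + h x \<le> (\<Sum>i. ennreal \<bar>w i x\<bar>) + h x" using elim by (intro add_mono) auto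
        also have "\<dots> = (\<Sum>k. F k x)" unfolding h_def F_def by (rule suminf_add) auto
        finally show ?case using p0 by (intro epow_mono) auto
      qed
    qed
    also have "\<dots> \<le> (\<integral>\<^sup>+x. ennreal (2 powr p) * (\<Sum>k. ennreal ((2 ^ k) powr p) * epow (F k x) p) \<partial>M)"
      by (intro nn_integral_mono epow_suminf_le p0)
    also have "\<dots> = ennreal (2 powr p) * (\<Sum>k. ennreal ((2 ^ k) powr p) * (\<integral>\<^sup>+x. epow (F k x) p \<partial>M))"
      by (subst nn_integral_cmult, measurable, subst nn_integral_suminf, measurable)
         (simp add: nn_integral_cmult)
    also have "\<dots> \<le> ennreal (2 powr p) * (\<Sum>k. ennreal (C1 * (4 * N) powr p * (1 / 2) ^ k))"
    proof (intro mult_left_mono suminf_le)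
      fix k :: nat
      have "(\<integral>\<^sup>+x. epow (F k x) p \<partial>M) \<le> ennreal C1 * epow (H1_lipnorm M D p (w k)) p"
        unfolding F_def by (rule C1(2)[OF w_loc])
      also have "\<dots> \<le> ennreal C1 * epow (ennreal (4 * N / 4 ^ k)) p"
        using p0 by (intro mult_left_mono epow_mono w_norm) auto
      also have "\<dots> = ennreal (C1 * (4 * N / 4 ^ k) powr p)"
        using N C1(1) by (simp add: epow_ennreal ennreal_mult)
      finally have "ennreal ((2 ^ k) powr p) * (\<integral>\<^sup>+x. epow (F k x) p \<partial>M)
        \<le> ennreal ((2 ^ k) powr p) * ennreal (C1 * (4 * N / 4 ^ k) powr p)" by (intro mult_left_mono) auto
      also have "\<dots> = ennreal ((2 ^ k) powr p * (C1 * (4 * N / 4 ^ k) powr p))"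
        using C1(1) by (intro ennreal_mult[symmetric]) auto
      also have "\<dots> \<le> ennreal (C1 * (4 * N) powr p * (1 / 2) ^ k)"
      proof (rule ennreal_leI)
        \<comment> \<open>The weight \<open>2 ^ k\<close> against the decay \<open>4 ^ -k\<close>
          leaves \<open>(1 / 2) ^ k\<close>, and its \<open>p\<close>-th power is at most
          \<open>(1 / 2) ^ k\<close> because \<open>p > 1\<close>.\<close>
        have "(2 ^ k) powr p * (C1 * (4 * N / 4 ^ k) powr p) = C1 * ((4 * N) * (1 / 2) ^ k) powr p"
        proof -
          have "(2 ^ k) * (4 * N / 4 ^ k) = (4 * N) * (1 / 2) ^ k"
            using power_mult_distrib[of "2::real" 2 k] by (simp add: field_simps)
          then have "(2 ^ k) powr p * (4 * N / 4 ^ k) powr p = ((4 * N) * (1 / 2) ^ k) powr p"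
            using N by (subst powr_mult[symmetric]) auto
          then show ?thesis by (simp only: mult.left_commute)
        qed
        also have "\<dots> = C1 * (4 * N) powr p * ((1 / 2) ^ k) powr p"
          using N by (subst powr_mult) auto
        also have "\<dots> \<le> C1 * (4 * N) powr p * ((1 / 2) ^ k) powr 1"
          using p1 C1(1) by (intro mult_left_mono powr_mono') (auto simp: power_le_one)
        also have "\<dots> = C1 * (4 * N) powr p * (1 / 2) ^ k" by simp
        finally show "(2 ^ k) powr p * (C1 * (4 * N / 4 ^ k) powr p) \<le> C1 * (4 * N) powr p * (1 / 2) ^ k" .
      qed
      finally show "ennreal ((2 ^ k) powr p) * (\<integral>\<^sup>+x. epow (F k x) p \<partial>M)
        \<le> ennreal (C1 * (4 * N) powr p * (1 / 2) ^ k)" .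
    qed auto
    also have "(\<Sum>k. ennreal (C1 * (4 * N) powr p * (1 / 2) ^ k)) = ennreal (C1 * (4 * N) powr p * 2)"
    proof (rule suminf_ennreal_eq)
      show "(\<lambda>k. C1 * (4 * N) powr p * (1 / 2) ^ k) sums (C1 * (4 * N) powr p * 2)"
        using sums_mult[OF geometric_sums[of "1/2::real"], of "C1 * (4 * N) powr p"] by simp
    qed (use C1 in auto)
    also have "ennreal (2 powr p) * ennreal (C1 * (4 * N) powr p * 2) = ennreal (C * N powr p)"
      using N C1(1) by (subst ennreal_mult[symmetric]) (auto simp: C_def powr_mult mult_ac)
    finally show ?thesis using haj by (intro bexI[of _ h]) auto
  qed
  moreover have "0 < C" using C1 by (simp add: C_def)
  ultimately show ?thesis by blast
qed

text \<open>Stated for every \<open>N\<close> above the norm, since the infimum that defines the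
  norm need not be attained.\<close>

lemma H1_norm_less_imp_hajlasz:
  assumes p: "q < p"
  shows "\<exists>C>0. \<forall>f N. H1_norm M D (ereal p) f < ennreal N \<longrightarrow>
    (\<exists>h\<in>borel_measurable M. hajlasz M f h \<and>
      (\<integral>\<^sup>+x. epow (ennreal \<bar>f x\<bar> + h x) p \<partial>M) \<le> ennreal (C * N powr p))"
proof -
  obtain C where C: "0 < C" "\<And>u f N n0. H1_approx M D p u f \<Longrightarrow> 0 < N \<Longrightarrow> H1_lipnorm M D p (u n0) \<le> ennreal N \<Longrightarrow>
    (\<forall>m\<ge>n0. \<forall>n\<ge>n0. H1_lipnorm M D p (\<lambda>x. u m x - u n x) \<le> ennreal N) \<Longrightarrow>
    (\<exists>h\<in>borel_measurable M. hajlasz M f h \<and>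
      (\<integral>\<^sup>+x. epow (ennreal \<bar>f x\<bar> + h x) p \<partial>M) \<le> ennreal (C * N powr p))"
    using H1_approx_imp_hajlasz[OF p] by blast
  have "\<exists>h\<in>borel_measurable M. hajlasz M f h \<and>
      (\<integral>\<^sup>+x. epow (ennreal \<bar>f x\<bar> + h x) p \<partial>M) \<le> ennreal (C * N powr p)"
    if less: "H1_norm M D (ereal p) f < ennreal N" for f N
  proof -
    have N: "0 < N" using less by (cases "0 < N") (auto simp: ennreal_neg)
    from less obtain u c where u: "H1_approx M D p u f" "(\<lambda>n. H1_lipnorm M D p (u n)) \<longlonglongrightarrow> c" "c < ennreal N"
      by (auto simp: H1_norm_def Inf_less_iff)
    obtain n1 where n1: "\<And>n. n \<ge> n1 \<Longrightarrow> H1_lipnorm M D p (u n) < ennreal N"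
      using order_tendstoD(2)[OF u(2,3)] unfolding eventually_sequentially by blast
    obtain n2 where n2: "\<forall>m\<ge>n2. \<forall>n\<ge>n2. H1_lipnorm M D p (\<lambda>x. u m x - u n x) < ennreal N"
      using u(1) N unfolding H1_approx_def by blast
    show ?thesis
      by (rule C(2)[OF u(1) N, of "max n1 n2"]) (use n1 n2 in \<open>auto intro: less_imp_le\<close>)
  qed
  then show ?thesis using C(1) by blast
qed

text \<open>Membership supplies an approximating sequence but no limit for its norms, so the bound
  is taken from one late member of the sequence and only finiteness is claimed.\<close>

lemma H1_imp_hajlasz:
  assumes p: "q < p" and f: "H1 M D (ereal p) f"
  shows "\<exists>h\<in>borel_measurable M. hajlasz M f h \<and> (\<integral>\<^sup>+x. epow (ennreal \<bar>f x\<bar> + h x) p \<partial>M) < top"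
proof -
  obtain C where C: "0 < C" "\<And>u f N n0. H1_approx M D p u f \<Longrightarrow> 0 < N \<Longrightarrow> H1_lipnorm M D p (u n0) \<le> ennreal N \<Longrightarrow>
    (\<forall>m\<ge>n0. \<forall>n\<ge>n0. H1_lipnorm M D p (\<lambda>x. u m x - u n x) \<le> ennreal N) \<Longrightarrow>
    (\<exists>h\<in>borel_measurable M. hajlasz M f h \<and>
      (\<integral>\<^sup>+x. epow (ennreal \<bar>f x\<bar> + h x) p \<partial>M) \<le> ennreal (C * N powr p))"
    using H1_approx_imp_hajlasz[OF p] by blast
  obtain u where u: "H1_approx M D p u f" using f unfolding H1_def by auto
  obtain n0 where n0: "\<forall>m\<ge>n0. \<forall>n\<ge>n0. H1_lipnorm M D p (\<lambda>x. u m x - u n x) < ennreal 1"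
    using u unfolding H1_approx_def by (meson zero_less_one)
  have "H1_lipnorm M D p (u n0) < top" using u unfolding H1_approx_def by auto
  then obtain a where a: "H1_lipnorm M D p (u n0) = ennreal a" "0 \<le> a"
    by (cases "H1_lipnorm M D p (u n0)") auto
  define N where "N = a + 1"
  have "\<exists>h\<in>borel_measurable M. hajlasz M f h \<and>
      (\<integral>\<^sup>+x. epow (ennreal \<bar>f x\<bar> + h x) p \<partial>M) \<le> ennreal (C * N powr p)"
  proof (rule C(2)[OF u])
    show "0 < N" using a by (simp add: N_def)
    show "H1_lipnorm M D p (u n0) \<le> ennreal N" unfolding a N_def by (intro ennreal_leI) simp
    have "ennreal 1 \<le> ennreal N" using a by (intro ennreal_leI) (simp add: N_def)
    then show "\<forall>m\<ge>n0. \<forall>n\<ge>n0. H1_lipnorm M D p (\<lambda>x. u m x - u n x) \<le> ennreal N"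
      using n0 by (meson less_imp_le order_trans)
  qed
  then show ?thesis using ennreal_less_top le_less_trans by blast
qed

text \<open>The norm controls only the essential supremum of \<open>norm (D u)\<close>, not the
  Lipschitz constant of \<open>u\<close>. A constant bound passes through the maximal function
  unchanged, so \<open>haj_grad u\<close> is at most \<open>Chaj * N\<close> everywhere.\<close>

lemma H1_norm_infinity_less_imp_hajlasz:
  assumes less: "H1_norm M D \<infinity> f < ennreal N"
  shows "hajlasz M f (\<lambda>_. ennreal (Chaj * N))" "AE x in M. ennreal \<bar>f x\<bar> \<le> ennreal N"
proof -
  have N: "0 < N" using less by (cases "0 < N") (auto simp: ennreal_neg)
  from less obtain u L B where u: "L-lipschitz_on UNIV u" "AE x in M. f x = u x"
    "Linf_norm M u + Linf_norm M (\<lambda>x. norm (D u x)) < ennreal N"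
    by (auto simp: H1_norm_def Inf_less_iff)
  have loc: "loc_lipschitz u" by (rule lipschitz_loc_lipschitz[OF u(1)])
  have "Linf_norm M u \<le> ennreal N" "Linf_norm M (\<lambda>x. norm (D u x)) \<le> ennreal N"
    using order_trans[OF add_increasing2[OF zero_le order_refl] less_imp_le[OF u(3)]]
      order_trans[OF add_increasing[OF zero_le order_refl] less_imp_le[OF u(3)]] by auto
  note Linf = this
  have "AE x in M. ennreal \<bar>u x\<bar> \<le> Linf_norm M u" unfolding Linf_norm_def by (rule esssup_AE)
  with u(2) show "AE x in M. ennreal \<bar>f x\<bar> \<le> ennreal N"
    by eventually_elim (use Linf(1) in auto)
  have "AE x in M. ennreal \<bar>norm (D u x)\<bar> \<le> Linf_norm M (\<lambda>x. norm (D u x))"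
    unfolding Linf_norm_def by (rule esssup_AE)
  then have DN: "AE x in M. epow (ennreal (norm (D u x))) q \<le> epow (ennreal N) q"
    by eventually_elim (use Linf(2) q1 in \<open>auto intro!: epow_mono\<close>)
  have "haj_grad u x \<le> ennreal (Chaj * N)" for x
  proof -
    have "epow (maxf M (\<lambda>y. epow (ennreal (norm (D u y))) q) x) (1 / q) \<le> epow (epow (ennreal N) q) (1 / q)"
      using q1 by (intro epow_mono maxf_le_const_AE DN) auto
    also have "\<dots> = ennreal N" using q1 by (simp add: epow_epow)
    finally show ?thesis using N Chaj_pos by (simp add: haj_grad_def ennreal_mult mult_left_mono)
  qed
  then have "ennreal \<bar>u x - u y\<bar> \<le> ennreal (dist x y) * (ennreal (Chaj * N) + ennreal (Chaj * N))" for x y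
    using haj_grad_pointwise[OF loc, of x y] by (meson add_mono mult_left_mono order_trans zero_le)
  then have "hajlasz M u (\<lambda>_. ennreal (Chaj * N))"
    unfolding hajlasz_def by (intro bexI[of _ "{}"]) auto
  then show "hajlasz M f (\<lambda>_. ennreal (Chaj * N))"
    by (rule hajlasz_mono_AE) (use u(2) in auto)
qed

end

section \<open>Discretisation of the interpolation norm\<close>

lemma dyad_floor:
  assumes "0 < t"
  shows "dyad \<lfloor>log 2 t\<rfloor> \<le> t" "t < dyad (\<lfloor>log 2 t\<rfloor> + 1)"
proof -
  have "dyad \<lfloor>log 2 t\<rfloor> \<le> 2 powr log 2 t" by (intro powr_mono) auto
  then show "dyad \<lfloor>log 2 t\<rfloor> \<le> t" using assms by simp
  have "2 powr log 2 t < dyad (\<lfloor>log 2 t\<rfloor> + 1)" by (intro powr_less_mono) linarith+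
  then show "t < dyad (\<lfloor>log 2 t\<rfloor> + 1)" using assms by simp
qed

lemma dyad_Suc: "dyad (k + 1) = 2 * dyad k"
  by (simp add: powr_add)

lemma dyad_Suc_powr: "dyad (k + 1) powr a = 2 powr a * dyad k powr a"
  unfolding dyad_Suc by (simp add: powr_mult)

lemma ennreal_min: "ennreal (min a b) = min (ennreal a) (ennreal b)"
  by (metis ennreal_leI linear min.absorb1 min.absorb2)

lemma nn_integral_dyadic_step:
  fixes c :: "int \<Rightarrow> ennreal"
  shows "(\<integral>\<^sup>+t. \<integral>\<^sup>+k. c k * indicator {dyad k..<dyad (k + 1)} t \<partial>count_space UNIV \<partial>lborel)
    = (\<integral>\<^sup>+k. c k * ennreal (dyad k) \<partial>count_space UNIV)"
proof -
  have "(\<integral>\<^sup>+t. c k * indicator {dyad k..<dyad (k + 1)} t \<partial>lborel) = c k * ennreal (dyad k)" for k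
    by (subst nn_integral_cmult_indicator) (auto simp: powr_add)
  then show ?thesis
    by (subst nn_integral_count_space_nn_integral) auto
qed

text \<open>On \<open>{dyad k..<dyad (k + 1)}\<close> the value of \<open>\<phi>\<close> is at most
  the one at the right end, the weights are largest at the left end, and the length
  \<open>dyad k\<close> cancels \<open>1 / t\<close>. Moving the index by one costs
  \<open>2 powr a\<close>.\<close>

lemma dyadic_integral_upper:
  fixes \<phi> :: "real \<Rightarrow> ennreal"
  assumes mono: "\<And>s t. 0 < s \<Longrightarrow> s \<le> t \<Longrightarrow> \<phi> s \<le> \<phi> t" and a: "0 < a"
  shows "(\<integral>\<^sup>+t\<in>{0<..}. ennreal (t powr -a) * \<phi> t * ennreal (1 / t) \<partial>lborel)
    \<le> ennreal (2 powr a) * (\<integral>\<^sup>+k. ennreal (dyad k powr -a) * \<phi> (dyad k) \<partial>count_space UNIV)"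
proof -
  define c where "c k = ennreal (dyad k powr -a) * \<phi> (dyad (k + 1)) * ennreal (1 / dyad k)" for k
  have "(\<integral>\<^sup>+t\<in>{0<..}. ennreal (t powr -a) * \<phi> t * ennreal (1 / t) \<partial>lborel)
    \<le> (\<integral>\<^sup>+t. \<integral>\<^sup>+k. c k * indicator {dyad k..<dyad (k + 1)} t \<partial>count_space UNIV \<partial>lborel)"
  proof (rule nn_integral_mono)
    fix t :: real
    show "ennreal (t powr -a) * \<phi> t * ennreal (1 / t) * indicator {0<..} t
      \<le> (\<integral>\<^sup>+k. c k * indicator {dyad k..<dyad (k + 1)} t \<partial>count_space UNIV)"
    proof (cases "0 < t")
      case True
      define k where "k = \<lfloor>log 2 t\<rfloor>"
      have k: "dyad k \<le> t" "t < dyad (k + 1)" using dyad_floor[OF True] by (auto simp: k_def)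
      have "ennreal (t powr -a) * \<phi> t * ennreal (1 / t) \<le> c k"
        unfolding c_def
      proof (intro mult_mono ennreal_leI)
        show "t powr -a \<le> dyad k powr -a" using k a by (intro powr_mono2') auto
        show "\<phi> t \<le> \<phi> (dyad (k + 1))" using k True by (intro mono) auto
        show "1 / t \<le> 1 / dyad k" using k by (intro divide_left_mono) (auto simp: True)
      qed auto
      also have "c k = c k * indicator {dyad k..<dyad (k + 1)} t" using k by simp
      also have "\<dots> \<le> (\<integral>\<^sup>+k. c k * indicator {dyad k..<dyad (k + 1)} t \<partial>count_space UNIV)"
        by (rule int_sum_ge)
      finally show ?thesis using True by simp
    qed simp
  qed
  also have "\<dots> = (\<integral>\<^sup>+k. c k * ennreal (dyad k) \<partial>count_space UNIV)" by (rule nn_integral_dyadic_step)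
  also have "\<dots> = (\<integral>\<^sup>+k. ennreal (2 powr a) * (ennreal (dyad (k + 1) powr -a) * \<phi> (dyad (k + 1))) \<partial>count_space UNIV)"
  proof (rule nn_integral_cong)
    fix k :: int
    have "ennreal (1 / dyad k) * ennreal (dyad k) = 1" by (simp add: ennreal_mult[symmetric])
    then have "c k * ennreal (dyad k) = ennreal (dyad k powr -a) * \<phi> (dyad (k + 1))"
      by (simp add: c_def mult.assoc)
    also have "ennreal (dyad k powr -a) = ennreal (2 powr a) * ennreal (dyad (k + 1) powr -a)"
      unfolding dyad_Suc_powr by (simp add: ennreal_mult[symmetric] powr_minus field_simps)
    finally show "c k * ennreal (dyad k)
      = ennreal (2 powr a) * (ennreal (dyad (k + 1) powr -a) * \<phi> (dyad (k + 1)))" by (simp add: mult.assoc)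
  qed
  also have "\<dots> = ennreal (2 powr a) * (\<integral>\<^sup>+k. ennreal (dyad (k + 1) powr -a) * \<phi> (dyad (k + 1)) \<partial>count_space UNIV)"
    by (intro nn_integral_cmult) auto
  also have "(\<integral>\<^sup>+k. ennreal (dyad (k + 1) powr -a) * \<phi> (dyad (k + 1)) \<partial>count_space UNIV)
    = (\<integral>\<^sup>+k. ennreal (dyad k powr -a) * \<phi> (dyad k) \<partial>count_space UNIV)"
    by (rule int_sum_shift[of "\<lambda>k. ennreal (dyad k powr -a) * \<phi> (dyad k)" 1])
  finally show ?thesis .
qed

text \<open>The same intervals with the two ends exchanged; the additional factor 2 is the loss in
  \<open>1 / t\<close>.\<close>

lemma dyadic_integral_lower:
  fixes \<phi> :: "real \<Rightarrow> ennreal"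
  assumes mono: "\<And>s t. 0 < s \<Longrightarrow> s \<le> t \<Longrightarrow> \<phi> s \<le> \<phi> t" and a: "0 < a"
  shows "(\<integral>\<^sup>+k. ennreal (dyad k powr -a) * \<phi> (dyad k) \<partial>count_space UNIV)
    \<le> ennreal (2 powr (a + 1)) * (\<integral>\<^sup>+t\<in>{0<..}. ennreal (t powr -a) * \<phi> t * ennreal (1 / t) \<partial>lborel)"
    (is "_ \<le> _ * ?J")
proof -
  define c where "c k = ennreal (dyad (k + 1) powr -a) * \<phi> (dyad k) * ennreal (1 / dyad (k + 1))" for k
  have "(\<integral>\<^sup>+k. ennreal (dyad k powr -a) * \<phi> (dyad k) \<partial>count_space UNIV)
    = (\<integral>\<^sup>+k. ennreal (2 powr (a + 1)) * (c k * ennreal (dyad k)) \<partial>count_space UNIV)"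
  proof (rule nn_integral_cong)
    fix k :: int
    have "2 powr (a + 1) * (dyad (k + 1) powr -a * (1 / dyad (k + 1) * dyad k)) = dyad k powr -a"
      unfolding dyad_Suc_powr unfolding dyad_Suc by (simp add: powr_add powr_minus field_simps)
    moreover have "ennreal (x * (y * (z * w))) = ennreal x * (ennreal y * (ennreal z * ennreal w))"
      if "0 \<le> x" "0 \<le> y" "0 \<le> z" "0 \<le> w" for x y z w using that by (simp add: ennreal_mult)
    from this[of "2 powr (a + 1)" "dyad (k + 1) powr -a" "1 / dyad (k + 1)" "dyad k"]
    have "ennreal (2 powr (a + 1) * (dyad (k + 1) powr -a * (1 / dyad (k + 1) * dyad k)))
      = ennreal (2 powr (a + 1)) * (ennreal (dyad (k + 1) powr -a) * (ennreal (1 / dyad (k + 1)) * ennreal (dyad k)))"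
      by (simp only: powr_ge_zero zero_le_divide_1_iff)
    ultimately have "ennreal (dyad k powr -a)
      = ennreal (2 powr (a + 1)) * (ennreal (dyad (k + 1) powr -a) * (ennreal (1 / dyad (k + 1)) * ennreal (dyad k)))"
      by simp
    then show "ennreal (dyad k powr -a) * \<phi> (dyad k) = ennreal (2 powr (a + 1)) * (c k * ennreal (dyad k))"
      by (simp only: c_def mult_ac)
  qed
  also have "\<dots> = ennreal (2 powr (a + 1)) * (\<integral>\<^sup>+k. c k * ennreal (dyad k) \<partial>count_space UNIV)"
    by (intro nn_integral_cmult) auto
  also have "(\<integral>\<^sup>+k. c k * ennreal (dyad k) \<partial>count_space UNIV)
    = (\<integral>\<^sup>+t. \<integral>\<^sup>+k. c k * indicator {dyad k..<dyad (k + 1)} t \<partial>count_space UNIV \<partial>lborel)"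
    by (rule nn_integral_dyadic_step[symmetric])
  also have "\<dots> \<le> ?J"
  proof (rule nn_integral_mono)
    fix t :: real
    show "(\<integral>\<^sup>+k. c k * indicator {dyad k..<dyad (k + 1)} t \<partial>count_space UNIV)
      \<le> ennreal (t powr -a) * \<phi> t * ennreal (1 / t) * indicator {0<..} t"
    proof (cases "0 < t")
      case True
      define k where "k = \<lfloor>log 2 t\<rfloor>"
      have k: "dyad k \<le> t" "t < dyad (k + 1)" using dyad_floor[OF True] by (auto simp: k_def)
      have uniq: "j = k" if "dyad j \<le> t" "t < dyad (j + 1)" for j
      proof -
        have "dyad j < dyad (k + 1)" "dyad k < dyad (j + 1)" using k that by linarith+
        then show ?thesis by simp
      qed
      have "(\<integral>\<^sup>+k. c k * indicator {dyad k..<dyad (k + 1)} t \<partial>count_space UNIV)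
        = (\<Sum>j\<in>{k}. c j * indicator {dyad j..<dyad (j + 1)} t)"
        by (rule nn_integral_count_space') (use uniq in \<open>auto simp: indicator_def\<close>)
      also have "\<dots> = c k" using k by simp
      also have "c k \<le> ennreal (t powr -a) * \<phi> t * ennreal (1 / t)"
        unfolding c_def
      proof (intro mult_mono ennreal_leI)
        show "dyad (k + 1) powr -a \<le> t powr -a" using k a True by (intro powr_mono2') auto
        show "\<phi> (dyad k) \<le> \<phi> t" using k by (intro mono) auto
        show "1 / dyad (k + 1) \<le> 1 / t" using k True by (intro divide_left_mono) auto
      qed auto
      finally show ?thesis using True by simp
    next
      case False
      have "indicator {dyad k..<dyad (k + 1)} t = (0::ennreal)" for k
      proof -
        have "0 < dyad k" by simp
        with False have "\<not> dyad k \<le> t" by linarith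
        then show ?thesis by simp
      qed
      then show ?thesis by simp
    qed
  qed
  finally show ?thesis by (simp add: mult_left_mono)
qed

text \<open>Dividing by \<open>c\<close> reduces the sum to \<open>dyadic_sum_min\<close> at
  \<open>a / c\<close> with exponents \<open>(1 - \<theta>) * p\<close> and \<open>p\<close>. It is
  the discrete interpolation norm of an element whose K-functional is
  \<open>min a (t * c)\<close>.\<close>

lemma dyadic_sum_min_interp:
  assumes \<theta>: "0 < \<theta>" "\<theta> < 1" and p: "0 < p"
  shows "\<exists>C>0. \<forall>a\<ge>0. \<forall>c\<ge>0.
    (\<integral>\<^sup>+k. ennreal (dyad k powr -(\<theta> * p)) * epow (min (ennreal a) (ennreal (dyad k * c))) p \<partial>count_space UNIV)
    \<le> ennreal (C * (a powr ((1 - \<theta>) * p) * c powr (\<theta> * p)))"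
proof (intro exI conjI allI impI)
  define P where "P = (1 - \<theta>) * p"
  define C where "C = 1 / (1 - 2 powr -P) + 1 / (1 - 2 powr (P - p) :: real)"
  have P: "0 < P" "P < p" using assms by (auto simp: P_def)
  have Pp: "P - p = - (\<theta> * p)" by (simp add: P_def algebra_simps)
  show C: "0 < C" unfolding C_def using P by (intro add_pos_pos) (auto simp: powr_less_one)
  fix a c :: real assume a: "0 \<le> a" and c: "0 \<le> c"
  show "(\<integral>\<^sup>+k. ennreal (dyad k powr -(\<theta> * p)) * epow (min (ennreal a) (ennreal (dyad k * c))) p \<partial>count_space UNIV)
    \<le> ennreal (C * (a powr ((1 - \<theta>) * p) * c powr (\<theta> * p)))"
  proof (cases "c = 0")
    case False
    with c have c0: "0 < c" by simp
    have "min (ennreal a) (ennreal (dyad k * c)) = ennreal c * min (ennreal (a / c)) (ennreal (dyad k))" for k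
    proof -
      have "min a (dyad k * c) = c * min (a / c) (dyad k)"
        using c0 by (simp add: min_mult_distrib_left mult.commute)
      then have "ennreal (min a (dyad k * c)) = ennreal c * ennreal (min (a / c) (dyad k))"
        using c0 a by (simp add: ennreal_mult)
      then show ?thesis by (simp add: ennreal_min)
    qed
    then have "(\<integral>\<^sup>+k. ennreal (dyad k powr -(\<theta> * p)) * epow (min (ennreal a) (ennreal (dyad k * c))) p \<partial>count_space UNIV)
      = (\<integral>\<^sup>+k. ennreal (c powr p) * (ennreal (dyad k powr (P - p)) * epow (min (ennreal (a / c)) (ennreal (dyad k))) p) \<partial>count_space UNIV)"
      using c0 p by (simp add: Pp epow_cmult mult.left_commute)
    also have "\<dots> = ennreal (c powr p) * (\<integral>\<^sup>+k. ennreal (dyad k powr (P - p)) * epow (min (ennreal (a / c)) (ennreal (dyad k))) p \<partial>count_space UNIV)"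
      by (intro nn_integral_cmult) auto
    also have "\<dots> \<le> ennreal (c powr p) * (ennreal C * epow (ennreal (a / c)) P)"
      unfolding C_def by (intro mult_left_mono dyadic_sum_min P) auto
    also have "\<dots> = ennreal (c powr p * (C * (a / c) powr P))"
      using C a c0 by (simp add: epow_ennreal ennreal_mult[symmetric])
    also have "c powr p * (C * (a / c) powr P) = C * (a powr P * c powr (p - P))"
      using a c0 by (simp add: powr_divide powr_diff)
    also have "p - P = \<theta> * p" using Pp by simp
    finally show ?thesis by (simp add: P_def)
  qed (use p in simp)
qed

lemma dyad_unbounded:
  assumes "0 < s"
  shows "\<exists>j\<ge>j0. Y \<le> dyad j powr s"
proof -
  define j where "j = max j0 \<lceil>log 2 (max 1 Y) / s\<rceil>"
  have "log 2 (max 1 Y) / s \<le> real_of_int j" unfolding j_def by linarith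
  then have "log 2 (max 1 Y) \<le> real_of_int j * s" using assms by (simp add: divide_le_eq)
  then have "max 1 Y \<le> 2 powr (real_of_int j * s)" by (simp add: log_le_iff)
  then show ?thesis by (intro exI[of _ j]) (auto simp: j_def powr_powr)
qed

text \<open>The level that balances the two terms of the \<open>K\<close>-functional is the one after which
  \<open>t * c j\<close> takes over from \<open>a j\<close> as the larger one.\<close>
lemma balance_dyadic:
  fixes a c :: "int \<Rightarrow> real"
  assumes a: "\<And>j. 0 \<le> a j" "\<And>j. a j \<le> Ca * dyad j powr -s1" "0 < s1"
    and c: "\<And>j. 0 \<le> c j" "\<And>j. c j \<le> Cc * dyad j powr s2" "0 < s2"
    and t: "0 < t" and p: "0 < p"
    and k: "\<And>j. \<kappa> \<le> ennreal (a j + t * c j)"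
  shows "epow \<kappa> p \<le> ennreal (2 powr p) *
    (\<integral>\<^sup>+j. epow (min (ennreal (a j)) (ennreal (t * c (j + 1)))) p \<partial>count_space UNIV)"
proof -
  \<comment> \<open>Either a crossover index exists, or one of the two terms dominates along one end
    of the integers. In the latter cases the decay assumptions force \<open>\<kappa>\<close> to
    vanish.\<close>
  consider j where "t * c j < a j" "a (j + 1) \<le> t * c (j + 1)"
    | j0 where "\<And>j. j \<ge> j0 \<Longrightarrow> t * c j < a j" | "\<And>j. a j \<le> t * c j"
  proof (cases "\<exists>j. t * c j < a j \<and> a (j + 1) \<le> t * c (j + 1)")
    case False
    show ?thesis
    proof (cases "\<exists>j0. t * c j0 < a j0")
      case True
      then obtain j0 where j0: "t * c j0 < a j0" by blast
      have "t * c j < a j" if "j \<ge> j0" for j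
        using that
      proof (induction j rule: int_ge_induct)
        case (step i)
        then show ?case using False by (meson not_le)
      qed (rule j0)
      then show ?thesis by (rule that(2))
    next
      case False
      then show ?thesis by (intro that(3)) (meson not_le)
    qed
  qed (use that(1) in blast)
  then show ?thesis
  proof cases
    case (1 j)
    \<comment> \<open>Level \<open>j\<close> costs at most \<open>2 * a j\<close>, level
      \<open>j + 1\<close> at most \<open>2 * t * c (j + 1)\<close>; the cheaper one is
      used.\<close>
    have "\<kappa> \<le> ennreal (2 * min (a j) (t * c (j + 1)))"
    proof (cases "a j \<le> t * c (j + 1)")
      case True
      have "\<kappa> \<le> ennreal (a j + t * c j)" by (rule k)
      also have "\<dots> \<le> ennreal (2 * a j)" using 1 by (intro ennreal_leI) simp
      finally show ?thesis using True by (simp add: min_def)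
    next
      case False
      have "\<kappa> \<le> ennreal (a (j + 1) + t * c (j + 1))" by (rule k)
      also have "\<dots> \<le> ennreal (2 * (t * c (j + 1)))" using 1 by (intro ennreal_leI) simp
      finally show ?thesis using False by (simp add: min_def)
    qed
    also have "ennreal (2 * min (a j) (t * c (j + 1))) = ennreal 2 * min (ennreal (a j)) (ennreal (t * c (j + 1)))"
      unfolding ennreal_min[symmetric] using a(1)[of j] t c(1)[of "j + 1"] by (intro ennreal_mult) auto
    finally have "epow \<kappa> p \<le> epow (ennreal 2 * min (ennreal (a j)) (ennreal (t * c (j + 1)))) p"
      using p by (intro epow_mono) auto
    also have "\<dots> = ennreal (2 powr p) * epow (min (ennreal (a j)) (ennreal (t * c (j + 1)))) p"
      using p by (simp add: epow_cmult del: ennreal_numeral)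
    also have "\<dots> \<le> ennreal (2 powr p) *
      (\<integral>\<^sup>+j. epow (min (ennreal (a j)) (ennreal (t * c (j + 1)))) p \<partial>count_space UNIV)"
      by (intro mult_left_mono int_sum_ge) auto
    finally show ?thesis .
  next
    case (2 j0)
    have "\<kappa> \<le> 0 + ennreal e" if e: "0 < e" for e
    proof -
      obtain j where j: "j \<ge> j0" "2 * \<bar>Ca\<bar> / e \<le> dyad j powr s1" using dyad_unbounded[OF a(3)] by blast
      have "\<kappa> \<le> ennreal (a j + t * c j)" by (rule k)
      also have "\<dots> \<le> ennreal e"
      proof (rule ennreal_leI)
        have "2 * a j \<le> 2 * (\<bar>Ca\<bar> * dyad j powr -s1)"
          using a(2)[of j] mult_right_mono[OF abs_ge_self powr_ge_zero, of Ca "dyad j" "-s1"] by linarith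
        also have "\<dots> \<le> e" using j(2) e by (simp add: powr_minus field_simps)
        finally show "a j + t * c j \<le> e" using 2[OF j(1)] by linarith
      qed
      finally show ?thesis by simp
    qed
    note small = this
    have "\<kappa> \<le> 0" by (rule ennreal_le_epsilon) (rule small)
    then show ?thesis by simp
  next
    case 3
    have "\<kappa> \<le> 0 + ennreal e" if e: "0 < e" for e
    proof -
      obtain j where j: "2 * t * \<bar>Cc\<bar> / e \<le> dyad j powr s2" using dyad_unbounded[OF c(3)] by blast
      have "\<kappa> \<le> ennreal (a (-j) + t * c (-j))" by (rule k)
      also have "\<dots> \<le> ennreal e"
      proof (rule ennreal_leI)
        have "c (-j) \<le> \<bar>Cc\<bar> * dyad (-j) powr s2"
          using c(2)[of "-j"] mult_right_mono[OF abs_ge_self powr_ge_zero, of Cc "dyad (-j)" s2] by linarith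
        then have "2 * t * c (-j) \<le> 2 * t * (\<bar>Cc\<bar> * dyad (-j) powr s2)" using t by (intro mult_left_mono) auto
        also have "dyad (-j) powr s2 = 1 / dyad j powr s2"
          unfolding powr_powr by (simp add: powr_minus_divide)
        also have "2 * t * (\<bar>Cc\<bar> * (1 / dyad j powr s2)) = 2 * t * \<bar>Cc\<bar> / dyad j powr s2" by simp
        also have "\<dots> \<le> e" using j e by (simp add: field_simps)
        finally show "a (-j) + t * c (-j) \<le> e" using 3[of "-j"] by linarith
      qed
      finally show ?thesis by simp
    qed
    note small = this
    have "\<kappa> \<le> 0" by (rule ennreal_le_epsilon) (rule small)
    then show ?thesis by simp
  qed
qed

lemma Kfun_mono: "0 \<le> s \<Longrightarrow> s \<le> t \<Longrightarrow> Kfun M A0 N0 A1 N1 f s \<le> Kfun M A0 N0 A1 N1 f t"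
  unfolding Kfun_def
  by (rule Inf_mono) (fastforce intro!: add_mono mult_right_mono ennreal_leI)

lemma interp_norm_eq:
  assumes "0 < p"
  shows "interp_norm M A0 N0 A1 N1 \<theta> p f = epow (\<integral>\<^sup>+t\<in>{0<..}.
    ennreal (t powr -(\<theta> * p)) * epow (Kfun M A0 N0 A1 N1 f t) p * ennreal (1 / t) \<partial>lborel) (1 / p)"
proof -
  have "epow (ennreal (t powr -\<theta>) * Kfun M A0 N0 A1 N1 f t) p
    = ennreal (t powr -(\<theta> * p)) * epow (Kfun M A0 N0 A1 N1 f t) p" for t
    using assms by (simp add: epow_cmult powr_powr)
  then show ?thesis unfolding interp_norm_def by simp
qed

text \<open>The \<open>p\<close>-th power of the interpolation norm, discretised at
  \<open>t = dyad k\<close>; the root is postponed so that Tonelli can be used.\<close>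

definition K_sum :: "real \<Rightarrow> real \<Rightarrow> (real \<Rightarrow> ennreal) \<Rightarrow> ennreal" where
  "K_sum \<theta> p \<kappa> = (\<integral>\<^sup>+k. ennreal (dyad k powr -(\<theta> * p)) * epow (\<kappa> (dyad k)) p \<partial>count_space UNIV)"

lemma interp_norm_dyadic:
  assumes "0 < p" "0 < \<theta>"
  shows "interp_norm M A0 N0 A1 N1 \<theta> p f
      \<le> ennreal (2 powr \<theta>) * epow (K_sum \<theta> p (Kfun M A0 N0 A1 N1 f)) (1 / p)"
    and "K_sum \<theta> p (Kfun M A0 N0 A1 N1 f)
      \<le> ennreal (2 powr (\<theta> * p + 1)) * epow (interp_norm M A0 N0 A1 N1 \<theta> p f) p"
proof -
  have mono: "epow (Kfun M A0 N0 A1 N1 f s) p \<le> epow (Kfun M A0 N0 A1 N1 f t) p" if "0 < s" "s \<le> t" for s t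
    using that assms by (intro epow_mono Kfun_mono) auto
  have "interp_norm M A0 N0 A1 N1 \<theta> p f
    \<le> epow (ennreal (2 powr (\<theta> * p)) * K_sum \<theta> p (Kfun M A0 N0 A1 N1 f)) (1 / p)"
    unfolding interp_norm_eq[OF assms(1)] K_sum_def using assms
    by (intro epow_mono dyadic_integral_upper mono) auto
  also have "\<dots> = ennreal (2 powr \<theta>) * epow (K_sum \<theta> p (Kfun M A0 N0 A1 N1 f)) (1 / p)"
    using assms by (simp add: epow_mult epow_ennreal powr_powr)
  finally show "interp_norm M A0 N0 A1 N1 \<theta> p f
      \<le> ennreal (2 powr \<theta>) * epow (K_sum \<theta> p (Kfun M A0 N0 A1 N1 f)) (1 / p)" .
  have "K_sum \<theta> p (Kfun M A0 N0 A1 N1 f) \<le> ennreal (2 powr (\<theta> * p + 1)) *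
    (\<integral>\<^sup>+t\<in>{0<..}. ennreal (t powr -(\<theta> * p)) * epow (Kfun M A0 N0 A1 N1 f t) p * ennreal (1 / t) \<partial>lborel)"
    unfolding K_sum_def using assms by (intro dyadic_integral_lower mono) auto
  also have "(\<integral>\<^sup>+t\<in>{0<..}. ennreal (t powr -(\<theta> * p)) * epow (Kfun M A0 N0 A1 N1 f t) p * ennreal (1 / t) \<partial>lborel)
    = epow (interp_norm M A0 N0 A1 N1 \<theta> p f) p"
    using assms by (simp add: interp_norm_eq epow_epow)
  finally show "K_sum \<theta> p (Kfun M A0 N0 A1 N1 f)
      \<le> ennreal (2 powr (\<theta> * p + 1)) * epow (interp_norm M A0 N0 A1 N1 \<theta> p f) p" .
qed

text \<open>For each \<open>t\<close> the optimal level is unknown, so the bound for it is replaced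
  by the sum over all levels. Then the sums over \<open>t\<close> and over levels are exchanged, and
  the sum over \<open>t\<close> is evaluated by \<open>dyadic_sum_min_interp\<close>. The growth
  bounds on \<open>a\<close> and \<open>c\<close> only serve \<open>balance_dyadic\<close> and leave
  no trace in \<open>C\<close>.\<close>

lemma K_sum_le_balanced:
  assumes \<theta>: "0 < \<theta>" "\<theta> < 1" and p: "0 < p"
  shows "\<exists>C>0. \<forall>\<kappa> a c Ca Cc s1 s2. (\<forall>j. 0 \<le> a j \<and> a j \<le> Ca * dyad j powr -s1) \<longrightarrow> 0 < s1 \<longrightarrow>
    (\<forall>j. 0 \<le> c j \<and> c j \<le> Cc * dyad j powr s2) \<longrightarrow> 0 < s2 \<longrightarrow>
    (\<forall>t>0. \<forall>j. \<kappa> t \<le> ennreal (a j + t * c j)) \<longrightarrow>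
    K_sum \<theta> p \<kappa> \<le> ennreal C *
      (\<integral>\<^sup>+j. ennreal (a j powr ((1 - \<theta>) * p) * c (j + 1) powr (\<theta> * p)) \<partial>count_space UNIV)"
proof -
  obtain C where C: "0 < C" "\<And>a c. 0 \<le> a \<Longrightarrow> 0 \<le> c \<Longrightarrow>
    (\<integral>\<^sup>+k. ennreal (dyad k powr -(\<theta> * p)) * epow (min (ennreal a) (ennreal (dyad k * c))) p \<partial>count_space UNIV)
    \<le> ennreal (C * (a powr ((1 - \<theta>) * p) * c powr (\<theta> * p)))"
    using dyadic_sum_min_interp[OF \<theta> p] by blast
  have "K_sum \<theta> p \<kappa> \<le> ennreal (2 powr p * C) *
      (\<integral>\<^sup>+j. ennreal (a j powr ((1 - \<theta>) * p) * c (j + 1) powr (\<theta> * p)) \<partial>count_space UNIV)"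
    if a: "\<forall>j. 0 \<le> a j \<and> a j \<le> Ca * dyad j powr -s1" "0 < s1"
      and c: "\<forall>j. 0 \<le> c j \<and> c j \<le> Cc * dyad j powr s2" "0 < s2"
      and \<kappa>: "\<forall>t>0. \<forall>j. \<kappa> t \<le> ennreal (a j + t * c j)" for \<kappa> a c Ca Cc s1 s2
  proof -
    have "K_sum \<theta> p \<kappa> \<le> (\<integral>\<^sup>+k. ennreal (dyad k powr -(\<theta> * p)) * (ennreal (2 powr p) *
      (\<integral>\<^sup>+j. epow (min (ennreal (a j)) (ennreal (dyad k * c (j + 1)))) p \<partial>count_space UNIV)) \<partial>count_space UNIV)"
      unfolding K_sum_def using a c \<kappa> p
      by (intro nn_integral_mono mult_left_mono balance_dyadic[where Ca=Ca and Cc=Cc and ?s1.0=s1 and ?s2.0=s2]) auto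
    also have "\<dots> = (\<integral>\<^sup>+k. \<integral>\<^sup>+j. ennreal (2 powr p) * (ennreal (dyad k powr -(\<theta> * p)) *
      epow (min (ennreal (a j)) (ennreal (dyad k * c (j + 1)))) p) \<partial>count_space UNIV \<partial>count_space UNIV)"
      by (intro nn_integral_cong) (simp add: nn_integral_cmult[symmetric] mult_ac)
    also have "\<dots> = (\<integral>\<^sup>+j. \<integral>\<^sup>+k. ennreal (2 powr p) * (ennreal (dyad k powr -(\<theta> * p)) *
      epow (min (ennreal (a j)) (ennreal (dyad k * c (j + 1)))) p) \<partial>count_space UNIV \<partial>count_space UNIV)"
      by (rule nn_integral_count_space_nn_integral) auto
    also have "\<dots> = (\<integral>\<^sup>+j. ennreal (2 powr p) * (\<integral>\<^sup>+k. ennreal (dyad k powr -(\<theta> * p)) *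
      epow (min (ennreal (a j)) (ennreal (dyad k * c (j + 1)))) p \<partial>count_space UNIV) \<partial>count_space UNIV)"
      by (intro nn_integral_cong nn_integral_cmult) auto
    also have "\<dots> \<le> (\<integral>\<^sup>+j. ennreal (2 powr p) * ennreal (C * (a j powr ((1 - \<theta>) * p) * c (j + 1) powr (\<theta> * p))) \<partial>count_space UNIV)"
      using a c by (intro nn_integral_mono mult_left_mono C(2)) auto
    also have "\<dots> = (\<integral>\<^sup>+j. ennreal (2 powr p * C) * ennreal (a j powr ((1 - \<theta>) * p) * c (j + 1) powr (\<theta> * p)) \<partial>count_space UNIV)"
      using C(1) by (intro nn_integral_cong) (simp add: ennreal_mult[symmetric] mult.assoc)
    also have "\<dots> = ennreal (2 powr p * C) *
      (\<integral>\<^sup>+j. ennreal (a j powr ((1 - \<theta>) * p) * c (j + 1) powr (\<theta> * p)) \<partial>count_space UNIV)"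
      by (intro nn_integral_cmult) auto
    finally show ?thesis .
  qed
  moreover have "0 < 2 powr p * C" using C by simp
  ultimately show ?thesis by blast
qed

section \<open>Tails and truncations of one function over all dyadic levels\<close>

lemma nn_integral_tail_le:
  assumes [measurable]: "F \<in> borel_measurable M" and p: "0 < p1" "p1 < p" and l: "0 < l"
  shows "(\<integral>\<^sup>+x. epow (F x * of_bool (ennreal l < F x)) p1 \<partial>M)
    \<le> ennreal (l powr (p1 - p)) * (\<integral>\<^sup>+x. epow (F x) p \<partial>M)"
proof -
  have "epow (y * of_bool (ennreal l < y)) p1 \<le> ennreal (l powr (p1 - p)) * epow y p" for y
  proof (cases y)
    case (real r)
    show ?thesis
    proof (cases "l < r")
      case True
      have "r powr p1 = r powr (p1 - p) * r powr p" using True l by (simp add: powr_add[symmetric])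
      also have "\<dots> \<le> l powr (p1 - p) * r powr p"
        using True l p by (intro mult_right_mono powr_mono2') auto
      finally have "ennreal (r powr p1) \<le> ennreal (l powr (p1 - p) * r powr p)" by (rule ennreal_leI)
      also have "\<dots> = ennreal (l powr (p1 - p)) * ennreal (r powr p)" by (intro ennreal_mult) auto
      finally show ?thesis using real True by (simp add: epow_ennreal ennreal_lessI of_bool_def)
    next
      case False
      then have "\<not> ennreal l < y" using real by (simp add: ennreal_leI not_less)
      then show ?thesis by simp
    qed
  qed (use l in \<open>simp add: ennreal_mult_top\<close>)
  then have "(\<integral>\<^sup>+x. epow (F x * of_bool (ennreal l < F x)) p1 \<partial>M)
    \<le> (\<integral>\<^sup>+x. ennreal (l powr (p1 - p)) * epow (F x) p \<partial>M)" by (intro nn_integral_mono)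
  also have "\<dots> = ennreal (l powr (p1 - p)) * (\<integral>\<^sup>+x. epow (F x) p \<partial>M)" by (intro nn_integral_cmult) measurable
  finally show ?thesis .
qed

lemma nn_integral_min_le:
  assumes [measurable]: "F \<in> borel_measurable M" and p: "0 < p" "p < p2" and l: "0 < l"
  shows "(\<integral>\<^sup>+x. epow (min (F x) (ennreal l)) p2 \<partial>M)
    \<le> ennreal (l powr (p2 - p)) * (\<integral>\<^sup>+x. epow (F x) p \<partial>M)"
proof -
  have "epow (min y (ennreal l)) p2 \<le> ennreal (l powr (p2 - p)) * epow y p" for y
  proof (cases y)
    case (real r)
    define m where "m = min r l"
    have m: "0 \<le> m" "m \<le> l" "m \<le> r" using real l by (auto simp: m_def)
    have "m powr p2 = m powr (p2 - p) * m powr p" by (simp add: powr_add[symmetric])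
    also have "\<dots> \<le> l powr (p2 - p) * r powr p" using m p by (intro mult_mono powr_mono2) auto
    finally have "ennreal (m powr p2) \<le> ennreal (l powr (p2 - p) * r powr p)" by (rule ennreal_leI)
    also have "\<dots> = ennreal (l powr (p2 - p)) * ennreal (r powr p)" by (intro ennreal_mult) auto
    finally show ?thesis using real m by (simp add: ennreal_min[symmetric] m_def[symmetric] epow_ennreal)
  qed (use l in \<open>simp add: ennreal_mult_top\<close>)
  then have "(\<integral>\<^sup>+x. epow (min (F x) (ennreal l)) p2 \<partial>M)
    \<le> (\<integral>\<^sup>+x. ennreal (l powr (p2 - p)) * epow (F x) p \<partial>M)" by (intro nn_integral_mono)
  also have "\<dots> = ennreal (l powr (p2 - p)) * (\<integral>\<^sup>+x. epow (F x) p \<partial>M)" by (intro nn_integral_cmult) measurable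
  finally show ?thesis .
qed

text \<open>After Tonelli the levels below \<open>F x\<close> contribute about
  \<open>F x powr (p - p1)\<close>, which completes \<open>F x powr p1\<close> to
  \<open>F x powr p\<close>. The single-level estimate \<open>nn_integral_tail_le\<close> gives only
  boundedness of the terms, not summability.\<close>

lemma dyadic_sum_tails:
  assumes [measurable]: "F \<in> borel_measurable M" and p: "0 < p1" "p1 < p"
  shows "(\<integral>\<^sup>+j. ennreal (dyad j powr (p - p1)) * (\<integral>\<^sup>+x. epow (F x * of_bool (ennreal (dyad j) < F x)) p1 \<partial>M)
      \<partial>count_space UNIV)
    \<le> ennreal (1 / (1 - 2 powr -(p - p1))) * (\<integral>\<^sup>+x. epow (F x) p \<partial>M)"
proof -
  have eq: "epow (y * of_bool P) p1 = epow y p1 * of_bool P" for y :: ennreal and P by simp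
  have "(\<integral>\<^sup>+j. ennreal (dyad j powr (p - p1)) * (\<integral>\<^sup>+x. epow (F x * of_bool (ennreal (dyad j) < F x)) p1 \<partial>M)
      \<partial>count_space UNIV)
    = (\<integral>\<^sup>+j. \<integral>\<^sup>+x. epow (F x) p1 * (ennreal (dyad j powr (p - p1)) * of_bool (ennreal (dyad j) < F x)) \<partial>M
      \<partial>count_space UNIV)"
  proof (rule nn_integral_cong)
    fix j :: int
    have "ennreal (dyad j powr (p - p1)) * (\<integral>\<^sup>+x. epow (F x * of_bool (ennreal (dyad j) < F x)) p1 \<partial>M)
      = (\<integral>\<^sup>+x. ennreal (dyad j powr (p - p1)) * epow (F x * of_bool (ennreal (dyad j) < F x)) p1 \<partial>M)"
      by (intro nn_integral_cmult[symmetric]) measurable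
    also have "\<dots> = (\<integral>\<^sup>+x. epow (F x) p1 * (ennreal (dyad j powr (p - p1)) * of_bool (ennreal (dyad j) < F x)) \<partial>M)"
      by (simp only: eq mult.left_commute)
    finally show "ennreal (dyad j powr (p - p1)) * (\<integral>\<^sup>+x. epow (F x * of_bool (ennreal (dyad j) < F x)) p1 \<partial>M)
      = (\<integral>\<^sup>+x. epow (F x) p1 * (ennreal (dyad j powr (p - p1)) * of_bool (ennreal (dyad j) < F x)) \<partial>M)" .
  qed
  also have "\<dots> = (\<integral>\<^sup>+x. \<integral>\<^sup>+j. epow (F x) p1 * (ennreal (dyad j powr (p - p1)) * of_bool (ennreal (dyad j) < F x))
      \<partial>count_space UNIV \<partial>M)"
    by (rule nn_integral_count_space_nn_integral[symmetric]) auto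
  also have "\<dots> \<le> (\<integral>\<^sup>+x. ennreal (1 / (1 - 2 powr -(p - p1))) * epow (F x) p \<partial>M)"
  proof (rule nn_integral_mono)
    fix x
    have "(\<integral>\<^sup>+j. epow (F x) p1 * (ennreal (dyad j powr (p - p1)) * of_bool (ennreal (dyad j) < F x)) \<partial>count_space UNIV)
      = epow (F x) p1 * (\<integral>\<^sup>+j. ennreal (dyad j powr (p - p1)) * of_bool (ennreal (dyad j) < F x) \<partial>count_space UNIV)"
      by (intro nn_integral_cmult) auto
    also have "\<dots> \<le> epow (F x) p1 * (ennreal (1 / (1 - 2 powr -(p - p1))) * epow (F x) (p - p1))"
      using p by (intro mult_left_mono dyadic_sum_below) auto
    also have "\<dots> = ennreal (1 / (1 - 2 powr -(p - p1))) * epow (F x) (p1 + (p - p1))"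
      unfolding epow_add_exp by (simp only: mult_ac)
    finally show "(\<integral>\<^sup>+j. epow (F x) p1 * (ennreal (dyad j powr (p - p1)) * of_bool (ennreal (dyad j) < F x)) \<partial>count_space UNIV)
      \<le> ennreal (1 / (1 - 2 powr -(p - p1))) * epow (F x) p" by simp
  qed
  also have "\<dots> = ennreal (1 / (1 - 2 powr -(p - p1))) * (\<integral>\<^sup>+x. epow (F x) p \<partial>M)"
    by (intro nn_integral_cmult) measurable
  finally show ?thesis .
qed

lemma dyadic_sum_mins:
  assumes [measurable]: "F \<in> borel_measurable M" and p: "0 < p" "p < p2"
  shows "(\<integral>\<^sup>+j. ennreal (dyad j powr (p - p2)) * (\<integral>\<^sup>+x. epow (min (F x) (ennreal (dyad j))) p2 \<partial>M)
      \<partial>count_space UNIV)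
    \<le> ennreal (1 / (1 - 2 powr -p) + 1 / (1 - 2 powr (p - p2))) * (\<integral>\<^sup>+x. epow (F x) p \<partial>M)"
proof -
  have "(\<integral>\<^sup>+j. ennreal (dyad j powr (p - p2)) * (\<integral>\<^sup>+x. epow (min (F x) (ennreal (dyad j))) p2 \<partial>M)
      \<partial>count_space UNIV)
    = (\<integral>\<^sup>+j. \<integral>\<^sup>+x. ennreal (dyad j powr (p - p2)) * epow (min (F x) (ennreal (dyad j))) p2 \<partial>M
      \<partial>count_space UNIV)"
    by (intro nn_integral_cong nn_integral_cmult[symmetric]) measurable
  also have "\<dots> = (\<integral>\<^sup>+x. \<integral>\<^sup>+j. ennreal (dyad j powr (p - p2)) * epow (min (F x) (ennreal (dyad j))) p2
      \<partial>count_space UNIV \<partial>M)"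
    by (rule nn_integral_count_space_nn_integral[symmetric]) auto
  also have "\<dots> \<le> (\<integral>\<^sup>+x. ennreal (1 / (1 - 2 powr -p) + 1 / (1 - 2 powr (p - p2))) * epow (F x) p \<partial>M)"
    using p by (intro nn_integral_mono dyadic_sum_min) auto
  also have "\<dots> = ennreal (1 / (1 - 2 powr -p) + 1 / (1 - 2 powr (p - p2))) * (\<integral>\<^sup>+x. epow (F x) p \<partial>M)"
    by (intro nn_integral_cmult) measurable
  finally show ?thesis .
qed

text \<open>A crude form of Young's inequality; the optimal weights are irrelevant for the later
  sums.\<close>

lemma powr_mult_powr_le_add:
  fixes x y :: real
  assumes "0 \<le> x" "0 \<le> y" "0 < \<alpha>" "0 \<le> \<beta>" "\<alpha> + \<beta> = 1"
  shows "x powr \<alpha> * y powr \<beta> \<le> x + y"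
proof -
  have "x powr \<alpha> * y powr \<beta> \<le> (max x y) powr \<alpha> * (max x y) powr \<beta>"
    using assms by (intro mult_mono powr_mono2) auto
  also have "\<dots> = (max x y) powr 1" using assms by (simp add: powr_add[symmetric])
  also have "\<dots> \<le> x + y" using assms by simp
  finally show ?thesis .
qed

context cheeger_space
begin

text \<open>The constant is that of \<open>hajlasz_imp_H1\<close> times 6: on the bad set the
  difference \<open>f - g\<close> costs \<open>2 * F\<close> and its gradient
  \<open>4 * F\<close>.\<close>

lemma truncation_H1:
  assumes [measurable]: "f \<in> borel_measurable M" "h \<in> borel_measurable M"
    and haj: "hajlasz M f h" and l: "0 < l" and p1: "0 < p1"
  defines "F \<equiv> \<lambda>x. ennreal \<bar>f x\<bar> + h x"
  assumes fin: "(\<integral>\<^sup>+x. epow (F x * of_bool (ennreal l < F x)) p1 \<partial>M) < top"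
  obtains g where "(2 * l)-lipschitz_on UNIV g" "\<And>x. \<bar>g x\<bar> \<le> l" "g \<in> borel_measurable M"
    "AE x in M. ennreal \<bar>g x\<bar> \<le> min (F x) (ennreal l)" "hajlasz M g (\<lambda>x. 2 * min (F x) (ennreal l))"
    "H1 M D (ereal p1) (\<lambda>x. f x - g x)"
    "H1_norm M D (ereal p1) (\<lambda>x. f x - g x) \<le> ennreal (12 * (1 + 2 * CD)) *
      epow (\<integral>\<^sup>+x. epow (F x * of_bool (ennreal l < F x)) p1 \<partial>M) (1 / p1)"
proof -
  obtain g where g: "(2 * l)-lipschitz_on UNIV g" "\<And>x. \<bar>g x\<bar> \<le> l"
    "AE x in M. ennreal \<bar>f x - g x\<bar> \<le> 2 * (F x * of_bool (ennreal l < F x))"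
    "AE x in M. ennreal \<bar>g x\<bar> \<le> min (F x) (ennreal l)"
    "hajlasz M (\<lambda>x. f x - g x) (\<lambda>x. 4 * (F x * of_bool (ennreal l < F x)))"
    "hajlasz M g (\<lambda>x. 2 * min (F x) (ennreal l))"
    unfolding F_def using lipschitz_truncation[OF haj l] by blast
  have [measurable]: "F \<in> borel_measurable M" unfolding F_def by measurable
  have gm [measurable]: "g \<in> borel_measurable M"
    by (rule loc_lipschitz_measurable[OF lipschitz_loc_lipschitz[OF g(1)]])
  define B where "B x = F x * of_bool (ennreal l < F x)" for x
  have [measurable]: "B \<in> borel_measurable M" unfolding B_def by measurable
  have "AE x in M. ennreal \<bar>f x - g x\<bar> + 4 * B x \<le> ennreal 6 * B x"
    using g(3)
  proof eventually_elim
    case (elim x)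
    have "ennreal \<bar>f x - g x\<bar> + 4 * B x \<le> 2 * B x + 4 * B x" using elim by (intro add_mono) (auto simp: B_def)
    also have "\<dots> = (2 + 4) * B x" by (simp only: distrib_right)
    finally show ?case by simp
  qed
  then have le: "(\<integral>\<^sup>+x. epow (ennreal \<bar>f x - g x\<bar> + 4 * B x) p1 \<partial>M) \<le> ennreal (6 powr p1) * (\<integral>\<^sup>+x. epow (B x) p1 \<partial>M)"
    using p1 by (intro nn_integral_epow_le) auto
  have fin': "(\<integral>\<^sup>+x. epow (B x) p1 \<partial>M) < top" using fin by (simp add: B_def)
  then have "ennreal (6 powr p1) * (\<integral>\<^sup>+x. epow (B x) p1 \<partial>M) < top" by (simp add: ennreal_mult_less_top)
  with le have less: "(\<integral>\<^sup>+x. epow (ennreal \<bar>f x - g x\<bar> + 4 * B x) p1 \<partial>M) < top" by order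
  have haj': "hajlasz M (\<lambda>x. f x - g x) (\<lambda>x. 4 * B x)" using g(5) by (simp add: B_def)
  have "H1 M D (ereal p1) (\<lambda>x. f x - g x)"
    by (rule hajlasz_imp_H1(1)[OF _ _ haj' p1 less]) measurable
  moreover have "H1_norm M D (ereal p1) (\<lambda>x. f x - g x) \<le> ennreal (12 * (1 + 2 * CD)) * epow (\<integral>\<^sup>+x. epow (B x) p1 \<partial>M) (1 / p1)"
  proof -
    have "H1_norm M D (ereal p1) (\<lambda>x. f x - g x)
      \<le> ennreal (2 * (1 + 2 * CD)) * epow (\<integral>\<^sup>+x. epow (ennreal \<bar>f x - g x\<bar> + 4 * B x) p1 \<partial>M) (1 / p1)"
      by (rule hajlasz_imp_H1(2)[OF _ _ haj' p1 less]) measurable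
    also have "\<dots> \<le> ennreal (2 * (1 + 2 * CD)) * epow (ennreal (6 powr p1) * (\<integral>\<^sup>+x. epow (B x) p1 \<partial>M)) (1 / p1)"
      using p1 by (intro mult_left_mono epow_mono le) auto
    also have "\<dots> = ennreal (2 * (1 + 2 * CD)) * (ennreal 6 * epow (\<integral>\<^sup>+x. epow (B x) p1 \<partial>M) (1 / p1))"
      using p1 by (subst epow_enn_cmult_inv) auto
    also have "\<dots> = ennreal (2 * (1 + 2 * CD)) * ennreal 6 * epow (\<integral>\<^sup>+x. epow (B x) p1 \<partial>M) (1 / p1)"
      by (simp only: mult.assoc)
    also have "ennreal (2 * (1 + 2 * CD)) * ennreal 6 = ennreal (12 * (1 + 2 * CD))"
      using CD_nonneg by (subst ennreal_mult[symmetric]) auto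
    finally show ?thesis .
  qed
  ultimately show thesis using that[OF g(1,2) gm g(4,6)] by (simp add: B_def)
qed

text \<open>Here the factor is 3: once the truncated \<open>F\<close> for the function, twice for
  its gradient.\<close>

lemma truncation_H1_upper:
  assumes [measurable]: "g \<in> borel_measurable M" "F \<in> borel_measurable M"
    and "AE x in M. ennreal \<bar>g x\<bar> \<le> min (F x) (ennreal l)" "hajlasz M g (\<lambda>x. 2 * min (F x) (ennreal l))"
    and p2: "0 < p2" and fin: "(\<integral>\<^sup>+x. epow (min (F x) (ennreal l)) p2 \<partial>M) < top"
  shows "H1 M D (ereal p2) g"
    "H1_norm M D (ereal p2) g \<le> ennreal (6 * (1 + 2 * CD)) *
      epow (\<integral>\<^sup>+x. epow (min (F x) (ennreal l)) p2 \<partial>M) (1 / p2)"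
proof -
  define B where "B x = min (F x) (ennreal l)" for x
  have [measurable]: "B \<in> borel_measurable M" unfolding B_def by measurable
  have "AE x in M. ennreal \<bar>g x\<bar> + 2 * B x \<le> ennreal 3 * B x"
    using assms(3)
  proof eventually_elim
    case (elim x)
    have "ennreal \<bar>g x\<bar> + 2 * B x \<le> 1 * B x + 2 * B x" using elim by (intro add_mono) (auto simp: B_def)
    also have "\<dots> = (1 + 2) * B x" by (simp only: distrib_right)
    finally show ?case by simp
  qed
  then have le: "(\<integral>\<^sup>+x. epow (ennreal \<bar>g x\<bar> + 2 * B x) p2 \<partial>M) \<le> ennreal (3 powr p2) * (\<integral>\<^sup>+x. epow (B x) p2 \<partial>M)"
    using p2 by (intro nn_integral_epow_le) auto
  have fin': "(\<integral>\<^sup>+x. epow (B x) p2 \<partial>M) < top" using fin by (simp add: B_def)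
  then have "ennreal (3 powr p2) * (\<integral>\<^sup>+x. epow (B x) p2 \<partial>M) < top" by (simp add: ennreal_mult_less_top)
  with le have less: "(\<integral>\<^sup>+x. epow (ennreal \<bar>g x\<bar> + 2 * B x) p2 \<partial>M) < top" by order
  have haj': "hajlasz M g (\<lambda>x. 2 * B x)" using assms(4) by (simp add: B_def)
  show "H1 M D (ereal p2) g"
    by (rule hajlasz_imp_H1(1)[OF _ _ haj' p2 less]) measurable
  have "H1_norm M D (ereal p2) g
    \<le> ennreal (2 * (1 + 2 * CD)) * epow (\<integral>\<^sup>+x. epow (ennreal \<bar>g x\<bar> + 2 * B x) p2 \<partial>M) (1 / p2)"
    by (rule hajlasz_imp_H1(2)[OF _ _ haj' p2 less]) measurable
  also have "\<dots> \<le> ennreal (2 * (1 + 2 * CD)) * epow (ennreal (3 powr p2) * (\<integral>\<^sup>+x. epow (B x) p2 \<partial>M)) (1 / p2)"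
    using p2 by (intro mult_left_mono epow_mono le) auto
  also have "\<dots> = ennreal (2 * (1 + 2 * CD)) * (ennreal 3 * epow (\<integral>\<^sup>+x. epow (B x) p2 \<partial>M) (1 / p2))"
    using p2 by (subst epow_enn_cmult_inv) auto
  also have "\<dots> = ennreal (2 * (1 + 2 * CD)) * ennreal 3 * epow (\<integral>\<^sup>+x. epow (B x) p2 \<partial>M) (1 / p2)"
    by (simp only: mult.assoc)
  also have "ennreal (2 * (1 + 2 * CD)) * ennreal 3 = ennreal (6 * (1 + 2 * CD))"
    using CD_nonneg by (subst ennreal_mult[symmetric]) auto
  finally show "H1_norm M D (ereal p2) g \<le> ennreal (6 * (1 + 2 * CD)) *
      epow (\<integral>\<^sup>+x. epow (min (F x) (ennreal l)) p2 \<partial>M) (1 / p2)" by (simp add: B_def)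
qed

end

section \<open>Estimates of the K-functional\<close>

text \<open>With thresholds \<open>\<Lambda> k = C * dyad k powr -\<sigma> * \<kappa> k\<close>,
  almost every positive value of \<open>G\<close> lies between some \<open>\<Lambda> k\<close> and
  \<open>\<Lambda> (k - 1)\<close>, so its \<open>p\<close>-th power is at most the sum of
  \<open>\<Lambda> (k - 1) powr p\<close> over the \<open>k\<close> with
  \<open>\<Lambda> k < G\<close>. The thresholds need not be monotone, but
  \<open>\<Lambda> (k - 1) \<le> 2 powr \<sigma> * \<Lambda> k\<close>. The measure bound then turns
  the exponent \<open>-\<sigma> * p + \<sigma> * p1\<close> into
  \<open>-\<theta> * p\<close>.\<close>

lemma (in doubling_space) tail_sum:
  fixes \<kappa> :: "int \<Rightarrow> real"
  assumes [measurable]: "G \<in> borel_measurable M"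
    and \<kappa>: "\<And>k. 0 \<le> \<kappa> k" "\<And>k. \<kappa> (k - 1) \<le> \<kappa> k"
    and C: "0 < C" and p: "0 < p1" "0 < p" and \<sigma>: "0 < \<sigma>" "\<theta> < \<sigma>" "\<sigma> * (p - p1) = \<theta> * p"
    and tail: "\<And>k \<kappa>'. \<kappa> k < \<kappa>' \<Longrightarrow>
      emeasure M {x. ennreal (C * dyad k powr -\<sigma> * \<kappa>') < G x} \<le> ennreal (2 * dyad k powr (\<sigma> * p1))"
    and fin: "(\<integral>\<^sup>+k. ennreal (dyad k powr -(\<theta> * p) * \<kappa> k powr p) \<partial>count_space UNIV) < top"
  shows "(\<integral>\<^sup>+x. epow (G x) p \<partial>M) \<le> ennreal (2 * (2 powr \<sigma> * C) powr p) *
    (\<integral>\<^sup>+k. ennreal (dyad k powr -(\<theta> * p) * \<kappa> k powr p) \<partial>count_space UNIV)"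
proof -
  define \<Lambda> where "\<Lambda> k = C * dyad k powr -\<sigma> * \<kappa> k" for k
  have \<Lambda>0: "0 \<le> \<Lambda> k" for k using C \<kappa> by (simp add: \<Lambda>_def)
  have \<Lambda>_step: "\<Lambda> (k - 1) \<le> 2 powr \<sigma> * \<Lambda> k" for k
  proof -
    have "dyad ((k - 1) + 1) powr -\<sigma> = 2 powr -\<sigma> * dyad (k - 1) powr -\<sigma>" by (rule dyad_Suc_powr)
    then have "dyad (k - 1) powr -\<sigma> = 2 powr \<sigma> * dyad k powr -\<sigma>"
      by (simp add: powr_minus field_simps)
    then have "\<Lambda> (k - 1) = 2 powr \<sigma> * (C * dyad k powr -\<sigma>) * \<kappa> (k - 1)" by (simp add: \<Lambda>_def)
    also have "\<dots> \<le> 2 powr \<sigma> * (C * dyad k powr -\<sigma>) * \<kappa> k" using C \<kappa>(2) by (intro mult_left_mono) auto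
    finally show ?thesis by (simp add: \<Lambda>_def mult.assoc)
  qed
  \<comment> \<open>The hypothesis concerns only \<open>\<kappa>'\<close> strictly above
    \<open>\<kappa> k\<close>, as the K-functional is an infimum; the limit case follows by
    continuity from below.\<close>
  have level: "emeasure M {x. ennreal (\<Lambda> k) < G x} \<le> ennreal (2 * dyad k powr (\<sigma> * p1))" for k
  proof -
    define S where "S n = {x. ennreal (C * dyad k powr -\<sigma> * (\<kappa> k + 1 / (real n + 1))) < G x}" for n :: nat
    have S_sets: "S n \<in> sets M" for n
    proof -
      have "{x \<in> space M. ennreal (C * dyad k powr -\<sigma> * (\<kappa> k + 1 / (real n + 1))) < G x} \<in> sets M" by measurable
      then show ?thesis by (simp add: S_def)
    qed
    have inc: "incseq S"
    proof (rule incseq_SucI, rule subsetI)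
      fix n x assume x: "x \<in> S n"
      have "1 / (real (Suc n) + 1) \<le> 1 / (real n + 1)" by (simp add: field_simps)
      then have "C * dyad k powr -\<sigma> * (\<kappa> k + 1 / (real (Suc n) + 1)) \<le> C * dyad k powr -\<sigma> * (\<kappa> k + 1 / (real n + 1))"
        using C by (intro mult_left_mono) auto
      then have "ennreal (C * dyad k powr -\<sigma> * (\<kappa> k + 1 / (real (Suc n) + 1)))
        \<le> ennreal (C * dyad k powr -\<sigma> * (\<kappa> k + 1 / (real n + 1)))" by (rule ennreal_leI)
      then show "x \<in> S (Suc n)" using x unfolding S_def by auto
    qed
    have "{x. ennreal (\<Lambda> k) < G x} \<subseteq> (\<Union>n. S n)"
    proof
      fix x assume x: "x \<in> {x. ennreal (\<Lambda> k) < G x}"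
      have "(\<lambda>n. ennreal (C * dyad k powr -\<sigma> * (\<kappa> k + 1 / (real n + 1)))) \<longlonglongrightarrow> ennreal (C * dyad k powr -\<sigma> * (\<kappa> k + 0))"
      proof (intro tendsto_ennrealI tendsto_mult tendsto_add tendsto_const)
        show "(\<lambda>n. 1 / (real n + 1)) \<longlonglongrightarrow> 0"
          using LIMSEQ_inverse_real_of_nat by (simp add: inverse_eq_divide add.commute)
      qed
      then have "eventually (\<lambda>n. ennreal (C * dyad k powr -\<sigma> * (\<kappa> k + 1 / (real n + 1))) < G x) sequentially"
        using x by (intro order_tendstoD(2)) (auto simp: \<Lambda>_def)
      then have "\<exists>n. x \<in> S n" unfolding S_def eventually_sequentially by blast
      then show "x \<in> (\<Union>n. S n)" by blast
    qed
    then have "emeasure M {x. ennreal (\<Lambda> k) < G x} \<le> emeasure M (\<Union>n. S n)"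
      using S_sets by (intro emeasure_mono sets.countable_UN) auto
    also have "\<dots> = (SUP n. emeasure M (S n))"
      using S_sets inc by (intro SUP_emeasure_incseq[symmetric]) auto
    also have "\<dots> \<le> ennreal (2 * dyad k powr (\<sigma> * p1))"
      unfolding S_def by (intro SUP_least tail) simp
    finally show ?thesis .
  qed
  \<comment> \<open>Each term is bounded by the finite sum, so \<open>\<kappa> k\<close> grows at
    most like \<open>dyad k powr \<theta>\<close>. As \<open>\<theta> < \<sigma>\<close>, the
    thresholds become arbitrarily small for large \<open>k\<close>.\<close>
  define Y where "Y = enn2real (\<integral>\<^sup>+k. ennreal (dyad k powr -(\<theta> * p) * \<kappa> k powr p) \<partial>count_space UNIV)"
  have Y: "dyad k powr -(\<theta> * p) * \<kappa> k powr p \<le> Y" for k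
  proof -
    have "ennreal (dyad k powr -(\<theta> * p) * \<kappa> k powr p)
      \<le> (\<integral>\<^sup>+k. ennreal (dyad k powr -(\<theta> * p) * \<kappa> k powr p) \<partial>count_space UNIV)"
      by (rule int_sum_ge)
    also have "\<dots> = ennreal Y" using fin by (simp add: Y_def)
    finally show ?thesis by (simp add: Y_def)
  qed
  have \<kappa>_le: "\<kappa> k \<le> Y powr (1 / p) * dyad k powr \<theta>" for k
  proof -
    have "\<kappa> k powr p \<le> Y * dyad k powr (\<theta> * p)" using Y[of k] by (simp add: powr_minus field_simps)
    then have "(\<kappa> k powr p) powr (1 / p) \<le> (Y * dyad k powr (\<theta> * p)) powr (1 / p)"
      using p by (intro powr_mono2) auto
    then show ?thesis using p \<kappa>(1)[of k] by (simp add: powr_mult powr_powr Y_def)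
  qed
  have \<Lambda>_small: "\<exists>k\<ge>k0. \<Lambda> k < e" if e: "0 < e" for k0 e
  proof -
    have "0 < \<sigma> - \<theta>" using \<sigma> by simp
    then obtain k where k: "k \<ge> k0" "C * Y powr (1 / p) / e + 1 \<le> dyad k powr (\<sigma> - \<theta>)" using dyad_unbounded by blast
    have "\<Lambda> k \<le> C * dyad k powr -\<sigma> * (Y powr (1 / p) * dyad k powr \<theta>)"
      unfolding \<Lambda>_def using C \<kappa>_le by (intro mult_left_mono) auto
    also have "\<dots> = C * Y powr (1 / p) / dyad k powr (\<sigma> - \<theta>)"
      by (simp add: powr_diff powr_minus field_simps)
    also have "\<dots> < e"
    proof -
      have "C * Y powr (1 / p) / e < dyad k powr (\<sigma> - \<theta>)" using k by linarith
      then show ?thesis using e by (simp add: divide_less_eq mult.commute)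
    qed
    finally show ?thesis using k by blast
  qed
  have null: "(\<Inter>k. {x. ennreal (\<Lambda> k) < G x}) \<in> null_sets M"
  proof -
    have sets: "{x. ennreal (\<Lambda> k) < G x} \<in> sets M" for k
    proof -
      have "{x \<in> space M. ennreal (\<Lambda> k) < G x} \<in> sets M" by measurable
      then show ?thesis by simp
    qed
    have I: "(\<Inter>k. {x. ennreal (\<Lambda> k) < G x}) \<in> sets M"
      by (rule sets.countable_INT'') (use sets in auto)
    have "emeasure M (\<Inter>k. {x. ennreal (\<Lambda> k) < G x}) \<le> 0 + ennreal e" if e: "0 < e" for e
    proof -
      have "0 < \<sigma> * p1" using \<sigma> p by simp
      then obtain k where k: "2 / e \<le> dyad k powr (\<sigma> * p1)" using dyad_unbounded by blast
      have "emeasure M (\<Inter>k. {x. ennreal (\<Lambda> k) < G x}) \<le> emeasure M {x. ennreal (\<Lambda> (-k)) < G x}"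
        using sets by (intro emeasure_mono) auto
      also have "\<dots> \<le> ennreal (2 * dyad (-k) powr (\<sigma> * p1))" by (rule level)
      also have "\<dots> \<le> ennreal e"
      proof (rule ennreal_leI)
        have "dyad (-k) powr (\<sigma> * p1) = 1 / dyad k powr (\<sigma> * p1)"
          unfolding powr_powr by (simp add: powr_minus_divide)
        then have "2 * dyad (-k) powr (\<sigma> * p1) = 2 / dyad k powr (\<sigma> * p1)" by simp
        also have "\<dots> \<le> e" using k e by (simp add: field_simps)
        finally show "2 * dyad (-k) powr (\<sigma> * p1) \<le> e" .
      qed
      finally show ?thesis by simp
    qed
    note small = this
    have "emeasure M (\<Inter>k. {x. ennreal (\<Lambda> k) < G x}) \<le> 0" by (rule ennreal_le_epsilon) (rule small)
    then show ?thesis using I by auto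
  qed
  have "(\<integral>\<^sup>+x. epow (G x) p \<partial>M) \<le>
    (\<integral>\<^sup>+x. \<integral>\<^sup>+k. ennreal (\<Lambda> (k - 1) powr p) * of_bool (ennreal (\<Lambda> k) < G x) \<partial>count_space UNIV \<partial>M)"
  proof (rule nn_integral_mono_AE)
    show "AE x in M. epow (G x) p \<le>
      (\<integral>\<^sup>+k. ennreal (\<Lambda> (k - 1) powr p) * of_bool (ennreal (\<Lambda> k) < G x) \<partial>count_space UNIV)"
      using AE_not_in[OF null]
    proof eventually_elim
      case (elim x)
      then obtain k1 where k1: "G x \<le> ennreal (\<Lambda> k1)" by (auto simp: not_less)
      show ?case
      proof (cases "G x = 0")
        case False
        have "\<exists>k. ennreal (\<Lambda> k) < G x \<and> G x \<le> ennreal (\<Lambda> (k - 1))"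
        proof (rule ccontr)
          assume no: "\<not> ?thesis"
          \<comment> \<open>If \<open>G x\<close> never crosses a threshold above \<open>k1\<close>,
            it stays below all of them, although they become arbitrarily small.\<close>
          have all: "G x \<le> ennreal (\<Lambda> k)" if "k \<ge> k1" for k
            using that
          proof (induction k rule: int_ge_induct)
            case (step i)
            have "(i + 1) - 1 = i" by simp
            then show ?case using no step by (metis not_le)
          qed (rule k1)
          obtain r where r: "G x = ennreal r" "0 < r"
            using False k1 by (cases "G x") (auto simp: top_unique)
          obtain k where k: "k \<ge> k1" "\<Lambda> k < r" using \<Lambda>_small[OF r(2)] by blast
          have "ennreal r \<le> ennreal (\<Lambda> k)" using all[OF k(1)] r by simp
          then show False using k r \<Lambda>0 by (simp add: ennreal_le_iff)
        qed
        then obtain k where k: "ennreal (\<Lambda> k) < G x" "G x \<le> ennreal (\<Lambda> (k - 1))" by blast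
        have "epow (G x) p \<le> epow (ennreal (\<Lambda> (k - 1))) p" using k p by (intro epow_mono) auto
        also have "\<dots> = ennreal (\<Lambda> (k - 1) powr p) * of_bool (ennreal (\<Lambda> k) < G x)"
          using k \<Lambda>0 by (simp add: epow_ennreal)
        also have "\<dots> \<le> (\<integral>\<^sup>+k. ennreal (\<Lambda> (k - 1) powr p) * of_bool (ennreal (\<Lambda> k) < G x) \<partial>count_space UNIV)"
          by (rule int_sum_ge)
        finally show ?thesis .
      qed simp
    qed
  qed
  also have "\<dots> = (\<integral>\<^sup>+k. ennreal (\<Lambda> (k - 1) powr p) * emeasure M {x. ennreal (\<Lambda> k) < G x} \<partial>count_space UNIV)"
    by (subst nn_integral_count_space_nn_integral)
       (auto intro!: nn_integral_cong simp: nn_integral_cmult nn_integral_of_bool)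
  also have "\<dots> \<le> (\<integral>\<^sup>+k. ennreal (2 * (2 powr \<sigma> * C) powr p) * ennreal (dyad k powr -(\<theta> * p) * \<kappa> k powr p) \<partial>count_space UNIV)"
  proof (rule nn_integral_mono)
    fix k :: int
    have "ennreal (\<Lambda> (k - 1) powr p) * emeasure M {x. ennreal (\<Lambda> k) < G x}
      \<le> ennreal ((2 powr \<sigma> * \<Lambda> k) powr p) * ennreal (2 * dyad k powr (\<sigma> * p1))"
      using p \<Lambda>0 \<Lambda>_step by (intro mult_mono ennreal_leI powr_mono2 level) auto
    also have "\<dots> = ennreal ((2 powr \<sigma> * \<Lambda> k) powr p * (2 * dyad k powr (\<sigma> * p1)))"
      by (intro ennreal_mult[symmetric]) auto
    also have "(2 powr \<sigma> * \<Lambda> k) powr p * (2 * dyad k powr (\<sigma> * p1))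
      = 2 * (2 powr \<sigma> * C) powr p * (dyad k powr -(\<theta> * p) * \<kappa> k powr p)"
    proof -
      have "(2 powr \<sigma> * \<Lambda> k) powr p = ((2 powr \<sigma> * C) * (dyad k powr -\<sigma> * \<kappa> k)) powr p"
        by (simp add: \<Lambda>_def mult.assoc)
      also have "\<dots> = (2 powr \<sigma> * C) powr p * ((dyad k powr -\<sigma>) powr p * \<kappa> k powr p)"
        using C \<kappa>(1)[of k] by (simp only: powr_mult)
      also have "(dyad k powr -\<sigma>) powr p = dyad k powr (-\<sigma> * p)" by (rule powr_powr)
      finally have 1: "(2 powr \<sigma> * \<Lambda> k) powr p = (2 powr \<sigma> * C) powr p * (dyad k powr (-\<sigma> * p) * \<kappa> k powr p)" .
      have "-\<sigma> * p + \<sigma> * p1 = -(\<theta> * p)" using \<sigma>(3) by (simp add: algebra_simps)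
      then have "dyad k powr (-\<sigma> * p) * dyad k powr (\<sigma> * p1) = dyad k powr -(\<theta> * p)"
        by (simp only: powr_add[symmetric])
      then show ?thesis unfolding 1 by (simp only: mult_ac)
    qed
    also have "ennreal (2 * (2 powr \<sigma> * C) powr p * (dyad k powr -(\<theta> * p) * \<kappa> k powr p))
      = ennreal (2 * (2 powr \<sigma> * C) powr p) * ennreal (dyad k powr -(\<theta> * p) * \<kappa> k powr p)"
      by (intro ennreal_mult) auto
    finally show "ennreal (\<Lambda> (k - 1) powr p) * emeasure M {x. ennreal (\<Lambda> k) < G x}
      \<le> ennreal (2 * (2 powr \<sigma> * C) powr p) * ennreal (dyad k powr -(\<theta> * p) * \<kappa> k powr p)" .
  qed
  also have "\<dots> = ennreal (2 * (2 powr \<sigma> * C) powr p) *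
    (\<integral>\<^sup>+k. ennreal (dyad k powr -(\<theta> * p) * \<kappa> k powr p) \<partial>count_space UNIV)"
    by (intro nn_integral_cmult) auto
  finally show ?thesis .
qed

section \<open>Bounding the K-functional by Hajlasz gradients\<close>

context cheeger_space
begin

text \<open>The properties of a truncation that do not mention \<open>f\<close>. They are all that
  the second end point of the couple sees, for finite exponent and for \<open>\<infinity>\<close>
  alike.\<close>

definition trunc_of :: "('a \<Rightarrow> ennreal) \<Rightarrow> real \<Rightarrow> ('a \<Rightarrow> real) \<Rightarrow> bool" where
  "trunc_of F l g \<longleftrightarrow> (2 * l)-lipschitz_on UNIV g \<and> (\<forall>x. \<bar>g x\<bar> \<le> l) \<and> g \<in> borel_measurable M \<and>
    (AE x in M. ennreal \<bar>g x\<bar> \<le> min (F x) (ennreal l)) \<and> hajlasz M g (\<lambda>x. 2 * min (F x) (ennreal l))"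

text \<open>At level \<open>dyad j\<close> the splitting is \<open>f - g j\<close> plus
  \<open>g j\<close>. The first piece is measured by the tail of \<open>F\<close> in L^p1, in the
  same way for every couple; the end point \<open>P2\<close> enters only through the numbers
  \<open>c j\<close>, which the two later cases supply.\<close>

lemma K_truncation:
  fixes P2 :: ereal
  assumes p: "0 < p1" "p1 < p" and \<theta>: "0 < \<theta>" "\<theta> < 1"
  defines "\<K> \<equiv> Kfun M (H1 M D (ereal p1)) (H1_norm M D (ereal p1)) (H1 M D P2) (H1_norm M D P2)"
  shows "\<exists>C>0. \<forall>f h F X c Cc s2. f \<in> borel_measurable M \<longrightarrow> h \<in> borel_measurable M \<longrightarrow> hajlasz M f h \<longrightarrow>
    F = (\<lambda>x. ennreal \<bar>f x\<bar> + h x) \<longrightarrow> 0 \<le> X \<longrightarrow> (\<integral>\<^sup>+x. epow (F x) p \<partial>M) \<le> ennreal X \<longrightarrow>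
    (\<forall>j. 0 \<le> c j \<and> c j \<le> Cc * dyad j powr s2) \<longrightarrow> 0 < s2 \<longrightarrow>
    (\<forall>j g. trunc_of F (dyad j) g \<longrightarrow> H1 M D P2 g \<and> H1_norm M D P2 g \<le> ennreal (c j)) \<longrightarrow>
    in_sum_space M (H1 M D (ereal p1)) (H1 M D P2) f \<and>
    K_sum \<theta> p (\<K> f) \<le> ennreal C *
      (\<integral>\<^sup>+j. ennreal (enn2real (\<integral>\<^sup>+x. epow (F x * of_bool (ennreal (dyad j) < F x)) p1 \<partial>M) powr ((1 - \<theta>) * p / p1)
        * c (j + 1) powr (\<theta> * p)) \<partial>count_space UNIV)"
proof -
  have p0: "0 < p" using p by simp
  obtain C where C: "0 < C" "\<And>\<kappa> a c Ca Cc s1 s2. (\<forall>j. 0 \<le> a j \<and> a j \<le> Ca * dyad j powr -s1) \<Longrightarrow> 0 < s1 \<Longrightarrow>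
    (\<forall>j. 0 \<le> c j \<and> c j \<le> Cc * dyad j powr s2) \<Longrightarrow> 0 < s2 \<Longrightarrow>
    (\<forall>t>0. \<forall>j. \<kappa> t \<le> ennreal (a j + t * c j)) \<Longrightarrow>
    K_sum \<theta> p \<kappa> \<le> ennreal C *
      (\<integral>\<^sup>+j. ennreal (a j powr ((1 - \<theta>) * p) * c (j + 1) powr (\<theta> * p)) \<partial>count_space UNIV)"
    using K_sum_le_balanced[OF \<theta> p0] by blast
  define K0 where "K0 = 12 * (1 + 2 * CD)"
  have K0: "0 < K0" using CD_nonneg by (simp add: K0_def)
  define C' where "C' = C * K0 powr ((1 - \<theta>) * p)"
  have C': "0 < C'" using C K0 by (simp add: C'_def)
  have "in_sum_space M (H1 M D (ereal p1)) (H1 M D P2) f \<and>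
    K_sum \<theta> p (\<K> f) \<le> ennreal C' *
      (\<integral>\<^sup>+j. ennreal (enn2real (\<integral>\<^sup>+x. epow (F x * of_bool (ennreal (dyad j) < F x)) p1 \<partial>M) powr ((1 - \<theta>) * p / p1)
        * c (j + 1) powr (\<theta> * p)) \<partial>count_space UNIV)"
    if [measurable]: "f \<in> borel_measurable M" "h \<in> borel_measurable M" and haj: "hajlasz M f h"
      and F: "F = (\<lambda>x. ennreal \<bar>f x\<bar> + h x)" and X: "0 \<le> X" "(\<integral>\<^sup>+x. epow (F x) p \<partial>M) \<le> ennreal X"
      and c: "\<forall>j. 0 \<le> c j \<and> c j \<le> Cc * dyad j powr s2" "0 < s2"
      and H: "\<forall>j g. trunc_of F (dyad j) g \<longrightarrow> H1 M D P2 g \<and> H1_norm M D P2 g \<le> ennreal (c j)"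
    for f h F X c Cc s2
  proof -
    have [measurable]: "F \<in> borel_measurable M" unfolding F by measurable
    define I where "I j = (\<integral>\<^sup>+x. epow (F x * of_bool (ennreal (dyad j) < F x)) p1 \<partial>M)" for j
    define A where "A j = enn2real (I j)" for j
    have I_le: "I j \<le> ennreal (dyad j powr (p1 - p) * X)" for j
    proof -
      have "I j \<le> ennreal (dyad j powr (p1 - p)) * (\<integral>\<^sup>+x. epow (F x) p \<partial>M)"
        unfolding I_def using p by (intro nn_integral_tail_le) auto
      also have "\<dots> \<le> ennreal (dyad j powr (p1 - p)) * ennreal X" by (intro mult_left_mono X) auto
      finally show ?thesis using X by (simp add: ennreal_mult)
    qed
    have I_fin: "I j < top" for j using I_le[of j] by (auto intro: le_less_trans)
    have IA: "I j = ennreal (A j)" "0 \<le> A j" for j using I_fin[of j] by (auto simp: A_def)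
    have A_le: "A j \<le> dyad j powr (p1 - p) * X" for j
      using I_le[of j] X by (simp add: IA)
    define a where "a j = K0 * A j powr (1 / p1)" for j
    define s1 where "s1 = (p - p1) / p1"
    have s1: "0 < s1" using p by (simp add: s1_def)
    have a: "\<forall>j. 0 \<le> a j \<and> a j \<le> (K0 * X powr (1 / p1)) * dyad j powr -s1"
    proof (intro allI conjI)
      fix j
      show "0 \<le> a j" using K0 by (simp add: a_def)
      have "A j powr (1 / p1) \<le> (dyad j powr (p1 - p) * X) powr (1 / p1)"
        using A_le IA p by (intro powr_mono2) auto
      also have "\<dots> = (dyad j powr (p1 - p)) powr (1 / p1) * X powr (1 / p1)" using X by (simp add: powr_mult)
      also have "(dyad j powr (p1 - p)) powr (1 / p1) = dyad j powr ((p1 - p) * (1 / p1))" by (rule powr_powr)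
      also have "(p1 - p) * (1 / p1) = -s1" using p by (simp add: s1_def field_simps)
      finally have "K0 * A j powr (1 / p1) \<le> K0 * (dyad j powr -s1 * X powr (1 / p1))"
        using K0 by (intro mult_left_mono) auto
      then show "a j \<le> (K0 * X powr (1 / p1)) * dyad j powr -s1" by (simp add: a_def mult_ac)
    qed
    have "\<exists>g. H1 M D (ereal p1) (\<lambda>x. f x - g x) \<and> H1_norm M D (ereal p1) (\<lambda>x. f x - g x) \<le> ennreal (a j) \<and>
      trunc_of F (dyad j) g" for j
    proof -
      have fin: "(\<integral>\<^sup>+x. epow ((ennreal \<bar>f x\<bar> + h x) * of_bool (ennreal (dyad j) < ennreal \<bar>f x\<bar> + h x)) p1 \<partial>M) < top"
        using I_fin[of j] by (simp add: I_def F)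
      have dj: "0 < dyad j" by simp
      obtain g where g: "(2 * dyad j)-lipschitz_on UNIV g" "\<And>x. \<bar>g x\<bar> \<le> dyad j" "g \<in> borel_measurable M"
        "AE x in M. ennreal \<bar>g x\<bar> \<le> min (F x) (ennreal (dyad j))" "hajlasz M g (\<lambda>x. 2 * min (F x) (ennreal (dyad j)))"
        "H1 M D (ereal p1) (\<lambda>x. f x - g x)"
        "H1_norm M D (ereal p1) (\<lambda>x. f x - g x) \<le> ennreal K0 * epow (I j) (1 / p1)"
        by (rule truncation_H1[OF _ _ haj dj p(1) fin]) (auto simp: F I_def K0_def)
      have "ennreal K0 * epow (I j) (1 / p1) = ennreal (a j)"
        using K0 IA[of j] by (simp add: a_def epow_ennreal ennreal_mult)
      then show ?thesis using g by (intro exI[of _ g]) (auto simp: trunc_of_def)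
    qed
    then obtain g where g: "\<And>j. H1 M D (ereal p1) (\<lambda>x. f x - g j x)"
      "\<And>j. H1_norm M D (ereal p1) (\<lambda>x. f x - g j x) \<le> ennreal (a j)" "\<And>j. trunc_of F (dyad j) (g j)" by metis
    have gP: "H1 M D P2 (g j)" "H1_norm M D P2 (g j) \<le> ennreal (c j)" for j using H g(3) by blast+
    have sum: "in_sum_space M (H1 M D (ereal p1)) (H1 M D P2) f"
      unfolding in_sum_space_def using g(1)[of 0] gP(1)[of 0]
      by (intro exI[of _ "\<lambda>x. f x - g 0 x"] exI[of _ "g 0"]) auto
    have "\<forall>t>0. \<forall>j. \<K> f t \<le> ennreal (a j + t * c j)"
    proof (intro allI impI)
      fix t :: real and j assume t: "0 < t"
      have "\<K> f t \<le> H1_norm M D (ereal p1) (\<lambda>x. f x - g j x) + ennreal t * H1_norm M D P2 (g j)"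
        unfolding \<K>_def Kfun_def using g(1)[of j] gP(1)[of j]
        by (intro Inf_lower CollectI exI[of _ "\<lambda>x. f x - g j x"] exI[of _ "g j"]) auto
      also have "\<dots> \<le> ennreal (a j) + ennreal t * ennreal (c j)" by (intro add_mono mult_left_mono g gP) auto
      also have "\<dots> = ennreal (a j) + ennreal (t * c j)" using t c by (simp add: ennreal_mult)
      also have "\<dots> = ennreal (a j + t * c j)" using t a c by (intro ennreal_plus[symmetric]) auto
      finally show "\<K> f t \<le> ennreal (a j + t * c j)" .
    qed
    from C(2)[OF a s1 c this] have "K_sum \<theta> p (\<K> f) \<le> ennreal C *
      (\<integral>\<^sup>+j. ennreal (a j powr ((1 - \<theta>) * p) * c (j + 1) powr (\<theta> * p)) \<partial>count_space UNIV)" .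
    also have "\<dots> = ennreal C * (\<integral>\<^sup>+j. ennreal (K0 powr ((1 - \<theta>) * p)) *
      ennreal (A j powr ((1 - \<theta>) * p / p1) * c (j + 1) powr (\<theta> * p)) \<partial>count_space UNIV)"
    proof (intro arg_cong2[where f = "(*)"] refl nn_integral_cong)
      fix j
      have "a j powr ((1 - \<theta>) * p) = K0 powr ((1 - \<theta>) * p) * A j powr ((1 - \<theta>) * p / p1)"
        using K0 by (simp add: a_def powr_mult powr_powr)
      then show "ennreal (a j powr ((1 - \<theta>) * p) * c (j + 1) powr (\<theta> * p))
        = ennreal (K0 powr ((1 - \<theta>) * p)) * ennreal (A j powr ((1 - \<theta>) * p / p1) * c (j + 1) powr (\<theta> * p))"
        by (simp add: ennreal_mult[symmetric] mult.assoc)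
    qed
    also have "\<dots> = ennreal C * (ennreal (K0 powr ((1 - \<theta>) * p)) *
      (\<integral>\<^sup>+j. ennreal (A j powr ((1 - \<theta>) * p / p1) * c (j + 1) powr (\<theta> * p)) \<partial>count_space UNIV))"
      by (subst nn_integral_cmult) auto
    also have "\<dots> = ennreal C' *
      (\<integral>\<^sup>+j. ennreal (A j powr ((1 - \<theta>) * p / p1) * c (j + 1) powr (\<theta> * p)) \<partial>count_space UNIV)"
      using C by (simp add: C'_def ennreal_mult mult.assoc)
    finally show ?thesis using sum by (simp add: A_def I_def)
  qed
  then show ?thesis using C' by blast
qed

end

context cheeger_space
begin

text \<open>Each term is a product of powers \<open>\<alpha>\<close> and \<open>\<beta>\<close> of a
  tail integral and a truncated integral with \<open>\<alpha> + \<beta> = 1\<close>. Young's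
  inequality with suitable dyadic weights separates them into the series of
  \<open>dyadic_sum_tails\<close> and \<open>dyadic_sum_mins\<close>, both bounded by the integral
  of \<open>F powr p\<close>.\<close>

lemma K_sum_upper_finite:
  assumes p: "0 < p1" "p1 < p" "p < p2" and \<theta>: "0 < \<theta>" "\<theta> < 1" "1 / p = (1 - \<theta>) / p1 + \<theta> / p2"
  shows "\<exists>C>0. \<forall>f h X. f \<in> borel_measurable M \<longrightarrow> h \<in> borel_measurable M \<longrightarrow> hajlasz M f h \<longrightarrow>
    0 \<le> X \<longrightarrow> (\<integral>\<^sup>+x. epow (ennreal \<bar>f x\<bar> + h x) p \<partial>M) \<le> ennreal X \<longrightarrow>
    in_sum_space M (H1 M D (ereal p1)) (H1 M D (ereal p2)) f \<and>
    K_sum \<theta> p (Kfun M (H1 M D (ereal p1)) (H1_norm M D (ereal p1)) (H1 M D (ereal p2)) (H1_norm M D (ereal p2)) f)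
      \<le> ennreal (C * X)"
proof -
  define \<alpha> \<beta> where "\<alpha> = (1 - \<theta>) * p / p1" and "\<beta> = \<theta> * p / p2"
  have p0: "0 < p" "0 < p2" using p by auto
  have \<alpha>\<beta>: "0 < \<alpha>" "0 < \<beta>" using p \<theta> by (auto simp: \<alpha>_def \<beta>_def)
  have sum1: "\<alpha> + \<beta> = 1"
  proof -
    have "\<alpha> + \<beta> = p * ((1 - \<theta>) / p1 + \<theta> / p2)" by (simp add: \<alpha>_def \<beta>_def distrib_left mult.commute)
    also have "\<dots> = 1" using p0 by (simp add: \<theta>(3)[symmetric])
    finally show ?thesis .
  qed
  \<comment> \<open>The weights \<open>dyad j powr (p - p1)\<close> and
    \<open>dyad j powr (p - p2)\<close>, raised to \<open>\<alpha>\<close> and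
    \<open>\<beta>\<close>, cancel, so they can be inserted free of charge before Young's
    inequality.\<close>
  have scale: "\<alpha> * (p - p1) + \<beta> * (p - p2) = 0"
  proof -
    have "\<alpha> * p1 = (1 - \<theta>) * p" "\<beta> * p2 = \<theta> * p" using p by (auto simp: \<alpha>_def \<beta>_def)
    then have "\<alpha> * (p - p1) + \<beta> * (p - p2) = (\<alpha> + \<beta>) * p - ((1 - \<theta>) * p + \<theta> * p)"
      by (simp add: algebra_simps)
    then show ?thesis by (simp add: sum1 algebra_simps)
  qed
  obtain C where C: "0 < C" "\<And>f h F X c Cc s2. f \<in> borel_measurable M \<Longrightarrow> h \<in> borel_measurable M \<Longrightarrow> hajlasz M f h \<Longrightarrow>
    F = (\<lambda>x. ennreal \<bar>f x\<bar> + h x) \<Longrightarrow> 0 \<le> X \<Longrightarrow> (\<integral>\<^sup>+x. epow (F x) p \<partial>M) \<le> ennreal X \<Longrightarrow>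
    (\<forall>j. 0 \<le> c j \<and> c j \<le> Cc * dyad j powr s2) \<Longrightarrow> 0 < s2 \<Longrightarrow>
    (\<forall>j g. trunc_of F (dyad j) g \<longrightarrow> H1 M D (ereal p2) g \<and> H1_norm M D (ereal p2) g \<le> ennreal (c j)) \<Longrightarrow>
    in_sum_space M (H1 M D (ereal p1)) (H1 M D (ereal p2)) f \<and>
    K_sum \<theta> p (Kfun M (H1 M D (ereal p1)) (H1_norm M D (ereal p1)) (H1 M D (ereal p2)) (H1_norm M D (ereal p2)) f) \<le> ennreal C *
      (\<integral>\<^sup>+j. ennreal (enn2real (\<integral>\<^sup>+x. epow (F x * of_bool (ennreal (dyad j) < F x)) p1 \<partial>M) powr ((1 - \<theta>) * p / p1)
        * c (j + 1) powr (\<theta> * p)) \<partial>count_space UNIV)"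
    using K_truncation[OF p(1,2) \<theta>(1,2), where ?P2.0 = "ereal p2"] by blast
  define K1 where "K1 = 6 * (1 + 2 * CD)"
  have K1: "0 < K1" using CD_nonneg by (simp add: K1_def)
  define E1 where "E1 = 1 / (1 - 2 powr -(p - p1) :: real)"
  define E2 where "E2 = 1 / (1 - 2 powr -p) + 1 / (1 - 2 powr (p - p2) :: real)"
  have E1: "0 < E1" using p by (simp add: E1_def powr_less_one)
  have E2: "0 < E2" unfolding E2_def using p by (intro add_pos_pos) (auto simp: powr_less_one)
  define C' where "C' = C * (K1 powr (\<theta> * p) * (E1 + 2 powr (p2 - p) * E2))"
  have C': "0 < C'" using C(1) K1 E1 E2 by (simp add: C'_def add_pos_pos)
  have "in_sum_space M (H1 M D (ereal p1)) (H1 M D (ereal p2)) f \<and>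
    K_sum \<theta> p (Kfun M (H1 M D (ereal p1)) (H1_norm M D (ereal p1)) (H1 M D (ereal p2)) (H1_norm M D (ereal p2)) f)
      \<le> ennreal (C' * X)"
    if [measurable]: "f \<in> borel_measurable M" "h \<in> borel_measurable M" and haj: "hajlasz M f h"
      and X: "0 \<le> X" "(\<integral>\<^sup>+x. epow (ennreal \<bar>f x\<bar> + h x) p \<partial>M) \<le> ennreal X" for f h X
  proof -
    define F where "F x = ennreal \<bar>f x\<bar> + h x" for x
    have [measurable]: "F \<in> borel_measurable M" unfolding F_def by measurable
    have FX: "(\<integral>\<^sup>+x. epow (F x) p \<partial>M) \<le> ennreal X" using X(2) by (simp add: F_def)
    define I where "I j = (\<integral>\<^sup>+x. epow (F x * of_bool (ennreal (dyad j) < F x)) p1 \<partial>M)" for j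
    define J where "J j = (\<integral>\<^sup>+x. epow (min (F x) (ennreal (dyad j))) p2 \<partial>M)" for j
    define A B where "A j = enn2real (I j)" and "B j = enn2real (J j)" for j
    have I_fin: "I j < top" for j
    proof -
      have "I j \<le> ennreal (dyad j powr (p1 - p)) * (\<integral>\<^sup>+x. epow (F x) p \<partial>M)"
        unfolding I_def using p by (intro nn_integral_tail_le) auto
      also have "\<dots> \<le> ennreal (dyad j powr (p1 - p)) * ennreal X" by (intro mult_left_mono FX) auto
      also have "\<dots> < top" by (simp add: ennreal_mult_less_top)
      finally show ?thesis .
    qed
    have J_le: "J j \<le> ennreal (dyad j powr (p2 - p) * X)" for j
    proof -
      have "J j \<le> ennreal (dyad j powr (p2 - p)) * (\<integral>\<^sup>+x. epow (F x) p \<partial>M)"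
        unfolding J_def using p by (intro nn_integral_min_le) auto
      also have "\<dots> \<le> ennreal (dyad j powr (p2 - p)) * ennreal X" by (intro mult_left_mono FX) auto
      finally show ?thesis using X by (simp add: ennreal_mult)
    qed
    have J_fin: "J j < top" for j using J_le[of j] by (auto intro: le_less_trans)
    have IA: "I j = ennreal (A j)" "0 \<le> A j" for j using I_fin[of j] by (auto simp: A_def)
    have JB: "J j = ennreal (B j)" "0 \<le> B j" for j using J_fin[of j] by (auto simp: B_def)
    have B_le: "B j \<le> dyad j powr (p2 - p) * X" for j using J_le[of j] X by (simp add: JB)
    define c where "c j = K1 * B j powr (1 / p2)" for j
    define s2 where "s2 = (p2 - p) / p2"
    have s2: "0 < s2" using p by (simp add: s2_def)
    have c: "\<forall>j. 0 \<le> c j \<and> c j \<le> (K1 * X powr (1 / p2)) * dyad j powr s2"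
    proof (intro allI conjI)
      fix j
      show "0 \<le> c j" using K1 by (simp add: c_def)
      have "B j powr (1 / p2) \<le> (dyad j powr (p2 - p) * X) powr (1 / p2)"
        using B_le JB p0 by (intro powr_mono2) auto
      also have "\<dots> = (dyad j powr (p2 - p)) powr (1 / p2) * X powr (1 / p2)" using X by (simp add: powr_mult)
      also have "(dyad j powr (p2 - p)) powr (1 / p2) = dyad j powr ((p2 - p) * (1 / p2))" by (rule powr_powr)
      also have "(p2 - p) * (1 / p2) = s2" by (simp add: s2_def)
      finally have "K1 * B j powr (1 / p2) \<le> K1 * (dyad j powr s2 * X powr (1 / p2))"
        using K1 by (intro mult_left_mono) auto
      then show "c j \<le> (K1 * X powr (1 / p2)) * dyad j powr s2" by (simp add: c_def mult_ac)
    qed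
    have H: "\<forall>j g. trunc_of F (dyad j) g \<longrightarrow> H1 M D (ereal p2) g \<and> H1_norm M D (ereal p2) g \<le> ennreal (c j)"
    proof (intro allI impI)
      fix j g assume "trunc_of F (dyad j) g"
      then have g: "g \<in> borel_measurable M" "AE x in M. ennreal \<bar>g x\<bar> \<le> min (F x) (ennreal (dyad j))"
        "hajlasz M g (\<lambda>x. 2 * min (F x) (ennreal (dyad j)))" by (auto simp: trunc_of_def)
      have fin: "(\<integral>\<^sup>+x. epow (min (F x) (ennreal (dyad j))) p2 \<partial>M) < top" using J_fin[of j] by (simp add: J_def)
      have "H1 M D (ereal p2) g"
        by (rule truncation_H1_upper(1)[OF g(1) _ g(2,3) p0(2) fin]) measurable
      moreover have "H1_norm M D (ereal p2) g \<le> ennreal K1 * epow (J j) (1 / p2)"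
        unfolding K1_def J_def by (rule truncation_H1_upper(2)[OF g(1) _ g(2,3) p0(2) fin]) measurable
      moreover have "ennreal K1 * epow (J j) (1 / p2) = ennreal (c j)"
        using K1 JB[of j] by (simp add: c_def epow_ennreal ennreal_mult)
      ultimately show "H1 M D (ereal p2) g \<and> H1_norm M D (ereal p2) g \<le> ennreal (c j)" by simp
    qed
    have term_le: "ennreal (A j powr \<alpha> * c (j + 1) powr (\<theta> * p)) \<le> ennreal (K1 powr (\<theta> * p)) *
      (ennreal (dyad j powr (p - p1)) * I j + ennreal (2 powr (p2 - p)) * (ennreal (dyad (j + 1) powr (p - p2)) * J (j + 1)))" for j
    proof -
      define x y where "x = dyad j powr (p - p1) * A j" and "y = dyad j powr (p - p2) * B (j + 1)"
      have xy: "0 \<le> x" "0 \<le> y" using IA JB by (auto simp: x_def y_def)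
      have cc: "c (j + 1) powr (\<theta> * p) = K1 powr (\<theta> * p) * B (j + 1) powr \<beta>"
        using K1 JB p0 by (simp add: c_def powr_mult powr_powr \<beta>_def)
      have "x powr \<alpha> * y powr \<beta> = ((dyad j powr (p - p1)) powr \<alpha> * (dyad j powr (p - p2)) powr \<beta>) * (A j powr \<alpha> * B (j + 1) powr \<beta>)"
        using IA JB by (simp add: x_def y_def powr_mult)
      also have "(dyad j powr (p - p1)) powr \<alpha> * (dyad j powr (p - p2)) powr \<beta>
        = dyad j powr (\<alpha> * (p - p1) + \<beta> * (p - p2))"
        by (simp only: powr_powr[of "dyad j"] powr_add mult.commute)
      also have "\<dots> = 1" by (simp add: scale)
      finally have "A j powr \<alpha> * B (j + 1) powr \<beta> = x powr \<alpha> * y powr \<beta>" by simp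
      also have "\<dots> \<le> x + y" using xy \<alpha>\<beta> sum1 by (intro powr_mult_powr_le_add) auto
      finally have "A j powr \<alpha> * c (j + 1) powr (\<theta> * p) \<le> K1 powr (\<theta> * p) * (x + y)"
        unfolding cc using mult_left_mono[of "A j powr \<alpha> * B (j + 1) powr \<beta>" "x + y" "K1 powr (\<theta> * p)"]
        by (simp add: mult_ac)
      then have "ennreal (A j powr \<alpha> * c (j + 1) powr (\<theta> * p)) \<le> ennreal (K1 powr (\<theta> * p) * (x + y))"
        by (rule ennreal_leI)
      also have "\<dots> = ennreal (K1 powr (\<theta> * p)) * (ennreal x + ennreal y)"
        using xy by (subst ennreal_mult) auto
      also have "ennreal x = ennreal (dyad j powr (p - p1)) * I j"
        unfolding x_def IA(1) by (intro ennreal_mult IA) auto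
      also have "ennreal y = ennreal (2 powr (p2 - p)) * (ennreal (dyad (j + 1) powr (p - p2)) * J (j + 1))"
      proof -
        \<comment> \<open>The truncated integral carries the index \<open>j + 1\<close> while its
          weight carries \<open>j\<close>; adjusting the weight costs
          \<open>2 powr (p2 - p)\<close>.\<close>
        have "dyad j powr (p - p2) = 2 powr (p2 - p) * dyad (j + 1) powr (p - p2)"
        proof -
          have "2 powr (p2 - p) * 2 powr (p - p2) = (1::real)" by (simp add: powr_add[symmetric])
          then show ?thesis unfolding dyad_Suc_powr by (simp add: mult.assoc[symmetric])
        qed
        then have "y = 2 powr (p2 - p) * (dyad (j + 1) powr (p - p2) * B (j + 1))" by (simp only: y_def mult.assoc)
        then show ?thesis using JB(2)[of "j + 1"] unfolding JB(1) by (simp only: ennreal_mult powr_ge_zero mult_nonneg_nonneg)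
      qed
      finally show ?thesis .
    qed
    have "(\<integral>\<^sup>+j. ennreal (A j powr \<alpha> * c (j + 1) powr (\<theta> * p)) \<partial>count_space UNIV) \<le>
      (\<integral>\<^sup>+j. ennreal (K1 powr (\<theta> * p)) * (ennreal (dyad j powr (p - p1)) * I j + ennreal (2 powr (p2 - p)) *
        (ennreal (dyad (j + 1) powr (p - p2)) * J (j + 1))) \<partial>count_space UNIV)"
      by (intro nn_integral_mono term_le)
    also have "\<dots> = ennreal (K1 powr (\<theta> * p)) * ((\<integral>\<^sup>+j. ennreal (dyad j powr (p - p1)) * I j \<partial>count_space UNIV)
      + ennreal (2 powr (p2 - p)) * (\<integral>\<^sup>+j. ennreal (dyad (j + 1) powr (p - p2)) * J (j + 1) \<partial>count_space UNIV))"
      by (simp only: nn_integral_cmult nn_integral_add borel_measurable_count_space)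
    also have "(\<integral>\<^sup>+j. ennreal (dyad (j + 1) powr (p - p2)) * J (j + 1) \<partial>count_space UNIV)
      = (\<integral>\<^sup>+j. ennreal (dyad j powr (p - p2)) * J j \<partial>count_space UNIV)"
      by (rule int_sum_shift[of "\<lambda>j. ennreal (dyad j powr (p - p2)) * J j" 1])
    also have "ennreal (K1 powr (\<theta> * p)) * ((\<integral>\<^sup>+j. ennreal (dyad j powr (p - p1)) * I j \<partial>count_space UNIV)
      + ennreal (2 powr (p2 - p)) * (\<integral>\<^sup>+j. ennreal (dyad j powr (p - p2)) * J j \<partial>count_space UNIV))
      \<le> ennreal (K1 powr (\<theta> * p)) * (ennreal E1 * ennreal X + ennreal (2 powr (p2 - p)) * (ennreal E2 * ennreal X))"
    proof (intro mult_left_mono add_mono)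
      have "(\<integral>\<^sup>+j. ennreal (dyad j powr (p - p1)) * I j \<partial>count_space UNIV) \<le> ennreal E1 * (\<integral>\<^sup>+x. epow (F x) p \<partial>M)"
        unfolding I_def E1_def using p by (intro dyadic_sum_tails) auto
      also have "\<dots> \<le> ennreal E1 * ennreal X" by (intro mult_left_mono FX) auto
      finally show "(\<integral>\<^sup>+j. ennreal (dyad j powr (p - p1)) * I j \<partial>count_space UNIV) \<le> ennreal E1 * ennreal X" .
      have "(\<integral>\<^sup>+j. ennreal (dyad j powr (p - p2)) * J j \<partial>count_space UNIV) \<le> ennreal E2 * (\<integral>\<^sup>+x. epow (F x) p \<partial>M)"
        unfolding J_def E2_def using p by (intro dyadic_sum_mins) auto
      also have "\<dots> \<le> ennreal E2 * ennreal X" by (intro mult_left_mono FX) auto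
      finally show "(\<integral>\<^sup>+j. ennreal (dyad j powr (p - p2)) * J j \<partial>count_space UNIV) \<le> ennreal E2 * ennreal X" .
    qed auto
    also have "\<dots> = ennreal (K1 powr (\<theta> * p) * (E1 * X + 2 powr (p2 - p) * (E2 * X)))"
      using E1 E2 X by (simp add: ennreal_mult ennreal_plus)
    finally have sum_le: "(\<integral>\<^sup>+j. ennreal (A j powr \<alpha> * c (j + 1) powr (\<theta> * p)) \<partial>count_space UNIV)
      \<le> ennreal (K1 powr (\<theta> * p) * (E1 * X + 2 powr (p2 - p) * (E2 * X)))" .
    have main: "in_sum_space M (H1 M D (ereal p1)) (H1 M D (ereal p2)) f \<and>
      K_sum \<theta> p (Kfun M (H1 M D (ereal p1)) (H1_norm M D (ereal p1)) (H1 M D (ereal p2)) (H1_norm M D (ereal p2)) f)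
      \<le> ennreal C * (\<integral>\<^sup>+j. ennreal (A j powr \<alpha> * c (j + 1) powr (\<theta> * p)) \<partial>count_space UNIV)"
      unfolding A_def I_def \<alpha>_def
      by (rule C(2)[OF _ _ haj _ X(1) FX c s2 H]) (simp_all add: F_def fun_eq_iff)
    have "ennreal C * (\<integral>\<^sup>+j. ennreal (A j powr \<alpha> * c (j + 1) powr (\<theta> * p)) \<partial>count_space UNIV)
      \<le> ennreal C * ennreal (K1 powr (\<theta> * p) * (E1 * X + 2 powr (p2 - p) * (E2 * X)))"
      by (intro mult_left_mono sum_le) auto
    also have "\<dots> = ennreal (C * (K1 powr (\<theta> * p) * (E1 * X + 2 powr (p2 - p) * (E2 * X))))"
      using C(1) E1 E2 X by (intro ennreal_mult[symmetric]) auto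
    also have "C * (K1 powr (\<theta> * p) * (E1 * X + 2 powr (p2 - p) * (E2 * X))) = C' * X"
      by (simp add: C'_def algebra_simps)
    finally show ?thesis using main by (meson order_trans)
  qed
  then show ?thesis using C' by blast
qed

text \<open>Now \<open>(1 - \<theta>) * p = p1\<close>, so the tail integral enters with exponent 1,
  and \<open>c j\<close> is a multiple of \<open>dyad j\<close>: only the tail series remains and no
  Young inequality is involved.\<close>

lemma K_sum_upper_infinity:
  assumes p: "0 < p1" "p1 < p" and \<theta>: "0 < \<theta>" "\<theta> < 1" "1 / p = (1 - \<theta>) / p1"
  shows "\<exists>C>0. \<forall>f h X. f \<in> borel_measurable M \<longrightarrow> h \<in> borel_measurable M \<longrightarrow> hajlasz M f h \<longrightarrow>
    0 \<le> X \<longrightarrow> (\<integral>\<^sup>+x. epow (ennreal \<bar>f x\<bar> + h x) p \<partial>M) \<le> ennreal X \<longrightarrow>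
    in_sum_space M (H1 M D (ereal p1)) (H1 M D \<infinity>) f \<and>
    K_sum \<theta> p (Kfun M (H1 M D (ereal p1)) (H1_norm M D (ereal p1)) (H1 M D \<infinity>) (H1_norm M D \<infinity>) f)
      \<le> ennreal (C * X)"
proof -
  have p0: "0 < p" using p by simp
  have e1: "(1 - \<theta>) * p = p1" using \<theta>(3) p p0 by (simp add: field_simps)
  have e2: "\<theta> * p = p - p1" using e1 by (simp add: algebra_simps)
  obtain C where C: "0 < C" "\<And>f h F X c Cc s2. f \<in> borel_measurable M \<Longrightarrow> h \<in> borel_measurable M \<Longrightarrow> hajlasz M f h \<Longrightarrow>
    F = (\<lambda>x. ennreal \<bar>f x\<bar> + h x) \<Longrightarrow> 0 \<le> X \<Longrightarrow> (\<integral>\<^sup>+x. epow (F x) p \<partial>M) \<le> ennreal X \<Longrightarrow>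
    (\<forall>j. 0 \<le> c j \<and> c j \<le> Cc * dyad j powr s2) \<Longrightarrow> 0 < s2 \<Longrightarrow>
    (\<forall>j g. trunc_of F (dyad j) g \<longrightarrow> H1 M D \<infinity> g \<and> H1_norm M D \<infinity> g \<le> ennreal (c j)) \<Longrightarrow>
    in_sum_space M (H1 M D (ereal p1)) (H1 M D \<infinity>) f \<and>
    K_sum \<theta> p (Kfun M (H1 M D (ereal p1)) (H1_norm M D (ereal p1)) (H1 M D \<infinity>) (H1_norm M D \<infinity>) f) \<le> ennreal C *
      (\<integral>\<^sup>+j. ennreal (enn2real (\<integral>\<^sup>+x. epow (F x * of_bool (ennreal (dyad j) < F x)) p1 \<partial>M) powr ((1 - \<theta>) * p / p1)
        * c (j + 1) powr (\<theta> * p)) \<partial>count_space UNIV)"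
    using K_truncation[OF p \<theta>(1,2), where ?P2.0 = \<infinity>] by blast
  \<comment> \<open>A truncation at level \<open>l\<close> has supremum at most \<open>l\<close> and
    Lipschitz constant \<open>2 * l\<close>, hence norm at most
    \<open>l + CD * (2 * l)\<close>.\<close>
  define K1 where "K1 = 1 + 2 * CD"
  have K1: "0 < K1" using CD_nonneg by (simp add: K1_def)
  define E1 where "E1 = 1 / (1 - 2 powr -(p - p1) :: real)"
  have E1: "0 < E1" using p by (simp add: E1_def powr_less_one)
  define C' where "C' = C * ((2 * K1) powr (p - p1) * E1)"
  have C': "0 < C'" using C(1) K1 E1 by (simp add: C'_def)
  have "in_sum_space M (H1 M D (ereal p1)) (H1 M D \<infinity>) f \<and>
    K_sum \<theta> p (Kfun M (H1 M D (ereal p1)) (H1_norm M D (ereal p1)) (H1 M D \<infinity>) (H1_norm M D \<infinity>) f)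
      \<le> ennreal (C' * X)"
    if [measurable]: "f \<in> borel_measurable M" "h \<in> borel_measurable M" and haj: "hajlasz M f h"
      and X: "0 \<le> X" "(\<integral>\<^sup>+x. epow (ennreal \<bar>f x\<bar> + h x) p \<partial>M) \<le> ennreal X" for f h X
  proof -
    define F where "F x = ennreal \<bar>f x\<bar> + h x" for x
    have [measurable]: "F \<in> borel_measurable M" unfolding F_def by measurable
    have FX: "(\<integral>\<^sup>+x. epow (F x) p \<partial>M) \<le> ennreal X" using X(2) by (simp add: F_def)
    define I where "I j = (\<integral>\<^sup>+x. epow (F x * of_bool (ennreal (dyad j) < F x)) p1 \<partial>M)" for j
    define A where "A j = enn2real (I j)" for j
    have I_fin: "I j < top" for j
    proof -
      have "I j \<le> ennreal (dyad j powr (p1 - p)) * (\<integral>\<^sup>+x. epow (F x) p \<partial>M)"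
        unfolding I_def using p by (intro nn_integral_tail_le) auto
      also have "\<dots> \<le> ennreal (dyad j powr (p1 - p)) * ennreal X" by (intro mult_left_mono FX) auto
      also have "\<dots> < top" by (simp add: ennreal_mult_less_top)
      finally show ?thesis .
    qed
    have IA: "I j = ennreal (A j)" "0 \<le> A j" for j using I_fin[of j] by (auto simp: A_def)
    define c where "c j = K1 * dyad j" for j
    have c: "\<forall>j. 0 \<le> c j \<and> c j \<le> K1 * dyad j powr 1" using K1 by (simp add: c_def)
    have H: "\<forall>j g. trunc_of F (dyad j) g \<longrightarrow> H1 M D \<infinity> g \<and> H1_norm M D \<infinity> g \<le> ennreal (c j)"
    proof (intro allI impI)
      fix j g assume "trunc_of F (dyad j) g"
      then have g: "g \<in> borel_measurable M" "(2 * dyad j)-lipschitz_on UNIV g" "\<And>x. \<bar>g x\<bar> \<le> dyad j"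
        by (auto simp: trunc_of_def)
      have "dyad j + CD * (2 * dyad j) = c j" by (simp add: c_def K1_def algebra_simps)
      then show "H1 M D \<infinity> g \<and> H1_norm M D \<infinity> g \<le> ennreal (c j)"
        using lipschitz_imp_H1_infinity[OF g] by simp
    qed
    have "(\<integral>\<^sup>+j. ennreal (A j powr ((1 - \<theta>) * p / p1) * c (j + 1) powr (\<theta> * p)) \<partial>count_space UNIV)
      = (\<integral>\<^sup>+j. ennreal ((2 * K1) powr (p - p1)) * (ennreal (dyad j powr (p - p1)) * I j) \<partial>count_space UNIV)"
    proof (rule nn_integral_cong)
      fix j
      have "c (j + 1) = (2 * K1) * dyad j" unfolding c_def dyad_Suc by simp
      then have "c (j + 1) powr (\<theta> * p) = (2 * K1) powr (p - p1) * dyad j powr (p - p1)"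
        using K1 by (simp add: e2 powr_mult)
      moreover have "A j powr ((1 - \<theta>) * p / p1) = A j" using p IA(2)[of j] by (simp add: e1)
      ultimately have "A j powr ((1 - \<theta>) * p / p1) * c (j + 1) powr (\<theta> * p)
        = (2 * K1) powr (p - p1) * (dyad j powr (p - p1) * A j)" by simp
      then show "ennreal (A j powr ((1 - \<theta>) * p / p1) * c (j + 1) powr (\<theta> * p))
        = ennreal ((2 * K1) powr (p - p1)) * (ennreal (dyad j powr (p - p1)) * I j)"
        using IA(2)[of j] unfolding IA(1) by (simp only: ennreal_mult powr_ge_zero mult_nonneg_nonneg)
    qed
    also have "\<dots> = ennreal ((2 * K1) powr (p - p1)) * (\<integral>\<^sup>+j. ennreal (dyad j powr (p - p1)) * I j \<partial>count_space UNIV)"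
      by (intro nn_integral_cmult) auto
    also have "\<dots> \<le> ennreal ((2 * K1) powr (p - p1)) * (ennreal E1 * ennreal X)"
    proof (intro mult_left_mono)
      have "(\<integral>\<^sup>+j. ennreal (dyad j powr (p - p1)) * I j \<partial>count_space UNIV) \<le> ennreal E1 * (\<integral>\<^sup>+x. epow (F x) p \<partial>M)"
        unfolding I_def E1_def using p by (intro dyadic_sum_tails) auto
      also have "\<dots> \<le> ennreal E1 * ennreal X" by (intro mult_left_mono FX) auto
      finally show "(\<integral>\<^sup>+j. ennreal (dyad j powr (p - p1)) * I j \<partial>count_space UNIV) \<le> ennreal E1 * ennreal X" .
    qed simp
    also have "\<dots> = ennreal ((2 * K1) powr (p - p1) * (E1 * X))" using E1 X by (simp add: ennreal_mult)
    finally have sum_le: "(\<integral>\<^sup>+j. ennreal (A j powr ((1 - \<theta>) * p / p1) * c (j + 1) powr (\<theta> * p)) \<partial>count_space UNIV)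
      \<le> ennreal ((2 * K1) powr (p - p1) * (E1 * X))" .
    have main: "in_sum_space M (H1 M D (ereal p1)) (H1 M D \<infinity>) f \<and>
      K_sum \<theta> p (Kfun M (H1 M D (ereal p1)) (H1_norm M D (ereal p1)) (H1 M D \<infinity>) (H1_norm M D \<infinity>) f)
      \<le> ennreal C * (\<integral>\<^sup>+j. ennreal (A j powr ((1 - \<theta>) * p / p1) * c (j + 1) powr (\<theta> * p)) \<partial>count_space UNIV)"
      unfolding A_def I_def
      by (rule C(2)[OF _ _ haj _ X(1) FX c _ H]) (simp_all add: F_def fun_eq_iff)
    have "ennreal C * (\<integral>\<^sup>+j. ennreal (A j powr ((1 - \<theta>) * p / p1) * c (j + 1) powr (\<theta> * p)) \<partial>count_space UNIV)
      \<le> ennreal C * ennreal ((2 * K1) powr (p - p1) * (E1 * X))"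
      by (intro mult_left_mono sum_le) auto
    also have "\<dots> = ennreal (C' * X)"
      using C(1) E1 X by (simp add: ennreal_mult[symmetric] C'_def mult.assoc)
    finally show ?thesis using main by (meson order_trans)
  qed
  then show ?thesis using C' by blast
qed

end

section \<open>Bounding the Sobolev norm by the K-functional\<close>

lemma (in doubling_space) maxf_add_le:
  assumes [measurable]: "g \<in> borel_measurable M" "h \<in> borel_measurable M"
  shows "maxf M (\<lambda>y. g y + h y) x \<le> maxf M g x + maxf M h x"
  unfolding maxf_def[of M "\<lambda>y. g y + h y"]
proof (rule SUP_least)
  fix b assume "b \<in> {b. 0 < snd b \<and> x \<in> ball (fst b) (snd b)}"
  then show "mavg M (\<lambda>y. g y + h y) (fst b) (snd b) \<le> maxf M g x + maxf M h x"
    by (simp add: mavg_add add_mono mavg_le_maxf)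
qed

context cheeger_space
begin

lemma H1_measurable: "H1 M D P f \<Longrightarrow> f \<in> borel_measurable M"
  unfolding H1_def H1_approx_def by (auto split: if_splits)

text \<open>The exponent \<open>e\<close> is chosen differently at the two end points, so that thresholds of the same size
  give the same bound \<open>dyad k powr \<tau>\<close> on the measure of the superlevel set.\<close>
definition weak_bound :: "ereal \<Rightarrow> real \<Rightarrow> real \<Rightarrow> bool" where
  "weak_bound P e \<tau> \<longleftrightarrow> (\<exists>C>0. \<forall>f N. H1 M D P f \<longrightarrow> H1_norm M D P f < ennreal N \<longrightarrow>
    (\<exists>h\<in>borel_measurable M. hajlasz M f h \<and> (AE x in M. h x < top) \<and> (AE x in M. maxf M h x < top) \<and>
      (\<forall>k::int. emeasure M {x. ennreal (C * N * dyad k powr -e) < ennreal \<bar>f x\<bar> + ennreal (4 * Csharp) * maxf M h x}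
        \<le> ennreal (dyad k powr \<tau>))))"

text \<open>Chebyshev's inequality for \<open>\<bar>f\<bar> + 4 * Csharp * maxf h\<close>, which is
  in L^p by the maximal theorem. The factor \<open>4 * Csharp\<close> is what
  \<open>sharp_le_maxf\<close> makes of \<open>Csharp * sharp\<close>. The root in \<open>C\<close>
  is calibrated so that the measure bound is exactly \<open>dyad k powr \<tau>\<close>.\<close>

lemma weak_bound_finite:
  assumes p: "q < p" and e: "e * p = \<tau>"
  shows "weak_bound (ereal p) e \<tau>"
proof -
  have p1: "1 < p" using p q1 by simp
  then have p0: "0 < p" by simp
  obtain C1 where C1: "0 < C1" "\<And>f N. H1_norm M D (ereal p) f < ennreal N \<Longrightarrow>
    (\<exists>h\<in>borel_measurable M. hajlasz M f h \<and>
      (\<integral>\<^sup>+x. epow (ennreal \<bar>f x\<bar> + h x) p \<partial>M) \<le> ennreal (C1 * N powr p))"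
    using H1_norm_less_imp_hajlasz[OF p] by blast
  obtain Cs where Cs: "0 < Cs" "\<And>g::'a \<Rightarrow> ennreal. g \<in> borel_measurable M \<Longrightarrow>
    (\<integral>\<^sup>+x. epow (maxf M g x) p \<partial>M) \<le> ennreal Cs * (\<integral>\<^sup>+x. epow (g x) p \<partial>M)"
    using maxf_strong_type[OF p1] by blast
  define c where "c = 4 * Csharp"
  have c: "0 < c" using Csharp_pos by (simp add: c_def)
  define C2 where "C2 = 2 powr p * (1 + c powr p * Cs) * C1"
  have C2: "0 < C2" using C1(1) Cs(1) by (simp add: C2_def add_pos_nonneg)
  define C where "C = C2 powr (1 / p)"
  have C: "0 < C" using C2 by (simp add: C_def)
  have CC: "C powr p = C2" using C2 p0 by (simp add: C_def powr_powr)
  show ?thesis unfolding weak_bound_def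
  proof (intro exI[of _ C] conjI allI impI C)
    fix f N assume H: "H1 M D (ereal p) f" and less: "H1_norm M D (ereal p) f < ennreal N"
    have N: "0 < N" using less by (cases "0 < N") (auto simp: ennreal_neg)
    have [measurable]: "f \<in> borel_measurable M" by (rule H1_measurable[OF H])
    obtain h where h: "h \<in> borel_measurable M" "hajlasz M f h"
      and hI: "(\<integral>\<^sup>+x. epow (ennreal \<bar>f x\<bar> + h x) p \<partial>M) \<le> ennreal (C1 * N powr p)"
      using C1(2)[OF less] by blast
    note [measurable] = h(1)
    have le_f: "(\<integral>\<^sup>+x. epow (ennreal \<bar>f x\<bar>) p \<partial>M) \<le> ennreal (C1 * N powr p)"
    proof -
      have "(\<integral>\<^sup>+x. epow (ennreal \<bar>f x\<bar>) p \<partial>M) \<le> (\<integral>\<^sup>+x. epow (ennreal \<bar>f x\<bar> + h x) p \<partial>M)"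
        using p0 by (intro nn_integral_mono epow_mono) auto
      then show ?thesis using hI by order
    qed
    have le_h: "(\<integral>\<^sup>+x. epow (h x) p \<partial>M) \<le> ennreal (C1 * N powr p)"
    proof -
      have "(\<integral>\<^sup>+x. epow (h x) p \<partial>M) \<le> (\<integral>\<^sup>+x. epow (ennreal \<bar>f x\<bar> + h x) p \<partial>M)"
        using p0 by (intro nn_integral_mono epow_mono) auto
      then show ?thesis using hI by order
    qed
    have le_m: "(\<integral>\<^sup>+x. epow (maxf M h x) p \<partial>M) \<le> ennreal (Cs * (C1 * N powr p))"
    proof -
      have "(\<integral>\<^sup>+x. epow (maxf M h x) p \<partial>M) \<le> ennreal Cs * (\<integral>\<^sup>+x. epow (h x) p \<partial>M)" by (rule Cs(2)[OF h(1)])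
      also have "\<dots> \<le> ennreal Cs * ennreal (C1 * N powr p)" by (intro mult_left_mono le_h) auto
      finally show ?thesis using Cs(1) C1(1) by (simp add: ennreal_mult)
    qed
    have AE_fin: "AE x in M. g x < top"
      if [measurable]: "g \<in> borel_measurable M" and "(\<integral>\<^sup>+x. epow (g x) p \<partial>M) \<le> ennreal r" for g r
    proof -
      have "AE x in M. epow (g x) p \<noteq> \<infinity>"
        using that(2) by (intro nn_integral_PInf_AE) (auto simp: top_unique)
      then show ?thesis by eventually_elim (simp add: less_top)
    qed
    define G where "G x = ennreal \<bar>f x\<bar> + ennreal c * maxf M h x" for x
    have [measurable]: "G \<in> borel_measurable M" unfolding G_def by measurable
    have le_G: "(\<integral>\<^sup>+x. epow (G x) p \<partial>M) \<le> ennreal (C2 * N powr p)"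
    proof -
      have "(\<integral>\<^sup>+x. epow (G x) p \<partial>M)
        \<le> (\<integral>\<^sup>+x. ennreal (2 powr p) * (epow (ennreal \<bar>f x\<bar>) p + ennreal (c powr p) * epow (maxf M h x) p) \<partial>M)"
        using epow_add_le[OF p0] c p0 unfolding G_def by (intro nn_integral_mono) (simp add: epow_cmult[symmetric])
      also have "\<dots> = ennreal (2 powr p) * ((\<integral>\<^sup>+x. epow (ennreal \<bar>f x\<bar>) p \<partial>M) + ennreal (c powr p) * (\<integral>\<^sup>+x. epow (maxf M h x) p \<partial>M))"
        by (simp add: nn_integral_cmult nn_integral_add)
      also have "\<dots> \<le> ennreal (2 powr p) * (ennreal (C1 * N powr p) + ennreal (c powr p) * ennreal (Cs * (C1 * N powr p)))"
        by (intro mult_left_mono add_mono le_f le_m) auto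
      also have "\<dots> = ennreal (2 powr p * (C1 * N powr p + c powr p * (Cs * (C1 * N powr p))))"
        using C1(1) Cs(1) by (simp add: ennreal_mult ennreal_plus)
      also have "2 powr p * (C1 * N powr p + c powr p * (Cs * (C1 * N powr p))) = C2 * N powr p"
        by (simp add: C2_def algebra_simps)
      finally show ?thesis .
    qed
    have "emeasure M {x. ennreal (C * N * dyad k powr -e) < G x} \<le> ennreal (dyad k powr \<tau>)" for k :: int
    proof -
      define s where "s = C * N * dyad k powr -e"
      have s: "0 < s" using C N by (simp add: s_def)
      have "ennreal (s powr p) * emeasure M {x. ennreal s < G x} = (\<integral>\<^sup>+x. ennreal (s powr p) * of_bool (ennreal s < G x) \<partial>M)"
        by (simp add: nn_integral_cmult nn_integral_of_bool)
      also have "\<dots> \<le> (\<integral>\<^sup>+x. epow (G x) p \<partial>M)"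
      proof (rule nn_integral_mono)
        fix x
        show "ennreal (s powr p) * of_bool (ennreal s < G x) \<le> epow (G x) p"
          using epow_mono[of "ennreal s" "G x" p] s p0 by (auto simp: epow_ennreal)
      qed
      also note le_G
      finally have "ennreal (1 / s powr p) * (ennreal (s powr p) * emeasure M {x. ennreal s < G x})
        \<le> ennreal (1 / s powr p) * ennreal (C2 * N powr p)" by (intro mult_left_mono) auto
      moreover have "ennreal (1 / s powr p) * (ennreal (s powr p) * emeasure M {x. ennreal s < G x}) = emeasure M {x. ennreal s < G x}"
        using s by (simp add: mult.assoc[symmetric] ennreal_mult[symmetric])
      moreover have "ennreal (1 / s powr p) * ennreal (C2 * N powr p) = ennreal (dyad k powr \<tau>)"
      proof -
        have "s powr p = (C2 * N powr p) * (dyad k powr -e) powr p"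
          using C N by (simp only: s_def powr_mult CC)
        also have "(dyad k powr -e) powr p = dyad k powr -\<tau>" unfolding powr_powr[of "dyad k"] by (simp add: e[symmetric])
        finally have "1 / s powr p * (C2 * N powr p) = dyad k powr \<tau>"
          using C2 N s by (simp add: powr_minus field_simps)
        then show ?thesis using C2 by (subst ennreal_mult[symmetric]) auto
      qed
      ultimately show ?thesis by (simp add: s_def)
    qed
    then show "\<exists>h\<in>borel_measurable M. hajlasz M f h \<and> (AE x in M. h x < top) \<and> (AE x in M. maxf M h x < top) \<and>
      (\<forall>k::int. emeasure M {x. ennreal (C * N * dyad k powr -e) < ennreal \<bar>f x\<bar> + ennreal (4 * Csharp) * maxf M h x}
        \<le> ennreal (dyad k powr \<tau>))"
      using h AE_fin[OF h(1) le_h] AE_fin[OF maxf_measurable le_m]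
      by (intro bexI[of _ h]) (auto simp: G_def c_def)
  qed
qed

text \<open>With \<open>e = 0\<close> the threshold is \<open>C * N\<close>, which the function
  exceeds only on a null set; therefore every \<open>\<tau>\<close> is admissible and can be matched
  to the other end point.\<close>

lemma weak_bound_infinity: "weak_bound \<infinity> 0 \<tau>"
proof -
  define C where "C = 1 + 4 * Csharp * Chaj"
  have C: "0 < C" using Csharp_pos Chaj_pos by (simp add: C_def add_pos_pos)
  show ?thesis unfolding weak_bound_def
  proof (intro exI[of _ C] conjI allI impI C)
    fix f N assume H: "H1 M D \<infinity> f" and less: "H1_norm M D \<infinity> f < ennreal N"
    have N: "0 < N" using less by (cases "0 < N") (auto simp: ennreal_neg)
    have [measurable]: "f \<in> borel_measurable M" by (rule H1_measurable[OF H])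
    define h where "h = (\<lambda>_::'a. ennreal (Chaj * N))"
    have h: "hajlasz M f h" "AE x in M. ennreal \<bar>f x\<bar> \<le> ennreal N"
      using H1_norm_infinity_less_imp_hajlasz[OF less] by (auto simp: h_def)
    have [measurable]: "h \<in> borel_measurable M" by (simp add: h_def)
    have m: "maxf M h x \<le> ennreal (Chaj * N)" for x by (rule maxf_le_const_AE) (simp add: h_def)
    have m_fin: "maxf M h x < top" for x using m[of x] by (auto intro: le_less_trans)
    have "emeasure M {x. ennreal (C * N * dyad k powr -0) < ennreal \<bar>f x\<bar> + ennreal (4 * Csharp) * maxf M h x} = 0" for k :: int
    proof -
      have "AE x in M. \<not> ennreal (C * N) < ennreal \<bar>f x\<bar> + ennreal (4 * Csharp) * maxf M h x"
        using h(2)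
      proof eventually_elim
        case (elim x)
        have "ennreal \<bar>f x\<bar> + ennreal (4 * Csharp) * maxf M h x \<le> ennreal N + ennreal (4 * Csharp) * ennreal (Chaj * N)"
          by (intro add_mono mult_left_mono elim m) auto
        also have "\<dots> = ennreal N + ennreal (4 * Csharp * (Chaj * N))"
          using Csharp_pos Chaj_pos N by (simp add: ennreal_mult)
        also have "\<dots> = ennreal (N + 4 * Csharp * (Chaj * N))"
          using Csharp_pos Chaj_pos N by (intro ennreal_plus[symmetric]) auto
        also have "N + 4 * Csharp * (Chaj * N) = C * N" by (simp add: C_def algebra_simps)
        finally show ?case by (simp add: not_less)
      qed
      then have "emeasure M {x \<in> space M. ennreal (C * N) < ennreal \<bar>f x\<bar> + ennreal (4 * Csharp) * maxf M h x} = 0"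
        by (subst (asm) AE_iff_measurable[OF _ refl]) auto
      then show ?thesis by simp
    qed
    then show "\<exists>h\<in>borel_measurable M. hajlasz M f h \<and> (AE x in M. h x < top) \<and> (AE x in M. maxf M h x < top) \<and>
      (\<forall>k::int. emeasure M {x. ennreal (C * N * dyad k powr -0) < ennreal \<bar>f x\<bar> + ennreal (4 * Csharp) * maxf M h x}
        \<le> ennreal (dyad k powr \<tau>))"
      using h(1) m_fin by (intro bexI[of _ h]) (auto simp: h_def[symmetric], simp add: h_def)
  qed
qed

text \<open>A splitting close to optimal at \<open>t = dyad k\<close> has norms below
  \<open>\<kappa>\<close> and \<open>\<kappa> / t\<close>. The sharp function of \<open>f\<close> is
  controlled by the sum of the two maximal functions, so it is large only where one of them is.
  Finiteness of these maximal functions also makes almost every point a Lebesgue point, and this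
  turns the sharp function into a Hajlasz gradient.\<close>

lemma K_tail:
  fixes P2 :: ereal
  assumes "weak_bound (ereal p1) \<sigma> \<tau>" "weak_bound P2 (\<sigma> - 1) \<tau>"
  shows "\<exists>C>0. \<forall>f k \<kappa>. f \<in> borel_measurable M \<longrightarrow>
    Kfun M (H1 M D (ereal p1)) (H1_norm M D (ereal p1)) (H1 M D P2) (H1_norm M D P2) f (dyad k) < ennreal \<kappa> \<longrightarrow>
    hajlasz M f (\<lambda>x. ennreal Csharp * sharp M f x) \<and>
    emeasure M {x. ennreal (C * dyad k powr -\<sigma> * \<kappa>) < ennreal \<bar>f x\<bar> + ennreal Csharp * sharp M f x}
      \<le> ennreal (2 * dyad k powr \<tau>)"
proof -
  obtain C0 where C0: "0 < C0" "\<And>f N. H1 M D (ereal p1) f \<Longrightarrow> H1_norm M D (ereal p1) f < ennreal N \<Longrightarrow>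
    (\<exists>h\<in>borel_measurable M. hajlasz M f h \<and> (AE x in M. h x < top) \<and> (AE x in M. maxf M h x < top) \<and>
      (\<forall>k::int. emeasure M {x. ennreal (C0 * N * dyad k powr -\<sigma>) < ennreal \<bar>f x\<bar> + ennreal (4 * Csharp) * maxf M h x}
        \<le> ennreal (dyad k powr \<tau>)))"
    using assms(1) unfolding weak_bound_def by blast
  obtain C1 where C1: "0 < C1" "\<And>f N. H1 M D P2 f \<Longrightarrow> H1_norm M D P2 f < ennreal N \<Longrightarrow>
    (\<exists>h\<in>borel_measurable M. hajlasz M f h \<and> (AE x in M. h x < top) \<and> (AE x in M. maxf M h x < top) \<and>
      (\<forall>k::int. emeasure M {x. ennreal (C1 * N * dyad k powr -(\<sigma> - 1)) < ennreal \<bar>f x\<bar> + ennreal (4 * Csharp) * maxf M h x}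
        \<le> ennreal (dyad k powr \<tau>)))"
    using assms(2) unfolding weak_bound_def by blast
  have "hajlasz M f (\<lambda>x. ennreal Csharp * sharp M f x) \<and>
    emeasure M {x. ennreal ((C0 + C1) * dyad k powr -\<sigma> * \<kappa>) < ennreal \<bar>f x\<bar> + ennreal Csharp * sharp M f x}
      \<le> ennreal (2 * dyad k powr \<tau>)"
    if [measurable]: "f \<in> borel_measurable M"
      and less: "Kfun M (H1 M D (ereal p1)) (H1_norm M D (ereal p1)) (H1 M D P2) (H1_norm M D P2) f (dyad k) < ennreal \<kappa>"
    for f k \<kappa>
  proof -
    obtain f0 f1 where f01: "H1 M D (ereal p1) f0" "H1 M D P2 f1" "AE x in M. f x = f0 x + f1 x"
      and N: "H1_norm M D (ereal p1) f0 + ennreal (dyad k) * H1_norm M D P2 f1 < ennreal \<kappa>"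
      using less unfolding Kfun_def Inf_less_iff by auto
    have \<kappa>: "0 < \<kappa>" using N by (cases "0 < \<kappa>") (auto simp: ennreal_neg)
    have [measurable]: "f0 \<in> borel_measurable M" "f1 \<in> borel_measurable M"
      using f01 H1_measurable by auto
    have "H1_norm M D (ereal p1) f0 \<le> H1_norm M D (ereal p1) f0 + ennreal (dyad k) * H1_norm M D P2 f1" by simp
    then have N0: "H1_norm M D (ereal p1) f0 < ennreal \<kappa>" using N by order
    have "ennreal (dyad k) * H1_norm M D P2 f1 \<le> H1_norm M D (ereal p1) f0 + ennreal (dyad k) * H1_norm M D P2 f1" by simp
    then have N1': "ennreal (dyad k) * H1_norm M D P2 f1 < ennreal \<kappa>" using N by order
    have N1: "H1_norm M D P2 f1 < ennreal (\<kappa> / dyad k)"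
    proof (rule ccontr)
      assume "\<not> ?thesis"
      then have "ennreal (dyad k) * ennreal (\<kappa> / dyad k) \<le> ennreal (dyad k) * H1_norm M D P2 f1"
        by (intro mult_left_mono) auto
      also have "ennreal (dyad k) * ennreal (\<kappa> / dyad k) = ennreal \<kappa>"
        using \<kappa> by (subst ennreal_mult[symmetric]) auto
      finally show False using N1' by order
    qed
    obtain h0 where h0: "h0 \<in> borel_measurable M" "hajlasz M f0 h0" "AE x in M. h0 x < top" "AE x in M. maxf M h0 x < top"
      "\<And>k. emeasure M {x. ennreal (C0 * \<kappa> * dyad k powr -\<sigma>) < ennreal \<bar>f0 x\<bar> + ennreal (4 * Csharp) * maxf M h0 x}
        \<le> ennreal (dyad k powr \<tau>)"
      using C0(2)[OF f01(1) N0] by blast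
    obtain h1 where h1: "h1 \<in> borel_measurable M" "hajlasz M f1 h1" "AE x in M. h1 x < top" "AE x in M. maxf M h1 x < top"
      "\<And>k'. emeasure M {x. ennreal (C1 * (\<kappa> / dyad k) * dyad k' powr -(\<sigma> - 1)) < ennreal \<bar>f1 x\<bar> + ennreal (4 * Csharp) * maxf M h1 x}
        \<le> ennreal (dyad k' powr \<tau>)"
      using C1(2)[OF f01(2) N1] by blast
    note [measurable] = h0(1) h1(1)
    define h where "h x = h0 x + h1 x" for x
    have [measurable]: "h \<in> borel_measurable M" unfolding h_def by measurable
    have "hajlasz M (\<lambda>x. f0 x + f1 x) h"
      unfolding h_def by (rule hajlasz_lincomb[OF h0(2) h1(2)]) simp
    then have haj: "hajlasz M f h" by (rule hajlasz_mono_AE) (use f01(3) in \<open>auto elim: eventually_mono\<close>)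
    have m_le: "maxf M h x \<le> maxf M h0 x + maxf M h1 x" for x
      unfolding h_def by (rule maxf_add_le) measurable
    have "AE x in M. h x < top" using h0(3) h1(3) by eventually_elim (simp add: h_def)
    moreover have "AE x in M. maxf M h x < top"
      using h0(4) h1(4) by eventually_elim (rule le_less_trans[OF m_le], simp)
    ultimately have "AE x in M. leb_pt M f x" by (intro leb_pt_hajlasz[OF haj]) auto
    then obtain Z where Z: "Z \<in> null_sets M" "\<And>x. x \<notin> Z \<Longrightarrow> leb_pt M f x" using AE_null_set by blast
    have haj': "hajlasz M f (\<lambda>x. ennreal Csharp * sharp M f x)"
      unfolding hajlasz_def by (intro bexI[OF _ Z(1)] allI impI sharp_pointwise Z) auto
    define G0 G1 G where "G0 x = ennreal \<bar>f0 x\<bar> + ennreal (4 * Csharp) * maxf M h0 x"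
      and "G1 x = ennreal \<bar>f1 x\<bar> + ennreal (4 * Csharp) * maxf M h1 x"
      and "G x = ennreal \<bar>f x\<bar> + ennreal Csharp * sharp M f x" for x
    have [measurable]: "G0 \<in> borel_measurable M" "G1 \<in> borel_measurable M" "G \<in> borel_measurable M"
      unfolding G0_def G1_def G_def by measurable
    have G_le: "AE x in M. G x \<le> G0 x + G1 x"
      using f01(3)
    proof eventually_elim
      case (elim x)
      have "ennreal \<bar>f x\<bar> \<le> ennreal (\<bar>f0 x\<bar> + \<bar>f1 x\<bar>)" unfolding elim by (intro ennreal_leI) simp
      also have "\<dots> = ennreal \<bar>f0 x\<bar> + ennreal \<bar>f1 x\<bar>" by simp
      finally have 1: "ennreal \<bar>f x\<bar> \<le> ennreal \<bar>f0 x\<bar> + ennreal \<bar>f1 x\<bar>" .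
      have "ennreal Csharp * sharp M f x \<le> ennreal Csharp * (4 * maxf M h x)"
        by (intro mult_left_mono sharp_le_maxf haj) auto
      also have "\<dots> = ennreal (4 * Csharp) * maxf M h x" using Csharp_pos by (simp add: ennreal_mult mult_ac)
      also have "\<dots> \<le> ennreal (4 * Csharp) * (maxf M h0 x + maxf M h1 x)" by (intro mult_left_mono m_le) auto
      also have "\<dots> = ennreal (4 * Csharp) * maxf M h0 x + ennreal (4 * Csharp) * maxf M h1 x" by (rule distrib_left)
      finally have "G x \<le> (ennreal \<bar>f0 x\<bar> + ennreal \<bar>f1 x\<bar>)
        + (ennreal (4 * Csharp) * maxf M h0 x + ennreal (4 * Csharp) * maxf M h1 x)"
        unfolding G_def by (intro add_mono 1)
      then show ?case by (simp add: G0_def G1_def add_ac)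
    qed
    define s0 s1 where "s0 = C0 * \<kappa> * dyad k powr -\<sigma>" and "s1 = C1 * (\<kappa> / dyad k) * dyad k powr -(\<sigma> - 1)"
    have s: "0 \<le> s0" "0 \<le> s1" using C0(1) C1(1) \<kappa> by (auto simp: s0_def s1_def)
    \<comment> \<open>The exponent \<open>\<sigma> - 1\<close> compensates the division of
      \<open>\<kappa>\<close> by \<open>dyad k\<close>: both thresholds are multiples of
      \<open>dyad k powr -\<sigma> * \<kappa>\<close>.\<close>
    have "dyad k powr -(\<sigma> - 1) = dyad k * dyad k powr -\<sigma>"
    proof -
      have "dyad k powr -(\<sigma> - 1) = dyad k powr (1 + -\<sigma>)" by simp
      also have "\<dots> = dyad k powr 1 * dyad k powr -\<sigma>" by (rule powr_add)
      finally show ?thesis by simp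
    qed
    then have s01: "(C0 + C1) * dyad k powr -\<sigma> * \<kappa> = s0 + s1"
      by (simp add: s0_def s1_def algebra_simps)
    have sets: "{x. ennreal a < g x} \<in> sets M" if "g \<in> borel_measurable M" for a and g :: "'a \<Rightarrow> ennreal"
    proof -
      note [measurable] = that
      have "{x \<in> space M. ennreal a < g x} \<in> sets M" by measurable
      then show ?thesis by simp
    qed
    have "emeasure M {x. ennreal (s0 + s1) < G x} \<le> emeasure M ({x. ennreal s0 < G0 x} \<union> {x. ennreal s1 < G1 x})"
    proof (rule emeasure_mono_AE)
      show "AE x in M. x \<in> {x. ennreal (s0 + s1) < G x} \<longrightarrow> x \<in> {x. ennreal s0 < G0 x} \<union> {x. ennreal s1 < G1 x}"
        using G_le
      proof eventually_elim
        case (elim x)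
        show ?case
        proof (rule impI, rule ccontr)
          assume 1: "x \<in> {x. ennreal (s0 + s1) < G x}" and 2: "x \<notin> {x. ennreal s0 < G0 x} \<union> {x. ennreal s1 < G1 x}"
          have "G x \<le> G0 x + G1 x" by (rule elim)
          also have "\<dots> \<le> ennreal s0 + ennreal s1" using 2 by (intro add_mono) auto
          also have "\<dots> = ennreal (s0 + s1)" using s by (intro ennreal_plus[symmetric])
          finally show False using 1 by simp
        qed
      qed
      show "{x. ennreal s0 < G0 x} \<union> {x. ennreal s1 < G1 x} \<in> sets M"
        by (intro sets.Un sets) measurable
    qed
    also have "\<dots> \<le> emeasure M {x. ennreal s0 < G0 x} + emeasure M {x. ennreal s1 < G1 x}"
      by (intro emeasure_subadditive sets) measurable
    also have "\<dots> \<le> ennreal (dyad k powr \<tau>) + ennreal (dyad k powr \<tau>)"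
      unfolding s0_def s1_def G0_def G1_def by (intro add_mono h0(5) h1(5))
    also have "\<dots> = ennreal (2 * dyad k powr \<tau>)" by (simp add: ennreal_plus[symmetric] del: ennreal_plus)
    finally show ?thesis using haj' unfolding s01 G_def by blast
  qed
  moreover have "0 < C0 + C1" using C0 C1 by simp
  ultimately show ?thesis by blast
qed

text \<open>\<open>tail_sum\<close> is applied to \<open>\<bar>f\<bar> + Csharp * sharp f\<close>,
  whose second summand is a Hajlasz gradient; the resulting L^p bound returns to the Sobolev space
  through \<open>hajlasz_imp_H1\<close>.\<close>

lemma K_sum_lower:
  fixes P2 :: ereal
  assumes p: "0 < p1" "p1 < p" and \<sigma>: "0 < \<sigma>" "\<theta> < \<sigma>" "\<sigma> * (p - p1) = \<theta> * p"
    and weak: "weak_bound (ereal p1) \<sigma> (\<sigma> * p1)" "weak_bound P2 (\<sigma> - 1) (\<sigma> * p1)"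
  defines "\<K> \<equiv> Kfun M (H1 M D (ereal p1)) (H1_norm M D (ereal p1)) (H1 M D P2) (H1_norm M D P2)"
  shows "\<exists>C>0. \<forall>f. f \<in> borel_measurable M \<longrightarrow> K_sum \<theta> p (\<K> f) < top \<longrightarrow>
    H1 M D (ereal p) f \<and> H1_norm M D (ereal p) f \<le> ennreal C * epow (K_sum \<theta> p (\<K> f)) (1 / p)"
proof -
  have p0: "0 < p" using p by simp
  obtain C where C: "0 < C" "\<And>f k \<kappa>. f \<in> borel_measurable M \<Longrightarrow> \<K> f (dyad k) < ennreal \<kappa> \<Longrightarrow>
    hajlasz M f (\<lambda>x. ennreal Csharp * sharp M f x) \<and>
    emeasure M {x. ennreal (C * dyad k powr -\<sigma> * \<kappa>) < ennreal \<bar>f x\<bar> + ennreal Csharp * sharp M f x}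
      \<le> ennreal (2 * dyad k powr (\<sigma> * p1))"
    using K_tail[OF weak] unfolding \<K>_def by blast
  define C2 where "C2 = 2 * (2 powr \<sigma> * C) powr p"
  have C2: "0 < C2" using C by (simp add: C2_def)
  define C3 where "C3 = 2 * (1 + 2 * CD) * C2 powr (1 / p)"
  have C3: "0 < C3" using C2 CD_nonneg by (simp add: C3_def)
  have "H1 M D (ereal p) f \<and> H1_norm M D (ereal p) f \<le> ennreal C3 * epow (K_sum \<theta> p (\<K> f)) (1 / p)"
    if [measurable]: "f \<in> borel_measurable M" and fin: "K_sum \<theta> p (\<K> f) < top" for f
  proof -
    have K_fin: "\<K> f (dyad k) < top" for k
    proof -
      have "ennreal (dyad k powr -(\<theta> * p)) * epow (\<K> f (dyad k)) p \<le> K_sum \<theta> p (\<K> f)"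
        unfolding K_sum_def by (rule int_sum_ge)
      also note fin
      finally show ?thesis by (auto simp: ennreal_mult_less_top ennreal_eq_0_iff)
    qed
    define \<kappa> where "\<kappa> k = enn2real (\<K> f (dyad k))" for k
    have \<kappa>K: "\<K> f (dyad k) = ennreal (\<kappa> k)" "0 \<le> \<kappa> k" for k using K_fin[of k] by (auto simp: \<kappa>_def)
    have \<kappa>_mono: "\<kappa> (k - 1) \<le> \<kappa> k" for k
    proof -
      have "dyad (k - 1) \<le> dyad k" by simp
      then have "\<K> f (dyad (k - 1)) \<le> \<K> f (dyad k)" unfolding \<K>_def by (intro Kfun_mono) auto
      then show ?thesis using \<kappa>K[of k] \<kappa>K[of "k - 1"] by simp
    qed
    have Ks: "K_sum \<theta> p (\<K> f) = (\<integral>\<^sup>+k. ennreal (dyad k powr -(\<theta> * p) * \<kappa> k powr p) \<partial>count_space UNIV)"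
      unfolding K_sum_def
      by (intro nn_integral_cong) (simp add: \<kappa>K epow_ennreal ennreal_mult[symmetric])
    define G where "G x = ennreal \<bar>f x\<bar> + ennreal Csharp * sharp M f x" for x
    have [measurable]: "G \<in> borel_measurable M" unfolding G_def by measurable
    have G_int: "(\<integral>\<^sup>+x. epow (G x) p \<partial>M) \<le> ennreal C2 * K_sum \<theta> p (\<K> f)"
      unfolding Ks C2_def
    proof (rule tail_sum[where \<kappa> = \<kappa> and G = G, OF _ \<kappa>K(2) \<kappa>_mono C(1) p(1) p0 \<sigma>])
      show "emeasure M {x. ennreal (C * dyad k powr -\<sigma> * \<kappa>') < G x} \<le> ennreal (2 * dyad k powr (\<sigma> * p1))"
        if "\<kappa> k < \<kappa>'" for k \<kappa>'
      proof -
        have "\<K> f (dyad k) < ennreal \<kappa>'" unfolding \<kappa>K(1) using that \<kappa>K(2)[of k] by (intro ennreal_lessI) auto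
        from C(2)[OF _ this] show ?thesis unfolding G_def by simp
      qed
      show "(\<integral>\<^sup>+k. ennreal (dyad k powr -(\<theta> * p) * \<kappa> k powr p) \<partial>count_space UNIV) < top"
        using fin unfolding Ks .
    qed measurable
    have "ennreal C2 * K_sum \<theta> p (\<K> f) < top" using fin by (simp add: ennreal_mult_less_top)
    with G_int have G_fin: "(\<integral>\<^sup>+x. epow (ennreal \<bar>f x\<bar> + ennreal Csharp * sharp M f x) p \<partial>M) < top"
      unfolding G_def by order
    have "\<K> f (dyad 0) < ennreal (\<kappa> 0 + 1)" unfolding \<kappa>K(1) using \<kappa>K(2)[of 0] by (intro ennreal_lessI) auto
    then have haj: "hajlasz M f (\<lambda>x. ennreal Csharp * sharp M f x)" using C(2)[of f 0] by simp
    have "H1_norm M D (ereal p) f \<le> ennreal (2 * (1 + 2 * CD)) * epow (\<integral>\<^sup>+x. epow (G x) p \<partial>M) (1 / p)"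
      unfolding G_def by (rule hajlasz_imp_H1(2)[OF _ _ haj p0 G_fin]) measurable
    also have "\<dots> \<le> ennreal (2 * (1 + 2 * CD)) * epow (ennreal C2 * K_sum \<theta> p (\<K> f)) (1 / p)"
      using p0 by (intro mult_left_mono epow_mono G_int) auto
    also have "\<dots> = ennreal C3 * epow (K_sum \<theta> p (\<K> f)) (1 / p)"
      using p0 C2 CD_nonneg by (simp add: epow_cmult C3_def ennreal_mult mult.assoc)
    finally show ?thesis using hajlasz_imp_H1(1)[OF _ _ haj p0 G_fin] by simp
  qed
  then show ?thesis using C3 by blast
qed

lemma H1_interpolation:
  fixes p1 p :: real and P2 :: ereal
  assumes p: "q < p1" "p1 < p" "ereal p < P2" and \<theta>: "0 < \<theta>" "\<theta> < 1"
    and eq: "1 / p = (1 - \<theta>) / p1 + \<theta> * einv P2"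
  shows "\<exists>C>0. \<forall>f h X. f \<in> borel_measurable M \<longrightarrow> h \<in> borel_measurable M \<longrightarrow> hajlasz M f h \<longrightarrow>
      0 \<le> X \<longrightarrow> (\<integral>\<^sup>+x. epow (ennreal \<bar>f x\<bar> + h x) p \<partial>M) \<le> ennreal X \<longrightarrow>
      in_sum_space M (H1 M D (ereal p1)) (H1 M D P2) f \<and>
      K_sum \<theta> p (Kfun M (H1 M D (ereal p1)) (H1_norm M D (ereal p1)) (H1 M D P2) (H1_norm M D P2) f)
        \<le> ennreal (C * X)" (is ?upper)
    and "\<exists>C>0. \<forall>f. f \<in> borel_measurable M \<longrightarrow>
      K_sum \<theta> p (Kfun M (H1 M D (ereal p1)) (H1_norm M D (ereal p1)) (H1 M D P2) (H1_norm M D P2) f) < top \<longrightarrow>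
      H1 M D (ereal p) f \<and> H1_norm M D (ereal p) f \<le> ennreal C *
        epow (K_sum \<theta> p (Kfun M (H1 M D (ereal p1)) (H1_norm M D (ereal p1)) (H1 M D P2) (H1_norm M D P2) f)) (1 / p)"
      (is ?lower)
proof -
  have p0: "0 < p1" "0 < p" using p q1 by auto
  have "?upper \<and> ?lower"
  proof (cases P2)
    case (real p2)
    have p2: "p < p2" using p(3) real by simp
    have eq': "1 / p = (1 - \<theta>) / p1 + \<theta> / p2" using eq real by (simp add: einv_def)
    \<comment> \<open>Forced by equal measure bounds at both end points,
      \<open>\<sigma> * p1 = (\<sigma> - 1) * p2\<close>; for \<open>P2 = \<infinity>\<close> it
      degenerates to 1. The relation \<open>\<sigma> * (p - p1) = \<theta> * p\<close> is then the
      interpolation identity between the exponents.\<close>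
    define \<sigma> where "\<sigma> = p2 / (p2 - p1)"
    have \<sigma>1: "1 < \<sigma>" using p0 p(2) p2 by (simp add: \<sigma>_def field_simps)
    have 1: "\<sigma> * (p - p1) = \<theta> * p"
    proof -
      have "p1 * p2 = p * ((1 - \<theta>) * p2 + \<theta> * p1)" using eq' p0 p(2) p2 by (simp add: field_simps)
      then have "p2 * (p - p1) = \<theta> * p * (p2 - p1)" by (simp add: algebra_simps)
      then show ?thesis using p(2) p2 by (simp add: \<sigma>_def field_simps)
    qed
    have 2: "(\<sigma> - 1) * p2 = \<sigma> * p1" using p(2) p2 by (simp add: \<sigma>_def field_simps)
    have "weak_bound P2 (\<sigma> - 1) (\<sigma> * p1)"
      unfolding real by (rule weak_bound_finite) (use p p2 2 in auto)
    then show ?thesis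
      using K_sum_upper_finite[OF p0(1) p(2) p2 \<theta> eq']
        K_sum_lower[OF p0(1) p(2) _ _ 1 weak_bound_finite[OF p(1) refl], of P2] \<sigma>1 \<theta> unfolding real by auto
  next
    case PInf
    have eq': "1 / p = (1 - \<theta>) / p1" using eq PInf by (simp add: einv_def)
    have "(1 - \<theta>) * p = p1" using eq' p0 by (simp add: field_simps)
    then have 1: "1 * (p - p1) = \<theta> * p" by (simp add: algebra_simps)
    have "weak_bound P2 (1 - 1) (1 * p1)" unfolding PInf using weak_bound_infinity by simp
    then show ?thesis
      using K_sum_upper_infinity[OF p0(1) p(2) \<theta> eq']
        K_sum_lower[OF p0(1) p(2) _ _ 1 weak_bound_finite[OF p(1) refl], of P2] \<theta> unfolding PInf by auto
  qed (use p(3) in simp)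
  then show ?upper ?lower by blast+
qed

end

theorem mainTheorem14:
  fixes M :: "'a::{metric_space, complete_space} measure"
    and D :: "('a \<Rightarrow> real) \<Rightarrow> 'a \<Rightarrow> real^'n"
    and p1 p :: real and p2 :: ereal and \<theta> :: real
  assumes "mm_space M"
    and "\<not> compact (UNIV :: 'a set)"
    and "doubling M"
    and "\<exists>q. 1 < q \<and> poincare M q"
    and "cheeger_diff M D"
    and "Inf {q. 1 < q \<and> poincare M q} < p1"
    and "p1 < p" and "ereal p < p2"
    and "0 < \<theta>" and "\<theta> < 1"
    and "1 / p = (1 - \<theta>) / p1 + \<theta> * einv p2"
  shows "(\<forall>f. H1 M D (ereal p) f \<longleftrightarrow>
            in_interp M (H1 M D (ereal p1)) (H1_norm M D (ereal p1))
                        (H1 M D p2) (H1_norm M D p2) \<theta> p f)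
       \<and> (\<exists>C>0. \<forall>f. H1 M D (ereal p) f \<longrightarrow>
            H1_norm M D (ereal p) f
              \<le> ennreal C * interp_norm M (H1 M D (ereal p1)) (H1_norm M D (ereal p1))
                                         (H1 M D p2) (H1_norm M D p2) \<theta> p f
          \<and> interp_norm M (H1 M D (ereal p1)) (H1_norm M D (ereal p1))
                           (H1 M D p2) (H1_norm M D p2) \<theta> p f
              \<le> ennreal C * H1_norm M D (ereal p) f)"
proof -
  have "{q. 1 < q \<and> poincare M q} \<noteq> {}" using assms(4) by auto
  moreover have "bdd_below {q. 1 < q \<and> poincare M q}" by (rule bdd_belowI[of _ 1]) auto
  \<comment> \<open>The infimum itself need not be an admissible exponent; its being strictly below
    \<open>p1\<close> provides an admissible \<open>q < p1\<close>.\<close>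
  ultimately obtain q where q: "1 < q" "poincare M q" "q < p1"
    using assms(6) by (auto simp: cInf_less_iff)
  obtain C0 where C0: "\<And>x r. 0 < r \<Longrightarrow> emeasure M (ball x (2 * r)) \<le> ennreal C0 * emeasure M (ball x r)"
    and ball: "\<And>x r. 0 < r \<Longrightarrow> 0 < emeasure M (ball x r)" "\<And>x r. 0 < r \<Longrightarrow> emeasure M (ball x r) < \<infinity>"
    using assms(3) unfolding doubling_def by blast
  interpret doubling_space M "max 1 C0"
  proof
    show "sets M = sets borel" using assms(1) by (simp add: mm_space_def)
    fix r :: real and x :: 'a assume r: "0 < r"
    show "0 < emeasure M (ball x r)" by (rule ball(1)[OF r])
    show "emeasure M (ball x r) < top" using ball(2)[OF r] by simp
    have "ennreal C0 * emeasure M (ball x r) \<le> ennreal (max 1 C0) * emeasure M (ball x r)"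
      by (intro mult_right_mono ennreal_leI) auto
    then show "emeasure M (ball x (2 * r)) \<le> ennreal (max 1 C0) * emeasure M (ball x r)"
      using C0[OF r, of x] by order
  qed simp
  obtain Cp lam where Cp: "0 < Cp" "1 \<le> lam" "\<And>u g x r. continuous_on UNIV u \<Longrightarrow> upper_gradient M u g \<Longrightarrow> 0 < r \<Longrightarrow>
        epow ((\<integral>\<^sup>+ y\<in>ball x r. ennreal (\<bar>u y - avg M (ball x r) u\<bar> powr q) \<partial>M)
               / emeasure M (ball x r)) (1/q)
        \<le> ennreal (Cp * r) *
          epow ((\<integral>\<^sup>+ y\<in>ball x (lam*r). epow (g y) q \<partial>M) / emeasure M (ball x (lam*r))) (1/q)"
    using q(2) unfolding poincare_def by blast
  interpret poincare_space M "max 1 C0" q Cp lam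
    by standard (use q(1) Cp in auto)
  have not_isolated: "at x \<noteq> bot" for x :: 'a
  proof -
    have "\<exists>y. x \<noteq> y"
    proof (rule ccontr)
      \<comment> \<open>Non-compactness excludes the one-point space, so every point has a partner
        for \<open>no_isolated_points\<close>.\<close>
      assume "\<not> ?thesis"
      then have "(UNIV :: 'a set) = {x}" by auto
      then show False using assms(2) by (metis compact_sing)
    qed
    then show ?thesis using no_isolated_points by blast
  qed
  obtain CD where CD: "\<And>u. loc_lipschitz u \<Longrightarrow> D u \<in> borel_measurable M"
    "\<And>u. loc_lipschitz u \<Longrightarrow> AE x in M. Lip u x \<le> ereal (norm (D u x)) \<and> ereal (norm (D u x)) \<le> ereal CD * Lip u x"
    using assms(5) unfolding cheeger_diff_def by blast
  interpret cheeger_space M "max 1 C0" q Cp lam D "max CD 0"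
  proof
    fix u :: "'a \<Rightarrow> real" assume u: "loc_lipschitz u"
    show "D u \<in> borel_measurable M" by (rule CD(1)[OF u])
    show "AE x in M. lipn u x \<le> ennreal (norm (D u x))"
      using CD(2)[OF u]
    proof eventually_elim
      case (elim x)
      then show ?case unfolding lipn_def e2ennreal_ereal[symmetric] by (intro e2ennreal_mono) simp
    qed
    show "AE x in M. ennreal (norm (D u x)) \<le> ennreal (max CD 0) * lipn u x"
      using CD(2)[OF u]
    proof eventually_elim
      case (elim x)
      \<comment> \<open>Without isolated points the limit superior of nonnegative quotients is
        nonnegative. Hence \<open>Lip u x\<close> is a nonnegative real, \<open>lipn\<close> loses
        nothing, and \<open>CD\<close> may be replaced by \<open>max CD 0\<close>.\<close>
      have "0 \<le> Lip u x" unfolding Lip_def by (rule le_Limsup[OF not_isolated]) auto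
      moreover have "Lip u x < ereal (enn2real (lipn u x) + 1)" using Lip_less_lipn(2)[OF u] by simp
      ultimately obtain r where r: "Lip u x = ereal r" "0 \<le> r" by (cases "Lip u x") auto
      have "norm (D u x) \<le> CD * r" using elim r by simp
      also have "\<dots> \<le> max CD 0 * r" using r by (intro mult_right_mono) auto
      finally have "ennreal (norm (D u x)) \<le> ennreal (max CD 0 * r)" by (rule ennreal_leI)
      then show ?case using r by (simp add: lipn_def ennreal_mult)
    qed
  qed simp
  have p0: "0 < p" using q assms(7) by simp
  have qp: "q < p" using q(3) assms(7) by simp
  define \<K> where "\<K> = Kfun M (H1 M D (ereal p1)) (H1_norm M D (ereal p1)) (H1 M D p2) (H1_norm M D p2)"
  define IN where "IN = interp_norm M (H1 M D (ereal p1)) (H1_norm M D (ereal p1)) (H1 M D p2) (H1_norm M D p2) \<theta> p"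
  have IN_le: "IN f \<le> ennreal (2 powr \<theta>) * epow (K_sum \<theta> p (\<K> f)) (1 / p)"
    and Ks_le: "K_sum \<theta> p (\<K> f) \<le> ennreal (2 powr (\<theta> * p + 1)) * epow (IN f) p" for f
    unfolding IN_def \<K>_def using interp_norm_dyadic[OF p0 assms(9)] by blast+
  obtain C1 where C1: "0 < C1" "\<And>f h X. f \<in> borel_measurable M \<Longrightarrow> h \<in> borel_measurable M \<Longrightarrow> hajlasz M f h \<Longrightarrow>
      0 \<le> X \<Longrightarrow> (\<integral>\<^sup>+x. epow (ennreal \<bar>f x\<bar> + h x) p \<partial>M) \<le> ennreal X \<Longrightarrow>
      in_sum_space M (H1 M D (ereal p1)) (H1 M D p2) f \<and> K_sum \<theta> p (\<K> f) \<le> ennreal (C1 * X)"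
    using H1_interpolation(1)[OF q(3) assms(7-11)] unfolding \<K>_def by blast
  obtain C2 where C2: "0 < C2" "\<And>f. f \<in> borel_measurable M \<Longrightarrow> K_sum \<theta> p (\<K> f) < top \<Longrightarrow>
      H1 M D (ereal p) f \<and> H1_norm M D (ereal p) f \<le> ennreal C2 * epow (K_sum \<theta> p (\<K> f)) (1 / p)"
    using H1_interpolation(2)[OF q(3) assms(7-11)] unfolding \<K>_def by blast
  obtain C3 where C3: "0 < C3" "\<And>f N. H1_norm M D (ereal p) f < ennreal N \<Longrightarrow>
    (\<exists>h\<in>borel_measurable M. hajlasz M f h \<and>
      (\<integral>\<^sup>+x. epow (ennreal \<bar>f x\<bar> + h x) p \<partial>M) \<le> ennreal (C3 * N powr p))"
    using H1_norm_less_imp_hajlasz[OF qp] by blast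
  have IN_fin: "IN f < top" if "K_sum \<theta> p (\<K> f) < top" for f
    using that by (intro le_less_trans[OF IN_le]) (simp add: ennreal_mult_less_top)
  have Ks_fin: "K_sum \<theta> p (\<K> f) < top" if "IN f < top" for f
    using that by (intro le_less_trans[OF Ks_le]) (simp add: ennreal_mult_less_top)
  have into: "in_sum_space M (H1 M D (ereal p1)) (H1 M D p2) f \<and> IN f < top" if f: "H1 M D (ereal p) f" for f
  proof -
    obtain h where h: "h \<in> borel_measurable M" "hajlasz M f h"
      "(\<integral>\<^sup>+x. epow (ennreal \<bar>f x\<bar> + h x) p \<partial>M) < top" using H1_imp_hajlasz[OF qp f] by blast
    define X where "X = enn2real (\<integral>\<^sup>+x. epow (ennreal \<bar>f x\<bar> + h x) p \<partial>M)"
    have "(\<integral>\<^sup>+x. epow (ennreal \<bar>f x\<bar> + h x) p \<partial>M) \<le> ennreal X" using h(3) by (simp add: X_def)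
    from C1(2)[OF H1_measurable[OF f] h(1,2) _ this]
    have "in_sum_space M (H1 M D (ereal p1)) (H1 M D p2) f \<and> K_sum \<theta> p (\<K> f) \<le> ennreal (C1 * X)"
      by (simp add: X_def)
    then show ?thesis using IN_fin[OF le_less_trans[OF _ ennreal_less_top]] by blast
  qed
  have iff: "H1 M D (ereal p) f \<longleftrightarrow>
    f \<in> borel_measurable M \<and> in_sum_space M (H1 M D (ereal p1)) (H1 M D p2) f \<and> IN f < \<infinity>" for f
  proof
    assume f: "H1 M D (ereal p) f"
    show "f \<in> borel_measurable M \<and> in_sum_space M (H1 M D (ereal p1)) (H1 M D p2) f \<and> IN f < \<infinity>"
      using into[OF f] H1_measurable[OF f] by simp
  next
    assume f: "f \<in> borel_measurable M \<and> in_sum_space M (H1 M D (ereal p1)) (H1 M D p2) f \<and> IN f < \<infinity>"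
    then have "K_sum \<theta> p (\<K> f) < top" by (intro Ks_fin) simp
    with f show "H1 M D (ereal p) f" using C2(2) by blast
  qed
  define A where "A = C2 * (2 powr (\<theta> * p + 1)) powr (1 / p)"
  define B where "B = 2 powr \<theta> * (C1 * C3) powr (1 / p)"
  have A: "0 < A" and B: "0 < B" using C1 C2 C3 by (auto simp: A_def B_def)
  have lower: "H1_norm M D (ereal p) f \<le> ennreal A * IN f" if f: "H1 M D (ereal p) f" for f
  proof -
    have "IN f < top" using into[OF f] by simp
    then have "H1_norm M D (ereal p) f \<le> ennreal C2 * epow (K_sum \<theta> p (\<K> f)) (1 / p)"
      using C2(2)[OF H1_measurable[OF f] Ks_fin] by blast
    also have "\<dots> \<le> ennreal C2 * epow (ennreal (2 powr (\<theta> * p + 1)) * epow (IN f) p) (1 / p)"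
      using p0 by (intro mult_left_mono epow_mono Ks_le) auto
    also have "\<dots> = ennreal A * IN f"
      using p0 C2(1) by (simp add: epow_mult epow_ennreal epow_epow A_def ennreal_mult mult.assoc)
    finally show ?thesis .
  qed
  have upper: "IN f \<le> ennreal B * H1_norm M D (ereal p) f" if f: "H1 M D (ereal p) f" for f
  proof (cases "H1_norm M D (ereal p) f")
    case top
    then show ?thesis using B by (simp add: ennreal_mult_top)
  next
    case (real n)
    \<comment> \<open>A Hajlasz gradient is available only for bounds strictly above the norm;
      letting \<open>N\<close> decrease to \<open>n\<close> gives the estimate with the norm itself,
      also when \<open>n = 0\<close>.\<close>
    have le: "IN f \<le> ennreal (B * N)" if N: "n < N" for N
    proof -
      have N0: "0 < N" using N real by simp
      have "H1_norm M D (ereal p) f < ennreal N" unfolding real(2) using N real(1) by (intro ennreal_lessI) auto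
      from C3(2)[OF this] obtain h where h: "h \<in> borel_measurable M" "hajlasz M f h"
        "(\<integral>\<^sup>+x. epow (ennreal \<bar>f x\<bar> + h x) p \<partial>M) \<le> ennreal (C3 * N powr p)" by blast
      have "K_sum \<theta> p (\<K> f) \<le> ennreal (C1 * (C3 * N powr p))"
        using C1(2)[OF H1_measurable[OF f] h(1,2) _ h(3)] C3(1) by simp
      then have "IN f \<le> ennreal (2 powr \<theta>) * epow (ennreal (C1 * (C3 * N powr p))) (1 / p)"
        using p0 by (intro order_trans[OF IN_le] mult_left_mono epow_mono) auto
      also have "epow (ennreal (C1 * (C3 * N powr p))) (1 / p) = ennreal ((C1 * C3) powr (1 / p) * N)"
        using C1(1) C3(1) N0 p0 by (simp add: epow_ennreal powr_mult powr_powr mult.assoc)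
      also have "ennreal (2 powr \<theta>) * ennreal ((C1 * C3) powr (1 / p) * N) = ennreal (B * N)"
        using N0 by (simp add: ennreal_mult[symmetric] B_def mult.assoc)
      finally show ?thesis .
    qed
    have "IN f \<le> ennreal (B * n)"
    proof (rule ennreal_le_epsilon)
      fix e :: real assume e: "0 < e"
      have "IN f \<le> ennreal (B * (n + e / B))" using e B by (intro le) simp
      also have "B * (n + e / B) = B * n + e" using B by (simp add: distrib_left)
      also have "ennreal (B * n + e) = ennreal (B * n) + ennreal e"
        using B real e by (intro ennreal_plus) auto
      finally show "IN f \<le> ennreal (B * n) + ennreal e" .
    qed
    then show ?thesis using B real by (simp add: ennreal_mult)
  qed
  define C where "C = max A B"
  have "\<exists>C>0. \<forall>f. H1 M D (ereal p) f \<longrightarrow>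
    H1_norm M D (ereal p) f \<le> ennreal C * IN f \<and> IN f \<le> ennreal C * H1_norm M D (ereal p) f"
  proof (intro exI[of _ C] conjI allI impI)
    show "0 < C" using A by (simp add: C_def)
    fix f assume f: "H1 M D (ereal p) f"
    have "ennreal A * IN f \<le> ennreal C * IN f" by (intro mult_right_mono ennreal_leI) (auto simp: C_def)
    then show "H1_norm M D (ereal p) f \<le> ennreal C * IN f" using lower[OF f] by order
    have "ennreal B * H1_norm M D (ereal p) f \<le> ennreal C * H1_norm M D (ereal p) f"
      by (intro mult_right_mono ennreal_leI) (auto simp: C_def)
    then show "IN f \<le> ennreal C * H1_norm M D (ereal p) f" using upper[OF f] by order
  qed
  then show ?thesis using iff unfolding in_interp_def IN_def by blast
qed

end
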